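(* Let $T=[0,1]$ or $T=\mathbb R$, let $\mathcal P=\mathcal P(T)$ be a set of probability densities on $T$, and let $\Pi_n$ be priors (probability measures) defined on some $\sigma$-algebra of $\mathcal P$ for which the maps $p\mapsto p(x)$ are measurable for all $x\in T$. Let $1\le r\le\infty$ and let $\varepsilon_n\to0$ be a sequence of positive numbers such that $\sqrt n\,\varepsilon_n\to\infty$ as $n\to\infty$. Let $$\delta_n=\varepsilon_n(n\varepsilon_n^2)^{\frac12-\frac1{2r}}\gamma_n$$ for some sequence $\gamma_n$ satisfying $\gamma_n\ge1$ for all $n$. Let $J_n$ be any sequence of resolution levels satisfying $2^{J_n}\le c\,n\varepsilon_n^2$ for some fixed $0<c<\infty$, and let $K_j$ be an admissible approximating sequence. Let $\mathcal P_n$ be a sequence of subsets of $$\big\{p\in\mathcal P:\ \|K_{J_n}(p)-p\|_r\le C(K)\delta_n,\ \|p\|_{\mu_w}\le D\big\},$$ where $C(K)$ is a constant that depends only on the operator kernel $K$, $D$ is a fixed constant, and where $w>(2-r)/r$ if $r<2$ and $w=0$ if $r\ge2$. Assume there exists $C>0$ such that, for every $n$ large enough: (1) $\Pi_n(\mathcal P\setminus\mathcal P_n)\le e^{-(C+4)n\varepsilon_n^2}$, and (2) $\Pi_n\big\{p\in\mathcal P:\ -P_0\log\frac p{p_0}\le\varepsilon_n^2,\ P_0\big(\log\frac p{p_0}\big)^2\le\varepsilon_n^2\big\}\ge e^{-Cn\varepsilon_n^2}$. Let $X_1,X_2,\dots$ be i.i.d. with law $P_0$ and density $p_0$ on $T$,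 where $p_0\in L^r(T)$ is such that $\|K_{J_n}(p_0)-p_0\|_r=O(\delta_n)$ and such that $\|p_0\|_{\mu_w}<\infty$ if $T=\mathbb R$ and $1\le r<2$. If $\delta_n\to0$ as $n\to\infty$, then there exists $M<\infty$ such that $$\Pi_n\{p\in\mathcal P:\|p-p_0\|_r\ge M\delta_n\,|\,X_1,\dots,X_n\}\to0\quad\text{as }n\to\infty$$ in $P_0^{\mathbb N}$-probability.
   Context: Notation: $P_0f=\int f\,dP_0$; $\|\cdot\|_r$ is the $L^r(T)$-norm (Lebesgue measure), $\|f\|_\infty=\sup_{x\in T}|f(x)|$, and $1/(2r)=0$ for $r=\infty$. For $w\ge0$, $\|f\|_{\mu_w}=\int|f(t)|(1+|t|)^w\,dt$ (integral over the domain of $f$). The posterior is $\Pi_n(B|X_1,\dots,X_n)=\int_B\prod_{i=1}^np(X_i)\,d\Pi_n(p)\big/\int_{\mathcal P}\prod_{i=1}^np(X_i)\,d\Pi_n(p)$ for measurable $B$. For a kernel $K_j(x,y)$ on $T\times T$, $K_j(p)(x)=\int_TK_j(x,y)p(y)\,dy$. A function has bounded $q$-variation if the supremum over all finite increasing sequences $x_0<\dots<x_m$ of $\sum_i|f(x_i)-f(x_{i-1})|^q$ is finite. Admissible approximating sequence: the operators $K_j(x,y)=2^jK(2^jx,2^jy)$, $x,y\in T$, $j\ge0$ integer, satisfying one of the following. (a) (convolution kernel case) $K(x,y)=K(x-y)$ where $K\in L^\infty(\mathbb R)$ is of bounded $q$-variation for some finite $q\ge1$, right (or left) continuous, and $\|K\|_{\mu_v}<\infty$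 for some $v>2$. (b) (multiresolution projection case) $K(x,y)=\sum_k\phi(x-k)\phi(y-k)$, the sum extending over any subset of $\mathbb Z$, where $\phi\in L^1\cap L^\infty$ has bounded $q$-variation for some finite $q\ge1$, $\sup_{x\in\mathbb R}\sum_k|\phi(x-k)|<\infty$, and $|K(x,y)|\le\Phi(|x-y|)$ for all $x,y$ and some $\Phi\in L^\infty(\mathbb R)$ with $\|\Phi\|_{\mu_v}<\infty$ for some $v>2$. (c) (multiresolution case, $T=[0,1]$) $K(x,y)=\sum_k\phi_k(x)\phi_k(y)$ is the projection kernel of a Cohen–Daubechies–Vial (CDV) wavelet basis of $L^2([0,1])$, i.e. for $j\ge J_0$, $K_j(x,y)=\sum_k\phi_{jk}(x)\phi_{jk}(y)$, $\phi_{jk}=2^{j/2}\phi_k(2^j\cdot)$, is the kernel of the orthogonal projection onto the $2^j$-dimensional space $V_j$ of the CDV multiresolution analysis. Here, for a Daubechies scaling function $\phi$ of order $N$ and $2^{J_0}\ge2N$, the orthonormal basis $\{\phi_{jk}\}$ of $V_j$ consists of $N$ left edge functions $2^{j/2}\phi^0_k(2^jx)$, $N$ right edge functions $2^{j/2}\phi_k^1(2^jx)$ ($\phi^0_k,\phi_k^1$ bounded, boundedly supported modifications of $\phi$), and the $2^j-2N$ interior functions $2^{j/2}\phi(2^jx-k)$ (Cohen, Daubechies, Vial 1993, Theorem 4.4). In this case only levels $j\ge J_0$ are considered.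
   Formalization: The priors are additionally assumed to make (p,x) ↦ p(x) jointly measurable, not only each map p ↦ p(x); without this the posterior need not be measurable in the sample, Fubini can fail for the likelihood, and the claim can be false. *)

theory Defs
  imports "HOL-Probability.Probability"
begin

subsection \<open>Norms, densities, variation\<close>

text \<open>For \<open>r = \<infinity>\<close> this is the pointwise supremum over \<open>T\<close>, not the essential supremum.\<close>

definition Lr_norm :: "real set \<Rightarrow> ennreal \<Rightarrow> (real \<Rightarrow> real) \<Rightarrow> ennreal" where
  "Lr_norm T r f =
     (if r = \<top> then (SUP x\<in>T. ennreal \<bar>f x\<bar>)
      else let I = (\<integral>\<^sup>+x\<in>T. ennreal (\<bar>f x\<bar> powr enn2real r) \<partial>lborel)
           in if I = \<top> then \<top> else ennreal (enn2real I powr (1 / enn2real r)))"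

definition mu_norm :: "real set \<Rightarrow> real \<Rightarrow> (real \<Rightarrow> real) \<Rightarrow> ennreal" where
  "mu_norm T w f = (\<integral>\<^sup>+t\<in>T. ennreal (\<bar>f t\<bar> * (1 + \<bar>t\<bar>) powr w) \<partial>lborel)"

text \<open>A density on \<open>T\<close> is represented by a total function of which only the values on \<open>T\<close> matter.\<close>

definition prob_density :: "real set \<Rightarrow> (real \<Rightarrow> real) \<Rightarrow> bool" where
  "prob_density T p \<longleftrightarrow>
     p \<in> borel_measurable (restrict_space borel T) \<and>
     (\<forall>x\<in>T. 0 \<le> p x) \<and>
     (\<integral>\<^sup>+x\<in>T. ennreal (p x) \<partial>lborel) = 1"

definition law :: "real set \<Rightarrow> (real \<Rightarrow> real) \<Rightarrow> real measure" where
  "law T p = density (restrict_space lborel T) (\<lambda>x. ennreal (p x))"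

definition bounded_q_variation :: "real \<Rightarrow> (real \<Rightarrow> real) \<Rightarrow> bool" where
  "bounded_q_variation q f \<longleftrightarrow>
     (\<exists>B. \<forall>(m::nat) (x::nat \<Rightarrow> real). strict_mono_on {..m} x \<longrightarrow>
        (\<Sum>i<m. \<bar>f (x (Suc i)) - f (x i)\<bar> powr q) \<le> B)"


subsection \<open>Admissible approximating sequences\<close>

definition kernel_op :: "real set \<Rightarrow> (real \<Rightarrow> real \<Rightarrow> real) \<Rightarrow> (real \<Rightarrow> real) \<Rightarrow> real \<Rightarrow> real" where
  "kernel_op T K p x = (LINT y:T|lborel. K x y * p y)"

definition dilated_kernel :: "(real \<Rightarrow> real \<Rightarrow> real) \<Rightarrow> nat \<Rightarrow> real \<Rightarrow> real \<Rightarrow> real" where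
  "dilated_kernel K j x y = 2 ^ j * K (2 ^ j * x) (2 ^ j * y)"

definition convolution_kernel :: "(real \<Rightarrow> real \<Rightarrow> real) \<Rightarrow> bool" where
  "convolution_kernel K \<longleftrightarrow>
     (\<exists>k :: real \<Rightarrow> real. (\<forall>x y. K x y = k (x - y)) \<and>
        k \<in> borel_measurable borel \<and> bounded (range k) \<and>
        (\<exists>q\<ge>1. bounded_q_variation q k) \<and>
        ((\<forall>x. continuous (at_right x) k) \<or> (\<forall>x. continuous (at_left x) k)) \<and>
        (\<exists>v>2. mu_norm UNIV v k < \<top>))"

definition projection_kernel :: "(real \<Rightarrow> real \<Rightarrow> real) \<Rightarrow> bool" where
  "projection_kernel K \<longleftrightarrow>
     (\<exists>(\<phi> :: real \<Rightarrow> real) (Z :: int set) (\<Phi> :: real \<Rightarrow> real).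
        integrable lborel \<phi> \<and> bounded (range \<phi>) \<and>
        (\<exists>q\<ge>1. bounded_q_variation q \<phi>) \<and>
        (\<forall>x. (\<lambda>k. \<bar>\<phi> (x - of_int k)\<bar>) summable_on Z) \<and>
        bdd_above (range (\<lambda>x. \<Sum>\<^sub>\<infinity>k\<in>Z. \<bar>\<phi> (x - of_int k)\<bar>)) \<and>
        (\<forall>x y. K x y = (\<Sum>\<^sub>\<infinity>k\<in>Z. \<phi> (x - of_int k) * \<phi> (y - of_int k))) \<and>
        \<Phi> \<in> borel_measurable borel \<and> bounded (range \<Phi>) \<and>
        (\<exists>v>2. mu_norm UNIV v \<Phi> < \<top>) \<and>
        (\<forall>x y. \<bar>K x y\<bar> \<le> \<Phi> \<bar>x - y\<bar>))"

text \<open>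
  Daubechies scaling functions of order \<open>N\<close>, normalised to have support in \<open>[1 - N, N]\<close>: orthonormal
  integer translates, a refinement equation with the minimal number \<open>2N\<close> of filter coefficients, and
  \<open>N\<close> vanishing moments of the wavelet, expressed through the filter.  The spectral factor is not
  fixed, so extremal phase and least asymmetric filters are both covered.  Any bounded
  representative is allowed; \<open>N = 1\<close> is the Haar function.
\<close>

definition daubechies_scaling :: "nat \<Rightarrow> (real \<Rightarrow> real) \<Rightarrow> bool" where
  "daubechies_scaling N \<phi> \<longleftrightarrow>
     N \<ge> 1 \<and> \<phi> \<in> borel_measurable borel \<and> bounded (range \<phi>) \<and>
     (\<forall>x. x \<notin> {1 - real N..real N} \<longrightarrow> \<phi> x = 0) \<and>
     (LINT x|lborel. \<phi> x) = 1 \<and>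
     (\<forall>k::int. (LINT x|lborel. \<phi> x * \<phi> (x - of_int k)) = of_bool (k = 0)) \<and>
     (\<exists>h :: int \<Rightarrow> real.
        (AE x in lborel. \<phi> x = sqrt 2 * (\<Sum>k = 1 - int N..int N. h k * \<phi> (2 * x - of_int k))) \<and>
        (\<forall>m<N. (\<Sum>k = 1 - int N..int N. (-1) powi k * of_int k ^ m * h k) = 0))"

text \<open>
  The edge functions of Cohen, Daubechies and Vial before orthonormalisation.  Up to the factors
  \<open>n choose k\<close>, which run through a basis of the polynomials of degree less than \<open>N\<close> in \<open>n\<close>, they
  collect the translates of \<open>\<phi>\<close> that are not used as interior functions, cut off at the end point.
\<close>

definition cdv_left_raw :: "nat \<Rightarrow> (real \<Rightarrow> real) \<Rightarrow> nat \<Rightarrow> real \<Rightarrow> real" where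
  "cdv_left_raw N \<phi> k x =
     (if 0 \<le> x then \<Sum>n = k..2 * N - 2. real (n choose k) * \<phi> (x + real n - real N + 1) else 0)"

definition cdv_right_raw :: "nat \<Rightarrow> (real \<Rightarrow> real) \<Rightarrow> nat \<Rightarrow> real \<Rightarrow> real" where
  "cdv_right_raw N \<phi> k x =
     (if x \<le> 0 then \<Sum>n = k..2 * N - 2. real (n choose k) * \<phi> (x - real n + real N) else 0)"

text \<open>
  Orthonormal systems of \<open>N\<close> edge functions in the span of the \<open>N\<close> raw ones.  The projection kernel
  does not depend on the orthonormalisation.
\<close>

definition orthonormal_edge ::
    "nat \<Rightarrow> real set \<Rightarrow> (nat \<Rightarrow> real \<Rightarrow> real) \<Rightarrow> (nat \<Rightarrow> real \<Rightarrow> real) \<Rightarrow> bool" where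
  "orthonormal_edge N S raw e \<longleftrightarrow>
     (\<forall>k<N. e k \<in> borel_measurable borel \<and> bounded (range (e k)) \<and> (\<forall>x. x \<notin> S \<longrightarrow> e k x = 0) \<and>
        (\<exists>a :: nat \<Rightarrow> real. AE x in lborel. e k x = (\<Sum>l<N. a l * raw l x))) \<and>
     (\<forall>k<N. \<forall>l<N. (LINT x|lborel. e k x * e l x) = of_bool (k = l))"

definition cdv_system ::
    "nat \<Rightarrow> (real \<Rightarrow> real) \<Rightarrow> (nat \<Rightarrow> real \<Rightarrow> real) \<Rightarrow> (nat \<Rightarrow> real \<Rightarrow> real) \<Rightarrow> bool" where
  "cdv_system N \<phi> \<phi>0 \<phi>1 \<longleftrightarrow>
     daubechies_scaling N \<phi> \<and>
     orthonormal_edge N {0..2 * real N - 1} (cdv_left_raw N \<phi>) \<phi>0 \<and>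
     orthonormal_edge N {1 - 2 * real N..0} (cdv_right_raw N \<phi>) \<phi>1"

text \<open>
  The basis functions \<open>\<phi>\<^sub>j\<^sub>k\<close>, \<open>0 \<le> k < 2 ^ j\<close>, of \<open>V\<^sub>j\<close>.  The right edge functions \<open>\<phi>1\<close> live on
  the negative half line, so they are translated to the end point \<open>1\<close>.
\<close>

definition cdv_basis ::
    "nat \<Rightarrow> (real \<Rightarrow> real) \<Rightarrow> (nat \<Rightarrow> real \<Rightarrow> real) \<Rightarrow> (nat \<Rightarrow> real \<Rightarrow> real) \<Rightarrow> nat \<Rightarrow> nat \<Rightarrow> real \<Rightarrow> real" where
  "cdv_basis N \<phi> \<phi>0 \<phi>1 j k x = sqrt (2 ^ j) *
     (if k < N then \<phi>0 k (2 ^ j * x)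
      else if k < 2 ^ j - N then \<phi> (2 ^ j * x - real k)
      else \<phi>1 (2 ^ j - 1 - k) (2 ^ j * (x - 1)))"

definition cdv_kernel ::
    "nat \<Rightarrow> (real \<Rightarrow> real) \<Rightarrow> (nat \<Rightarrow> real \<Rightarrow> real) \<Rightarrow> (nat \<Rightarrow> real \<Rightarrow> real) \<Rightarrow> nat \<Rightarrow> real \<Rightarrow> real \<Rightarrow> real" where
  "cdv_kernel N \<phi> \<phi>0 \<phi>1 j x y =
     (\<Sum>k<2 ^ j. cdv_basis N \<phi> \<phi>0 \<phi>1 j k x * cdv_basis N \<phi> \<phi>0 \<phi>1 j k y)"

text \<open>\<open>J0\<close> is the lowest level at which the sequence is considered.\<close>

definition admissible_sequence :: "real set \<Rightarrow> nat \<Rightarrow> (nat \<Rightarrow> real \<Rightarrow> real \<Rightarrow> real) \<Rightarrow> bool" where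
  "admissible_sequence T J0 Ks \<longleftrightarrow>
     (J0 = 0 \<and> (\<exists>K. (convolution_kernel K \<or> projection_kernel K) \<and> Ks = dilated_kernel K)) \<or>
     (T = {0..1} \<and> (\<exists>N \<phi> \<phi>0 \<phi>1. cdv_system N \<phi> \<phi>0 \<phi>1 \<and> 2 * N \<le> 2 ^ J0 \<and>
        (\<forall>j\<ge>J0. Ks j = cdv_kernel N \<phi> \<phi>0 \<phi>1 j)))"


subsection \<open>Priors and posteriors\<close>

text \<open>
  Measurability of each evaluation \<open>p \<mapsto> p x\<close> alone gives neither measurability of the posterior in
  the sample nor Fubini's theorem for the likelihood, hence the last condition.
\<close>

definition is_prior :: "real set \<Rightarrow> (real \<Rightarrow> real) set \<Rightarrow> (real \<Rightarrow> real) measure \<Rightarrow> bool" where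
  "is_prior T \<P> Q \<longleftrightarrow>
     prob_space Q \<and> space Q = \<P> \<and>
     (\<forall>x\<in>T. (\<lambda>p. p x) \<in> borel_measurable Q) \<and>
     (\<lambda>(p, x). p x) \<in> borel_measurable (Q \<Otimes>\<^sub>M restrict_space borel T)"

text \<open>
  \<open>- P\<^sub>0 log (p / p\<^sub>0) \<le> e\<^sup>2\<close> and \<open>P\<^sub>0 (log (p / p\<^sub>0))\<^sup>2 \<le> e\<^sup>2\<close>.  Since \<open>ln 0 = 0\<close> here, densities \<open>p\<close> that
  vanish on a set of positive \<open>P\<^sub>0\<close>-probability, for which both quantities are infinite, are excluded
  explicitly.
\<close>

definition KL_neighbourhood ::
    "real set \<Rightarrow> (real \<Rightarrow> real) set \<Rightarrow> (real \<Rightarrow> real) \<Rightarrow> real \<Rightarrow> (real \<Rightarrow> real) set" where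
  "KL_neighbourhood T \<P> p0 e = {p \<in> \<P>.
     (AE x in law T p0. 0 < p x) \<and>
     (\<integral>\<^sup>+x. ennreal ((ln (p x / p0 x))\<^sup>2) \<partial>law T p0) \<le> ennreal (e\<^sup>2) \<and>
     - (LINT x|law T p0. ln (p x / p0 x)) \<le> e\<^sup>2}"

text \<open>The observation \<open>X\<^sub>i\<close> is the coordinate \<open>\<omega> (i - 1)\<close>.\<close>

definition likelihood :: "nat \<Rightarrow> (nat \<Rightarrow> real) \<Rightarrow> (real \<Rightarrow> real) \<Rightarrow> ennreal" where
  "likelihood n \<omega> p = ennreal (\<Prod>i<n. p (\<omega> i))"

definition posterior :: "(real \<Rightarrow> real) measure \<Rightarrow> nat \<Rightarrow> (nat \<Rightarrow> real) \<Rightarrow> (real \<Rightarrow> real) measure" where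
  "posterior Q n \<omega> = density Q (\<lambda>p. likelihood n \<omega> p / (\<integral>\<^sup>+p'. likelihood n \<omega> p' \<partial>Q))"

lemma measurable_likelihood:
  assumes "is_prior T \<P> Q" "\<And>i. i < n \<Longrightarrow> \<omega> i \<in> T"
  shows "likelihood n \<omega> \<in> borel_measurable Q"
proof -
  have "(\<lambda>p. p (\<omega> i)) \<in> borel_measurable Q" if "i < n" for i
    using assms that by (auto simp: is_prior_def)
  then have "(\<lambda>p. \<Prod>i<n. p (\<omega> i)) \<in> borel_measurable Q"
    by (intro borel_measurable_prod) auto
  then show ?thesis
    unfolding likelihood_def by (rule measurable_compose[OF _ measurable_ennreal])
qed

lemma emeasure_posterior:
  assumes "is_prior T \<P> Q" "\<And>i. i < n \<Longrightarrow> \<omega> i \<in> T" "B \<in> sets Q"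
  shows "emeasure (posterior Q n \<omega>) B =
    (\<integral>\<^sup>+p\<in>B. likelihood n \<omega> p \<partial>Q) / (\<integral>\<^sup>+p. likelihood n \<omega> p \<partial>Q)"
proof -
  have [measurable]: "likelihood n \<omega> \<in> borel_measurable Q" "B \<in> sets Q"
    using measurable_likelihood[OF assms(1,2)] assms(3) by auto
  have "emeasure (posterior Q n \<omega>) B =
      (\<integral>\<^sup>+p. likelihood n \<omega> p * indicator B p / (\<integral>\<^sup>+p'. likelihood n \<omega> p' \<partial>Q) \<partial>Q)"
    unfolding posterior_def
    by (subst emeasure_density) (auto simp: divide_ennreal_def ac_simps intro!: nn_integral_cong)
  also have "\<dots> = (\<integral>\<^sup>+p\<in>B. likelihood n \<omega> p \<partial>Q) / (\<integral>\<^sup>+p. likelihood n \<omega> p \<partial>Q)"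
    by (rule nn_integral_divide) measurable
  finally show ?thesis .
qed

definition tendsto_in_prob :: "'a measure \<Rightarrow> (nat \<Rightarrow> 'a \<Rightarrow> real) \<Rightarrow> real \<Rightarrow> bool" where
  "tendsto_in_prob M Y l \<longleftrightarrow>
     (\<forall>n. Y n \<in> borel_measurable M) \<and>
     (\<forall>e>0. (\<lambda>n. measure M {\<omega> \<in> space M. \<bar>Y n \<omega> - l\<bar> > e}) \<longlonglongrightarrow> 0)"

end

theory Submission
  imports Defs
begin

text \<open>
  Write \<open>N = n \<epsilon>\<^sub>n\<^sup>2\<close>. The test rejects when the estimator \<open>n\<^sup>-\<^sup>1 \<Sum>\<^sub>i K\<^sub>J(\<sqdot>, X\<^sub>i)\<close> is further than a multiple
  of \<open>\<delta>\<^sub>n\<close> from \<open>K\<^sub>J(p\<^sub>0)\<close> in \<open>L\<^sup>r\<close>. For its error of the second kind no supremum has to be controlled: if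
  \<open>\<parallel>K\<^sub>J(p - p\<^sub>0)\<parallel>\<^sub>r\<close> is large, a single linear functional, given by the dual extremal function, separates
  \<open>p\<close> from \<open>p\<^sub>0\<close>. It is bounded by a multiple of \<open>2\<^bsup>J(1 - 1/r)\<^esup>\<close> and has variance at most a multiple of
  \<open>\<parallel>p\<parallel>\<^sub>r 2\<^bsup>J(1 - 1/r)\<^esup>\<close>, so that a Chernoff bound gives exactly the exponent \<open>N\<close>. The error of the first
  kind only has to tend to \<open>0\<close>. For \<open>1 < r < \<infinity>\<close> this follows from moment bounds, since the expected norm
  under \<open>p\<^sub>0\<close> is \<open>O(\<epsilon>\<^sub>n)\<close>, which is \<open>o(\<delta>\<^sub>n)\<close>; for \<open>r = 1\<close> a variance bound for functions of independent
  variables is added. For \<open>r = \<infinity>\<close> the estimator is replaced by countably many empirical averages which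
  control \<open>\<parallel>K\<^sub>J(h)\<parallel>\<^sub>\<infinity>\<close>: cell frequencies for convolution kernels, basis coefficients otherwise.
\<close>

subsection \<open>Independent samples\<close>

text \<open>What shapes the second-kind bound is that nothing limits how far an alternative lies
  from \<open>p0\<close>. If its distance is \<open>\<Delta>\<close> and \<open>p0\<close> has norm
  \<open>U\<close>, its norm may reach \<open>U + \<Delta>\<close>, and the variance of the
  separating functional grows with it. The exponent is therefore of the order of
  \<open>n \<Delta>^2 / ((U + \<Delta>) R powr (1 - 1/r))\<close> with \<open>R = 2 ^ J\<close>. It
  increases with \<open>\<Delta>\<close>, so the nearest alternatives are the worst; there
  \<open>\<Delta> = M \<delta>\<close>, eventually at most \<open>1\<close>, and a large
  \<open>M\<close> lifts the exponent above \<open>(C + 4) N\<close>. Of the four spare units, two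
  are consumed by the lower bound of the denominator, and \<open>exp (- 2 N)\<close> remains. For
  \<open>r = 1\<close> the mean of the estimation error and the rate are both of order
  \<open>\<epsilon>\<close>, so Markov's inequality yields nothing small, whereas the variance of
  the norm is \<open>O(1/n)\<close>, negligible against \<open>\<epsilon>^2\<close> since
  \<open>N\<close> diverges. For \<open>r = \<infinity>\<close> infinitely many averages are treated
  by a union bound without a logarithmic loss: each probability is bounded by a multiple of the
  second moment of its own function, and these second moments are summable.\<close>

lemma product_sigma_finite_const:
  "sigma_finite_measure M \<Longrightarrow> product_sigma_finite (\<lambda>_. M)"
  by (simp add: product_sigma_finite_def)

text \<open>The bridge between the law of the sample and integrals of the likelihood against product
  Lebesgue measure. Measures on a finite product are determined by boxes, and on a box the integral
  of the product density factorises.\<close>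

lemma PiM_density_prod:
  fixes L :: "'a measure" and p :: "'a \<Rightarrow> ennreal" and I :: "'i set"
  assumes L: "sigma_finite_measure L" and D: "sigma_finite_measure (density L p)"
    and p[measurable]: "p \<in> borel_measurable L" and I: "finite I"
  shows "PiM I (\<lambda>_. density L p) = density (PiM I (\<lambda>_. L)) (\<lambda>x. \<Prod>i\<in>I. p (x i))"
proof -
  interpret L: product_sigma_finite "\<lambda>_::'i. L" using L by (rule product_sigma_finite_const)
  interpret D: product_sigma_finite "\<lambda>_::'i. density L p" using D by (rule product_sigma_finite_const)
  have sets: "sets (density (PiM I (\<lambda>_. L)) (\<lambda>x. \<Prod>i\<in>I. p (x i))) = sets (PiM I (\<lambda>_. density L p))"
    by (simp cong: sets_PiM_cong)
  show ?thesis
  proof (rule D.PiM_eqI[OF I sets, symmetric])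
    fix A :: "'i \<Rightarrow> 'a set" assume "\<And>i. i \<in> I \<Longrightarrow> A i \<in> sets (density L p)"
    then have A: "\<And>i. i \<in> I \<Longrightarrow> A i \<in> sets L" by simp
    have "emeasure (density (PiM I (\<lambda>_. L)) (\<lambda>x. \<Prod>i\<in>I. p (x i))) (PiE I A) =
        (\<integral>\<^sup>+x. (\<Prod>i\<in>I. p (x i)) * indicator (PiE I A) x \<partial>PiM I (\<lambda>_. L))"
      using A I by (intro emeasure_density) (auto intro!: sets_PiM_I_finite)
    also have "\<dots> = (\<integral>\<^sup>+x. (\<Prod>i\<in>I. p (x i) * indicator (A i) (x i)) \<partial>PiM I (\<lambda>_. L))"
    proof (intro nn_integral_cong)
      fix x assume x: "x \<in> space (PiM I (\<lambda>_. L))"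
      then have "indicator (PiE I A) x = (\<Prod>i\<in>I. indicator (A i) (x i) :: ennreal)"
        using I by (auto simp: indicator_def space_PiM PiE_iff)
      then show "(\<Prod>i\<in>I. p (x i)) * indicator (PiE I A) x = (\<Prod>i\<in>I. p (x i) * indicator (A i) (x i))"
        by (simp add: prod.distrib)
    qed
    also have "\<dots> = (\<Prod>i\<in>I. \<integral>\<^sup>+x. p x * indicator (A i) x \<partial>L)"
      using A I by (intro L.product_nn_integral_prod) auto
    also have "\<dots> = (\<Prod>i\<in>I. emeasure (density L p) (A i))"
      using A by (intro prod.cong) (auto simp: emeasure_density)
    finally show "emeasure (density (PiM I (\<lambda>_. L)) (\<lambda>x. \<Prod>i\<in>I. p (x i))) (PiE I A) =
      (\<Prod>i\<in>I. emeasure (density L p) (A i))" .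
  qed
qed

lemma exp_le_quadratic:
  fixes u :: real
  assumes "\<bar>u\<bar> \<le> 1"
  shows "exp u \<le> 1 + u + u\<^sup>2"
proof (cases "u \<ge> 0")
  case True
  then show ?thesis using assms exp_bound[of u] by simp
next
  case False
  define s where "s = - u"
  have s: "0 \<le> s" "s \<le> 1" using False assms by (auto simp: s_def)
  \<comment> \<open>With \<open>u = - s\<close> the claim becomes
    \<open>1 \<le> exp s * (1 - s + s\<^sup>2)\<close>. The quadratic Taylor polynomial is already
    enough in place of \<open>exp s\<close>, because all terms of the product beyond
    \<open>1\<close> are nonnegative.\<close>
  have *: "1 + s + s\<^sup>2 / 2 \<le> exp s" using exp_lower_Taylor_quadratic[OF s(1)] .
  have pos: "0 \<le> 1 - s + s\<^sup>2" using s by simp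
  have "(1 + s + s\<^sup>2 / 2) * (1 - s + s\<^sup>2) = 1 + s\<^sup>2 / 2 + s^3 / 2 + s^4 / 2"
    by (simp add: field_simps power2_eq_square power3_eq_cube power4_eq_xxxx)
  also have "\<dots> \<ge> 1" using s by simp
  finally have "1 \<le> exp s * (1 - s + s\<^sup>2)"
    using mult_right_mono[OF * pos] by simp
  then have "exp u \<le> 1 - s + s\<^sup>2"
    by (simp add: s_def exp_minus field_simps)
  then show ?thesis by (simp add: s_def)
qed

text \<open>The quadratic bound of the exponential is applied before centring, so the raw second
  moment takes the place of the variance; the mean then cancels through
  \<open>1 + u \<le> exp u\<close>. The sign of \<open>l\<close> is free, which gives both
  tails.\<close>

lemma iid_mgf_le:
  fixes f :: "'a \<Rightarrow> real" and n :: nat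
  assumes M: "prob_space M" and f[measurable]: "f \<in> borel_measurable M"
    and b: "\<And>x. x \<in> space M \<Longrightarrow> \<bar>f x\<bar> \<le> b" and l: "\<bar>l\<bar> * b \<le> 1"
    and v: "integral\<^sup>L M (\<lambda>x. (f x)\<^sup>2) \<le> v"
  shows "(\<integral>\<^sup>+x. ennreal (exp (l * (\<Sum>i<n. f (x i) - integral\<^sup>L M f))) \<partial>PiM {..<n} (\<lambda>_. M))
    \<le> ennreal (exp (real n * l\<^sup>2 * v))"
proof -
  interpret M: prob_space M by fact
  interpret P: product_prob_space "\<lambda>_::nat. M" "{..<n}" by unfold_locales
  define m where "m = integral\<^sup>L M f"
  have int_f: "integrable M f"
    by (rule M.integrable_const_bound[of _ b]) (use b in \<open>auto\<close>)
  have int_f2: "integrable M (\<lambda>x. (f x)\<^sup>2)"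
    by (rule M.integrable_const_bound[of _ "b\<^sup>2"])
      (use b in \<open>auto simp: abs_le_square_iff[symmetric] intro!: AE_I2 order_trans[OF b abs_ge_self]\<close>)
  have pt: "exp (l * (f x - m)) \<le> exp (- l * m) * (1 + l * f x + l\<^sup>2 * (f x)\<^sup>2)" if "x \<in> space M" for x
  proof -
    have "\<bar>l * f x\<bar> \<le> 1"
      using mult_left_mono[OF b[OF that] abs_ge_zero[of l]] l by (simp add: abs_mult)
    from exp_le_quadratic[OF this] have "exp (- l * m) * exp (l * f x) \<le> exp (- l * m) * (1 + l * f x + l\<^sup>2 * (f x)\<^sup>2)"
      by (simp add: power_mult_distrib)
    then show ?thesis by (simp add: exp_add[symmetric] algebra_simps)
  qed
  have nn: "0 \<le> exp (- l * m) * (1 + l * f x + l\<^sup>2 * (f x)\<^sup>2)" if "x \<in> space M" for x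
    using order_trans[OF _ pt[OF that], of 0] by simp
  have "(\<integral>\<^sup>+x. ennreal (exp (l * (f x - m))) \<partial>M) \<le>
      (\<integral>\<^sup>+x. ennreal (exp (- l * m) * (1 + l * f x + l\<^sup>2 * (f x)\<^sup>2)) \<partial>M)"
    using pt by (intro nn_integral_mono ennreal_leI) auto
  also have "\<dots> = ennreal (LINT x|M. exp (- l * m) * (1 + l * f x + l\<^sup>2 * (f x)\<^sup>2))"
    using int_f int_f2 nn by (intro nn_integral_eq_integral) auto
  also have "(LINT x|M. exp (- l * m) * (1 + l * f x + l\<^sup>2 * (f x)\<^sup>2)) =
      exp (- l * m) * (1 + l * m + l\<^sup>2 * (LINT x|M. (f x)\<^sup>2))"
    using int_f int_f2 by (simp add: m_def M.prob_space)
  also have "\<dots> \<le> exp (- l * m) * (1 + (l * m + l\<^sup>2 * v))"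
    using v by (auto intro!: mult_left_mono)
  also have "\<dots> \<le> exp (- l * m) * exp (l * m + l\<^sup>2 * v)"
    by (intro mult_left_mono exp_ge_add_one_self) auto
  also have "\<dots> = exp (l\<^sup>2 * v)" by (simp add: exp_add[symmetric])
  finally have one: "(\<integral>\<^sup>+x. ennreal (exp (l * (f x - m))) \<partial>M) \<le> ennreal (exp (l\<^sup>2 * v))"
    by (simp add: ennreal_leI)
  have "(\<integral>\<^sup>+x. ennreal (exp (l * (\<Sum>i<n. f (x i) - m))) \<partial>PiM {..<n} (\<lambda>_. M)) =
    (\<integral>\<^sup>+x. (\<Prod>i<n. ennreal (exp (l * (f (x i) - m)))) \<partial>PiM {..<n} (\<lambda>_. M))"
    by (intro nn_integral_cong) (simp add: sum_distrib_left exp_sum prod_ennreal)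
  also have "\<dots> = (\<Prod>i<n. \<integral>\<^sup>+x. ennreal (exp (l * (f x - m))) \<partial>M)"
    by (intro P.product_nn_integral_prod) auto
  also have "\<dots> \<le> (\<Prod>i<n. ennreal (exp (l\<^sup>2 * v)))"
    using one by (intro prod_mono_ennreal) auto
  also have "\<dots> = ennreal (exp (real n * l\<^sup>2 * v))"
    by (simp add: prod_ennreal exp_of_nat_mult[symmetric] ennreal_power mult.assoc)
  finally show ?thesis by (simp add: m_def)
qed

text \<open>Integrating out the last coordinate kills the cross term, so the bound grows by one
  second moment per observation. The induction on the product measure replaces an appeal to
  independence of random variables.\<close>

lemma iid_second_moment:
  fixes f :: "'a \<Rightarrow> real" and n :: nat
  assumes M: "prob_space M" and f[measurable]: "f \<in> borel_measurable M"
    and f2: "integrable M (\<lambda>x. (f x)\<^sup>2)"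
  shows "(\<integral>\<^sup>+x. ennreal ((\<Sum>i<n. f (x i) - integral\<^sup>L M f)\<^sup>2) \<partial>PiM {..<n} (\<lambda>_. M))
    \<le> ennreal (real n * integral\<^sup>L M (\<lambda>x. (f x)\<^sup>2))"
proof -
  interpret M: prob_space M by fact
  interpret P: product_prob_space "\<lambda>_::nat. M" "{..<k}" for k by unfold_locales
  define m where "m = integral\<^sup>L M f"
  define v where "v = integral\<^sup>L M (\<lambda>x. (f x)\<^sup>2)"
  have v0: "0 \<le> v" by (simp add: v_def)
  have int_f: "integrable M f" by (rule M.square_integrable_imp_integrable) (use f2 in auto)
  have inner: "(\<integral>\<^sup>+y. ennreal ((s + (f y - m))\<^sup>2) \<partial>M) \<le> ennreal (s\<^sup>2) + ennreal v" for s
  proof -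
    have eq: "(s + (f y - m))\<^sup>2 = (s - m)\<^sup>2 + 2 * (s - m) * f y + (f y)\<^sup>2" for y
      by (simp add: power2_eq_square algebra_simps)
    have "integrable M (\<lambda>y. (s + (f y - m))\<^sup>2)" unfolding eq using int_f f2 by simp
    then have "(\<integral>\<^sup>+y. ennreal ((s + (f y - m))\<^sup>2) \<partial>M) = ennreal (LINT y|M. (s + (f y - m))\<^sup>2)"
      by (intro nn_integral_eq_integral) simp_all
    also have "(LINT y|M. (s + (f y - m))\<^sup>2) = (s - m)\<^sup>2 + 2 * (s - m) * m + v"
      unfolding eq using int_f f2 by (simp add: m_def v_def M.prob_space)
    also have "\<dots> \<le> s\<^sup>2 + v" by (simp add: power2_eq_square algebra_simps)
    finally show ?thesis using v0 by (simp add: ennreal_leI)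
  qed
  have "(\<integral>\<^sup>+x. ennreal ((\<Sum>i<n. f (x i) - m)\<^sup>2) \<partial>PiM {..<n} (\<lambda>_. M)) \<le> ennreal (real n * v)"
  proof (induction n)
    case (Suc n)
    have "(\<integral>\<^sup>+x. ennreal ((\<Sum>i<Suc n. f (x i) - m)\<^sup>2) \<partial>PiM {..<Suc n} (\<lambda>_. M)) =
      (\<integral>\<^sup>+x. \<integral>\<^sup>+y. ennreal ((\<Sum>i<Suc n. f ((x(n:=y)) i) - m)\<^sup>2) \<partial>M \<partial>PiM {..<n} (\<lambda>_. M))"
      unfolding lessThan_Suc by (rule P.product_nn_integral_insert) auto
    also have "\<dots> = (\<integral>\<^sup>+x. \<integral>\<^sup>+y. ennreal (((\<Sum>i<n. f (x i) - m) + (f y - m))\<^sup>2) \<partial>M \<partial>PiM {..<n} (\<lambda>_. M))"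
      by (simp add: add_ac)
    also have "\<dots> \<le> (\<integral>\<^sup>+x. ennreal ((\<Sum>i<n. f (x i) - m)\<^sup>2) + ennreal v \<partial>PiM {..<n} (\<lambda>_. M))"
      by (intro nn_integral_mono inner)
    also have "\<dots> = (\<integral>\<^sup>+x. ennreal ((\<Sum>i<n. f (x i) - m)\<^sup>2) \<partial>PiM {..<n} (\<lambda>_. M)) + ennreal v"
      by (subst nn_integral_add) (auto simp: P.P.emeasure_space_1)
    also have "\<dots> \<le> ennreal (real n * v) + ennreal v" using Suc by (intro add_right_mono)
    also have "\<dots> = ennreal (real (Suc n) * v)"
      using v0 by (simp add: ennreal_plus[symmetric] algebra_simps del: ennreal_plus)
    finally show ?case .
  qed simp
  then show ?thesis by (simp add: m_def v_def)
qed

text \<open>Averaging over the last coordinate gives a function \<open>g\<close> of one variable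
  less that inherits both the bound and the bounded differences. The deviation splits orthogonally
  into \<open>f - g\<close>, at most \<open>c\<close> in absolute value, and \<open>g - m\<close>,
  to which the induction hypothesis applies.\<close>

lemma efron_stein_bounded_differences:
  fixes f :: "(nat \<Rightarrow> 'a) \<Rightarrow> real" and n :: nat
  assumes M: "prob_space M" and f: "f \<in> borel_measurable (PiM {..<n} (\<lambda>_. M))"
    and K: "\<And>x. x \<in> space (PiM {..<n} (\<lambda>_. M)) \<Longrightarrow> \<bar>f x\<bar> \<le> K"
    and c: "\<And>x i y. x \<in> space (PiM {..<n} (\<lambda>_. M)) \<Longrightarrow> i < n \<Longrightarrow> y \<in> space M \<Longrightarrow> \<bar>f (x(i := y)) - f x\<bar> \<le> c"
  shows "(\<integral>\<^sup>+x. ennreal ((f x - integral\<^sup>L (PiM {..<n} (\<lambda>_. M)) f)\<^sup>2) \<partial>PiM {..<n} (\<lambda>_. M))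
    \<le> ennreal (real n * c\<^sup>2)"
  using f K c
proof (induction n arbitrary: f)
  case 0
  let ?u = "\<lambda>_. undefined"
  have m: "integral\<^sup>L (PiM {..<0::nat} (\<lambda>_. M)) f = f ?u"
    by (simp add: PiM_empty lebesgue_integral_count_space_finite)
  have "(\<integral>\<^sup>+x. ennreal ((f x - f ?u)\<^sup>2) \<partial>PiM {..<0::nat} (\<lambda>_. M)) = (\<integral>\<^sup>+x. 0 \<partial>PiM {..<0::nat} (\<lambda>_. M))"
  proof (intro nn_integral_cong)
    fix x assume "x \<in> space (PiM {..<0::nat} (\<lambda>_. M))"
    then have "x = ?u" by (simp add: space_PiM)
    then show "ennreal ((f x - f ?u)\<^sup>2) = 0" by simp
  qed
  then have "(\<integral>\<^sup>+x. ennreal ((f x - integral\<^sup>L (PiM {..<0::nat} (\<lambda>_. M)) f)\<^sup>2) \<partial>PiM {..<0::nat} (\<lambda>_. M)) = 0"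
    unfolding m by simp
  then show ?case by simp
next
  case (Suc n)
  interpret M: prob_space M by fact
  interpret P: product_prob_space "\<lambda>_::nat. M" "{..<k}" for k by unfold_locales
  let ?S = "\<lambda>n. PiM {..<n::nat} (\<lambda>_. M)"
  note [measurable] = Suc.prems(1)
  have ins: "x(n := y) \<in> space (?S (Suc n))" if "x \<in> space (?S n)" "y \<in> space M" for x y
    using that by (auto simp: space_PiM PiE_iff extensional_def)
  have up[measurable]: "(\<lambda>(x, y). x(n := y)) \<in> measurable (?S n \<Otimes>\<^sub>M M) (?S (Suc n))"
    unfolding lessThan_Suc using measurable_add_dim by simp
  define g where "g x = (LINT y|M. f (x(n := y)))" for x
  have f_up[measurable]: "(\<lambda>(x, y). f (x(n := y))) \<in> borel_measurable (?S n \<Otimes>\<^sub>M M)"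
    using measurable_compose[OF up Suc.prems(1)] by (simp add: split_beta')
  have [measurable]: "g \<in> borel_measurable (?S n)"
    unfolding g_def by (rule M.borel_measurable_lebesgue_integral) (use f_up in simp)
  have fy[measurable]: "(\<lambda>y. f (x(n := y))) \<in> borel_measurable M" if "x \<in> space (?S n)" for x
    using measurable_Pair2[OF f_up that] by simp
  have int_y: "integrable M (\<lambda>y. f (x(n := y)))" if "x \<in> space (?S n)" for x
    using that by (intro M.integrable_const_bound[of _ K]) (auto intro!: AE_I2 Suc.prems(2) ins)
  have int_f: "integrable (?S (Suc n)) f"
    by (intro P.P.integrable_const_bound[of _ K]) (auto intro!: AE_I2 Suc.prems(2))
  have K0: "0 \<le> K"
  proof -
    obtain x where "x \<in> space (?S (Suc n))" using P.P.not_empty by blast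
    from Suc.prems(2)[OF this] show ?thesis by linarith
  qed
  have g_bd: "\<bar>g x\<bar> \<le> K" if "x \<in> space (?S n)" for x
  proof -
    have "\<bar>g x\<bar> \<le> (LINT y|M. \<bar>f (x(n := y))\<bar>)" unfolding g_def by (rule integral_abs_bound)
    also have "\<dots> \<le> (LINT y|M. K)"
      using that by (intro integral_mono integrable_abs int_y) (auto intro!: Suc.prems(2) ins)
    finally show ?thesis by (simp add: M.prob_space)
  qed
  have g_diff: "\<bar>g (x(i := z)) - g x\<bar> \<le> c" if x: "x \<in> space (?S n)" and i: "i < n" and z: "z \<in> space M" for x i z
  proof -
    have x': "x(i := z) \<in> space (?S n)"
      using x i z by (auto simp: space_PiM PiE_iff extensional_def)
    have "g (x(i := z)) - g x = (LINT y|M. f (x(i := z, n := y)) - f (x(n := y)))"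
      unfolding g_def using int_y[OF x] int_y[OF x'] by (intro Bochner_Integration.integral_diff[symmetric])
    then have "\<bar>g (x(i := z)) - g x\<bar> \<le> (LINT y|M. \<bar>f (x(i := z, n := y)) - f (x(n := y))\<bar>)"
      by (simp only: integral_abs_bound)
    also have "\<dots> \<le> (LINT y|M. c)"
    proof (intro integral_mono integrable_abs Bochner_Integration.integrable_diff int_y x x')
      fix y assume y: "y \<in> space M"
      have "x(i := z, n := y) = (x(n := y))(i := z)" using i by (auto simp: fun_eq_iff)
      then show "\<bar>f (x(i := z, n := y)) - f (x(n := y))\<bar> \<le> c"
        using Suc.prems(3)[OF ins[OF x y], of i z] i z by (simp del: fun_upd_apply)
    qed auto
    finally show ?thesis by (simp add: M.prob_space)
  qed
  have eq: "integral\<^sup>L (?S (Suc n)) f = integral\<^sup>L (?S n) g"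
    unfolding g_def lessThan_Suc
    by (rule P.product_integral_insert[OF _ _ int_f[unfolded lessThan_Suc]]) auto
  define m where "m = integral\<^sup>L (?S (Suc n)) f"
  have near: "\<bar>f (x(n := y)) - g x\<bar> \<le> c" if x: "x \<in> space (?S n)" and y: "y \<in> space M" for x y
  proof -
    have "f (x(n := y)) - g x = (LINT z|M. f (x(n := y)) - f (x(n := z)))"
      unfolding g_def using int_y[OF x] by (simp add: M.prob_space)
    then have "\<bar>f (x(n := y)) - g x\<bar> \<le> (LINT z|M. \<bar>f (x(n := y)) - f (x(n := z))\<bar>)"
      by (simp only: integral_abs_bound)
    also have "\<dots> \<le> (LINT z|M. c)"
      using Suc.prems(3)[OF ins[OF x], of _ n y] y
      by (intro integral_mono integrable_abs Bochner_Integration.integrable_diff int_y x) (auto simp del: fun_upd_apply)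
    finally show ?thesis by (simp add: M.prob_space)
  qed
  have fm: "(\<lambda>x. ennreal ((f x - m)\<^sup>2)) \<in> borel_measurable (PiM (insert n {..<n}) (\<lambda>_. M))"
    using Suc.prems(1) unfolding lessThan_Suc by measurable
  have inner: "(\<integral>\<^sup>+y. ennreal ((f (x(n := y)) - m)\<^sup>2) \<partial>M) \<le> ennreal (c\<^sup>2) + ennreal ((g x - m)\<^sup>2)"
    if x: "x \<in> space (?S n)" for x
  proof -
    \<comment> \<open>The square is expanded around \<open>g x\<close>. Only
      \<open>(f - g)\<^sup>2\<close> is estimated; the rest is affine in \<open>f\<close>, so its
      integral over the last coordinate can be evaluated exactly and the cross term drops
      out.\<close>
    have sq: "(f (x(n := y)) - m)\<^sup>2 \<le> c\<^sup>2 + (2 * (g x - m) * f (x(n := y)) - 2 * (g x - m) * g x + (g x - m)\<^sup>2)"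
      if "y \<in> space M" for y
    proof -
      have "(f (x(n := y)) - g x)\<^sup>2 \<le> c\<^sup>2"
        using near[OF x that] by (simp add: abs_le_square_iff[symmetric])
      then show ?thesis by (simp add: power2_eq_square algebra_simps)
    qed
    have "(\<integral>\<^sup>+y. ennreal ((f (x(n := y)) - m)\<^sup>2) \<partial>M) \<le>
       (\<integral>\<^sup>+y. ennreal (c\<^sup>2 + (2 * (g x - m) * f (x(n := y)) - 2 * (g x - m) * g x + (g x - m)\<^sup>2)) \<partial>M)"
      by (intro nn_integral_mono ennreal_leI sq)
    also have "\<dots> = ennreal (LINT y|M. c\<^sup>2 + (2 * (g x - m) * f (x(n := y)) - 2 * (g x - m) * g x + (g x - m)\<^sup>2))"
    proof (intro nn_integral_eq_integral AE_I2)
      show "0 \<le> c\<^sup>2 + (2 * (g x - m) * f (x(n := y)) - 2 * (g x - m) * g x + (g x - m)\<^sup>2)" if "y \<in> space M" for y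
        using sq[OF that] by (rule order_trans[rotated]) simp
    qed (use int_y[OF x] in simp)
    also have "(LINT y|M. c\<^sup>2 + (2 * (g x - m) * f (x(n := y)) - 2 * (g x - m) * g x + (g x - m)\<^sup>2)) = c\<^sup>2 + (g x - m)\<^sup>2"
      using int_y[OF x] by (simp add: M.prob_space g_def[symmetric])
    finally show ?thesis by (simp del: fun_upd_apply)
  qed
  have "(\<integral>\<^sup>+x. ennreal ((f x - m)\<^sup>2) \<partial>?S (Suc n)) = (\<integral>\<^sup>+x. \<integral>\<^sup>+y. ennreal ((f (x(n := y)) - m)\<^sup>2) \<partial>M \<partial>?S n)"
    unfolding lessThan_Suc by (rule P.product_nn_integral_insert) (use fm in auto)
  also have "\<dots> \<le> (\<integral>\<^sup>+x. ennreal (c\<^sup>2) + ennreal ((g x - m)\<^sup>2) \<partial>?S n)"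
    by (intro nn_integral_mono inner)
  also have "\<dots> = ennreal (c\<^sup>2) + (\<integral>\<^sup>+x. ennreal ((g x - m)\<^sup>2) \<partial>?S n)"
    by (subst nn_integral_add) (auto simp: P.P.emeasure_space_1)
  also have "(\<integral>\<^sup>+x. ennreal ((g x - m)\<^sup>2) \<partial>?S n) \<le> ennreal (real n * c\<^sup>2)"
    unfolding m_def eq by (rule Suc.IH) (simp_all add: g_bd g_diff del: fun_upd_apply)
  also have "ennreal (c\<^sup>2) + ennreal (real n * c\<^sup>2) = ennreal (real (Suc n) * c\<^sup>2)"
    by (simp add: ennreal_plus[symmetric] algebra_simps del: ennreal_plus)
  finally show ?case by (simp add: m_def add_left_mono)
qed

subsection \<open>Priors, posteriors and tests\<close>

lemma sigma_finite_restrict_lborel: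
  "T \<in> sets borel \<Longrightarrow> sigma_finite_measure (restrict_space lborel T)"
  by (intro sigma_finite_measure_restrict_space lborel.sigma_finite_measure_axioms) auto

lemma prob_densityD:
  assumes "prob_density T p" "T \<in> sets borel"
  shows "p \<in> borel_measurable (restrict_space lborel T)"
    "\<And>x. x \<in> T \<Longrightarrow> 0 \<le> p x"
    "(\<integral>\<^sup>+x. ennreal (p x) \<partial>restrict_space lborel T) = 1"
  using assms by (auto simp: prob_density_def nn_integral_restrict_space
      cong: measurable_cong_sets sets_restrict_space_cong)

lemma prob_space_law:
  assumes "prob_density T p" "T \<in> sets borel"
  shows "prob_space (law T p)"
  unfolding law_def using prob_densityD[OF assms]
  by (intro prob_spaceI) (simp add: emeasure_density cong: nn_integral_cong_simp)

lemma law_simps [simp]: "space (law T p) = T" "sets (law T p) = sets (restrict_space lborel T)"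
  by (auto simp: law_def space_restrict_space)

lemma PiM_law:
  assumes p: "prob_density T p" and T: "T \<in> sets borel" and I: "finite I"
  shows "PiM I (\<lambda>_. law T p) = density (PiM I (\<lambda>_. restrict_space lborel T)) (\<lambda>x. \<Prod>i\<in>I. ennreal (p (x i)))"
proof -
  interpret prob_space "law T p" using p T by (rule prob_space_law)
  show ?thesis
    using prob_densityD[OF p T] sigma_finite_measure_axioms unfolding law_def
    by (intro PiM_density_prod sigma_finite_restrict_lborel T I) auto
qed

lemma nn_integral_PiM_law:
  assumes p: "prob_density T p" and T: "T \<in> sets borel" and I: "finite I"
    and f: "f \<in> borel_measurable (PiM I (\<lambda>_. restrict_space lborel T))"
  shows "(\<integral>\<^sup>+x. f x \<partial>PiM I (\<lambda>_. law T p)) =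
    (\<integral>\<^sup>+x. (\<Prod>i\<in>I. ennreal (p (x i))) * f x \<partial>PiM I (\<lambda>_. restrict_space lborel T))"
proof -
  note [measurable] = prob_densityD(1)[OF p T]
  show ?thesis unfolding PiM_law[OF p T I] using f by (intro nn_integral_density) auto
qed

lemma likelihood_eq_prod:
  assumes "prob_density T p" "\<And>i. i < n \<Longrightarrow> \<omega> i \<in> T"
  shows "likelihood n \<omega> p = (\<Prod>i<n. ennreal (p (\<omega> i)))"
  using assms by (subst prod_ennreal) (auto simp: likelihood_def prob_density_def)

section \<open>Measurability of the likelihood and of the posterior mass\<close>

locale prior_setup =
  fixes T :: "real set" and \<P> :: "(real \<Rightarrow> real) set" and Q :: "(real \<Rightarrow> real) measure"
    and p0 :: "real \<Rightarrow> real"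
  assumes T[measurable]: "T \<in> sets borel"
    and prior: "is_prior T \<P> Q"
    and dens: "\<And>p. p \<in> \<P> \<Longrightarrow> prob_density T p"
    and p0: "prob_density T p0"
begin

abbreviation "L \<equiv> restrict_space lborel T"
abbreviation "Sn n \<equiv> PiM {..<n::nat} (\<lambda>_. L)"
abbreviation "P0n n \<equiv> PiM {..<n::nat} (\<lambda>_. law T p0)"

sublocale Q: prob_space Q using prior by (simp add: is_prior_def)
sublocale L: sigma_finite_measure L by (rule sigma_finite_restrict_lborel) (rule T)
sublocale P0: prob_space "law T p0" using p0 T by (rule prob_space_law)

lemma space_Q: "space Q = \<P>" using prior by (simp add: is_prior_def)

lemma eval_measurable: "(\<lambda>(p, x). p x) \<in> borel_measurable (Q \<Otimes>\<^sub>M L)"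
proof -
  have "sets (Q \<Otimes>\<^sub>M L) = sets (Q \<Otimes>\<^sub>M restrict_space borel T)"
    by (intro sets_pair_measure_cong sets_restrict_space_cong) auto
  then show ?thesis using prior by (simp add: is_prior_def cong: measurable_cong_sets)
qed

text \<open>The sample space \<open>N\<close> is left open because joint measurability is used
  twice: for finite samples under product Lebesgue measure and for infinite sequences of
  observations.\<close>

lemma likelihood_measurable:
  assumes "\<And>i. i < n \<Longrightarrow> (\<lambda>\<omega>. \<omega> i) \<in> measurable N L"
  shows "(\<lambda>(\<omega>, p). likelihood n \<omega> p) \<in> borel_measurable (N \<Otimes>\<^sub>M Q)"
proof -
  have "(\<lambda>z. (snd z) (fst z i)) \<in> borel_measurable (N \<Otimes>\<^sub>M Q)" if "i < n" for i
  proof -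
    have "(\<lambda>z. (snd z, fst z i)) \<in> measurable (N \<Otimes>\<^sub>M Q) (Q \<Otimes>\<^sub>M L)"
      using measurable_compose[OF measurable_fst assms[OF that]] by (intro measurable_Pair) auto
    from measurable_compose[OF this eval_measurable] show ?thesis by simp
  qed
  then have "(\<lambda>z. \<Prod>i<n. (snd z) (fst z i)) \<in> borel_measurable (N \<Otimes>\<^sub>M Q)"
    by (intro borel_measurable_prod) auto
  then show ?thesis by (simp add: likelihood_def split_beta' measurable_compose[OF _ measurable_ennreal])
qed

lemma likelihood_measurable_Sn [measurable]:
  "(\<lambda>(\<omega>, p). likelihood n \<omega> p) \<in> borel_measurable (Sn n \<Otimes>\<^sub>M Q)"
  by (rule likelihood_measurable) (auto intro!: measurable_component_singleton)

lemma product_sigma_finite_L: "product_sigma_finite (\<lambda>_::nat. L)"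
  by (intro product_sigma_finite_const L.sigma_finite_measure_axioms)

lemma sigma_finite_Sn: "sigma_finite_measure (Sn n)"
proof -
  interpret product_sigma_finite "\<lambda>_::nat. L" by (rule product_sigma_finite_L)
  show ?thesis by (rule sigma_finite) auto
qed

lemma space_Sn: "x \<in> space (Sn n) \<Longrightarrow> i < n \<Longrightarrow> x i \<in> T"
  by (auto simp: space_PiM space_restrict_space)

lemma nn_integral_likelihood:
  assumes p: "prob_density T p"
  shows "(\<integral>\<^sup>+x. likelihood n x p \<partial>Sn n) = 1"
proof -
  interpret product_sigma_finite "\<lambda>_::nat. L" by (rule product_sigma_finite_L)
  have "(\<integral>\<^sup>+x. likelihood n x p \<partial>Sn n) = (\<integral>\<^sup>+x. (\<Prod>i<n. ennreal (p (x i))) \<partial>Sn n)"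
    using p by (intro nn_integral_cong likelihood_eq_prod) (auto dest: space_Sn)
  also have "\<dots> = (\<Prod>i<n. \<integral>\<^sup>+x. ennreal (p x) \<partial>L)"
    using prob_densityD(1)[OF p T] by (intro product_nn_integral_prod) auto
  finally show ?thesis using prob_densityD(3)[OF p T] by simp
qed

text \<open>The posterior is absolutely continuous with respect to the prior, so a measurable hull of
  \<open>B\<close> under the prior is one under every posterior.\<close>

lemma outer_posterior_hull:
  assumes B: "B \<subseteq> \<P>"
  obtains A where "A \<in> sets Q" "B \<subseteq> A"
    "\<And>n \<omega>. (\<And>i. i < n \<Longrightarrow> \<omega> i \<in> T) \<Longrightarrow>
      outer_measure_of (posterior Q n \<omega>) B = emeasure (posterior Q n \<omega>) A"
proof -
  obtain A where A: "A \<in> sets Q" "B \<subseteq> A" "outer_measure_of Q B = emeasure Q A"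
    using outer_measure_of_attain[of B Q] B by (auto simp: space_Q)
  have "outer_measure_of (posterior Q n \<omega>) B = emeasure (posterior Q n \<omega>) A"
    if \<omega>: "\<And>i. i < n \<Longrightarrow> \<omega> i \<in> T" for n \<omega>
  proof (rule antisym)
    have sets: "sets (posterior Q n \<omega>) = sets Q" by (simp add: posterior_def)
    note [measurable] = measurable_likelihood[OF prior \<omega>]
    show "outer_measure_of (posterior Q n \<omega>) B \<le> emeasure (posterior Q n \<omega>) A"
      unfolding outer_measure_of_def using A by (intro INF_lower) (auto simp: sets)
    show "emeasure (posterior Q n \<omega>) A \<le> outer_measure_of (posterior Q n \<omega>) B"
      unfolding outer_measure_of_def
    proof (rule INF_greatest)
      fix D assume "D \<in> {D \<in> sets (posterior Q n \<omega>). B \<subseteq> D}"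
      then have D: "D \<in> sets Q" "B \<subseteq> D" by (auto simp: sets)
      \<comment> \<open>Minimality of the hull: \<open>A \<inter> D\<close> is again a measurable
        cover of \<open>B\<close>. Hence every measurable cover \<open>D\<close> contains
        \<open>A\<close> up to a null set of the prior, which is also null for the
        posterior.\<close>
      have "emeasure Q A \<le> emeasure Q (A \<inter> D)"
        unfolding A(3)[symmetric] outer_measure_of_def using A D by (intro INF_lower) auto
      then have "emeasure Q (A - D) = 0"
        using A D emeasure_Diff[of Q "A \<inter> D" A]
        by (simp add: Diff_Int antisym[OF emeasure_mono] Q.emeasure_finite)
          (metis Q.emeasure_finite diff_eq_0_iff_ennreal ennreal_minus_eq_0 infinity_ennreal_def top.not_eq_extremum)
      then have "A - D \<in> null_sets Q" using A D by auto
      then have AE: "AE p in Q. p \<notin> A - D" by (rule AE_not_in)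
      have "emeasure (posterior Q n \<omega>) A = (\<integral>\<^sup>+p. likelihood n \<omega> p / (\<integral>\<^sup>+p'. likelihood n \<omega> p' \<partial>Q) * indicator A p \<partial>Q)"
        unfolding posterior_def using A(1) by (intro emeasure_density) auto
      also have "\<dots> \<le> (\<integral>\<^sup>+p. likelihood n \<omega> p / (\<integral>\<^sup>+p'. likelihood n \<omega> p' \<partial>Q) * indicator D p \<partial>Q)"
        using AE by (intro nn_integral_mono_AE) (auto simp: indicator_def)
      also have "\<dots> = emeasure (posterior Q n \<omega>) D"
        unfolding posterior_def using D(1) by (intro emeasure_density[symmetric]) auto
      finally show "emeasure (posterior Q n \<omega>) A \<le> emeasure (posterior Q n \<omega>) D" .
    qed
  qed
  with A that show ?thesis by blast
qed

text \<open>A single hull, independent of \<open>n\<close> and of the sample, serves all posteriors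
  at once. The outer mass is thus a quotient of two integrals of the likelihood over fixed
  measurable sets, hence measurable in the sample even when \<open>B\<close> is not a measurable
  set.\<close>

lemma measurable_outer_posterior:
  assumes B: "B \<subseteq> \<P>"
  shows "(\<lambda>\<omega>. enn2real (outer_measure_of (posterior Q n \<omega>) B)) \<in>
    borel_measurable (PiM UNIV (\<lambda>_::nat. law T p0))"
proof -
  obtain A where A[measurable]: "A \<in> sets Q" and eq: "\<And>n \<omega>. (\<And>i. i < n \<Longrightarrow> \<omega> i \<in> T) \<Longrightarrow>
      outer_measure_of (posterior Q n \<omega>) B = emeasure (posterior Q n \<omega>) A"
    using outer_posterior_hull[OF B] by metis
  let ?N = "PiM UNIV (\<lambda>_::nat. law T p0)"
  have sp: "\<omega> i \<in> T" if "\<omega> \<in> space ?N" for \<omega> i using that by (auto simp: space_PiM)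
  have [measurable]: "(\<lambda>(\<omega>, p). likelihood n \<omega> p) \<in> borel_measurable (?N \<Otimes>\<^sub>M Q)"
  proof (rule likelihood_measurable)
    fix i :: nat
    have "(\<lambda>\<omega>. \<omega> i) \<in> measurable ?N (law T p0)" by measurable
    then show "(\<lambda>\<omega>. \<omega> i) \<in> measurable ?N L" by (simp cong: measurable_cong_sets)
  qed
  have "(\<lambda>\<omega>. enn2real ((\<integral>\<^sup>+p\<in>A. likelihood n \<omega> p \<partial>Q) / (\<integral>\<^sup>+p. likelihood n \<omega> p \<partial>Q))) \<in> borel_measurable ?N"
    by measurable
  then show ?thesis
    by (rule measurable_cong[THEN iffD1, rotated])
      (simp add: eq sp emeasure_posterior[OF prior])
qed

end

section \<open>Bounding the posterior mass by means of a test\<close>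

context prior_setup
begin

sublocale P0n: prob_space "P0n n" for n
  by (rule prob_space_PiM) (rule P0.prob_space_axioms)

lemma sets_P0n: "sets (P0n n) = sets (Sn n)"
  by (intro sets_PiM_cong) auto

lemma likelihood_Sn [measurable]:
  assumes "prob_density T p"
  shows "(\<lambda>x. likelihood n x p) \<in> borel_measurable (Sn n)"
proof -
  note [measurable] = prob_densityD(1)[OF assms T]
  have "(\<lambda>x. \<Prod>i<n. ennreal (p (x i))) \<in> borel_measurable (Sn n)" by measurable
  then show ?thesis
    by (rule measurable_cong[THEN iffD2, rotated]) (auto intro!: likelihood_eq_prod assms dest: space_Sn)
qed

lemma nn_integral_P0n:
  assumes f: "f \<in> borel_measurable (Sn n)"
  shows "(\<integral>\<^sup>+x. f x \<partial>P0n n) = (\<integral>\<^sup>+x. likelihood n x p0 * f x \<partial>Sn n)"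
  unfolding nn_integral_PiM_law[OF p0 T finite_lessThan f]
proof (intro nn_integral_cong)
  fix x assume "x \<in> space (Sn n)"
  then have "likelihood n x p0 = (\<Prod>i<n. ennreal (p0 (x i)))"
    by (intro likelihood_eq_prod[where T = T] p0) (rule space_Sn)
  then show "(\<Prod>i<n. ennreal (p0 (x i))) * f x = likelihood n x p0 * f x" by simp
qed

text \<open>With \<open>N = n e^2\<close>, the log likelihood ratio has mean at least
  \<open>- N\<close> and variance at most \<open>N\<close>. Falling below \<open>- 2 N\<close> is a
  deviation of at least \<open>N\<close>, so Chebyshev's inequality gives
  \<open>N / N^2\<close>.\<close>

lemma KL_chebyshev:
  assumes p: "p \<in> KL_neighbourhood T \<P> p0 e" and n: "n \<ge> 1" and e: "e > 0"
  shows "emeasure (P0n n) {x \<in> space (P0n n). likelihood n x p < ennreal (exp (- 2 * real n * e\<^sup>2)) * likelihood n x p0}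
    \<le> ennreal (1 / (real n * e\<^sup>2))"
proof -
  define N where "N = real n * e\<^sup>2"
  have N: "0 < N" using n e by (simp add: N_def)
  let ?Y = "\<lambda>x. ln (p x / p0 x)"
  from p have pP: "p \<in> \<P>" and pos: "AE x in law T p0. 0 < p x"
    and m2: "(\<integral>\<^sup>+x. ennreal ((?Y x)\<^sup>2) \<partial>law T p0) \<le> ennreal (e\<^sup>2)"
    and m1: "- (LINT x|law T p0. ?Y x) \<le> e\<^sup>2"
    by (auto simp: KL_neighbourhood_def)
  have p_dens: "prob_density T p" by (rule dens) fact
  note [measurable] = prob_densityD(1)[OF p_dens T] prob_densityD(1)[OF p0 T]
  have [measurable]: "?Y \<in> borel_measurable (law T p0)" by (simp cong: measurable_cong_sets)
  have Y2: "integrable (law T p0) (\<lambda>x. (?Y x)\<^sup>2)"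
    using m2 by (intro integrableI_nonneg) (auto simp: less_top[symmetric] top_unique)
  have m2': "(LINT x|law T p0. (?Y x)\<^sup>2) \<le> e\<^sup>2"
    using m2 by (subst (asm) nn_integral_eq_integral[OF Y2]) auto
  define m where "m = integral\<^sup>L (law T p0) ?Y"
  have sec: "(\<integral>\<^sup>+x. ennreal ((\<Sum>i<n. ?Y (x i) - m)\<^sup>2) \<partial>P0n n) \<le> ennreal N"
  proof -
    have "(\<integral>\<^sup>+x. ennreal ((\<Sum>i<n. ?Y (x i) - m)\<^sup>2) \<partial>P0n n) \<le> ennreal (real n * (LINT x|law T p0. (?Y x)\<^sup>2))"
      unfolding m_def by (rule iid_second_moment[OF P0.prob_space_axioms _ Y2]) simp
    also have "\<dots> \<le> ennreal N"
      using m2' unfolding N_def by (intro ennreal_leI mult_left_mono) auto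
    finally show ?thesis .
  qed
  \<comment> \<open>Positivity of both densities at the sample points is what allows the logarithm
    of the product to be split; \<open>ln 0 = 0\<close> would otherwise falsify the identity. For
    \<open>p0\<close> it is automatic under its own law.\<close>
  have pos0: "AE x in law T p0. 0 < p0 x"
    unfolding law_def by (subst AE_density) auto
  have AEi: "AE x in P0n n. \<forall>i\<in>{..<n}. 0 < p (x i) \<and> 0 < p0 (x i)"
    by (intro AE_finite_allI AE_PiM_component P0.prob_space_axioms) (use pos pos0 in auto)
  have sub: "likelihood n x p < ennreal (exp (- 2 * N)) * likelihood n x p0 \<Longrightarrow> N\<^sup>2 \<le> (\<Sum>i<n. ?Y (x i) - m)\<^sup>2"
    if x: "\<forall>i\<in>{..<n}. 0 < p (x i) \<and> 0 < p0 (x i)" for x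
  proof -
    assume "likelihood n x p < ennreal (exp (- 2 * N)) * likelihood n x p0"
    moreover have pp: "0 < (\<Prod>i<n. p (x i))" "0 < (\<Prod>i<n. p0 (x i))" using x by (auto intro!: prod_pos)
    ultimately have *: "(\<Prod>i<n. p (x i)) < exp (- 2 * N) * (\<Prod>i<n. p0 (x i))"
      by (simp add: likelihood_def ennreal_mult'[symmetric] ennreal_less_iff)
    have "ln (\<Prod>i<n. p (x i)) < ln (exp (- 2 * N) * (\<Prod>i<n. p0 (x i)))"
      using * pp by (subst ln_less_cancel_iff) auto
    also have "\<dots> = - 2 * N + ln (\<Prod>i<n. p0 (x i))"
      using pp(2) by (simp only: ln_mult_pos exp_gt_zero ln_exp)
    finally have "ln (\<Prod>i<n. p (x i)) < - 2 * N + ln (\<Prod>i<n. p0 (x i))" .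
    moreover have "(\<Sum>i<n. ?Y (x i)) = ln (\<Prod>i<n. p (x i)) - ln (\<Prod>i<n. p0 (x i))"
    proof -
      have "ln (\<Prod>i<n. q (x i)) = (\<Sum>i<n. ln (q (x i)))" if "q = p \<or> q = p0" for q
        using x that by (intro ln_prod) force+
      moreover have "(\<Sum>i<n. ?Y (x i)) = (\<Sum>i<n. ln (p (x i)) - ln (p0 (x i)))"
        using x by (intro sum.cong refl ln_divide_pos) auto
      ultimately show ?thesis by (simp add: sum_subtractf)
    qed
    ultimately have "(\<Sum>i<n. ?Y (x i)) < - 2 * N" by simp
    moreover have "- N \<le> real n * m"
      using m1 n mult_left_mono[of "- m" "e\<^sup>2" "real n"] unfolding m_def[symmetric] N_def by simp
    ultimately have "(\<Sum>i<n. ?Y (x i) - m) \<le> - N" by (simp add: sum_subtractf)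
    then have "\<bar>N\<bar> \<le> \<bar>\<Sum>i<n. ?Y (x i) - m\<bar>" using N by linarith
    then show ?thesis by (simp add: abs_le_square_iff)
  qed
  have "emeasure (P0n n) {x \<in> space (P0n n). likelihood n x p < ennreal (exp (- 2 * real n * e\<^sup>2)) * likelihood n x p0} \<le>
    emeasure (P0n n) {x \<in> space (P0n n). 1 \<le> ennreal (1 / N\<^sup>2) * ennreal ((\<Sum>i<n. ?Y (x i) - m)\<^sup>2)}"
  proof (rule emeasure_mono_AE)
    show "AE x in P0n n. x \<in> {x \<in> space (P0n n). likelihood n x p < ennreal (exp (- 2 * real n * e\<^sup>2)) * likelihood n x p0} \<longrightarrow>
      x \<in> {x \<in> space (P0n n). 1 \<le> ennreal (1 / N\<^sup>2) * ennreal ((\<Sum>i<n. ?Y (x i) - m)\<^sup>2)}"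
      using AEi
    proof eventually_elim
      case (elim x)
      show ?case
        using sub[OF elim] N by (auto simp: N_def[symmetric] ennreal_mult'[symmetric] mult.assoc ennreal_1[symmetric] simp del: ennreal_1)
    qed
  qed measurable
  also have "\<dots> \<le> ennreal (1 / N\<^sup>2) * (\<integral>\<^sup>+x\<in>space (P0n n). ennreal ((\<Sum>i<n. ?Y (x i) - m)\<^sup>2) \<partial>P0n n)"
    by (rule nn_integral_Markov_inequality) auto
  also have "\<dots> \<le> ennreal (1 / N\<^sup>2) * ennreal N"
    using sec by (intro mult_left_mono) (simp_all cong: nn_integral_cong_simp)
  also have "\<dots> = ennreal (1 / N)"
    using N by (simp add: ennreal_mult'[symmetric] power2_eq_square)
  finally show ?thesis by (simp add: N_def)
qed

text \<open>Chebyshev's inequality for each single \<open>p\<close> and Fubini's theorem: off a small event at least half of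
  the prior mass of the neighbourhood has a large likelihood ratio, so Jensen's inequality is not needed.\<close>

lemma denominator_bound:
  assumes mass: "exp (- C * real n * e\<^sup>2) \<le> measure Q (KL_neighbourhood T \<P> p0 e)"
    and n: "n \<ge> 1" and e: "e > 0"
  shows "emeasure (P0n n) {x \<in> space (P0n n).
      (\<integral>\<^sup>+p. likelihood n x p \<partial>Q) < ennreal (exp (- (C + 2) * real n * e\<^sup>2) / 2) * likelihood n x p0}
    \<le> ennreal (2 / (real n * e\<^sup>2))"
proof -
  define N where "N = real n * e\<^sup>2"
  define V where "V = KL_neighbourhood T \<P> p0 e"
  have N: "0 < N" using n e by (simp add: N_def)
  have mass': "exp (- C * N) \<le> measure Q V" using mass by (simp add: N_def V_def mult.assoc)
  have V_pos: "0 < measure Q V" using mass' exp_gt_zero[of "- C * N"] by linarith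
  \<comment> \<open>\<open>measure\<close> is \<open>0\<close> on non-measurable sets, so the
    positive lower bound on the prior mass already forces the neighbourhood to be
    measurable.\<close>
  have V[measurable]: "V \<in> sets Q" using V_pos measure_notin_sets[of V Q] by force
  have VP: "V \<subseteq> \<P>" by (auto simp: V_def KL_neighbourhood_def)
  note sets_P0n[measurable_cong]
  note [measurable] = likelihood_Sn[OF p0]
  let ?bad = "\<lambda>x p. likelihood n x p < ennreal (exp (- 2 * N)) * likelihood n x p0"
  let ?D = "{x \<in> space (P0n n). (\<integral>\<^sup>+p. likelihood n x p \<partial>Q) < ennreal (exp (- (C + 2) * N) / 2) * likelihood n x p0}"
  have [measurable]: "(\<lambda>(x, p). likelihood n x p) \<in> borel_measurable (P0n n \<Otimes>\<^sub>M Q)"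
    using likelihood_measurable_Sn by (simp cong: measurable_cong_sets sets_pair_measure_cong add: sets_P0n)
  have [measurable]: "Measurable.pred (P0n n \<Otimes>\<^sub>M Q) (\<lambda>(x, p). ?bad x p)" by measurable
  have D[measurable]: "?D \<in> sets (P0n n)" by measurable
  \<comment> \<open>If fewer than half of the neighbourhood were bad at \<open>x\<close>, the good
    part alone, of mass at least \<open>exp (- C * N) / 2\<close> and with likelihood ratio at least
    \<open>exp (- 2 * N)\<close>, would already push the denominator above the threshold in
    \<open>?D\<close>.\<close>
  have half: "measure Q V / 2 \<le> measure Q {p \<in> V. ?bad x p}" if x: "x \<in> ?D" for x
  proof (rule ccontr)
    assume neg: "\<not> ?thesis"
    from x have xs: "x \<in> space (P0n n)" by auto
    have [measurable]: "(\<lambda>p. likelihood n x p) \<in> borel_measurable Q"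
      by (rule measurable_likelihood[OF prior]) (use xs in \<open>auto simp: space_PiM\<close>)
    have "V \<inter> {p \<in> space Q. ?bad x p} \<in> sets Q" "V \<inter> {p \<in> space Q. \<not> ?bad x p} \<in> sets Q"
      by measurable
    moreover have "V \<inter> {p \<in> space Q. P p} = {p \<in> V. P p}" for P using VP by (auto simp: space_Q)
    ultimately have [measurable]: "{p \<in> V. ?bad x p} \<in> sets Q" "{p \<in> V. \<not> ?bad x p} \<in> sets Q"
      by simp_all
    have "measure Q V = measure Q {p \<in> V. ?bad x p} + measure Q {p \<in> V. \<not> ?bad x p}"
      by (subst Q.finite_measure_Union[symmetric]) (auto intro!: arg_cong[where f = "measure Q"])
    with neg mass' have half': "exp (- C * N) / 2 \<le> measure Q {p \<in> V. \<not> ?bad x p}" by simp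
    have "ennreal (exp (- (C + 2) * N) / 2) = ennreal (exp (- 2 * N)) * ennreal (exp (- C * N) / 2)"
      by (simp add: ennreal_mult'[symmetric] exp_add[symmetric] algebra_simps)
    also have "\<dots> \<le> ennreal (exp (- 2 * N)) * emeasure Q {p \<in> V. \<not> ?bad x p}"
      using half' by (intro mult_left_mono) (auto simp: Q.emeasure_eq_measure ennreal_leI)
    finally have "ennreal (exp (- (C + 2) * N) / 2) * likelihood n x p0 \<le>
       ennreal (exp (- 2 * N)) * likelihood n x p0 * emeasure Q {p \<in> V. \<not> ?bad x p}"
      by (metis (no_types, lifting) mult.assoc mult.commute mult_right_mono zero_le)
    also have "\<dots> = (\<integral>\<^sup>+p\<in>{p \<in> V. \<not> ?bad x p}. ennreal (exp (- 2 * N)) * likelihood n x p0 \<partial>Q)"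
      by (simp add: nn_integral_cmult_indicator)
    also have "\<dots> \<le> (\<integral>\<^sup>+p. likelihood n x p \<partial>Q)"
      by (intro nn_integral_mono) (auto simp: indicator_def not_less)
    finally show False using x by auto
  qed
  \<comment> \<open>Markov's inequality for the prior mass of the bad part, followed by exchanging
    sample and parameter: the expected bad mass is at most \<open>1 / N\<close> times the mass of
    \<open>V\<close>. Dividing by half the mass of \<open>V\<close> gives
    \<open>2 / N\<close>.\<close>
  have "ennreal (measure Q V / 2) * emeasure (P0n n) ?D = (\<integral>\<^sup>+x\<in>?D. ennreal (measure Q V / 2) \<partial>P0n n)"
    by (simp add: nn_integral_cmult_indicator)
  also have "\<dots> \<le> (\<integral>\<^sup>+x. (\<integral>\<^sup>+p. indicator {p \<in> V. ?bad x p} p \<partial>Q) \<partial>P0n n)"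
  proof (intro nn_integral_mono)
    fix x assume xs: "x \<in> space (P0n n)"
    have [measurable]: "(\<lambda>p. likelihood n x p) \<in> borel_measurable Q"
      by (rule measurable_likelihood[OF prior]) (use xs in \<open>auto simp: space_PiM\<close>)
    have "V \<inter> {p \<in> space Q. ?bad x p} \<in> sets Q" by measurable
    also have "V \<inter> {p \<in> space Q. ?bad x p} = {p \<in> V. ?bad x p}" using VP by (auto simp: space_Q)
    finally have "(\<integral>\<^sup>+p. indicator {p \<in> V. ?bad x p} p \<partial>Q) = ennreal (measure Q {p \<in> V. ?bad x p})"
      by (simp only: nn_integral_indicator Q.emeasure_eq_measure)
    then show "(ennreal (measure Q V / 2)) * indicator ?D x \<le> (\<integral>\<^sup>+p. indicator {p \<in> V. ?bad x p} p \<partial>Q)"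
      using half[of x] by (cases "x \<in> ?D") (auto intro!: ennreal_leI simp del: nn_integral_indicator nn_integral_indicator')
  qed
  also have "\<dots> = (\<integral>\<^sup>+p. (\<integral>\<^sup>+x. indicator {p \<in> V. ?bad x p} p \<partial>P0n n) \<partial>Q)"
  proof (rule pair_sigma_finite.Fubini'[symmetric])
    show "pair_sigma_finite (P0n n) Q"
      by (intro pair_sigma_finite.intro Q.sigma_finite_measure_axioms P0n.sigma_finite_measure_axioms)
    have "(\<lambda>z. indicator V (snd z) * indicator {z \<in> space (P0n n \<Otimes>\<^sub>M Q). ?bad (fst z) (snd z)} z :: ennreal) \<in> borel_measurable (P0n n \<Otimes>\<^sub>M Q)"
      by measurable
    then show "(\<lambda>(x, p). indicator {p \<in> V. ?bad x p} p :: ennreal) \<in> borel_measurable (P0n n \<Otimes>\<^sub>M Q)"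
      by (rule measurable_cong[THEN iffD1, rotated]) (auto simp: indicator_def space_pair_measure)
  qed
  also have "\<dots> \<le> (\<integral>\<^sup>+p\<in>V. ennreal (1 / N) \<partial>Q)"
  proof (intro nn_integral_mono)
    fix p assume "p \<in> space Q"
    then have pd: "prob_density T p" by (auto simp: space_Q dens)
    note [measurable] = likelihood_Sn[OF pd]
    show "(\<integral>\<^sup>+x. indicator {p \<in> V. ?bad x p} p \<partial>P0n n) \<le> ennreal (1 / N) * indicator V p"
    proof (cases "p \<in> V")
      case True
      have "(\<integral>\<^sup>+x. indicator {p \<in> V. ?bad x p} p \<partial>P0n n) = (\<integral>\<^sup>+x. indicator {x \<in> space (P0n n). ?bad x p} x \<partial>P0n n)"
        using True by (intro nn_integral_cong) (auto simp: indicator_def)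
      also have "\<dots> = emeasure (P0n n) {x \<in> space (P0n n). ?bad x p}" by simp
      also have "\<dots> \<le> ennreal (1 / N)"
        using KL_chebyshev[OF True[unfolded V_def] n e] by (simp add: N_def mult.assoc)
      finally show ?thesis using True by simp
    qed simp
  qed
  also have "\<dots> = ennreal (1 / N) * ennreal (measure Q V)"
    by (simp add: nn_integral_cmult_indicator Q.emeasure_eq_measure)
  also have "\<dots> = ennreal (measure Q V / 2) * ennreal (2 / N)"
    using N by (simp add: ennreal_mult'[symmetric])
  finally have "ennreal (2 / measure Q V) * (ennreal (measure Q V / 2) * emeasure (P0n n) ?D) \<le>
      ennreal (2 / measure Q V) * (ennreal (measure Q V / 2) * ennreal (2 / N))"
    by (rule mult_left_mono) simp
  moreover have "ennreal (2 / measure Q V) * ennreal (measure Q V / 2) = 1"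
    using V_pos by (simp add: ennreal_mult'[symmetric])
  ultimately show ?thesis by (simp add: mult.assoc[symmetric] N_def)
qed

text \<open>The alternatives may form a non-measurable set; it is covered by the exceptional set \<open>H0\<close> and by
  the measurable set of the densities with small error probability of the second kind.\<close>

lemma posterior_test_bound:
  assumes mass: "exp (- C * real n * e\<^sup>2) \<le> measure Q (KL_neighbourhood T \<P> p0 e)"
    and n: "n \<ge> 1" and e: "e > 0" and \<eta>: "\<eta> > 0" and \<kappa>: "\<kappa> \<ge> 0"
    and E: "E \<in> sets (Sn n)" and H0: "H0 \<in> sets Q" "measure Q H0 \<le> \<kappa>"
    and B: "B \<subseteq> \<P>" "\<And>p. p \<in> B - H0 \<Longrightarrow> (\<integral>\<^sup>+x\<in>space (Sn n) - E. likelihood n x p \<partial>Sn n) \<le> ennreal \<kappa>"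
  shows "emeasure (PiM UNIV (\<lambda>_::nat. law T p0))
      {\<omega> \<in> space (PiM UNIV (\<lambda>_::nat. law T p0)). \<eta> < enn2real (outer_measure_of (posterior Q n \<omega>) B)}
    \<le> emeasure (P0n n) E + ennreal (2 / (real n * e\<^sup>2) + 4 * \<kappa> * exp ((C + 2) * real n * e\<^sup>2) / \<eta>)"
proof -
  define N where "N = real n * e\<^sup>2"
  \<comment> \<open>The factor in the lower bound for the denominator. Its \<open>1 / 2\<close>
    turns the \<open>2 * \<kappa>\<close> of the numerator bound into the
    \<open>4 * \<kappa>\<close> of the conclusion.\<close>
  define d where "d = exp (- (C + 2) * N) / 2"
  have N: "0 < N" using n e by (simp add: N_def)
  have d: "0 < d" by (simp add: d_def)
  note sets_P0n[measurable_cong]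
  note [measurable] = E H0(1)
  have spP0: "space (P0n n) = space (Sn n)" by (rule sets_eq_imp_space_eq[OF sets_P0n])
  have [measurable]: "(\<lambda>(p, x). likelihood n x p) \<in> borel_measurable (Q \<Otimes>\<^sub>M Sn n)"
    using measurable_pair_swap[OF likelihood_measurable_Sn[of n]] by simp
  interpret Sn: sigma_finite_measure "Sn n" by (rule sigma_finite_Sn)
  define H where "H = H0 \<union> {p \<in> space Q. (\<integral>\<^sup>+x\<in>space (Sn n) - E. likelihood n x p \<partial>Sn n) \<le> ennreal \<kappa>}"
  have H[measurable]: "H \<in> sets Q" unfolding H_def by measurable
  have BH: "B \<subseteq> H" using B by (auto simp: H_def space_Q)
  define num where "num x = (\<integral>\<^sup>+p\<in>H. likelihood n x p \<partial>Q)" for x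
  have [measurable]: "num \<in> borel_measurable (Sn n)" unfolding num_def by measurable
  define l0 where "l0 x = likelihood n x p0" for x
  have [measurable]: "l0 \<in> borel_measurable (Sn n)" unfolding l0_def by (rule likelihood_Sn[OF p0])
  define D where "D = {x \<in> space (P0n n). (\<integral>\<^sup>+p. likelihood n x p \<partial>Q) < ennreal d * l0 x}"
  define F where "F = {x \<in> space (P0n n). x \<notin> E \<and> ennreal (\<eta> * d) * l0 x \<le> num x}"
  have [measurable]: "D \<in> sets (P0n n)" unfolding D_def by measurable
  have "{x \<in> space (Sn n). ennreal (\<eta> * d) * l0 x \<le> num x} \<in> sets (Sn n)"
    by (intro borel_measurable_le borel_measurable_times_ennreal) auto
  moreover have "F = {x \<in> space (Sn n). ennreal (\<eta> * d) * l0 x \<le> num x} - E"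
    unfolding F_def spP0 by auto
  ultimately have [measurable]: "F \<in> sets (P0n n)" using E by (simp add: sets_P0n)
  have D_le: "emeasure (P0n n) D \<le> ennreal (2 / N)"
    using denominator_bound[OF mass n e] by (simp add: D_def d_def N_def l0_def mult.assoc)
  \<comment> \<open>Two contributions of at most \<open>\<kappa>\<close> each: on \<open>H0\<close>
    the likelihood integrates to \<open>1\<close> and the prior mass is small, outside
    \<open>H0\<close> the error of the second kind is small by the definition of
    \<open>H\<close>.\<close>
  have num_le: "(\<integral>\<^sup>+x\<in>space (Sn n) - E. num x \<partial>Sn n) \<le> ennreal (2 * \<kappa>)"
  proof -
    have "(\<integral>\<^sup>+x\<in>space (Sn n) - E. num x \<partial>Sn n) =
        (\<integral>\<^sup>+x. \<integral>\<^sup>+p. likelihood n x p * indicator H p * indicator (space (Sn n) - E) x \<partial>Q \<partial>Sn n)"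
      unfolding num_def by (intro nn_integral_cong nn_integral_multc[symmetric]) measurable
    also have "\<dots> = (\<integral>\<^sup>+p. \<integral>\<^sup>+x. likelihood n x p * indicator H p * indicator (space (Sn n) - E) x \<partial>Sn n \<partial>Q)"
      by (intro pair_sigma_finite.Fubini'[symmetric] pair_sigma_finite.intro Q.sigma_finite_measure_axioms
          Sn.sigma_finite_measure_axioms) measurable
    also have "\<dots> \<le> (\<integral>\<^sup>+p. indicator H0 p + ennreal \<kappa> \<partial>Q)"
    proof (intro nn_integral_mono)
      fix p assume p: "p \<in> space Q"
      then have pd: "prob_density T p" by (simp add: space_Q dens)
      note [measurable] = likelihood_Sn[OF pd]
      show "(\<integral>\<^sup>+x. likelihood n x p * indicator H p * indicator (space (Sn n) - E) x \<partial>Sn n) \<le> indicator H0 p + ennreal \<kappa>"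
      proof (cases "p \<in> H0")
        case True
        have "(\<integral>\<^sup>+x. likelihood n x p * indicator H p * indicator (space (Sn n) - E) x \<partial>Sn n) \<le>
          (\<integral>\<^sup>+x. likelihood n x p \<partial>Sn n)" by (intro nn_integral_mono) (auto simp: indicator_def)
        then show ?thesis using True by (simp add: nn_integral_likelihood[OF pd] add_increasing2)
      next
        case False
        then show ?thesis by (cases "p \<in> H") (auto simp: H_def)
      qed
    qed
    also have "\<dots> = emeasure Q H0 + ennreal \<kappa>"
      by (subst nn_integral_add) (auto simp: Q.emeasure_space_1)
    also have "\<dots> \<le> ennreal \<kappa> + ennreal \<kappa>"
      using H0(2) by (intro add_right_mono) (simp add: Q.emeasure_eq_measure ennreal_leI)
    finally show ?thesis using \<kappa> by (simp add: ennreal_plus[symmetric] del: ennreal_plus)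
  qed
  \<comment> \<open>Change of measure combined with Markov's inequality: on \<open>F\<close> the
    likelihood of \<open>p0\<close> is at most the numerator divided by \<open>\<eta> * d\<close>,
    so its integral over \<open>F\<close> is controlled by \<open>num_le\<close>.\<close>
  have F_le: "emeasure (P0n n) F \<le> ennreal (4 * \<kappa> * exp ((C + 2) * N) / \<eta>)"
  proof -
    have "emeasure (P0n n) F = (\<integral>\<^sup>+x. indicator F x \<partial>P0n n)" by simp
    also have "\<dots> = (\<integral>\<^sup>+x. likelihood n x p0 * indicator F x \<partial>Sn n)"
      by (rule nn_integral_P0n) measurable
    also have "\<dots> \<le> (\<integral>\<^sup>+x. ennreal (1 / (\<eta> * d)) * (num x * indicator (space (Sn n) - E) x) \<partial>Sn n)"
    proof (intro nn_integral_mono)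
      fix x
      show "likelihood n x p0 * indicator F x \<le> ennreal (1 / (\<eta> * d)) * (num x * indicator (space (Sn n) - E) x)"
      proof (cases "x \<in> F")
        case True
        then have "ennreal (1 / (\<eta> * d)) * (ennreal (\<eta> * d) * likelihood n x p0) \<le> ennreal (1 / (\<eta> * d)) * num x"
          by (intro mult_left_mono) (auto simp: F_def l0_def)
        also have "ennreal (1 / (\<eta> * d)) * (ennreal (\<eta> * d) * likelihood n x p0) = likelihood n x p0"
          using \<eta> d by (simp add: mult.assoc[symmetric] ennreal_mult'[symmetric])
        finally show ?thesis using True by (auto simp: F_def spP0 l0_def)
      qed simp
    qed
    also have "\<dots> \<le> ennreal (1 / (\<eta> * d)) * ennreal (2 * \<kappa>)"
      using num_le by (subst nn_integral_cmult) (auto intro: mult_left_mono)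
    also have "\<dots> = ennreal (4 * \<kappa> * exp ((C + 2) * N) / \<eta>)"
    proof -
      have "1 / (\<eta> * d) * (2 * \<kappa>) = 4 * \<kappa> * exp ((C + 2) * N) / \<eta>"
        using \<eta> by (simp add: d_def exp_minus divide_simps del: minus_add_distrib)
      then show ?thesis using \<eta> d by (simp add: ennreal_mult'[symmetric] del: times_divide_eq_left)
    qed
    finally show ?thesis .
  qed
  interpret PU: product_prob_space "\<lambda>_::nat. law T p0" UNIV by unfold_locales
  let ?P = "PiM UNIV (\<lambda>_::nat. law T p0)"
  let ?r = "\<lambda>\<omega>. restrict \<omega> {..<n}"
  have spP: "\<omega> i \<in> T" if "\<omega> \<in> space ?P" for \<omega> i using that by (auto simp: space_PiM)
  have r[measurable]: "?r \<in> measurable ?P (P0n n)" by (rule measurable_restrict_subset) auto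
  have like_r: "likelihood n (?r \<omega>) = likelihood n \<omega>" for \<omega> by (simp add: likelihood_def fun_eq_iff)
  have "{\<omega> \<in> space ?P. \<eta> < enn2real (outer_measure_of (posterior Q n \<omega>) B)} \<subseteq> ?r -` (E \<union> D \<union> F) \<inter> space ?P"
  proof -
    have "?r \<omega> \<in> F" if \<omega>: "\<omega> \<in> space ?P" and big: "\<eta> < enn2real (outer_measure_of (posterior Q n \<omega>) B)"
      and notin: "?r \<omega> \<notin> D" "?r \<omega> \<notin> E" for \<omega>
    proof -
    have rs: "?r \<omega> \<in> space (P0n n)" using measurable_space[OF r \<omega>] .
    have sets: "sets (posterior Q n \<omega>) = sets Q" by (simp add: posterior_def)
    have "ennreal \<eta> < outer_measure_of (posterior Q n \<omega>) B"
      using big \<eta> by (cases "outer_measure_of (posterior Q n \<omega>) B") (auto simp: ennreal_less_iff)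
    also have "\<dots> \<le> emeasure (posterior Q n \<omega>) H"
      unfolding outer_measure_of_def using BH H by (intro INF_lower) (auto simp: sets)
    also have "\<dots> = num (?r \<omega>) / (\<integral>\<^sup>+p. likelihood n \<omega> p \<partial>Q)"
      by (subst emeasure_posterior[OF prior]) (auto simp: num_def like_r spP \<omega>)
    finally have less: "ennreal \<eta> < num (?r \<omega>) / (\<integral>\<^sup>+p. likelihood n \<omega> p \<partial>Q)" .
    \<comment> \<open>Multiplying out needs the degenerate denominators to be treated apart. If it
      is \<open>0\<close> the left side vanishes; if it is infinite the quotient is
      \<open>0\<close>, which contradicts \<open>less\<close>.\<close>
    have "ennreal \<eta> * (\<integral>\<^sup>+p. likelihood n \<omega> p \<partial>Q) \<le> num (?r \<omega>)"
    proof (cases "(\<integral>\<^sup>+p. likelihood n \<omega> p \<partial>Q) = 0 \<or> (\<integral>\<^sup>+p. likelihood n \<omega> p \<partial>Q) = \<top>")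
      case True
      then show ?thesis using less by (auto simp: ennreal_divide_top)
    next
      case False
      have "ennreal \<eta> * (\<integral>\<^sup>+p. likelihood n \<omega> p \<partial>Q) \<le> num (?r \<omega>) / (\<integral>\<^sup>+p. likelihood n \<omega> p \<partial>Q) * (\<integral>\<^sup>+p. likelihood n \<omega> p \<partial>Q)"
        using less by (intro mult_right_mono) auto
      also have "\<dots> = num (?r \<omega>)" using False by (simp add: ennreal_divide_times ennreal_times_divide[symmetric] ennreal_divide_self less_top)
      finally show ?thesis .
    qed
    moreover have "ennreal d * likelihood n \<omega> p0 \<le> (\<integral>\<^sup>+p. likelihood n \<omega> p \<partial>Q)"
      using notin(1) rs by (auto simp: D_def l0_def like_r not_less)
    then have "ennreal \<eta> * (ennreal d * likelihood n \<omega> p0) \<le> ennreal \<eta> * (\<integral>\<^sup>+p. likelihood n \<omega> p \<partial>Q)"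
      by (rule mult_left_mono) simp
    ultimately have "ennreal (\<eta> * d) * likelihood n (?r \<omega>) p0 \<le> num (?r \<omega>)"
      using \<eta> by (simp add: like_r ennreal_mult' mult.assoc)
    then show ?thesis using rs notin(2) by (simp add: F_def l0_def)
    qed
    then show ?thesis by auto
  qed
  then have "emeasure ?P {\<omega> \<in> space ?P. \<eta> < enn2real (outer_measure_of (posterior Q n \<omega>) B)} \<le> emeasure ?P (?r -` (E \<union> D \<union> F) \<inter> space ?P)"
    by (intro emeasure_mono measurable_sets[OF r]) auto
  also have "\<dots> = emeasure (distr ?P (P0n n) ?r) (E \<union> D \<union> F)"
    by (rule emeasure_distr[symmetric]) measurable
  also have "\<dots> = emeasure (P0n n) (E \<union> D \<union> F)"
    by (subst PU.distr_PiM_restrict_finite) auto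
  also have "\<dots> \<le> emeasure (P0n n) E + emeasure (P0n n) D + emeasure (P0n n) F"
    by (intro order_trans[OF emeasure_subadditive] add_right_mono) measurable
  also have "\<dots> \<le> emeasure (P0n n) E + (ennreal (2 / N) + ennreal (4 * \<kappa> * exp ((C + 2) * N) / \<eta>))"
    using D_le F_le by (simp add: add.assoc add_mono)
  also have "ennreal (2 / N) + ennreal (4 * \<kappa> * exp ((C + 2) * N) / \<eta>) = ennreal (2 / N + 4 * \<kappa> * exp ((C + 2) * N) / \<eta>)"
    using N \<kappa> \<eta> by (intro ennreal_plus[symmetric]) auto
  finally show ?thesis by (simp add: N_def mult.assoc)
qed

end

subsection \<open>Integral operators on \<open>L\<^sup>r\<close>\<close>

text \<open>Written with \<open>a powr (\<rho> - 1)\<close> instead of a conjugate exponent, so that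
  \<open>\<rho> = 1\<close> is covered. The case \<open>a = 0\<close> is harmless there because
  \<open>0 powr 0 = 0\<close>.\<close>

lemma young_powr:
  fixes a b \<rho> :: real
  assumes "1 \<le> \<rho>" "0 \<le> a" "0 \<le> b"
  shows "a powr (\<rho> - 1) * b \<le> (1 - 1 / \<rho>) * a powr \<rho> + (1 / \<rho>) * b powr \<rho>"
proof (cases "a = 0 \<or> b = 0")
  case True
  then show ?thesis using assms by auto
next
  case False
  then have ab: "0 < a" "0 < b" using assms by auto
  have "(a powr \<rho>) powr (1 - 1 / \<rho>) * (b powr \<rho>) powr (1 / \<rho>) \<le> (1 - 1 / \<rho>) * a powr \<rho> + (1 / \<rho>) * b powr \<rho>"
    using assms ab by (intro Youngs_inequality_0) auto
  moreover have "(a powr \<rho>) powr (1 - 1 / \<rho>) = a powr (\<rho> - 1)" "(b powr \<rho>) powr (1 / \<rho>) = b"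
  proof -
    have "\<rho> * (1 - 1 / \<rho>) = \<rho> - 1" using assms by (simp add: field_simps)
    then show "(a powr \<rho>) powr (1 - 1 / \<rho>) = a powr (\<rho> - 1)" by (simp add: powr_powr)
    show "(b powr \<rho>) powr (1 / \<rho>) = b" using assms ab by (simp add: powr_powr)
  qed
  ultimately show ?thesis by simp
qed

text \<open>Convexity obtained from Young's inequality: in
  \<open>s powr \<rho> = s powr (\<rho> - 1) * s\<close> the last factor is expanded, and the
  resulting multiple of \<open>s powr \<rho>\<close> is absorbed on the left.\<close>

lemma powr_convex_combination:
  fixes u v t \<rho> :: real
  assumes r: "1 \<le> \<rho>" and uv: "0 \<le> u" "0 \<le> v" and t: "0 \<le> t" "t \<le> 1"
  shows "(t * u + (1 - t) * v) powr \<rho> \<le> t * u powr \<rho> + (1 - t) * v powr \<rho>"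
proof -
  define s where "s = t * u + (1 - t) * v"
  have s: "0 \<le> s" using uv t by (simp add: s_def)
  have "s powr \<rho> = s powr (\<rho> - 1) * s"
    using s by (cases "s = 0") (auto simp: powr_diff)
  also have "\<dots> = t * (s powr (\<rho> - 1) * u) + (1 - t) * (s powr (\<rho> - 1) * v)"
    by (subst (2) s_def) (simp add: algebra_simps)
  also have "\<dots> \<le> t * ((1 - 1 / \<rho>) * s powr \<rho> + (1 / \<rho>) * u powr \<rho>) + (1 - t) * ((1 - 1 / \<rho>) * s powr \<rho> + (1 / \<rho>) * v powr \<rho>)"
    using r uv t s by (intro add_mono mult_left_mono young_powr) auto
  also have "\<dots> = (1 - 1 / \<rho>) * s powr \<rho> + (1 / \<rho>) * (t * u powr \<rho> + (1 - t) * v powr \<rho>)"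
  proof -
    have "t * ((1 - c) * x + c * y) + (1 - t) * ((1 - c) * x + c * z) = (1 - c) * x + c * (t * y + (1 - t) * z)"
      for c x y z :: real by (simp add: algebra_simps)
    then show ?thesis .
  qed
  finally have "(1 / \<rho>) * s powr \<rho> \<le> (1 / \<rho>) * (t * u powr \<rho> + (1 - t) * v powr \<rho>)"
    by (simp add: algebra_simps)
  then show ?thesis using r by (simp add: s_def mult_le_cancel_left divide_le_cancel)
qed

text \<open>Hoelder's inequality for the weight occurring in the dual extremal function. After
  scaling by \<open>G\<close> and \<open>H\<close>, Young's inequality holds pointwise and its two
  weights add up to one. Norm bounds enter as powers, so no root of an integral appears.\<close>

lemma holder_dual:
  fixes g q :: "'a \<Rightarrow> real"
  assumes r: "1 \<le> \<rho>" and [measurable]: "g \<in> borel_measurable L" "q \<in> borel_measurable L"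
    and g: "(\<integral>\<^sup>+x. ennreal (\<bar>g x\<bar> powr \<rho>) \<partial>L) \<le> ennreal (G powr \<rho>)" "0 < G"
    and q: "(\<integral>\<^sup>+x. ennreal (\<bar>q x\<bar> powr \<rho>) \<partial>L) \<le> ennreal (H powr \<rho>)" "0 < H"
  shows "(\<integral>\<^sup>+x. ennreal (\<bar>g x\<bar> powr (\<rho> - 1) * \<bar>q x\<bar>) \<partial>L) \<le> ennreal (G powr (\<rho> - 1) * H)"
proof -
  define c where "c = G powr (\<rho> - 1) * H"
  have c: "0 < c" using g q by (simp add: c_def)
  define a1 where "a1 = c * (1 - 1 / \<rho>) / G powr \<rho>"
  define a2 where "a2 = c * (1 / \<rho>) / H powr \<rho>"
  have a: "0 \<le> a1" "0 \<le> a2" using r c by (auto simp: a1_def a2_def)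
  have pt: "\<bar>g x\<bar> powr (\<rho> - 1) * \<bar>q x\<bar> \<le> a1 * \<bar>g x\<bar> powr \<rho> + a2 * \<bar>q x\<bar> powr \<rho>" for x
  proof -
    have "(\<bar>g x\<bar> / G) powr (\<rho> - 1) * (\<bar>q x\<bar> / H) \<le> (1 - 1 / \<rho>) * (\<bar>g x\<bar> / G) powr \<rho> + (1 / \<rho>) * (\<bar>q x\<bar> / H) powr \<rho>"
      using r g q by (intro young_powr) auto
    from mult_left_mono[OF this less_imp_le[OF c]]
    have "c * ((\<bar>g x\<bar> / G) powr (\<rho> - 1) * (\<bar>q x\<bar> / H)) \<le> a1 * \<bar>g x\<bar> powr \<rho> + a2 * \<bar>q x\<bar> powr \<rho>"
      using g q by (simp add: a1_def a2_def powr_divide algebra_simps)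
    moreover have "c * ((\<bar>g x\<bar> / G) powr (\<rho> - 1) * (\<bar>q x\<bar> / H)) = \<bar>g x\<bar> powr (\<rho> - 1) * \<bar>q x\<bar>"
      using g q by (simp add: c_def powr_divide)
    ultimately show ?thesis by simp
  qed
  have "(\<integral>\<^sup>+x. ennreal (\<bar>g x\<bar> powr (\<rho> - 1) * \<bar>q x\<bar>) \<partial>L) \<le>
      (\<integral>\<^sup>+x. ennreal a1 * ennreal (\<bar>g x\<bar> powr \<rho>) + ennreal a2 * ennreal (\<bar>q x\<bar> powr \<rho>) \<partial>L)"
    using a pt by (intro nn_integral_mono) (simp add: ennreal_mult'[symmetric] ennreal_plus[symmetric] ennreal_leI del: ennreal_plus)
  also have "\<dots> = ennreal a1 * (\<integral>\<^sup>+x. ennreal (\<bar>g x\<bar> powr \<rho>) \<partial>L) + ennreal a2 * (\<integral>\<^sup>+x. ennreal (\<bar>q x\<bar> powr \<rho>) \<partial>L)"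
    by (simp add: nn_integral_add nn_integral_cmult)
  also have "\<dots> \<le> ennreal a1 * ennreal (G powr \<rho>) + ennreal a2 * ennreal (H powr \<rho>)"
    using g q by (intro add_mono mult_left_mono) auto
  also have "\<dots> = ennreal (a1 * G powr \<rho> + a2 * H powr \<rho>)"
    using a by (simp add: ennreal_mult'[symmetric] ennreal_plus[symmetric] del: ennreal_plus)
  also have "a1 * G powr \<rho> + a2 * H powr \<rho> = c"
  proof -
    have "a1 * G powr \<rho> = c * (1 - 1 / \<rho>)" "a2 * H powr \<rho> = c * (1 / \<rho>)"
      using g q by (auto simp: a1_def a2_def)
    then show ?thesis by (simp add: algebra_simps)
  qed
  finally show ?thesis by (simp add: c_def)
qed

text \<open>With \<open>f\<close> and \<open>g\<close> scaled by their bounds, the sum is a convex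
  combination with weights \<open>a / (a + b)\<close> and \<open>b / (a + b)\<close>, and convexity
  of the power is applied pointwise.\<close>

lemma minkowski_powr:
  fixes f g :: "'a \<Rightarrow> real"
  assumes r: "1 \<le> \<rho>" and [measurable]: "f \<in> borel_measurable L" "g \<in> borel_measurable L"
    and f: "(\<integral>\<^sup>+x. ennreal (\<bar>f x\<bar> powr \<rho>) \<partial>L) \<le> ennreal (a powr \<rho>)" "0 < a"
    and g: "(\<integral>\<^sup>+x. ennreal (\<bar>g x\<bar> powr \<rho>) \<partial>L) \<le> ennreal (b powr \<rho>)" "0 < b"
  shows "(\<integral>\<^sup>+x. ennreal (\<bar>f x + g x\<bar> powr \<rho>) \<partial>L) \<le> ennreal ((a + b) powr \<rho>)"
proof -
  define t where "t = a / (a + b)"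
  have t: "0 \<le> t" "t \<le> 1" and t': "1 - t = b / (a + b)" using f g by (auto simp: t_def field_simps)
  define c where "c = (a + b) powr \<rho>"
  have c: "0 < c" using f g by (simp add: c_def)
  define a1 where "a1 = c * t / a powr \<rho>"
  define a2 where "a2 = c * (1 - t) / b powr \<rho>"
  have a12: "0 \<le> a1" "0 \<le> a2" using t c by (auto simp: a1_def a2_def)
  have pt: "\<bar>f x + g x\<bar> powr \<rho> \<le> a1 * \<bar>f x\<bar> powr \<rho> + a2 * \<bar>g x\<bar> powr \<rho>" for x
  proof -
    have eq: "\<bar>f x\<bar> + \<bar>g x\<bar> = (a + b) * (t * (\<bar>f x\<bar> / a) + (1 - t) * (\<bar>g x\<bar> / b))"
    proof -
      have ab: "(a + b) * t = a" "(a + b) * (1 - t) = b" unfolding t' using f g by (auto simp: t_def)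
      have "(a + b) * (t * (\<bar>f x\<bar> / a) + (1 - t) * (\<bar>g x\<bar> / b)) =
          ((a + b) * t) * (\<bar>f x\<bar> / a) + ((a + b) * (1 - t)) * (\<bar>g x\<bar> / b)"
        by (simp only: distrib_left mult.assoc)
      then show ?thesis using ab f g by simp
    qed
    have "\<bar>f x + g x\<bar> powr \<rho> \<le> (\<bar>f x\<bar> + \<bar>g x\<bar>) powr \<rho>"
      using r by (intro powr_mono2) auto
    also have "\<dots> = c * (t * (\<bar>f x\<bar> / a) + (1 - t) * (\<bar>g x\<bar> / b)) powr \<rho>"
      unfolding eq c_def by (rule powr_mult)
    also have "\<dots> \<le> c * (t * (\<bar>f x\<bar> / a) powr \<rho> + (1 - t) * (\<bar>g x\<bar> / b) powr \<rho>)"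
      using f g t c r by (intro mult_left_mono powr_convex_combination) auto
    also have "\<dots> = a1 * \<bar>f x\<bar> powr \<rho> + a2 * \<bar>g x\<bar> powr \<rho>"
      using f g by (simp add: a1_def a2_def powr_divide algebra_simps)
    finally show ?thesis .
  qed
  have "(\<integral>\<^sup>+x. ennreal (\<bar>f x + g x\<bar> powr \<rho>) \<partial>L) \<le>
      (\<integral>\<^sup>+x. ennreal a1 * ennreal (\<bar>f x\<bar> powr \<rho>) + ennreal a2 * ennreal (\<bar>g x\<bar> powr \<rho>) \<partial>L)"
    using a12 pt by (intro nn_integral_mono) (simp add: ennreal_mult'[symmetric] ennreal_plus[symmetric] ennreal_leI del: ennreal_plus)
  also have "\<dots> = ennreal a1 * (\<integral>\<^sup>+x. ennreal (\<bar>f x\<bar> powr \<rho>) \<partial>L) + ennreal a2 * (\<integral>\<^sup>+x. ennreal (\<bar>g x\<bar> powr \<rho>) \<partial>L)"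
    by (simp add: nn_integral_add nn_integral_cmult)
  also have "\<dots> \<le> ennreal a1 * ennreal (a powr \<rho>) + ennreal a2 * ennreal (b powr \<rho>)"
    using f g by (intro add_mono mult_left_mono) auto
  also have "\<dots> = ennreal (a1 * a powr \<rho> + a2 * b powr \<rho>)"
    using a12 by (simp add: ennreal_mult'[symmetric] ennreal_plus[symmetric] del: ennreal_plus)
  also have "a1 * a powr \<rho> + a2 * b powr \<rho> = c"
  proof -
    have "a1 * a powr \<rho> = c * t" "a2 * b powr \<rho> = c * (1 - t)"
      using f g by (auto simp: a1_def a2_def)
    then show ?thesis by (simp add: algebra_simps)
  qed
  finally show ?thesis by (simp add: c_def)
qed

text \<open>Chernoff's method with \<open>l = - t / (2 * S)\<close>, the minimiser of
  \<open>l * t + l\<^sup>2 * S\<close>. The condition \<open>t * b \<le> 2 * S\<close> says exactly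
  that \<open>\<bar>l\<bar> * b \<le> 1\<close>, as the bound on the exponential moment
  requires.\<close>

lemma iid_lower_tail:
  fixes F :: "'a \<Rightarrow> real" and n :: nat
  assumes M: "prob_space M" and F[measurable]: "F \<in> borel_measurable M"
    and b: "\<And>x. x \<in> space M \<Longrightarrow> \<bar>F x\<bar> \<le> b" and S: "integral\<^sup>L M (\<lambda>x. (F x)\<^sup>2) \<le> S"
    and t: "0 < t" "t * b \<le> 2 * S" and S0: "0 < S"
  shows "emeasure (PiM {..<n} (\<lambda>_. M)) {x \<in> space (PiM {..<n} (\<lambda>_. M)). (\<Sum>i<n. F (x i)) \<le> real n * (integral\<^sup>L M F - t)}
    \<le> ennreal (exp (- real n * t\<^sup>2 / (4 * S)))"
proof -
  let ?P = "PiM {..<n} (\<lambda>_. M)"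
  define m where "m = integral\<^sup>L M F"
  define l where "l = - t / (2 * S)"
  define c where "c = exp (- real n * t\<^sup>2 / (2 * S))"
  have c: "0 < c" by (simp add: c_def)
  have l: "\<bar>l\<bar> * b \<le> 1" using t S0 by (simp add: l_def field_simps)
  have "emeasure ?P {x \<in> space ?P. (\<Sum>i<n. F (x i)) \<le> real n * (m - t)} \<le>
    emeasure ?P {x \<in> space ?P. 1 \<le> ennreal c * ennreal (exp (l * (\<Sum>i<n. F (x i) - m)))}"
  proof (intro emeasure_mono Collect_mono conj_mono impI subsetI)
    fix x assume "(\<Sum>i<n. F (x i)) \<le> real n * (m - t)"
    then have "(\<Sum>i<n. F (x i) - m) \<le> - (real n * t)" by (simp add: sum_subtractf algebra_simps)
    from mult_left_mono_neg[OF this, of l] have "real n * t\<^sup>2 / (2 * S) \<le> l * (\<Sum>i<n. F (x i) - m)"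
      using t S0 by (simp add: l_def field_simps power2_eq_square)
    then have "1 \<le> c * exp (l * (\<Sum>i<n. F (x i) - m))"
      unfolding c_def exp_add[symmetric] by simp
    then show "1 \<le> ennreal c * ennreal (exp (l * (\<Sum>i<n. F (x i) - m)))"
      using c by (simp add: ennreal_mult'[symmetric] ennreal_1[symmetric] ennreal_leI del: ennreal_1)
  qed measurable
  also have "\<dots> \<le> ennreal c * (\<integral>\<^sup>+x\<in>space ?P. ennreal (exp (l * (\<Sum>i<n. F (x i) - m))) \<partial>?P)"
    by (rule nn_integral_Markov_inequality) auto
  also have "\<dots> \<le> ennreal c * ennreal (exp (real n * l\<^sup>2 * S))"
    using iid_mgf_le[OF M F b l S, of n] by (intro mult_left_mono) (simp_all add: m_def cong: nn_integral_cong_simp)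
  also have "\<dots> = ennreal (exp (- real n * t\<^sup>2 / (4 * S)))"
    using S0 c by (simp add: ennreal_mult'[symmetric] c_def exp_add[symmetric] l_def power2_eq_square field_simps)
  finally show ?thesis by (simp add: m_def)
qed

text \<open>The hypotheses of Schur's test, with level and constants separated: \<open>R\<close>
  will be the dilation factor \<open>2 ^ j\<close>, while \<open>B\<close> is uniform over the
  levels. Only the uniform bound of the kernel is allowed to grow with \<open>R\<close>.\<close>

locale schur_kernel = L: sigma_finite_measure L for L :: "'a measure" +
  fixes k :: "'a \<Rightarrow> 'a \<Rightarrow> real" and B R :: real
  assumes k_meas[measurable]: "(\<lambda>(x, y). k x y) \<in> borel_measurable (L \<Otimes>\<^sub>M L)"
    and B1: "1 \<le> B" and R1: "1 \<le> R"
    and k_bd: "\<And>x y. x \<in> space L \<Longrightarrow> y \<in> space L \<Longrightarrow> \<bar>k x y\<bar> \<le> B * R"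
    and row: "\<And>x. x \<in> space L \<Longrightarrow> (\<integral>\<^sup>+y. ennreal \<bar>k x y\<bar> \<partial>L) \<le> ennreal B"
    and col: "\<And>y. y \<in> space L \<Longrightarrow> (\<integral>\<^sup>+x. ennreal \<bar>k x y\<bar> \<partial>L) \<le> ennreal B"
begin

definition dens :: "('a \<Rightarrow> real) \<Rightarrow> bool" where
  "dens p \<longleftrightarrow> p \<in> borel_measurable L \<and> (\<forall>x\<in>space L. 0 \<le> p x) \<and> (\<integral>\<^sup>+x. ennreal (p x) \<partial>L) = 1"

definition op :: "('a \<Rightarrow> real) \<Rightarrow> 'a \<Rightarrow> real" where "op p x = (LINT y|L. k x y * p y)"
text \<open>For densities, integrals against \<open>\<bar>k\<bar>\<close> are integrals of
  nonnegative functions. Norm estimates are therefore made for \<open>aop\<close>, where the order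
  of integration may be exchanged freely, and passed on to \<open>op\<close> by domination.\<close>

definition aop :: "('a \<Rightarrow> real) \<Rightarrow> 'a \<Rightarrow> real" where "aop p x = (LINT y|L. \<bar>k x y\<bar> * p y)"

definition Mp :: "('a \<Rightarrow> real) \<Rightarrow> 'a measure" where "Mp p = density L (\<lambda>x. ennreal (p x))"

lemma densD:
  assumes "dens p"
  shows "p \<in> borel_measurable L" "\<And>x. x \<in> space L \<Longrightarrow> 0 \<le> p x" "(\<integral>\<^sup>+x. ennreal (p x) \<partial>L) = 1"
  using assms by (auto simp: dens_def)

lemma Mp_simps [simp]: "space (Mp p) = space L" "sets (Mp p) = sets L"
  by (auto simp: Mp_def)

lemma prob_space_Mp: "dens p \<Longrightarrow> prob_space (Mp p)"
  using densD[of p] unfolding Mp_def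
  by (intro prob_spaceI) (simp add: emeasure_density cong: nn_integral_cong_simp)

lemma k_sec[measurable]:
  "x \<in> space L \<Longrightarrow> (\<lambda>y. k x y) \<in> borel_measurable L"
  "y \<in> space L \<Longrightarrow> (\<lambda>x. k x y) \<in> borel_measurable L"
  using measurable_Pair2[OF k_meas] measurable_Pair1[OF k_meas] by auto

lemma integrable_dens:
  assumes p: "dens p" and f[measurable]: "f \<in> borel_measurable L" and b: "\<And>x. x \<in> space L \<Longrightarrow> \<bar>f x\<bar> \<le> b"
  shows "integrable L (\<lambda>x. f x * p x)"
proof (rule integrableI_bounded)
  note [measurable] = densD(1)[OF p]
  show "(\<lambda>x. f x * p x) \<in> borel_measurable L" by measurable
  have "(\<integral>\<^sup>+x. ennreal (norm (f x * p x)) \<partial>L) \<le> (\<integral>\<^sup>+x. ennreal b * ennreal (p x) \<partial>L)"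
  proof (intro nn_integral_mono)
    fix x assume x: "x \<in> space L"
    have b0: "0 \<le> b" using b[OF x] by linarith
    show "ennreal (norm (f x * p x)) \<le> ennreal b * ennreal (p x)"
      using b[OF x] densD(2)[OF p x] b0 by (simp add: abs_mult ennreal_mult[symmetric] ennreal_leI mult_right_mono)
  qed
  also have "\<dots> = ennreal b" using densD(3)[OF p] by (simp add: nn_integral_cmult)
  finally show "(\<integral>\<^sup>+x. ennreal (norm (f x * p x)) \<partial>L) < \<infinity>" by (rule order_le_less_trans) simp
qed

lemma integral_Mp:
  assumes "dens p" "f \<in> borel_measurable L"
  shows "integral\<^sup>L (Mp p) f = (LINT x|L. f x * p x)"
  unfolding Mp_def using densD(1,2)[OF assms(1)] assms(2)
  by (subst integral_density) (auto simp: mult.commute)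

lemma k_dens_integrable:
  assumes "dens p" "x \<in> space L"
  shows "integrable L (\<lambda>y. k x y * p y)" "integrable L (\<lambda>y. \<bar>k x y\<bar> * p y)"
  using assms k_bd by (auto intro!: integrable_dens)

lemma op_measurable[measurable]:
  assumes [measurable]: "p \<in> borel_measurable L"
  shows "op p \<in> borel_measurable L"
  unfolding op_def by measurable

lemma aop_measurable[measurable]:
  assumes [measurable]: "p \<in> borel_measurable L"
  shows "aop p \<in> borel_measurable L"
  unfolding aop_def by measurable

lemma ennreal_aop:
  assumes p: "dens p" and x: "x \<in> space L"
  shows "ennreal (aop p x) = (\<integral>\<^sup>+y. ennreal \<bar>k x y\<bar> * ennreal (p y) \<partial>L)"
proof -
  have "(\<integral>\<^sup>+y. ennreal \<bar>k x y\<bar> * ennreal (p y) \<partial>L) = (\<integral>\<^sup>+y. ennreal (\<bar>k x y\<bar> * p y) \<partial>L)"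
    using densD(2)[OF p] by (intro nn_integral_cong) (simp add: ennreal_mult)
  also have "\<dots> = ennreal (aop p x)"
    unfolding aop_def using densD(2)[OF p] by (intro nn_integral_eq_integral k_dens_integrable p x) auto
  finally show ?thesis ..
qed

lemma aop_nonneg: "dens p \<Longrightarrow> x \<in> space L \<Longrightarrow> 0 \<le> aop p x"
  unfolding aop_def using densD(2) by (intro integral_nonneg_AE) auto

lemma op_le_aop: "dens p \<Longrightarrow> x \<in> space L \<Longrightarrow> \<bar>op p x\<bar> \<le> aop p x"
  unfolding op_def aop_def
  by (rule order_trans[OF integral_abs_bound], rule eq_refl, rule Bochner_Integration.integral_cong)
    (auto simp: abs_mult densD(2))

lemma aop_le:
  assumes "dens p" "x \<in> space L"
  shows "aop p x \<le> B * R"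
proof -
  have "ennreal (aop p x) \<le> (\<integral>\<^sup>+y. ennreal (B * R) * ennreal (p y) \<partial>L)"
    unfolding ennreal_aop[OF assms] using k_bd assms by (intro nn_integral_mono mult_right_mono ennreal_leI) auto
  also have "\<dots> = ennreal (B * R)" using densD[OF assms(1)] by (simp add: nn_integral_cmult)
  finally show ?thesis using B1 R1 by (simp add: ennreal_le_iff)
qed

lemma Fubini_k:
  assumes [measurable]: "(\<lambda>(x, y). f x y) \<in> borel_measurable (L \<Otimes>\<^sub>M L)"
  shows "(\<integral>\<^sup>+x. \<integral>\<^sup>+y. f x y \<partial>L \<partial>L) = (\<integral>\<^sup>+y. \<integral>\<^sup>+x. f x y \<partial>L \<partial>L)"
  by (rule pair_sigma_finite.Fubini'[symmetric])
    (simp_all add: pair_sigma_finite_def L.sigma_finite_measure_axioms)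

lemma aop_L1:
  assumes p: "dens p"
  shows "(\<integral>\<^sup>+x. ennreal (aop p x) \<partial>L) \<le> ennreal B"
proof -
  note [measurable] = densD(1)[OF p]
  have "(\<integral>\<^sup>+x. ennreal (aop p x) \<partial>L) = (\<integral>\<^sup>+x. \<integral>\<^sup>+y. ennreal \<bar>k x y\<bar> * ennreal (p y) \<partial>L \<partial>L)"
    by (intro nn_integral_cong ennreal_aop p)
  also have "\<dots> = (\<integral>\<^sup>+y. \<integral>\<^sup>+x. ennreal \<bar>k x y\<bar> * ennreal (p y) \<partial>L \<partial>L)"
    by (rule Fubini_k) measurable
  also have "\<dots> \<le> (\<integral>\<^sup>+y. ennreal B * ennreal (p y) \<partial>L)"
    using col by (intro nn_integral_mono) (simp add: nn_integral_multc mult_right_mono)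
  also have "\<dots> = ennreal B" using densD(3)[OF p] by (simp add: nn_integral_cmult)
  finally show ?thesis .
qed

lemma powr_le_bound:
  fixes u b \<rho> :: real
  assumes "0 \<le> u" "u \<le> b" "1 \<le> \<rho>"
  shows "u powr \<rho> \<le> b powr (\<rho> - 1) * u"
proof (cases "u = 0")
  case False
  then have "u powr \<rho> = u powr (\<rho> - 1) * u" using assms by (simp add: powr_diff)
  also have "\<dots> \<le> b powr (\<rho> - 1) * u" using assms by (intro mult_right_mono powr_mono2) auto
  finally show ?thesis .
qed simp

text \<open>Interpolation between the \<open>L^1\<close> bound \<open>B\<close> and the uniform
  bound \<open>B * R\<close>. This is where the factor \<open>R powr (1 - 1 / \<rho>)\<close>, and
  with it the exponent of the rate, comes from.\<close>

lemma bound_const: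
  assumes "1 \<le> \<rho>"
  shows "(B * R) powr (\<rho> - 1) * B = (B * R powr (1 - 1 / \<rho>)) powr \<rho>"
proof -
  have "\<rho> * (1 - 1 / \<rho>) = \<rho> - 1" using assms by (simp add: field_simps)
  then have "(B * R powr (1 - 1 / \<rho>)) powr \<rho> = B powr \<rho> * R powr (\<rho> - 1)"
    using B1 R1 by (simp add: powr_mult powr_powr mult.commute)
  moreover have "B powr \<rho> = B powr (\<rho> - 1) * B" using B1 by (simp add: powr_diff)
  ultimately show ?thesis using B1 R1 by (simp add: powr_mult)
qed

lemma aop_Lr_finite:
  assumes p: "dens p" and r: "1 \<le> \<rho>"
  shows "(\<integral>\<^sup>+x. ennreal (\<bar>aop p x\<bar> powr \<rho>) \<partial>L) \<le> ennreal ((B * R powr (1 - 1 / \<rho>)) powr \<rho>)"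
proof -
  note [measurable] = densD(1)[OF p]
  have "(\<integral>\<^sup>+x. ennreal (\<bar>aop p x\<bar> powr \<rho>) \<partial>L) \<le> (\<integral>\<^sup>+x. ennreal ((B * R) powr (\<rho> - 1)) * ennreal (aop p x) \<partial>L)"
    using aop_nonneg[OF p] aop_le[OF p] r
    by (intro nn_integral_mono) (simp add: ennreal_mult'[symmetric] ennreal_leI powr_le_bound)
  also have "\<dots> \<le> ennreal ((B * R) powr (\<rho> - 1)) * ennreal B"
    by (subst nn_integral_cmult) (auto intro!: mult_left_mono aop_L1[OF p])
  also have "\<dots> = ennreal ((B * R powr (1 - 1 / \<rho>)) powr \<rho>)"
    unfolding bound_const[OF r, symmetric] by (simp add: ennreal_mult'[symmetric])
  finally show ?thesis .
qed

lemma col_Lr: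
  assumes y: "y \<in> space L" and r: "1 \<le> \<rho>"
  shows "(\<integral>\<^sup>+x. ennreal (\<bar>k x y\<bar> powr \<rho>) \<partial>L) \<le> ennreal ((B * R powr (1 - 1 / \<rho>)) powr \<rho>)"
proof -
  note [measurable] = k_sec(2)[OF y]
  have "(\<integral>\<^sup>+x. ennreal (\<bar>k x y\<bar> powr \<rho>) \<partial>L) \<le> (\<integral>\<^sup>+x. ennreal ((B * R) powr (\<rho> - 1)) * ennreal \<bar>k x y\<bar> \<partial>L)"
    using k_bd[OF _ y] r by (intro nn_integral_mono) (simp add: ennreal_mult'[symmetric] ennreal_leI powr_le_bound)
  also have "\<dots> \<le> ennreal ((B * R) powr (\<rho> - 1)) * ennreal B"
    by (subst nn_integral_cmult) (auto intro!: mult_left_mono col y)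
  also have "\<dots> = ennreal ((B * R powr (1 - 1 / \<rho>)) powr \<rho>)"
    unfolding bound_const[OF r, symmetric] by (simp add: ennreal_mult'[symmetric])
  finally show ?thesis .
qed

text \<open>Pointwise this is Jensen's inequality for the measure
  \<open>\<bar>k x y\<bar> dy\<close> of mass at most \<open>B\<close>; it is derived from Young's
  inequality with the free value \<open>A\<close> chosen as \<open>aop p x / B\<close>, so that the
  power of \<open>A\<close> can be absorbed. Integration in \<open>x\<close> then uses the column
  bound.\<close>

lemma schur_test_aop:
  assumes p: "dens p" and r: "1 \<le> \<rho>" and U: "(\<integral>\<^sup>+x. ennreal (\<bar>p x\<bar> powr \<rho>) \<partial>L) \<le> ennreal (U powr \<rho>)" "0 < U"
  shows "(\<integral>\<^sup>+x. ennreal (\<bar>aop p x\<bar> powr \<rho>) \<partial>L) \<le> ennreal ((B * U) powr \<rho>)"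
proof -
  note [measurable] = densD(1)[OF p]
  have pt: "ennreal (\<bar>aop p x\<bar> powr \<rho>) \<le> ennreal (B powr (\<rho> - 1)) * (\<integral>\<^sup>+y. ennreal \<bar>k x y\<bar> * ennreal (\<bar>p y\<bar> powr \<rho>) \<partial>L)"
    if x: "x \<in> space L" for x
  proof -
    define A where "A = aop p x / B"
    define I where "I = (\<integral>\<^sup>+y. ennreal \<bar>k x y\<bar> * ennreal (\<bar>p y\<bar> powr \<rho>) \<partial>L)"
    have A0: "0 \<le> A" using aop_nonneg[OF p x] B1 by (simp add: A_def)
    have aopA: "aop p x = B * A" using B1 by (simp add: A_def)
    note [measurable] = k_sec(1)[OF x]
    have c1: "0 \<le> 1 - 1 / \<rho>" "0 \<le> 1 / \<rho>" using r by auto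
    have "ennreal (A powr (\<rho> - 1)) * ennreal (aop p x) =
        (\<integral>\<^sup>+y. ennreal (A powr (\<rho> - 1)) * (ennreal \<bar>k x y\<bar> * ennreal (p y)) \<partial>L)"
      by (simp add: ennreal_aop[OF p x] nn_integral_cmult)
    also have "\<dots> \<le> (\<integral>\<^sup>+y. ennreal ((1 - 1 / \<rho>) * A powr \<rho>) * ennreal \<bar>k x y\<bar> +
        ennreal (1 / \<rho>) * (ennreal \<bar>k x y\<bar> * ennreal (\<bar>p y\<bar> powr \<rho>)) \<partial>L)"
    proof (intro nn_integral_mono)
      fix y assume y: "y \<in> space L"
      have "A powr (\<rho> - 1) * (\<bar>k x y\<bar> * p y) \<le> ((1 - 1 / \<rho>) * A powr \<rho>) * \<bar>k x y\<bar> + (1 / \<rho>) * (\<bar>k x y\<bar> * \<bar>p y\<bar> powr \<rho>)"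
        using mult_left_mono[OF young_powr[OF r A0 densD(2)[OF p y]] abs_ge_zero[of "k x y"]] densD(2)[OF p y]
        by (simp add: algebra_simps)
      then show "ennreal (A powr (\<rho> - 1)) * (ennreal \<bar>k x y\<bar> * ennreal (p y)) \<le>
          ennreal ((1 - 1 / \<rho>) * A powr \<rho>) * ennreal \<bar>k x y\<bar> + ennreal (1 / \<rho>) * (ennreal \<bar>k x y\<bar> * ennreal (\<bar>p y\<bar> powr \<rho>))"
        using densD(2)[OF p y] c1 by (simp add: ennreal_mult[symmetric] ennreal_plus[symmetric] ennreal_leI del: ennreal_plus)
    qed
    also have "\<dots> = ennreal ((1 - 1 / \<rho>) * A powr \<rho>) * (\<integral>\<^sup>+y. ennreal \<bar>k x y\<bar> \<partial>L) + ennreal (1 / \<rho>) * I"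
      unfolding I_def by (simp add: nn_integral_add nn_integral_cmult)
    also have "\<dots> \<le> ennreal ((1 - 1 / \<rho>) * A powr \<rho>) * ennreal B + ennreal (1 / \<rho>) * I"
      by (intro add_right_mono mult_left_mono row x) simp
    finally have main: "ennreal (A powr (\<rho> - 1)) * ennreal (B * A) \<le> ennreal ((1 - 1 / \<rho>) * A powr \<rho>) * ennreal B + ennreal (1 / \<rho>) * I"
      by (simp add: aopA)
    have AA: "A powr (\<rho> - 1) * (B * A) = B * A powr \<rho>" using A0 by (cases "A = 0") (auto simp: powr_diff)
    show "ennreal (\<bar>aop p x\<bar> powr \<rho>) \<le> ennreal (B powr (\<rho> - 1)) * I"
    proof (cases I)
      case (real i)
      from main have "B * A powr \<rho> \<le> (1 - 1 / \<rho>) * A powr \<rho> * B + (1 / \<rho>) * i"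
        using real A0 B1 c1 AA by (simp add: ennreal_mult[symmetric] ennreal_plus[symmetric] del: ennreal_plus)
      then have "(1 / \<rho>) * (B * A powr \<rho>) \<le> (1 / \<rho>) * i" by (simp add: algebra_simps)
      then have "B * A powr \<rho> \<le> i" using r by (simp add: divide_le_cancel)
      then have "B powr (\<rho> - 1) * (B * A powr \<rho>) \<le> B powr (\<rho> - 1) * i" by (intro mult_left_mono) auto
      moreover have "B powr (\<rho> - 1) * (B * A powr \<rho>) = \<bar>aop p x\<bar> powr \<rho>"
        using B1 A0 by (simp add: aopA powr_mult powr_diff abs_mult)
      ultimately show ?thesis using real by (simp add: ennreal_mult[symmetric] ennreal_leI)
    next
      case top
      then show ?thesis using B1 by (simp add: ennreal_mult_top)
    qed
  qed
  have "(\<integral>\<^sup>+x. ennreal (\<bar>aop p x\<bar> powr \<rho>) \<partial>L) \<le>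
      (\<integral>\<^sup>+x. ennreal (B powr (\<rho> - 1)) * (\<integral>\<^sup>+y. ennreal \<bar>k x y\<bar> * ennreal (\<bar>p y\<bar> powr \<rho>) \<partial>L) \<partial>L)"
    by (intro nn_integral_mono pt)
  also have "\<dots> = ennreal (B powr (\<rho> - 1)) * (\<integral>\<^sup>+x. \<integral>\<^sup>+y. ennreal \<bar>k x y\<bar> * ennreal (\<bar>p y\<bar> powr \<rho>) \<partial>L \<partial>L)"
    by (intro nn_integral_cmult) measurable
  also have "(\<integral>\<^sup>+x. \<integral>\<^sup>+y. ennreal \<bar>k x y\<bar> * ennreal (\<bar>p y\<bar> powr \<rho>) \<partial>L \<partial>L) =
      (\<integral>\<^sup>+y. \<integral>\<^sup>+x. ennreal \<bar>k x y\<bar> * ennreal (\<bar>p y\<bar> powr \<rho>) \<partial>L \<partial>L)"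
    by (rule Fubini_k) measurable
  also have "\<dots> \<le> (\<integral>\<^sup>+y. ennreal B * ennreal (\<bar>p y\<bar> powr \<rho>) \<partial>L)"
    using col by (intro nn_integral_mono) (simp add: nn_integral_multc mult_right_mono)
  also have "\<dots> \<le> ennreal B * ennreal (U powr \<rho>)"
    by (subst nn_integral_cmult) (auto intro!: mult_left_mono U)
  finally have "(\<integral>\<^sup>+x. ennreal (\<bar>aop p x\<bar> powr \<rho>) \<partial>L) \<le> ennreal (B powr (\<rho> - 1)) * (ennreal B * ennreal (U powr \<rho>))"
    by (simp add: mult_left_mono)
  also have "\<dots> = ennreal ((B * U) powr \<rho>)"
    using B1 U by (simp add: ennreal_mult'[symmetric] powr_mult powr_diff mult.assoc)
  finally show ?thesis .
qed

end

section \<open>Error of the second kind for finite exponents\<close>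

context schur_kernel
begin

definition est :: "nat \<Rightarrow> (nat \<Rightarrow> 'a) \<Rightarrow> 'a \<Rightarrow> real" where
  "est n \<omega> x = (\<Sum>i<n. k x (\<omega> i)) / real n"

lemma op_Lr_le:
  assumes "dens q" "1 \<le> \<rho>"
  shows "(\<integral>\<^sup>+x. ennreal (\<bar>op q x\<bar> powr \<rho>) \<partial>L) \<le> (\<integral>\<^sup>+x. ennreal (\<bar>aop q x\<bar> powr \<rho>) \<partial>L)"
  using assms(2)
  by (intro nn_integral_mono ennreal_leI powr_mono2) (auto intro: order_trans[OF op_le_aop[OF assms(1)] abs_ge_self])

text \<open>If \<open>op p\<close> and \<open>op p0\<close> are far apart, then a single linear functional of the sample, given by the
  dual extremal function of \<open>op p - op p0\<close>, separates \<open>p\<close> from \<open>p0\<close>, and an exponential inequality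
  for this functional bounds the error of the second kind.\<close>

lemma type_II_Lr:
  assumes r: "1 \<le> \<rho>" and n: "n \<ge> 1" and p: "dens p" and p0: "dens p0"
    and U: "(\<integral>\<^sup>+x. ennreal (\<bar>p x\<bar> powr \<rho>) \<partial>L) \<le> ennreal (U powr \<rho>)" "0 < U"
    and U0: "(\<integral>\<^sup>+x. ennreal (\<bar>p0 x\<bar> powr \<rho>) \<partial>L) \<le> ennreal (U powr \<rho>)"
    and G: "(\<integral>\<^sup>+x. ennreal (\<bar>op p x - op p0 x\<bar> powr \<rho>) \<partial>L) = ennreal (G powr \<rho>)"
    and t: "0 < t" "0 < t0" "t + t0 \<le> G" "t \<le> 2 * B * U"
  shows "emeasure (PiM {..<n} (\<lambda>_. Mp p)) {\<omega> \<in> space (PiM {..<n} (\<lambda>_. Mp p)).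
      (\<integral>\<^sup>+x. ennreal (\<bar>est n \<omega> x - op p0 x\<bar> powr \<rho>) \<partial>L) \<le> ennreal (t0 powr \<rho>)}
    \<le> ennreal (exp (- real n * t\<^sup>2 / (4 * (B\<^sup>2 * U * R powr (1 - 1 / \<rho>)))))"
proof -
  define b where "b = B * R powr (1 - 1 / \<rho>)"
  have b: "0 < b" using B1 R1 by (simp add: b_def)
  have G0: "0 < G" using t by simp
  note [measurable] = densD(1)[OF p] densD(1)[OF p0]
  define g where "g x = op p x - op p0 x" for x
  \<comment> \<open>The extremal function of \<open>g\<close> for Hoelder's inequality: integrating
    it against \<open>g\<close> gives \<open>G\<close>, while against any other function it gives at
    most the norm of that function. It depends on \<open>p\<close>, which is harmless since it
    serves only in the analysis and not in the test.\<close>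
  define f where "f x = sgn (g x) * \<bar>g x\<bar> powr (\<rho> - 1) / G powr (\<rho> - 1)" for x
  \<comment> \<open>Integrating \<open>f\<close> against the estimator produces the average of
    \<open>F\<close> over the sample, so a norm deviation becomes a deviation of a sum of
    independent terms.\<close>
  define F where "F y = (LINT x|L. f x * k x y)" for y
  have [measurable]: "g \<in> borel_measurable L" "f \<in> borel_measurable L" unfolding g_def f_def by measurable
  have [measurable]: "F \<in> borel_measurable L" unfolding F_def by measurable
  have abs_f: "\<bar>f x\<bar> \<le> \<bar>g x\<bar> powr (\<rho> - 1) / G powr (\<rho> - 1)" for x
    by (auto simp: f_def abs_mult sgn_if)
  have dual: "(\<integral>\<^sup>+x. ennreal \<bar>f x * q x\<bar> \<partial>L) \<le> ennreal H"
    if [measurable]: "q \<in> borel_measurable L" and q: "(\<integral>\<^sup>+x. ennreal (\<bar>q x\<bar> powr \<rho>) \<partial>L) \<le> ennreal (H powr \<rho>)" "0 < H" for q H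
  proof -
    have "(\<integral>\<^sup>+x. ennreal \<bar>f x * q x\<bar> \<partial>L) \<le> (\<integral>\<^sup>+x. ennreal (1 / G powr (\<rho> - 1)) * ennreal (\<bar>g x\<bar> powr (\<rho> - 1) * \<bar>q x\<bar>) \<partial>L)"
      using mult_right_mono[OF abs_f abs_ge_zero]
      by (intro nn_integral_mono) (simp add: ennreal_mult'[symmetric] abs_mult ennreal_leI)
    also have "\<dots> = ennreal (1 / G powr (\<rho> - 1)) * (\<integral>\<^sup>+x. ennreal (\<bar>g x\<bar> powr (\<rho> - 1) * \<bar>q x\<bar>) \<partial>L)"
      by (intro nn_integral_cmult) measurable
    also have "\<dots> \<le> ennreal (1 / G powr (\<rho> - 1)) * ennreal (G powr (\<rho> - 1) * H)"
      using G by (intro mult_left_mono holder_dual r G0 q) (auto simp: g_def)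
    also have "\<dots> = ennreal H" using G0 by (simp add: ennreal_mult'[symmetric])
    finally show ?thesis .
  qed
  have dual_int: "integrable L (\<lambda>x. f x * q x)" "\<bar>LINT x|L. f x * q x\<bar> \<le> H"
    if [measurable]: "q \<in> borel_measurable L" and q: "(\<integral>\<^sup>+x. ennreal (\<bar>q x\<bar> powr \<rho>) \<partial>L) \<le> ennreal (H powr \<rho>)" "0 < H" for q H
  proof -
    have "(\<integral>\<^sup>+x. ennreal (norm (f x * q x)) \<partial>L) < \<infinity>"
      using dual[OF that] by (simp add: order_le_less_trans)
    then show i: "integrable L (\<lambda>x. f x * q x)" by (intro integrableI_bounded) measurable
    have "ennreal (LINT x|L. \<bar>f x * q x\<bar>) = (\<integral>\<^sup>+x. ennreal \<bar>f x * q x\<bar> \<partial>L)"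
      using i by (intro nn_integral_eq_integral[symmetric]) auto
    also have "\<dots> \<le> ennreal H" by (rule dual[OF that])
    finally have "(LINT x|L. \<bar>f x * q x\<bar>) \<le> H" using q(2) by (simp only: ennreal_le_iff less_imp_le)
    then show "\<bar>LINT x|L. f x * q x\<bar> \<le> H" using integral_abs_bound[of L "\<lambda>x. f x * q x"] by linarith
  qed
  have col_b: "(\<integral>\<^sup>+x. ennreal (\<bar>k x y\<bar> powr \<rho>) \<partial>L) \<le> ennreal (b powr \<rho>)" if "y \<in> space L" for y
    using col_Lr[OF that r] by (simp add: b_def)
  have F_b: "\<bar>F y\<bar> \<le> b" if y: "y \<in> space L" for y
    unfolding F_def using k_sec(2)[OF y] by (rule dual_int(2)) (use col_b[OF y] b in auto)
  have BU: "0 < B * U" using B1 U by simp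
  \<comment> \<open>This bound is used twice: it justifies the exchange of integrals in
    \<open>EF\<close>, and it bounds the first absolute moment of \<open>F\<close>, hence its
    variance.\<close>
  have prod_bd: "(\<integral>\<^sup>+y. \<integral>\<^sup>+x. ennreal \<bar>f x * k x y * q y\<bar> \<partial>L \<partial>L) \<le> ennreal (B * U)"
    if q: "dens q" and qU: "(\<integral>\<^sup>+x. ennreal (\<bar>q x\<bar> powr \<rho>) \<partial>L) \<le> ennreal (U powr \<rho>)" for q
  proof -
    note [measurable] = densD(1)[OF q]
    have "(\<integral>\<^sup>+y. \<integral>\<^sup>+x. ennreal \<bar>f x * k x y * q y\<bar> \<partial>L \<partial>L) = (\<integral>\<^sup>+x. \<integral>\<^sup>+y. ennreal \<bar>f x * k x y * q y\<bar> \<partial>L \<partial>L)"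
      by (rule Fubini_k[symmetric]) measurable
    also have "\<dots> = (\<integral>\<^sup>+x. ennreal \<bar>f x * aop q x\<bar> \<partial>L)"
    proof (intro nn_integral_cong)
      fix x assume x: "x \<in> space L"
      note [measurable] = k_sec(1)[OF x]
      have "(\<integral>\<^sup>+y. ennreal \<bar>f x * k x y * q y\<bar> \<partial>L) = (\<integral>\<^sup>+y. ennreal \<bar>f x\<bar> * (ennreal \<bar>k x y\<bar> * ennreal (q y)) \<partial>L)"
        using densD(2)[OF q] by (intro nn_integral_cong) (simp add: abs_mult ennreal_mult mult.assoc)
      also have "\<dots> = ennreal \<bar>f x\<bar> * ennreal (aop q x)" by (simp add: nn_integral_cmult ennreal_aop[OF q x])
      finally show "(\<integral>\<^sup>+y. ennreal \<bar>f x * k x y * q y\<bar> \<partial>L) = ennreal \<bar>f x * aop q x\<bar>"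
        using aop_nonneg[OF q x] by (simp add: abs_mult ennreal_mult)
    qed
    also have "\<dots> \<le> ennreal (B * U)"
      by (intro dual BU schur_test_aop q r qU U(2)) measurable
    finally show ?thesis .
  qed
  have EF: "integral\<^sup>L (Mp q) F = (LINT x|L. f x * op q x)"
    if q: "dens q" and qU: "(\<integral>\<^sup>+x. ennreal (\<bar>q x\<bar> powr \<rho>) \<partial>L) \<le> ennreal (U powr \<rho>)" for q
  proof -
    note [measurable] = densD(1)[OF q]
    interpret LL: pair_sigma_finite L L
      by (simp add: pair_sigma_finite_def L.sigma_finite_measure_axioms)
    have "integrable (L \<Otimes>\<^sub>M L) (\<lambda>(y, x). f x * k x y * q y)"
    proof (rule integrableI_bounded)
      have "(\<integral>\<^sup>+z. ennreal (norm (case z of (y, x) \<Rightarrow> f x * k x y * q y)) \<partial>(L \<Otimes>\<^sub>M L)) =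
          (\<integral>\<^sup>+y. \<integral>\<^sup>+x. ennreal \<bar>f x * k x y * q y\<bar> \<partial>L \<partial>L)"
        by (subst L.nn_integral_fst[symmetric]) (auto simp: split_beta')
      then show "(\<integral>\<^sup>+z. ennreal (norm (case z of (y, x) \<Rightarrow> f x * k x y * q y)) \<partial>(L \<Otimes>\<^sub>M L)) < \<infinity>"
        using prod_bd[OF that] by (simp add: order_le_less_trans)
    qed measurable
    from LL.Fubini_integral[OF this] have "(LINT x|L. LINT y|L. f x * k x y * q y) = (LINT y|L. LINT x|L. f x * k x y * q y)" .
    moreover have "(LINT y|L. LINT x|L. f x * k x y * q y) = (LINT y|L. F y * q y)"
      by (simp add: F_def)
    moreover have "(LINT x|L. LINT y|L. f x * k x y * q y) = (LINT x|L. f x * op q x)"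
      by (simp add: op_def mult.assoc)
    ultimately show ?thesis by (simp add: integral_Mp[OF q])
  qed
  have diff: "integral\<^sup>L (Mp p) F - integral\<^sup>L (Mp p0) F = G"
  proof -
    have i: "integrable L (\<lambda>x. f x * op q x)"
      if q: "dens q" and qU: "(\<integral>\<^sup>+x. ennreal (\<bar>q x\<bar> powr \<rho>) \<partial>L) \<le> ennreal (U powr \<rho>)" for q
    proof (rule dual_int(1)[OF _ _ BU])
      show "op q \<in> borel_measurable L" using densD(1)[OF q] by measurable
      have "(\<integral>\<^sup>+x. ennreal (\<bar>op q x\<bar> powr \<rho>) \<partial>L) \<le> (\<integral>\<^sup>+x. ennreal (\<bar>aop q x\<bar> powr \<rho>) \<partial>L)"
        by (rule op_Lr_le[OF q r])
      also have "\<dots> \<le> ennreal ((B * U) powr \<rho>)" by (intro schur_test_aop q r qU U(2))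
      finally show "(\<integral>\<^sup>+x. ennreal (\<bar>op q x\<bar> powr \<rho>) \<partial>L) \<le> ennreal ((B * U) powr \<rho>)" .
    qed
    have "integral\<^sup>L (Mp p) F - integral\<^sup>L (Mp p0) F = (LINT x|L. f x * g x)"
      unfolding EF[OF p U(1)] EF[OF p0 U0] g_def
      by (subst Bochner_Integration.integral_diff[symmetric])
        (use i[OF p U(1)] i[OF p0 U0] in \<open>auto simp: algebra_simps\<close>)
    also have "\<dots> = (LINT x|L. \<bar>g x\<bar> powr \<rho> / G powr (\<rho> - 1))"
    proof (intro Bochner_Integration.integral_cong refl)
      fix x
      show "f x * g x = \<bar>g x\<bar> powr \<rho> / G powr (\<rho> - 1)"
        by (cases "g x = 0") (auto simp: f_def powr_diff sgn_if)
    qed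
    also have "\<dots> = (LINT x|L. \<bar>g x\<bar> powr \<rho>) / G powr (\<rho> - 1)" by simp
    also have "(LINT x|L. \<bar>g x\<bar> powr \<rho>) = G powr \<rho>"
      using G by (intro integral_eq_nn_integral[THEN trans]) (auto simp: g_def)
    also have "G powr \<rho> / G powr (\<rho> - 1) = G" using G0 by (simp add: powr_diff)
    finally show ?thesis .
  qed
  let ?P = "PiM {..<n} (\<lambda>_. Mp p)"
  have F_Mp[measurable]: "F \<in> borel_measurable (Mp p)" by (simp cong: measurable_cong_sets)
  have "emeasure ?P {\<omega> \<in> space ?P. (\<integral>\<^sup>+x. ennreal (\<bar>est n \<omega> x - op p0 x\<bar> powr \<rho>) \<partial>L) \<le> ennreal (t0 powr \<rho>)}
    \<le> emeasure ?P {\<omega> \<in> space ?P. (\<Sum>i<n. F (\<omega> i)) \<le> real n * (integral\<^sup>L (Mp p) F - t)}"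
  proof (rule emeasure_mono)
    show "{\<omega> \<in> space ?P. (\<integral>\<^sup>+x. ennreal (\<bar>est n \<omega> x - op p0 x\<bar> powr \<rho>) \<partial>L) \<le> ennreal (t0 powr \<rho>)}
      \<subseteq> {\<omega> \<in> space ?P. (\<Sum>i<n. F (\<omega> i)) \<le> real n * (integral\<^sup>L (Mp p) F - t)}"
    proof safe
      fix \<omega> assume \<omega>: "\<omega> \<in> space ?P" and small: "(\<integral>\<^sup>+x. ennreal (\<bar>est n \<omega> x - op p0 x\<bar> powr \<rho>) \<partial>L) \<le> ennreal (t0 powr \<rho>)"
      have \<omega>i: "\<omega> i \<in> space L" if "i < n" for i using \<omega> that by (auto simp: space_PiM)
      have [measurable]: "(\<lambda>x. est n \<omega> x) \<in> borel_measurable L"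
        unfolding est_def using \<omega>i by (intro borel_measurable_divide borel_measurable_sum k_sec) auto
      have fk: "integrable L (\<lambda>x. f x * k x (\<omega> i))" if "i < n" for i
        by (rule dual_int(1)[OF k_sec(2)[OF \<omega>i[OF that]] col_b[OF \<omega>i[OF that]] b])
      have f_op: "integrable L (\<lambda>x. f x * op p0 x)"
      proof (rule dual_int(1)[OF _ _ b])
        have "(\<integral>\<^sup>+x. ennreal (\<bar>op p0 x\<bar> powr \<rho>) \<partial>L) \<le> (\<integral>\<^sup>+x. ennreal (\<bar>aop p0 x\<bar> powr \<rho>) \<partial>L)"
          by (rule op_Lr_le[OF p0 r])
        also have "\<dots> \<le> ennreal (b powr \<rho>)" unfolding b_def by (rule aop_Lr_finite[OF p0 r])
        finally show "(\<integral>\<^sup>+x. ennreal (\<bar>op p0 x\<bar> powr \<rho>) \<partial>L) \<le> ennreal (b powr \<rho>)" .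
      qed measurable
      have "(LINT x|L. f x * (est n \<omega> x - op p0 x)) =
          (LINT x|L. (\<Sum>i<n. f x * k x (\<omega> i)) / real n - f x * op p0 x)"
        by (intro Bochner_Integration.integral_cong refl)
          (simp add: est_def sum_distrib_left[symmetric] algebra_simps)
      also have "\<dots> = (\<Sum>i<n. F (\<omega> i)) / real n - integral\<^sup>L (Mp p0) F"
      proof -
        have i1: "integrable L (\<lambda>x. \<Sum>i<n. f x * k x (\<omega> i))" using fk by (intro Bochner_Integration.integrable_sum) auto
        have "(LINT x|L. (\<Sum>i<n. f x * k x (\<omega> i))) = (\<Sum>i<n. F (\<omega> i))"
          unfolding F_def using fk by (intro Bochner_Integration.integral_sum) auto
        then show ?thesis
          using Bochner_Integration.integral_diff[OF integrable_divide[OF i1, of "real n"] f_op]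
          by (simp add: EF[OF p0 U0])
      qed
      finally have "(\<Sum>i<n. F (\<omega> i)) / real n - integral\<^sup>L (Mp p0) F \<le> t0"
        using dual_int(2)[OF _ small t(2)] by simp
      then have "(\<Sum>i<n. F (\<omega> i)) / real n \<le> integral\<^sup>L (Mp p) F - t" using diff t(3) by linarith
      then show "(\<Sum>i<n. F (\<omega> i)) \<le> real n * (integral\<^sup>L (Mp p) F - t)"
        using n by (simp add: field_simps)
    qed
  qed measurable
  also have "\<dots> \<le> ennreal (exp (- real n * t\<^sup>2 / (4 * (B\<^sup>2 * U * R powr (1 - 1 / \<rho>)))))"
  proof (rule iid_lower_tail[OF prob_space_Mp[OF p]])
    show "\<bar>F x\<bar> \<le> b" if "x \<in> space (Mp p)" for x using F_b that by simp
    \<comment> \<open>The second moment of \<open>F\<close> is at most its uniform bound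
      \<open>b\<close> times its first absolute moment \<open>B * U\<close>. Using both keeps a
      single factor \<open>R powr (1 - 1 / \<rho>)\<close>, where \<open>b\<^sup>2\<close> would
      produce two.\<close>
    have S: "b * (B * U) = B\<^sup>2 * U * R powr (1 - 1 / \<rho>)" by (simp add: b_def power2_eq_square)
    show "0 < B\<^sup>2 * U * R powr (1 - 1 / \<rho>)" using B1 R1 U by simp
    show "t * b \<le> 2 * (B\<^sup>2 * U * R powr (1 - 1 / \<rho>))"
      unfolding S[symmetric] using mult_right_mono[OF t(4), of b] b by (simp add: algebra_simps)
    have "(\<integral>\<^sup>+y. ennreal ((F y)\<^sup>2 * p y) \<partial>L) \<le> (\<integral>\<^sup>+y. ennreal b * (\<integral>\<^sup>+x. ennreal \<bar>f x * k x y * p y\<bar> \<partial>L) \<partial>L)"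
    proof (intro nn_integral_mono)
      fix y assume y: "y \<in> space L"
      have "ennreal \<bar>F y\<bar> \<le> (\<integral>\<^sup>+x. ennreal (norm (f x * k x y)) \<partial>L)"
        unfolding F_def using integral_norm_bound_ennreal[OF dual_int(1)[OF k_sec(2)[OF y] col_b[OF y] b]] by simp
      then have "ennreal \<bar>F y\<bar> * ennreal (p y) \<le> (\<integral>\<^sup>+x. ennreal \<bar>f x * k x y\<bar> \<partial>L) * ennreal (p y)"
        by (intro mult_right_mono) auto
      also have "\<dots> = (\<integral>\<^sup>+x. ennreal \<bar>f x * k x y\<bar> * ennreal (p y) \<partial>L)"
        using y by (intro nn_integral_multc[symmetric]) measurable
      also have "\<dots> = (\<integral>\<^sup>+x. ennreal \<bar>f x * k x y * p y\<bar> \<partial>L)"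
        using densD(2)[OF p y] by (simp add: abs_mult ennreal_mult[symmetric])
      finally have *: "ennreal \<bar>F y\<bar> * ennreal (p y) \<le> (\<integral>\<^sup>+x. ennreal \<bar>f x * k x y * p y\<bar> \<partial>L)" .
      have "(F y)\<^sup>2 * p y \<le> b * (\<bar>F y\<bar> * p y)"
        using mult_right_mono[OF F_b[OF y], of "\<bar>F y\<bar> * p y"] densD(2)[OF p y]
        by (simp add: power2_eq_square mult.assoc[symmetric])
      then have "ennreal ((F y)\<^sup>2 * p y) \<le> ennreal b * (ennreal \<bar>F y\<bar> * ennreal (p y))"
        using b densD(2)[OF p y] by (simp add: ennreal_mult[symmetric] ennreal_leI)
      also have "\<dots> \<le> ennreal b * (\<integral>\<^sup>+x. ennreal \<bar>f x * k x y * p y\<bar> \<partial>L)"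
        using * by (intro mult_left_mono) auto
      finally show "ennreal ((F y)\<^sup>2 * p y) \<le> ennreal b * (\<integral>\<^sup>+x. ennreal \<bar>f x * k x y * p y\<bar> \<partial>L)" .
    qed
    also have "\<dots> = ennreal b * (\<integral>\<^sup>+y. \<integral>\<^sup>+x. ennreal \<bar>f x * k x y * p y\<bar> \<partial>L \<partial>L)"
      by (intro nn_integral_cmult) measurable
    also have "\<dots> \<le> ennreal b * ennreal (B * U)"
      by (intro mult_left_mono prod_bd p U) simp
    finally have *: "(\<integral>\<^sup>+y. ennreal ((F y)\<^sup>2 * p y) \<partial>L) \<le> ennreal (b * (B * U))"
      using b by (simp add: ennreal_mult'[symmetric])
    have "(LINT x|Mp p. (F x)\<^sup>2) = (LINT y|L. (F y)\<^sup>2 * p y)"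
      by (intro integral_Mp p) measurable
    also have "\<dots> = enn2real (\<integral>\<^sup>+y. ennreal ((F y)\<^sup>2 * p y) \<partial>L)"
      using densD(2)[OF p] by (intro integral_eq_nn_integral) auto
    also have "\<dots> \<le> b * (B * U)"
      using enn2real_mono[OF *] b BU by simp
    finally show "(LINT x|Mp p. (F x)\<^sup>2) \<le> B\<^sup>2 * U * R powr (1 - 1 / \<rho>)" by (simp add: S)
  qed (use t F_Mp in auto)
  finally show ?thesis .
qed

end

subsection \<open>The estimator under a fixed density\<close>

text \<open>Subtracting \<open>2\<close> leaves a quantity vanishing to second order at zero, so the
  bound is proportional to the second moment instead of being merely bounded. This proportionality
  is what later permits integration over the line and summation over infinitely many
  functions.\<close>

lemma iid_cosh_bound:
  fixes f :: "'a \<Rightarrow> real" and n :: nat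
  assumes M: "prob_space M" and f[measurable]: "f \<in> borel_measurable M"
    and b: "\<And>x. x \<in> space M \<Longrightarrow> \<bar>f x\<bar> \<le> b" and l: "\<bar>l\<bar> * b \<le> 1"
    and v: "integral\<^sup>L M (\<lambda>x. (f x)\<^sup>2) \<le> v" and nv: "real n * l\<^sup>2 * v \<le> 1"
  shows "(\<integral>\<^sup>+x. ennreal (exp (l * (\<Sum>i<n. f (x i) - integral\<^sup>L M f)) + exp (- (l * (\<Sum>i<n. f (x i) - integral\<^sup>L M f))) - 2)
      \<partial>PiM {..<n} (\<lambda>_. M)) \<le> ennreal (4 * (real n * l\<^sup>2 * v))"
proof -
  interpret M: prob_space M by fact
  interpret P: product_prob_space "\<lambda>_::nat. M" "{..<n}" by unfold_locales
  let ?P = "PiM {..<n} (\<lambda>_. M)"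
  define S where "S x = l * (\<Sum>i<n. f (x i) - integral\<^sup>L M f)" for x
  have [measurable]: "S \<in> borel_measurable ?P" unfolding S_def by measurable
  define a where "a = real n * l\<^sup>2 * v"
  have v0: "0 \<le> v" using v by (rule order_trans[rotated]) simp
  have a: "0 \<le> a" "a \<le> 1" using v0 nv by (auto simp: a_def)
  have pos: "0 \<le> exp u + exp (- u) - 2" for u :: real
    using exp_ge_add_one_self[of u] exp_ge_add_one_self[of "- u"] by linarith
  have m1: "(\<integral>\<^sup>+x. ennreal (exp (S x)) \<partial>?P) \<le> ennreal (exp a)"
    unfolding S_def a_def by (rule iid_mgf_le[OF M f b l v])
  have m2: "(\<integral>\<^sup>+x. ennreal (exp (- S x)) \<partial>?P) \<le> ennreal (exp a)"
    using iid_mgf_le[OF M f b _ v, of "- l" n] l unfolding S_def a_def by simp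
  have "(\<integral>\<^sup>+x. ennreal (exp (S x) + exp (- S x) - 2) \<partial>?P) + ennreal 2 =
     (\<integral>\<^sup>+x. ennreal (exp (S x) + exp (- S x) - 2) + ennreal 2 \<partial>?P)"
    by (subst nn_integral_add) (auto simp: P.P.emeasure_space_1)
  also have "\<dots> = (\<integral>\<^sup>+x. ennreal (exp (S x)) + ennreal (exp (- S x)) \<partial>?P)"
  proof (intro nn_integral_cong)
    fix x
    show "ennreal (exp (S x) + exp (- S x) - 2) + ennreal 2 = ennreal (exp (S x)) + ennreal (exp (- S x))"
      using pos[of "S x"] by (subst (1 2) ennreal_plus[symmetric]) auto
  qed
  also have "\<dots> = (\<integral>\<^sup>+x. ennreal (exp (S x)) \<partial>?P) + (\<integral>\<^sup>+x. ennreal (exp (- S x)) \<partial>?P)"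
    by (rule nn_integral_add) auto
  also have "\<dots> \<le> ennreal (exp a) + ennreal (exp a)" using m1 m2 by (rule add_mono)
  also have "\<dots> \<le> ennreal (4 * a + 2)"
    using exp_bound[OF a] mult_left_mono[OF a(2) a(1)]
    by (simp add: ennreal_plus[symmetric] ennreal_leI power2_eq_square del: ennreal_plus)
  also have "\<dots> = ennreal (4 * a) + ennreal 2" using a by (intro ennreal_plus) auto
  finally show ?thesis unfolding S_def a_def[symmetric]
    using ennreal_add_left_cancel_le[of "ennreal 2"] by (simp add: add.commute)
qed

text \<open>Near zero the right side is of the order of the square of \<open>u\<close>, which
  dominates because \<open>\<rho> \<ge> 2\<close>; away from zero one term of the exponential
  series, of degree at least \<open>\<rho>\<close>, dominates.\<close>

lemma powr_le_cosh:
  fixes \<rho> :: real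
  assumes "2 \<le> \<rho>"
  obtains C where "0 < C" "\<And>u. \<bar>u\<bar> powr \<rho> \<le> C * (exp u + exp (- u) - 2)"
proof -
  define m where "m = nat \<lceil>\<rho>\<rceil>"
  have m: "\<rho> \<le> real m" unfolding m_def by linarith
  define C where "C = 8 * fact m + (1::real)"
  have C: "0 < C" by (simp add: C_def add_pos_pos)
  have C2: "2 \<le> C" using fact_ge_1[of m, where ?'a = real] unfolding C_def by linarith
  have main: "u powr \<rho> \<le> C * (exp u + exp (- u) - 2)" if u: "0 \<le> u" for u :: real
  proof (cases "u \<le> 1")
    case True
    have "u powr \<rho> \<le> u\<^sup>2"
    proof (cases "u = 0")
      case False
      then have "u powr \<rho> \<le> u powr 2" using True u assms by (intro powr_mono') auto
      then show ?thesis using u False by simp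
    qed simp
    moreover have "1 + u + u\<^sup>2 / 2 \<le> exp u" by (rule exp_lower_Taylor_quadratic[OF u])
    moreover have "1 - u \<le> exp (- u)" using exp_ge_add_one_self[of "- u"] by simp
    ultimately have *: "u powr \<rho> \<le> 2 * (exp u + exp (- u) - 2)" by simp
    have "0 \<le> exp u + exp (- u) - 2" using exp_ge_add_one_self[of u] exp_ge_add_one_self[of "- u"] by linarith
    then have "2 * (exp u + exp (- u) - 2) \<le> C * (exp u + exp (- u) - 2)"
      using C2 by (intro mult_right_mono)
    with * show ?thesis by linarith
  next
    case False
    then have u1: "1 \<le> u" by simp
    have "u powr \<rho> \<le> u powr real m" using u1 m by (intro powr_mono) auto
    also have "\<dots> = u ^ m" using u1 by (intro powr_realpow) simp
    also have "\<dots> \<le> fact m * exp u"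
    proof -
      have "u ^ m / fact m \<le> exp u"
      proof -
        have "(\<Sum>i\<in>{m}. u ^ i /\<^sub>R fact i) \<le> exp u"
          unfolding exp_def using summable_exp_generic[of u] u by (intro sum_le_suminf) auto
        then show ?thesis by (simp add: divide_inverse mult.commute)
      qed
      then show ?thesis by (simp add: field_simps)
    qed
    also have "\<dots> \<le> fact m * (8 * (exp u - 2))"
    proof (intro mult_left_mono)
      \<comment> \<open>The factor \<open>8\<close> needs only \<open>exp u \<ge> 16 / 7\<close>,
        and \<open>5 / 2\<close> exceeds that.\<close>
      have "5 / 2 \<le> exp (1::real)" using exp_lower_Taylor_quadratic[of 1] by simp
      also have "exp 1 \<le> exp u" using u1 by simp
      finally show "exp u \<le> 8 * (exp u - 2)" by simp
    qed simp
    also have "\<dots> \<le> C * (exp u - 2)"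
    proof -
      have "5 / 2 \<le> exp (1::real)" using exp_lower_Taylor_quadratic[of 1] by simp
      also have "exp 1 \<le> exp u" using u1 by simp
      finally have "0 \<le> exp u - 2" by simp
      then show ?thesis by (simp add: C_def algebra_simps)
    qed
    also have "\<dots> \<le> C * (exp u + exp (- u) - 2)" using C by (intro mult_left_mono) auto
    finally show ?thesis .
  qed
  have "\<bar>u\<bar> powr \<rho> \<le> C * (exp u + exp (- u) - 2)" for u
    using main[of "\<bar>u\<bar>"] by (cases "0 \<le> u") (auto simp: add.commute)
  then show ?thesis by (rule that[OF C])
qed

text \<open>Rosenthal's inequality for bounded summands, obtained from the hyperbolic cosine bound
  by scaling. The constant depends on \<open>\<rho>\<close> alone, so it may be fixed before the
  kernel, the level and the sample size.\<close>

lemma rosenthal_moment_bound: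
  fixes \<rho> :: real
  assumes r: "2 \<le> \<rho>"
  obtains C where "0 < C" "\<And>(M :: 'a measure) f b v (n :: nat). \<lbrakk>prob_space M; f \<in> borel_measurable M; 0 < b;
      \<And>x. x \<in> space M \<Longrightarrow> \<bar>f x\<bar> \<le> b; integral\<^sup>L M (\<lambda>x. (f x)\<^sup>2) \<le> v\<rbrakk> \<Longrightarrow>
    (\<integral>\<^sup>+x. ennreal (\<bar>\<Sum>i<n. f (x i) - integral\<^sup>L M f\<bar> powr \<rho>) \<partial>PiM {..<n} (\<lambda>_. M))
      \<le> ennreal (C * (real n * v * b powr (\<rho> - 2) + (real n * v) powr (\<rho> / 2)))"
proof -
  obtain C where C: "0 < C" "\<And>u. \<bar>u\<bar> powr \<rho> \<le> C * (exp u + exp (- u) - 2)"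
    using powr_le_cosh[OF r] by blast
  define C' where "C' = 4 * C * 2 powr (\<rho> - 2)"
  have C': "0 < C'" using C by (simp add: C'_def)
  have sq: "y * sqrt y powr (\<rho> - 2) = y powr (\<rho> / 2)" if "0 \<le> y" for y :: real
  proof (cases "y = 0")
    case False
    then have y: "0 < y" using that by simp
    then have "sqrt y = y powr (1 / 2)" by (simp add: powr_half_sqrt)
    then have "sqrt y powr (\<rho> - 2) = y powr (1 / 2 * (\<rho> - 2))" by (simp only: powr_powr)
    moreover have "y powr 1 = y" using y by simp
    ultimately have "y * sqrt y powr (\<rho> - 2) = y powr (1 + 1 / 2 * (\<rho> - 2))" by (simp only: powr_add)
    also have "1 + 1 / 2 * (\<rho> - 2) = \<rho> / 2" by (simp add: field_simps)
    finally show ?thesis .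
  qed simp
  have "(\<integral>\<^sup>+x. ennreal (\<bar>\<Sum>i<n. f (x i) - integral\<^sup>L M f\<bar> powr \<rho>) \<partial>PiM {..<n} (\<lambda>_. M))
      \<le> ennreal (C' * (real n * v * b powr (\<rho> - 2) + (real n * v) powr (\<rho> / 2)))"
    if M: "prob_space M" and f[measurable]: "f \<in> borel_measurable M" and b: "0 < b"
      "\<And>x. x \<in> space M \<Longrightarrow> \<bar>f x\<bar> \<le> b" and v: "integral\<^sup>L M (\<lambda>x. (f x)\<^sup>2) \<le> v"
    for M :: "'a measure" and f b v and n :: nat
  proof -
    define m where "m = integral\<^sup>L M f"
    \<comment> \<open>The smallest natural scale meeting both side conditions of the exponential
      bound with \<open>l = 1 / s\<close>: \<open>s \<ge> b\<close> gives
      \<open>l * b \<le> 1\<close>, and \<open>s \<ge> sqrt (n * v)\<close> gives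
      \<open>n * l\<^sup>2 * v \<le> 1\<close>.\<close>
    define s where "s = b + sqrt (real n * v)"
    define l where "l = 1 / s"
    have v0: "0 \<le> v" using v by (rule order_trans[rotated]) simp
    have s: "b \<le> s" "sqrt (real n * v) \<le> s" "0 < s" using b v0 by (auto simp: s_def add_pos_nonneg)
    have lb: "\<bar>l\<bar> * b \<le> 1" using s b by (simp add: l_def)
    have "real n * v = (sqrt (real n * v))\<^sup>2" using v0 by simp
    also have "\<dots> \<le> s\<^sup>2" using s v0 by (intro power_mono) auto
    finally have nv: "real n * l\<^sup>2 * v \<le> 1" using s by (simp add: l_def power_divide field_simps)
    have "(\<integral>\<^sup>+x. ennreal (\<bar>\<Sum>i<n. f (x i) - m\<bar> powr \<rho>) \<partial>PiM {..<n} (\<lambda>_. M)) \<le>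
      (\<integral>\<^sup>+x. ennreal (C * s powr \<rho>) * ennreal (exp (l * (\<Sum>i<n. f (x i) - m)) + exp (- (l * (\<Sum>i<n. f (x i) - m))) - 2) \<partial>PiM {..<n} (\<lambda>_. M))"
    proof (intro nn_integral_mono)
      fix x
      let ?S = "\<Sum>i<n. f (x i) - m"
      have "\<bar>?S\<bar> powr \<rho> = s powr \<rho> * \<bar>l * ?S\<bar> powr \<rho>"
        using s by (simp add: l_def abs_mult powr_mult[symmetric] abs_divide)
      also have "\<dots> \<le> s powr \<rho> * (C * (exp (l * ?S) + exp (- (l * ?S)) - 2))"
        by (intro mult_left_mono C(2)) simp
      finally show "ennreal (\<bar>?S\<bar> powr \<rho>) \<le> ennreal (C * s powr \<rho>) * ennreal (exp (l * ?S) + exp (- (l * ?S)) - 2)"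
        using C by (simp add: ennreal_mult'[symmetric] ennreal_leI mult_ac)
    qed
    also have "\<dots> = ennreal (C * s powr \<rho>) * (\<integral>\<^sup>+x. ennreal (exp (l * (\<Sum>i<n. f (x i) - m)) + exp (- (l * (\<Sum>i<n. f (x i) - m))) - 2) \<partial>PiM {..<n} (\<lambda>_. M))"
      by (intro nn_integral_cmult) measurable
    also have "\<dots> \<le> ennreal (C * s powr \<rho>) * ennreal (4 * (real n * l\<^sup>2 * v))"
      unfolding m_def by (intro mult_left_mono iid_cosh_bound[OF M f b(2) lb v nv]) auto
    also have "\<dots> = ennreal (4 * C * (real n * v) * s powr (\<rho> - 2))"
      using s C by (simp add: ennreal_mult'[symmetric] l_def powr_diff power_divide mult_ac)
    also have "\<dots> \<le> ennreal (C' * (real n * v * b powr (\<rho> - 2) + (real n * v) powr (\<rho> / 2)))"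
    proof (intro ennreal_leI)
      let ?q = "sqrt (real n * v)"
      have "s \<le> 2 * max b ?q" by (simp add: s_def)
      then have "s powr (\<rho> - 2) \<le> (2 * max b ?q) powr (\<rho> - 2)" using s r by (intro powr_mono2) auto
      also have "\<dots> = 2 powr (\<rho> - 2) * (max b ?q) powr (\<rho> - 2)" by (rule powr_mult)
      also have "\<dots> \<le> 2 powr (\<rho> - 2) * (b powr (\<rho> - 2) + ?q powr (\<rho> - 2))"
        by (intro mult_left_mono) (auto simp: max_def)
      finally have "4 * C * (real n * v) * s powr (\<rho> - 2) \<le> 4 * C * (real n * v) * (2 powr (\<rho> - 2) * (b powr (\<rho> - 2) + ?q powr (\<rho> - 2)))"
        using C v0 by (intro mult_left_mono) auto
      also have "\<dots> = C' * (real n * v * b powr (\<rho> - 2) + real n * v * ?q powr (\<rho> - 2))"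
        by (simp add: C'_def algebra_simps)
      also have "real n * v * ?q powr (\<rho> - 2) = (real n * v) powr (\<rho> / 2)"
        using v0 by (intro sq) simp
      finally show "4 * C * (real n * v) * s powr (\<rho> - 2) \<le> C' * (real n * v * b powr (\<rho> - 2) + (real n * v) powr (\<rho> / 2))" .
    qed
    finally show ?thesis by (simp add: m_def)
  qed
  then show ?thesis by (rule that[OF C'])
qed

section \<open>Moments of the kernel estimator for exponents below two\<close>

context schur_kernel
begin

lemma product_prob_space_Mp:
  assumes "dens p"
  shows "product_prob_space (\<lambda>_::nat. Mp p)"
  using prob_space_Mp[OF assms]
  by (simp add: product_prob_space_def product_prob_space_axioms_def product_sigma_finite_def
      prob_space_imp_sigma_finite)

lemma est_measurable [measurable]:
  "(\<lambda>(\<omega>, x). est n \<omega> x) \<in> borel_measurable (PiM {..<n} (\<lambda>_. Mp p) \<Otimes>\<^sub>M L)"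
proof -
  have "(\<lambda>z. k (snd z) (fst z i)) \<in> borel_measurable (PiM {..<n} (\<lambda>_. Mp p) \<Otimes>\<^sub>M L)" if "i < n" for i
  proof -
    have "(\<lambda>z. fst z i) \<in> measurable (PiM {..<n} (\<lambda>_. Mp p) \<Otimes>\<^sub>M L) (Mp p)"
      using that by (intro measurable_compose[OF measurable_fst] measurable_component_singleton) auto
    then have [measurable]: "(\<lambda>z. fst z i) \<in> measurable (PiM {..<n} (\<lambda>_. Mp p) \<Otimes>\<^sub>M L) L"
      by (simp cong: measurable_cong_sets)
    show ?thesis by measurable
  qed
  then show ?thesis unfolding est_def split_beta' by (intro borel_measurable_divide borel_measurable_sum) auto
qed

lemma op_eq_expectation:
  "dens p \<Longrightarrow> x \<in> space L \<Longrightarrow> op p x = integral\<^sup>L (Mp p) (\<lambda>y. k x y)"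
  by (simp add: op_def integral_Mp)

text \<open>One factor of the kernel is bounded uniformly and the other is kept inside
  \<open>aop\<close>. The result is still integrable in \<open>x\<close>, which a bound by
  \<open>(B * R)\<^sup>2\<close> would not be on the line.\<close>

lemma k_square:
  assumes p: "dens p" and x: "x \<in> space L"
  shows "integrable (Mp p) (\<lambda>y. (k x y)\<^sup>2)" "integral\<^sup>L (Mp p) (\<lambda>y. (k x y)\<^sup>2) \<le> B * R * aop p x"
proof -
  interpret prob_space "Mp p" by (rule prob_space_Mp[OF p])
  note [measurable] = k_sec(1)[OF x]
  have bd: "(k x y)\<^sup>2 \<le> B * R * \<bar>k x y\<bar>" if "y \<in> space L" for y
    using mult_right_mono[OF k_bd[OF x that], of "\<bar>k x y\<bar>"] by (simp add: power2_eq_square abs_mult[symmetric])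
  have bd2: "(k x y)\<^sup>2 \<le> (B * R)\<^sup>2" if "y \<in> space L" for y
    using power_mono[OF k_bd[OF x that], of 2] by simp
  have m: "(\<lambda>y. (k x y)\<^sup>2) \<in> borel_measurable (Mp p)" by (simp cong: measurable_cong_sets)
  show "integrable (Mp p) (\<lambda>y. (k x y)\<^sup>2)"
    using bd2 m by (intro integrable_const_bound[of _ "(B * R)\<^sup>2"]) (auto intro!: AE_I2)
  have "integral\<^sup>L (Mp p) (\<lambda>y. (k x y)\<^sup>2) = (LINT y|L. (k x y)\<^sup>2 * p y)" by (intro integral_Mp p) measurable
  also have "\<dots> \<le> (LINT y|L. B * R * (\<bar>k x y\<bar> * p y))"
  proof (intro integral_mono)
    show "integrable L (\<lambda>y. (k x y)\<^sup>2 * p y)" using bd2 by (intro integrable_dens p) auto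
    show "integrable L (\<lambda>y. B * R * (\<bar>k x y\<bar> * p y))" by (intro integrable_mult_right k_dens_integrable p x)
    show "(k x y)\<^sup>2 * p y \<le> B * R * (\<bar>k x y\<bar> * p y)" if "y \<in> space L" for y
      using mult_right_mono[OF bd[OF that] densD(2)[OF p that]] by (simp add: mult.assoc)
  qed
  also have "\<dots> = B * R * aop p x" by (simp add: aop_def)
  finally show "integral\<^sup>L (Mp p) (\<lambda>y. (k x y)\<^sup>2) \<le> B * R * aop p x" .
qed

lemma est_minus_op:
  assumes "dens p" "x \<in> space L" "n \<ge> 1"
  shows "est n \<omega> x - op p x = (\<Sum>i<n. k x (\<omega> i) - integral\<^sup>L (Mp p) (\<lambda>y. k x y)) / real n"
  using assms by (simp add: est_def op_eq_expectation sum_subtractf diff_divide_distrib)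

lemma Fubini_est:
  fixes n :: nat
  assumes p: "dens p"
    and [measurable]: "(\<lambda>(\<omega>, x). h \<omega> x) \<in> borel_measurable (PiM {..<n} (\<lambda>_. Mp p) \<Otimes>\<^sub>M L)"
  shows "(\<integral>\<^sup>+\<omega>. \<integral>\<^sup>+x. h \<omega> x \<partial>L \<partial>PiM {..<n} (\<lambda>_. Mp p)) = (\<integral>\<^sup>+x. \<integral>\<^sup>+\<omega>. h \<omega> x \<partial>PiM {..<n} (\<lambda>_. Mp p) \<partial>L)"
proof -
  interpret P: product_prob_space "\<lambda>_::nat. Mp p" "{..<n}" using p by (rule product_prob_space_Mp)
  show ?thesis
    by (rule pair_sigma_finite.Fubini'[symmetric])
      (simp_all add: pair_sigma_finite_def L.sigma_finite_measure_axioms P.P.sigma_finite_measure_axioms)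
qed

text \<open>On the line an integrated variance does not control lower powers, so integrability at
  infinity has to be paid for by a weight. In the application \<open>W\<close> is a power of
  \<open>1 + \<bar>x\<bar>\<close>: the moment of the density makes \<open>A2\<close> finite, and a
  sufficiently large exponent makes \<open>A1\<close> finite.\<close>

lemma type_I_weighted:
  assumes r: "1 \<le> \<rho>" "\<rho> < 2" and n: "n \<ge> 1" and p: "dens p"
    and [measurable]: "W \<in> borel_measurable L" and W: "\<And>x. x \<in> space L \<Longrightarrow> 0 < W x"
    and A1: "(\<integral>\<^sup>+x. ennreal (W x powr (- (\<rho> / (2 - \<rho>)))) \<partial>L) \<le> ennreal A1" "0 \<le> A1"
    and A2: "(\<integral>\<^sup>+x. ennreal (aop p x * W x) \<partial>L) \<le> ennreal A2" "0 \<le> A2"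
  shows "(\<integral>\<^sup>+\<omega>. \<integral>\<^sup>+x. ennreal (\<bar>est n \<omega> x - op p x\<bar> powr \<rho>) \<partial>L \<partial>PiM {..<n} (\<lambda>_. Mp p))
    \<le> ennreal ((B * A2 + A1) * (R / real n) powr (\<rho> / 2))"
proof -
  note [measurable] = densD(1)[OF p]
  let ?P = "PiM {..<n} (\<lambda>_. Mp p)"
  define s where "s = R / real n"
  have s: "0 < s" using R1 n by (simp add: s_def)
  have pt: "(\<integral>\<^sup>+\<omega>. ennreal (\<bar>est n \<omega> x - op p x\<bar> powr \<rho>) \<partial>?P) \<le>
      ennreal (s powr (\<rho> / 2)) * (ennreal B * ennreal (aop p x * W x) + ennreal (W x powr (- (\<rho> / (2 - \<rho>)))))"
    if x: "x \<in> space L" for x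
  proof -
    interpret P: product_prob_space "\<lambda>_::nat. Mp p" "{..<n}" using p by (rule product_prob_space_Mp)
    txt \<open>The power is bounded by its secant \<open>u\<^sup>r \<le> a\<^bsup>r/2 - 1\<^esup> u\<^sup>2 + a\<^bsup>r/2\<^esup>\<close>; this choice of \<open>a\<close> turns the
      second moment into one with weight \<open>W\<close> and makes the second term integrable.\<close>
    define a where "a = s * W x powr (- (2 / (2 - \<rho>)))"
    have a: "0 < a" using s W[OF x] by (simp add: a_def)
    have a1: "a powr (\<rho> / 2 - 1) = s powr (\<rho> / 2 - 1) * W x"
    proof -
      have "- (2 / (2 - \<rho>)) * (\<rho> / 2 - 1) = 1" using r by (simp add: field_simps)
      then show ?thesis unfolding a_def powr_mult powr_powr using W[OF x] by simp
    qed
    have a2: "a powr (\<rho> / 2) = s powr (\<rho> / 2) * W x powr (- (\<rho> / (2 - \<rho>)))"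
    proof -
      have "- (2 / (2 - \<rho>)) * (\<rho> / 2) = - (\<rho> / (2 - \<rho>))" using r by (simp add: field_simps)
      then show ?thesis unfolding a_def powr_mult powr_powr by simp
    qed
    let ?S = "\<lambda>\<omega>. (\<Sum>i<n. k x (\<omega> i) - integral\<^sup>L (Mp p) (\<lambda>y. k x y))"
    have [measurable]: "(\<lambda>y. k x y) \<in> borel_measurable (Mp p)" using k_sec(1)[OF x] by (simp cong: measurable_cong_sets)
    have conc: "u powr \<rho> \<le> a powr (\<rho> / 2 - 1) * u\<^sup>2 + a powr (\<rho> / 2)" if "0 \<le> u" for u
    proof (cases "u\<^sup>2 \<le> a")
      case True
      have "u powr \<rho> = (u\<^sup>2) powr (\<rho> / 2)" using that by (simp add: powr_powr flip: powr_numeral)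
      also have "\<dots> \<le> a powr (\<rho> / 2)" using True r by (intro powr_mono2) auto
      finally show ?thesis using a by (simp add: add_increasing)
    next
      case False
      then have u2: "0 < u\<^sup>2" using a by linarith
      have "u powr \<rho> = (u\<^sup>2) powr (\<rho> / 2)" using that by (simp add: powr_powr flip: powr_numeral)
      also have "\<dots> = (u\<^sup>2) powr (\<rho> / 2 - 1 + 1)" by simp
      also have "\<dots> = (u\<^sup>2) powr (\<rho> / 2 - 1) * u\<^sup>2" using u2 by (simp only: powr_add powr_one)
      also have "\<dots> \<le> a powr (\<rho> / 2 - 1) * u\<^sup>2"
        using False a r by (intro mult_right_mono powr_mono2') auto
      finally show ?thesis by (simp add: add_increasing2)
    qed
    have "(\<integral>\<^sup>+\<omega>. ennreal (\<bar>est n \<omega> x - op p x\<bar> powr \<rho>) \<partial>?P) \<le>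
       (\<integral>\<^sup>+\<omega>. ennreal (a powr (\<rho> / 2 - 1) / (real n)\<^sup>2) * ennreal ((?S \<omega>)\<^sup>2) + ennreal (a powr (\<rho> / 2)) \<partial>?P)"
    proof (intro nn_integral_mono)
      fix \<omega>
      have "\<bar>est n \<omega> x - op p x\<bar> powr \<rho> \<le> a powr (\<rho> / 2 - 1) * (est n \<omega> x - op p x)\<^sup>2 + a powr (\<rho> / 2)"
        using conc[of "\<bar>est n \<omega> x - op p x\<bar>"] by simp
      also have "(est n \<omega> x - op p x)\<^sup>2 = (?S \<omega>)\<^sup>2 / (real n)\<^sup>2"
        by (simp add: est_minus_op[OF p x n] power_divide)
      finally show "ennreal (\<bar>est n \<omega> x - op p x\<bar> powr \<rho>) \<le>
          ennreal (a powr (\<rho> / 2 - 1) / (real n)\<^sup>2) * ennreal ((?S \<omega>)\<^sup>2) + ennreal (a powr (\<rho> / 2))"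
        by (simp add: ennreal_mult[symmetric] ennreal_plus[symmetric] ennreal_leI del: ennreal_plus)
    qed
    also have "\<dots> = ennreal (a powr (\<rho> / 2 - 1) / (real n)\<^sup>2) * (\<integral>\<^sup>+\<omega>. ennreal ((?S \<omega>)\<^sup>2) \<partial>?P) + ennreal (a powr (\<rho> / 2))"
      by (simp add: nn_integral_add nn_integral_cmult P.P.emeasure_space_1)
    also have "\<dots> \<le> ennreal (a powr (\<rho> / 2 - 1) / (real n)\<^sup>2) * ennreal (real n * (B * R * aop p x)) + ennreal (a powr (\<rho> / 2))"
    proof (intro add_right_mono mult_left_mono)
      have "(\<integral>\<^sup>+\<omega>. ennreal ((?S \<omega>)\<^sup>2) \<partial>?P) \<le> ennreal (real n * integral\<^sup>L (Mp p) (\<lambda>y. (k x y)\<^sup>2))"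
        by (intro iid_second_moment prob_space_Mp p k_square x) measurable
      also have "\<dots> \<le> ennreal (real n * (B * R * aop p x))"
        by (intro ennreal_leI mult_left_mono k_square p x) simp
      finally show "(\<integral>\<^sup>+\<omega>. ennreal ((?S \<omega>)\<^sup>2) \<partial>?P) \<le> ennreal (real n * (B * R * aop p x))" .
    qed simp
    also have "\<dots> = ennreal (s powr (\<rho> / 2) * (B * (aop p x * W x) + W x powr (- (\<rho> / (2 - \<rho>)))))"
    proof -
      have ao: "0 \<le> aop p x" by (rule aop_nonneg[OF p x])
      have "a powr (\<rho> / 2 - 1) / (real n)\<^sup>2 * (real n * (B * R * aop p x)) = s powr (\<rho> / 2 - 1) * s * (B * (aop p x * W x))"
        using n by (simp add: a1 s_def power2_eq_square)
      also have "s powr (\<rho> / 2 - 1) * s = s powr (\<rho> / 2)" using s by (simp add: powr_diff)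
      finally have "a powr (\<rho> / 2 - 1) / (real n)\<^sup>2 * (real n * (B * R * aop p x)) = s powr (\<rho> / 2) * (B * (aop p x * W x))" .
      then show ?thesis using ao B1 R1 W[OF x]
        by (simp add: ennreal_mult[symmetric] ennreal_plus[symmetric] a2 distrib_left del: ennreal_plus)
    qed
    also have "\<dots> = ennreal (s powr (\<rho> / 2)) * (ennreal B * ennreal (aop p x * W x) + ennreal (W x powr (- (\<rho> / (2 - \<rho>)))))"
      using aop_nonneg[OF p x] W[OF x] B1 by (simp add: ennreal_mult ennreal_plus)
    finally show ?thesis .
  qed
  have "(\<integral>\<^sup>+\<omega>. \<integral>\<^sup>+x. ennreal (\<bar>est n \<omega> x - op p x\<bar> powr \<rho>) \<partial>L \<partial>?P) =
    (\<integral>\<^sup>+x. \<integral>\<^sup>+\<omega>. ennreal (\<bar>est n \<omega> x - op p x\<bar> powr \<rho>) \<partial>?P \<partial>L)"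
    by (rule Fubini_est[OF p]) measurable
  also have "\<dots> \<le> (\<integral>\<^sup>+x. ennreal (s powr (\<rho> / 2)) * (ennreal B * ennreal (aop p x * W x) + ennreal (W x powr (- (\<rho> / (2 - \<rho>))))) \<partial>L)"
    by (intro nn_integral_mono pt)
  also have "\<dots> = ennreal (s powr (\<rho> / 2)) * (ennreal B * (\<integral>\<^sup>+x. ennreal (aop p x * W x) \<partial>L) + (\<integral>\<^sup>+x. ennreal (W x powr (- (\<rho> / (2 - \<rho>)))) \<partial>L))"
    by (simp add: nn_integral_add nn_integral_cmult)
  also have "\<dots> \<le> ennreal (s powr (\<rho> / 2)) * (ennreal B * ennreal A2 + ennreal A1)"
    using A1 A2 by (intro mult_left_mono add_mono) auto
  also have "\<dots> = ennreal ((B * A2 + A1) * s powr (\<rho> / 2))"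
    using A1 A2 B1 by (simp add: ennreal_mult[symmetric] ennreal_plus[symmetric] mult.commute del: ennreal_plus)
  finally show ?thesis by (simp add: s_def)
qed

end

section \<open>Moments for exponents at least two and concentration in \<open>L^1\<close>\<close>

context schur_kernel
begin

text \<open>The moment inequality is applied for each \<open>x\<close> with \<open>b = B * R\<close>
  and \<open>v = B * R * aop p x\<close>, and then integrated. It appears as a hypothesis so that
  its constant is chosen once, before the kernel and the sample size vary.\<close>

lemma type_I_ge2:
  assumes r: "2 \<le> \<rho>" and n: "n \<ge> 1" "R \<le> real n" and p: "dens p"
    and U: "(\<integral>\<^sup>+x. ennreal (\<bar>p x\<bar> powr \<rho>) \<partial>L) \<le> ennreal (U powr \<rho>)" "0 < U"
    and C: "0 < C" and mom: "\<And>(M :: 'a measure) f b v (n :: nat). \<lbrakk>prob_space M; f \<in> borel_measurable M; 0 < b;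
      \<And>x. x \<in> space M \<Longrightarrow> \<bar>f x\<bar> \<le> b; integral\<^sup>L M (\<lambda>x. (f x)\<^sup>2) \<le> v\<rbrakk> \<Longrightarrow>
    (\<integral>\<^sup>+x. ennreal (\<bar>\<Sum>i<n. f (x i) - integral\<^sup>L M f\<bar> powr \<rho>) \<partial>PiM {..<n} (\<lambda>_. M))
      \<le> ennreal (C * (real n * v * b powr (\<rho> - 2) + (real n * v) powr (\<rho> / 2)))"
  shows "(\<integral>\<^sup>+\<omega>. \<integral>\<^sup>+x. ennreal (\<bar>est n \<omega> x - op p x\<bar> powr \<rho>) \<partial>L \<partial>PiM {..<n} (\<lambda>_. Mp p))
    \<le> ennreal (C * (B powr \<rho> + B powr (\<rho> / 2) * (B + (B * U) powr \<rho>)) * (R / real n) powr (\<rho> / 2))"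
proof -
  note [measurable] = densD(1)[OF p]
  let ?P = "PiM {..<n} (\<lambda>_. Mp p)"
  define s where "s = R / real n"
  have s: "0 < s" "s \<le> 1" using R1 n by (auto simp: s_def)
  have n0: "0 < real n" using n by simp
  have nR: "R = s * real n" using n0 by (simp add: s_def)
  define c1 where "c1 = C * B powr (\<rho> - 1) * s powr (\<rho> / 2)"
  define c2 where "c2 = C * B powr (\<rho> / 2) * s powr (\<rho> / 2)"
  have c: "0 \<le> c1" "0 \<le> c2" using C by (auto simp: c1_def c2_def)
  have BU: "0 < B * U" using B1 U by simp
  have pt: "(\<integral>\<^sup>+\<omega>. ennreal (\<bar>est n \<omega> x - op p x\<bar> powr \<rho>) \<partial>?P) \<le>
      ennreal c1 * ennreal (aop p x) + ennreal c2 * (ennreal (aop p x) + ennreal (\<bar>aop p x\<bar> powr \<rho>))"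
    if x: "x \<in> space L" for x
  proof -
    let ?S = "\<lambda>\<omega>. (\<Sum>i<n. k x (\<omega> i) - integral\<^sup>L (Mp p) (\<lambda>y. k x y))"
    define v where "v = B * R * aop p x"
    have ao: "0 \<le> aop p x" by (rule aop_nonneg[OF p x])
    have v: "0 \<le> v" using ao B1 R1 by (simp add: v_def)
    have km[measurable]: "(\<lambda>y. k x y) \<in> borel_measurable (Mp p)" using k_sec(1)[OF x] by (simp cong: measurable_cong_sets)
    have "(\<integral>\<^sup>+\<omega>. ennreal (\<bar>est n \<omega> x - op p x\<bar> powr \<rho>) \<partial>?P) = (\<integral>\<^sup>+\<omega>. ennreal (1 / real n powr \<rho>) * ennreal (\<bar>?S \<omega>\<bar> powr \<rho>) \<partial>?P)"
      by (intro nn_integral_cong) (simp add: est_minus_op[OF p x n(1)] abs_divide powr_divide ennreal_mult[symmetric])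
    also have "\<dots> = ennreal (1 / real n powr \<rho>) * (\<integral>\<^sup>+\<omega>. ennreal (\<bar>?S \<omega>\<bar> powr \<rho>) \<partial>?P)"
      by (intro nn_integral_cmult) measurable
    also have "\<dots> \<le> ennreal (1 / real n powr \<rho>) * ennreal (C * (real n * v * (B * R) powr (\<rho> - 2) + (real n * v) powr (\<rho> / 2)))"
    proof (intro mult_left_mono)
      show "(\<integral>\<^sup>+\<omega>. ennreal (\<bar>?S \<omega>\<bar> powr \<rho>) \<partial>?P) \<le> ennreal (C * (real n * v * (B * R) powr (\<rho> - 2) + (real n * v) powr (\<rho> / 2)))"
        using B1 R1 k_bd[OF x] k_square(2)[OF p x] by (intro mom prob_space_Mp p km) (auto simp: v_def)
    qed simp
    also have "\<dots> = ennreal (C * (1 / real n powr \<rho> * (real n * v * (B * R) powr (\<rho> - 2))) + C * (1 / real n powr \<rho> * (real n * v) powr (\<rho> / 2)))"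
      using C v by (simp add: ennreal_mult[symmetric] algebra_simps)
    also have "\<dots> \<le> ennreal (c1 * aop p x + c2 * (aop p x + \<bar>aop p x\<bar> powr \<rho>))"
    proof (intro ennreal_leI add_mono)
      have "real n * v * (B * R) powr (\<rho> - 2) = real n * aop p x * ((B * R) powr 1 * (B * R) powr (\<rho> - 2))"
        using B1 R1 by (simp add: v_def)
      also have "(B * R) powr 1 * (B * R) powr (\<rho> - 2) = B powr (\<rho> - 1) * R powr (\<rho> - 1)"
      proof -
        have "(B * R) powr 1 * (B * R) powr (\<rho> - 2) = (B * R) powr (1 + (\<rho> - 2))" by (simp only: powr_add)
        also have "1 + (\<rho> - 2) = \<rho> - 1" by simp
        finally show ?thesis by (simp only: powr_mult)
      qed
      also have "R powr (\<rho> - 1) = s powr (\<rho> - 1) * real n powr (\<rho> - 1)" unfolding nR by (rule powr_mult)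
      finally have "1 / real n powr \<rho> * (real n * v * (B * R) powr (\<rho> - 2)) = B powr (\<rho> - 1) * s powr (\<rho> - 1) * aop p x"
        using n0 by (simp add: powr_diff)
      \<comment> \<open>Here \<open>R \<le> n\<close> enters: \<open>s \<le> 1\<close> and
        \<open>\<rho> - 1 \<ge> \<rho> / 2\<close>, so the Poisson-type term is dominated by the
        Gaussian-type one.\<close>
      moreover have "s powr (\<rho> - 1) \<le> s powr (\<rho> / 2)" using s r by (intro powr_mono') auto
      ultimately show "C * (1 / real n powr \<rho> * (real n * v * (B * R) powr (\<rho> - 2))) \<le> c1 * aop p x"
        using C ao by (simp add: c1_def mult.assoc mult_left_mono mult_right_mono)
      have "(real n * v) powr (\<rho> / 2) = (B * s * (real n)\<^sup>2 * aop p x) powr (\<rho> / 2)"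
        by (simp add: v_def nR power2_eq_square mult_ac)
      also have "\<dots> = B powr (\<rho> / 2) * s powr (\<rho> / 2) * ((real n)\<^sup>2) powr (\<rho> / 2) * aop p x powr (\<rho> / 2)"
        by (simp only: powr_mult)
      also have "((real n)\<^sup>2) powr (\<rho> / 2) = real n powr \<rho>" using n0 by (simp add: powr_powr flip: powr_numeral)
      finally have "1 / real n powr \<rho> * (real n * v) powr (\<rho> / 2) = B powr (\<rho> / 2) * s powr (\<rho> / 2) * aop p x powr (\<rho> / 2)"
        using n0 by simp
      \<comment> \<open>Interpolation between exponents \<open>1\<close> and \<open>\<rho>\<close>,
        pointwise: the intermediate power is below the first for small values and below the second
        for large ones. Both of these integrals are already bounded.\<close>
      moreover have "aop p x powr (\<rho> / 2) \<le> aop p x + \<bar>aop p x\<bar> powr \<rho>"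
      proof (cases "aop p x \<le> 1")
        case True
        have "aop p x powr (\<rho> / 2) \<le> aop p x powr 1"
        proof (cases "aop p x = 0")
          case False
          then show ?thesis using True ao r by (intro powr_mono') auto
        qed simp
        then show ?thesis using ao by (simp add: add_increasing2)
      next
        case False
        then have "aop p x powr (\<rho> / 2) \<le> aop p x powr \<rho>" using r by (intro powr_mono) auto
        then show ?thesis using ao by simp
      qed
      ultimately show "C * (1 / real n powr \<rho> * (real n * v) powr (\<rho> / 2)) \<le> c2 * (aop p x + \<bar>aop p x\<bar> powr \<rho>)"
        using C by (simp add: c2_def mult.assoc mult_left_mono)
    qed
    also have "\<dots> = ennreal c1 * ennreal (aop p x) + ennreal c2 * (ennreal (aop p x) + ennreal (\<bar>aop p x\<bar> powr \<rho>))"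
      using c ao by (simp add: ennreal_mult ennreal_plus)
    finally show ?thesis .
  qed
  have "(\<integral>\<^sup>+\<omega>. \<integral>\<^sup>+x. ennreal (\<bar>est n \<omega> x - op p x\<bar> powr \<rho>) \<partial>L \<partial>?P) =
    (\<integral>\<^sup>+x. \<integral>\<^sup>+\<omega>. ennreal (\<bar>est n \<omega> x - op p x\<bar> powr \<rho>) \<partial>?P \<partial>L)"
    by (rule Fubini_est[OF p]) measurable
  also have "\<dots> \<le> (\<integral>\<^sup>+x. ennreal c1 * ennreal (aop p x) + ennreal c2 * (ennreal (aop p x) + ennreal (\<bar>aop p x\<bar> powr \<rho>)) \<partial>L)"
    by (intro nn_integral_mono pt)
  also have "\<dots> = ennreal c1 * (\<integral>\<^sup>+x. ennreal (aop p x) \<partial>L) +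
      ennreal c2 * ((\<integral>\<^sup>+x. ennreal (aop p x) \<partial>L) + (\<integral>\<^sup>+x. ennreal (\<bar>aop p x\<bar> powr \<rho>) \<partial>L))"
    by (simp add: nn_integral_add nn_integral_cmult)
  also have "\<dots> \<le> ennreal c1 * ennreal B + ennreal c2 * (ennreal B + ennreal ((B * U) powr \<rho>))"
    using r by (intro add_mono mult_left_mono aop_L1 schur_test_aop p U) auto
  also have "\<dots> = ennreal (c1 * B + c2 * (B + (B * U) powr \<rho>))"
    using c B1 by (simp add: ennreal_mult[symmetric] ennreal_plus[symmetric] del: ennreal_plus)
  also have "c1 * B + c2 * (B + (B * U) powr \<rho>) = C * (B powr \<rho> + B powr (\<rho> / 2) * (B + (B * U) powr \<rho>)) * s powr (\<rho> / 2)"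
  proof -
    have "B powr (\<rho> - 1) * B = B powr \<rho>" using B1 by (simp add: powr_diff)
    then have "c1 * B = C * B powr \<rho> * s powr (\<rho> / 2)" by (simp add: c1_def mult_ac)
    then show ?thesis by (simp add: c2_def algebra_simps)
  qed
  finally show ?thesis by (simp add: s_def)
qed

text \<open>Replacing one observation moves the estimator by at most \<open>2 * B / n\<close> in
  \<open>L^1\<close>, since each column of the kernel has norm at most \<open>B\<close>. The
  variance of the distance is therefore at most \<open>4 * B\<^sup>2 / n\<close>, and Chebyshev's
  inequality applies around a mean of at most \<open>m\<close>.\<close>

lemma L1_concentration:
  assumes n: "n \<ge> 1" and p: "dens p" and \<tau>: "0 < \<tau>" and m: "0 \<le> m"
    and mean: "(\<integral>\<^sup>+\<omega>. \<integral>\<^sup>+x. ennreal \<bar>est n \<omega> x - op p x\<bar> \<partial>L \<partial>PiM {..<n} (\<lambda>_. Mp p)) \<le> ennreal m"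
  shows "emeasure (PiM {..<n} (\<lambda>_. Mp p)) {\<omega> \<in> space (PiM {..<n} (\<lambda>_. Mp p)).
      ennreal (m + \<tau>) < (\<integral>\<^sup>+x. ennreal \<bar>est n \<omega> x - op p x\<bar> \<partial>L)} \<le> ennreal (4 * B\<^sup>2 / (real n * \<tau>\<^sup>2))"
proof -
  note [measurable] = densD(1)[OF p]
  let ?P = "PiM {..<n} (\<lambda>_. Mp p)"
  interpret P: product_prob_space "\<lambda>_::nat. Mp p" "{..<n}" using p by (rule product_prob_space_Mp)
  have n0: "0 < real n" using n by simp
  have sp: "\<omega> i \<in> space L" if "\<omega> \<in> space ?P" "i < n" for \<omega> i using that by (auto simp: space_PiM)
  have int_k: "integrable L (\<lambda>x. k x y)" "(LINT x|L. \<bar>k x y\<bar>) \<le> B" if y: "y \<in> space L" for y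
  proof -
    note [measurable] = k_sec(2)[OF y]
    show i: "integrable L (\<lambda>x. k x y)"
      using col[OF y] by (intro integrableI_bounded) (auto simp: order_le_less_trans)
    have "ennreal (LINT x|L. \<bar>k x y\<bar>) \<le> ennreal B"
      using col[OF y] i by (subst nn_integral_eq_integral[symmetric]) auto
    then show "(LINT x|L. \<bar>k x y\<bar>) \<le> B" using B1 by (simp add: ennreal_le_iff)
  qed
  have int_est: "integrable L (est n \<omega>)" if "\<omega> \<in> space ?P" for \<omega>
    unfolding est_def using sp[OF that] int_k by (intro integrable_divide Bochner_Integration.integrable_sum) auto
  have abs_est: "(LINT x|L. \<bar>est n \<omega> x\<bar>) \<le> B" if \<omega>: "\<omega> \<in> space ?P" for \<omega>
  proof -
    have i: "integrable L (\<lambda>x. \<Sum>i<n. \<bar>k x (\<omega> i)\<bar>)"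
      using sp[OF \<omega>] int_k by (intro Bochner_Integration.integrable_sum integrable_abs) auto
    have "(LINT x|L. \<bar>est n \<omega> x\<bar>) \<le> (LINT x|L. (\<Sum>i<n. \<bar>k x (\<omega> i)\<bar>) / real n)"
      by (intro integral_mono integrable_abs integrable_divide int_est[OF \<omega>] i) (auto simp: est_def abs_divide divide_right_mono)
    also have "\<dots> = (\<Sum>i<n. LINT x|L. \<bar>k x (\<omega> i)\<bar>) / real n"
      using sp[OF \<omega>] int_k by (simp add: Bochner_Integration.integral_sum)
    also have "\<dots> \<le> (\<Sum>i<n. B) / real n"
      using sp[OF \<omega>] int_k by (intro divide_right_mono sum_mono) auto
    finally show ?thesis using n0 by simp
  qed
  have op_nn: "(\<integral>\<^sup>+x. ennreal \<bar>op p x\<bar> \<partial>L) \<le> ennreal B"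
    using op_le_aop[OF p] by (intro order_trans[OF nn_integral_mono aop_L1[OF p]] ennreal_leI) auto
  have int_op: "integrable L (op p)"
    using op_nn by (intro integrableI_bounded) (auto simp: order_le_less_trans)
  have abs_op: "(LINT x|L. \<bar>op p x\<bar>) \<le> B"
  proof -
    have "ennreal (LINT x|L. \<bar>op p x\<bar>) \<le> ennreal B"
      using op_nn int_op by (subst nn_integral_eq_integral[symmetric]) auto
    then show ?thesis using B1 by (simp add: ennreal_le_iff)
  qed
  define f where "f \<omega> = (LINT x|L. \<bar>est n \<omega> x - op p x\<bar>)" for \<omega>
  have f_meas[measurable]: "f \<in> borel_measurable ?P"
    unfolding f_def by (rule L.borel_measurable_lebesgue_integral) (simp add: split_beta')
  have int_diff: "integrable L (\<lambda>x. \<bar>est n \<omega> x - op p x\<bar>)" if "\<omega> \<in> space ?P" for \<omega>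
    using int_est[OF that] int_op by (intro integrable_abs Bochner_Integration.integrable_diff)
  have f_nn: "(\<integral>\<^sup>+x. ennreal \<bar>est n \<omega> x - op p x\<bar> \<partial>L) = ennreal (f \<omega>)" if "\<omega> \<in> space ?P" for \<omega>
    unfolding f_def by (intro nn_integral_eq_integral int_diff that) auto
  have f0: "0 \<le> f \<omega>" for \<omega> unfolding f_def by simp
  have f_bd: "\<bar>f \<omega>\<bar> \<le> 2 * B" if \<omega>: "\<omega> \<in> space ?P" for \<omega>
  proof -
    have "f \<omega> \<le> (LINT x|L. \<bar>est n \<omega> x\<bar> + \<bar>op p x\<bar>)" unfolding f_def
      using int_est[OF \<omega>] int_op int_diff[OF \<omega>]
      by (intro integral_mono Bochner_Integration.integrable_add integrable_abs) auto
    also have "\<dots> = (LINT x|L. \<bar>est n \<omega> x\<bar>) + (LINT x|L. \<bar>op p x\<bar>)"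
      using int_est[OF \<omega>] int_op by (intro Bochner_Integration.integral_add integrable_abs)
    finally show ?thesis using abs_est[OF \<omega>] abs_op f0[of \<omega>] by simp
  qed
  have f_diff: "\<bar>f (w(i := y)) - f w\<bar> \<le> 2 * B / real n"
    if w: "w \<in> space ?P" and i: "i < n" and y: "y \<in> space (Mp p)" for w i y
  proof -
    have y': "y \<in> space L" using y by simp
    have w': "w(i := y) \<in> space ?P" using w i y by (auto simp: space_PiM PiE_iff extensional_def)
    have est_diff: "est n (w(i := y)) x - est n w x = (k x y - k x (w i)) / real n" for x
    proof -
      have "(\<Sum>j<n. k x ((w(i := y)) j)) - (\<Sum>j<n. k x (w j)) = (\<Sum>j<n. if j = i then k x y - k x (w i) else 0)"
        unfolding sum_subtractf[symmetric] by (intro sum.cong) auto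
      then show ?thesis using i by (simp add: est_def diff_divide_distrib[symmetric] del: fun_upd_apply)
    qed
    have "f (w(i := y)) - f w = (LINT x|L. \<bar>est n (w(i := y)) x - op p x\<bar> - \<bar>est n w x - op p x\<bar>)"
      unfolding f_def using int_diff[OF w] int_diff[OF w'] by (intro Bochner_Integration.integral_diff[symmetric])
    then have "\<bar>f (w(i := y)) - f w\<bar> \<le> (LINT x|L. \<bar>\<bar>est n (w(i := y)) x - op p x\<bar> - \<bar>est n w x - op p x\<bar>\<bar>)"
      by (simp only: integral_abs_bound)
    also have "\<dots> \<le> (LINT x|L. (\<bar>k x y\<bar> + \<bar>k x (w i)\<bar>) / real n)"
    proof (intro integral_mono integrable_abs Bochner_Integration.integrable_diff int_diff w w'
        int_est int_op integrable_divide Bochner_Integration.integrable_add int_k y' sp i)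
      fix x
      have "\<bar>\<bar>est n (w(i := y)) x - op p x\<bar> - \<bar>est n w x - op p x\<bar>\<bar> \<le> \<bar>est n (w(i := y)) x - est n w x\<bar>"
        by linarith
      also have "\<dots> \<le> (\<bar>k x y\<bar> + \<bar>k x (w i)\<bar>) / real n"
        unfolding est_diff using n0 by (simp add: abs_divide divide_right_mono)
      finally show "\<bar>\<bar>est n (w(i := y)) x - op p x\<bar> - \<bar>est n w x - op p x\<bar>\<bar> \<le> (\<bar>k x y\<bar> + \<bar>k x (w i)\<bar>) / real n" .
    qed
    also have "\<dots> = ((LINT x|L. \<bar>k x y\<bar>) + (LINT x|L. \<bar>k x (w i)\<bar>)) / real n"
      using int_k[OF y'] int_k[OF sp[OF w i]] by (simp add: Bochner_Integration.integral_add)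
    also have "\<dots> \<le> (B + B) / real n"
      using int_k[OF y'] int_k[OF sp[OF w i]] by (intro divide_right_mono add_mono) auto
    finally show ?thesis by simp
  qed
  have var: "(\<integral>\<^sup>+\<omega>. ennreal ((f \<omega> - integral\<^sup>L ?P f)\<^sup>2) \<partial>?P) \<le> ennreal (real n * (2 * B / real n)\<^sup>2)"
    by (rule efron_stein_bounded_differences[OF prob_space_Mp[OF p] f_meas f_bd f_diff])
  have int_f: "integrable ?P f" using f_bd by (intro P.P.integrable_const_bound[of _ "2 * B"]) (auto intro!: AE_I2)
  have Ef: "integral\<^sup>L ?P f \<le> m"
  proof -
    have "ennreal (integral\<^sup>L ?P f) = (\<integral>\<^sup>+\<omega>. ennreal (f \<omega>) \<partial>?P)"
      using int_f f0 by (intro nn_integral_eq_integral[symmetric]) auto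
    also have "\<dots> = (\<integral>\<^sup>+\<omega>. \<integral>\<^sup>+x. ennreal \<bar>est n \<omega> x - op p x\<bar> \<partial>L \<partial>?P)"
      by (intro nn_integral_cong f_nn[symmetric])
    also have "\<dots> \<le> ennreal m" by (rule mean)
    finally show ?thesis using m by (simp add: ennreal_le_iff)
  qed
  have "emeasure ?P {\<omega> \<in> space ?P. ennreal (m + \<tau>) < (\<integral>\<^sup>+x. ennreal \<bar>est n \<omega> x - op p x\<bar> \<partial>L)} \<le>
    emeasure ?P {\<omega> \<in> space ?P. 1 \<le> ennreal (1 / \<tau>\<^sup>2) * ennreal ((f \<omega> - integral\<^sup>L ?P f)\<^sup>2)}"
  proof (rule emeasure_mono)
    show "{\<omega> \<in> space ?P. ennreal (m + \<tau>) < (\<integral>\<^sup>+x. ennreal \<bar>est n \<omega> x - op p x\<bar> \<partial>L)} \<subseteq>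
      {\<omega> \<in> space ?P. 1 \<le> ennreal (1 / \<tau>\<^sup>2) * ennreal ((f \<omega> - integral\<^sup>L ?P f)\<^sup>2)}"
    proof safe
      fix \<omega> assume \<omega>: "\<omega> \<in> space ?P" and "ennreal (m + \<tau>) < (\<integral>\<^sup>+x. ennreal \<bar>est n \<omega> x - op p x\<bar> \<partial>L)"
      then have "m + \<tau> < f \<omega>" using m \<tau> by (simp add: f_nn ennreal_less_iff del: ennreal_plus)
      then have "\<tau> \<le> f \<omega> - integral\<^sup>L ?P f" using Ef by simp
      then have "\<tau>\<^sup>2 \<le> (f \<omega> - integral\<^sup>L ?P f)\<^sup>2" using \<tau> by (intro power_mono) auto
      then have "1 \<le> 1 / \<tau>\<^sup>2 * (f \<omega> - integral\<^sup>L ?P f)\<^sup>2" using \<tau> by (simp add: field_simps)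
      then show "1 \<le> ennreal (1 / \<tau>\<^sup>2) * ennreal ((f \<omega> - integral\<^sup>L ?P f)\<^sup>2)"
        by (simp add: ennreal_mult[symmetric] ennreal_1[symmetric] ennreal_leI del: ennreal_1)
    qed
  qed measurable
  also have "\<dots> \<le> ennreal (1 / \<tau>\<^sup>2) * (\<integral>\<^sup>+\<omega>\<in>space ?P. ennreal ((f \<omega> - integral\<^sup>L ?P f)\<^sup>2) \<partial>?P)"
    by (rule nn_integral_Markov_inequality) auto
  also have "\<dots> \<le> ennreal (1 / \<tau>\<^sup>2) * ennreal (real n * (2 * B / real n)\<^sup>2)"
    using var by (intro mult_left_mono) (simp_all cong: nn_integral_cong_simp)
  also have "\<dots> = ennreal (4 * B\<^sup>2 / (real n * \<tau>\<^sup>2))"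
    using n0 \<tau> by (simp add: ennreal_mult[symmetric] power2_eq_square field_simps)
  finally show ?thesis .
qed

end

subsection \<open>The supremum norm\<close>

text \<open>With \<open>a = exp (y / 2)\<close> the right side is the square of
  \<open>a - 1 / a\<close>, which is at least \<open>y\<^sup>2 / 8\<close>. A fourth power is chosen
  because a quadratic lower bound would reproduce Chebyshev's inequality, whose union bound stays
  bounded at this rate without tending to zero.\<close>

lemma cosh_ge_fourth_power:
  fixes y :: real
  shows "y ^ 4 / 64 \<le> exp y + exp (- y) - 2"
proof -
  have main: "y ^ 4 / 64 \<le> exp y + exp (- y) - 2" if y: "0 \<le> y" for y :: real
  proof -
    define a where "a = exp (y / 2)"
    have "1 + y / 2 + (y / 2)\<^sup>2 / 2 \<le> a" unfolding a_def using y by (intro exp_lower_Taylor_quadratic) auto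
    moreover have "(y / 2)\<^sup>2 / 2 = y\<^sup>2 / 8" by (simp add: power_divide)
    ultimately have "y\<^sup>2 / 8 \<le> a - 1" using y by linarith
    also have "1 / a \<le> 1" using y by (simp add: a_def)
    then have "a - 1 \<le> a - 1 / a" by simp
    finally have "(y\<^sup>2 / 8)\<^sup>2 \<le> (a - 1 / a)\<^sup>2" by (intro power_mono) auto
    moreover have "(a - 1 / a)\<^sup>2 = exp y + exp (- y) - 2"
    proof -
      have inv: "1 / a = exp (- (y / 2))" by (simp add: a_def exp_minus field_simps)
      have "(a - 1 / a)\<^sup>2 = a * a + 1 / a * (1 / a) - 2 * (a * (1 / a))"
        unfolding power2_eq_square by (simp only: left_diff_distrib right_diff_distrib mult.commute)
      also have "a * (1 / a) = 1" by (simp add: a_def)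
      finally show ?thesis unfolding inv by (simp add: a_def mult_exp_exp)
    qed
    ultimately show ?thesis by (simp add: power2_eq_square power4_eq_xxxx)
  qed
  show ?thesis using main[of "\<bar>y\<bar>"] by (cases "0 \<le> y") (auto simp: add.commute)
qed

text \<open>The union bound over an infinite family converges because each term is proportional to
  the second moment of its function. These are summable: pointwise, the sum of the squares is at
  most \<open>B\<close> times the sum of the absolute values, hence at most
  \<open>B\<^sup>2\<close>.\<close>

lemma type_I_sup:
  fixes \<psi> :: "nat \<Rightarrow> 'a \<Rightarrow> real" and n :: nat
  assumes M: "prob_space M" and \<psi>[measurable]: "\<And>i. \<psi> i \<in> borel_measurable M"
    and B: "\<And>y. y \<in> space M \<Longrightarrow> (\<Sum>i. ennreal \<bar>\<psi> i y\<bar>) \<le> ennreal B" "0 < B"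
    and V: "\<And>i. integral\<^sup>L M (\<lambda>y. (\<psi> i y)\<^sup>2) \<le> V"
    and l: "0 < l" "l * B \<le> 1" "real n * l\<^sup>2 * V \<le> 1" and t0: "0 < t0" and n: "n \<ge> 1"
  shows "emeasure (PiM {..<n} (\<lambda>_. M)) {\<omega> \<in> space (PiM {..<n} (\<lambda>_. M)).
      \<exists>i. t0 < \<bar>(\<Sum>j<n. \<psi> i (\<omega> j)) / real n - integral\<^sup>L M (\<psi> i)\<bar>}
    \<le> ennreal (256 * (real n * l\<^sup>2 * B\<^sup>2) / (l * real n * t0) ^ 4)"
proof -
  interpret M: prob_space M by fact
  interpret P: product_prob_space "\<lambda>_::nat. M" "{..<n}" by unfold_locales
  let ?P = "PiM {..<n} (\<lambda>_. M)"
  define y where "y = l * real n * t0"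
  have y: "0 < y" using l t0 n by (simp add: y_def)
  define v where "v i = integral\<^sup>L M (\<lambda>y. (\<psi> i y)\<^sup>2)" for i
  have bd: "\<bar>\<psi> i x\<bar> \<le> B" if "x \<in> space M" for i x
  proof -
    have "ennreal \<bar>\<psi> i x\<bar> \<le> (\<Sum>i. ennreal \<bar>\<psi> i x\<bar>)"
    proof -
      have "(\<Sum>i\<in>{i}. ennreal \<bar>\<psi> i x\<bar>) \<le> (\<Sum>i. ennreal \<bar>\<psi> i x\<bar>)" by (rule sum_le_suminf) auto
      then show ?thesis by simp
    qed
    also have "\<dots> \<le> ennreal B" by (rule B(1)[OF that])
    finally have "ennreal \<bar>\<psi> i x\<bar> \<le> ennreal B" .
    then show ?thesis using B(2) by (simp add: ennreal_le_iff)
  qed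
  have int2: "integrable M (\<lambda>y. (\<psi> i y)\<^sup>2)" for i
    by (rule M.integrable_const_bound[of _ "B\<^sup>2"])
      (use bd B(2) in \<open>auto simp: abs_le_square_iff[symmetric] intro!: AE_I2 order_trans[OF bd abs_ge_self]\<close>)
  have v0: "0 \<le> v i" for i by (simp add: v_def)
  define S where "S i \<omega> = (\<Sum>j<n. \<psi> i (\<omega> j) - integral\<^sup>L M (\<psi> i))" for i \<omega>
  have [measurable]: "S i \<in> borel_measurable ?P" for i unfolding S_def by measurable
  have one: "emeasure ?P {\<omega> \<in> space ?P. t0 < \<bar>(\<Sum>j<n. \<psi> i (\<omega> j)) / real n - integral\<^sup>L M (\<psi> i)\<bar>}
      \<le> ennreal (256 * (real n * l\<^sup>2) / y ^ 4) * ennreal (v i)" (is "emeasure ?P ?E \<le> _") for i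
  proof -
    have "emeasure ?P ?E \<le> emeasure ?P {\<omega> \<in> space ?P. 1 \<le> ennreal (64 / y ^ 4) * ennreal (exp (l * S i \<omega>) + exp (- (l * S i \<omega>)) - 2)}"
    proof (rule emeasure_mono)
      show "?E \<subseteq> {\<omega> \<in> space ?P. 1 \<le> ennreal (64 / y ^ 4) * ennreal (exp (l * S i \<omega>) + exp (- (l * S i \<omega>)) - 2)}"
      proof safe
        fix \<omega> assume "t0 < \<bar>(\<Sum>j<n. \<psi> i (\<omega> j)) / real n - integral\<^sup>L M (\<psi> i)\<bar>"
        also have "(\<Sum>j<n. \<psi> i (\<omega> j)) / real n - integral\<^sup>L M (\<psi> i) = S i \<omega> / real n"
          using n by (simp add: S_def sum_subtractf diff_divide_distrib)
        finally have "t0 * real n < \<bar>S i \<omega>\<bar>" using n by (simp add: abs_divide field_simps)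
        then have "y \<le> \<bar>l * S i \<omega>\<bar>" using l by (simp add: y_def abs_mult mult_ac)
        then have "y ^ 4 \<le> \<bar>l * S i \<omega>\<bar> ^ 4" using y by (intro power_mono) auto
        then have "y ^ 4 / 64 \<le> exp (l * S i \<omega>) + exp (- (l * S i \<omega>)) - 2"
          using cosh_ge_fourth_power[of "l * S i \<omega>"] by simp
        then have "1 \<le> 64 / y ^ 4 * (exp (l * S i \<omega>) + exp (- (l * S i \<omega>)) - 2)"
          using y by (simp add: field_simps)
        moreover from this have "ennreal (64 / y ^ 4 * (exp (l * S i \<omega>) + exp (- (l * S i \<omega>)) - 2)) =
           ennreal (64 / y ^ 4) * ennreal (exp (l * S i \<omega>) + exp (- (l * S i \<omega>)) - 2)"
          using y by (intro ennreal_mult') simp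
        ultimately show "1 \<le> ennreal (64 / y ^ 4) * ennreal (exp (l * S i \<omega>) + exp (- (l * S i \<omega>)) - 2)"
          by (metis ennreal_1 ennreal_leI)
      qed
    qed measurable
    also have "\<dots> \<le> ennreal (64 / y ^ 4) * (\<integral>\<^sup>+\<omega>\<in>space ?P. ennreal (exp (l * S i \<omega>) + exp (- (l * S i \<omega>)) - 2) \<partial>?P)"
      by (rule nn_integral_Markov_inequality) auto
    also have "\<dots> = ennreal (64 / y ^ 4) * (\<integral>\<^sup>+\<omega>. ennreal (exp (l * S i \<omega>) + exp (- (l * S i \<omega>)) - 2) \<partial>?P)"
      by (simp cong: nn_integral_cong_simp)
    also have "\<dots> \<le> ennreal (64 / y ^ 4) * ennreal (4 * (real n * l\<^sup>2 * v i))"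
    proof (intro mult_left_mono)
      show "(\<integral>\<^sup>+\<omega>. ennreal (exp (l * S i \<omega>) + exp (- (l * S i \<omega>)) - 2) \<partial>?P) \<le> ennreal (4 * (real n * l\<^sup>2 * v i))"
        unfolding S_def
      proof (rule iid_cosh_bound[OF M \<psi> bd])
        show "real n * l\<^sup>2 * v i \<le> 1"
          using V[of i] by (intro order_trans[OF mult_left_mono l(3)]) (auto simp: v_def)
      qed (use l in \<open>auto simp: v_def\<close>)
    qed simp
    also have "\<dots> = ennreal (256 * (real n * l\<^sup>2) / y ^ 4) * ennreal (v i)"
      using y v0 by (simp add: ennreal_mult[symmetric] mult_ac)
    finally show ?thesis .
  qed
  have sumv: "(\<Sum>i. ennreal (v i)) \<le> ennreal (B\<^sup>2)"
  proof -
    have "(\<Sum>i. ennreal (v i)) = (\<Sum>i. \<integral>\<^sup>+y. ennreal ((\<psi> i y)\<^sup>2) \<partial>M)"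
      unfolding v_def by (intro suminf_cong nn_integral_eq_integral[symmetric] int2) auto
    also have "\<dots> = (\<integral>\<^sup>+y. (\<Sum>i. ennreal ((\<psi> i y)\<^sup>2)) \<partial>M)"
      by (rule nn_integral_suminf[symmetric]) measurable
    also have "\<dots> \<le> (\<integral>\<^sup>+y. ennreal (B\<^sup>2) \<partial>M)"
    proof (intro nn_integral_mono)
      fix x assume x: "x \<in> space M"
      have "(\<Sum>i. ennreal ((\<psi> i x)\<^sup>2)) \<le> (\<Sum>i. ennreal B * ennreal \<bar>\<psi> i x\<bar>)"
      proof (intro suminf_le allI summableI)
        fix i
        have "(\<psi> i x)\<^sup>2 \<le> B * \<bar>\<psi> i x\<bar>"
          using mult_right_mono[OF bd[OF x, of i] abs_ge_zero[of "\<psi> i x"]] by (simp add: power2_eq_square abs_mult[symmetric])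
        then show "ennreal ((\<psi> i x)\<^sup>2) \<le> ennreal B * ennreal \<bar>\<psi> i x\<bar>"
          using B by (simp add: ennreal_mult[symmetric] ennreal_leI)
      qed
      also have "\<dots> = ennreal B * (\<Sum>i. ennreal \<bar>\<psi> i x\<bar>)" by simp
      also have "\<dots> \<le> ennreal B * ennreal B" by (intro mult_left_mono B x) simp
      finally show "(\<Sum>i. ennreal ((\<psi> i x)\<^sup>2)) \<le> ennreal (B\<^sup>2)"
        using B by (simp add: ennreal_mult[symmetric] power2_eq_square)
    qed
    finally show ?thesis by (simp add: M.emeasure_space_1)
  qed
  have "{\<omega> \<in> space ?P. \<exists>i. t0 < \<bar>(\<Sum>j<n. \<psi> i (\<omega> j)) / real n - integral\<^sup>L M (\<psi> i)\<bar>} =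
     (\<Union>i. {\<omega> \<in> space ?P. t0 < \<bar>(\<Sum>j<n. \<psi> i (\<omega> j)) / real n - integral\<^sup>L M (\<psi> i)\<bar>})" by auto
  then have "emeasure ?P {\<omega> \<in> space ?P. \<exists>i. t0 < \<bar>(\<Sum>j<n. \<psi> i (\<omega> j)) / real n - integral\<^sup>L M (\<psi> i)\<bar>} \<le>
     (\<Sum>i. emeasure ?P {\<omega> \<in> space ?P. t0 < \<bar>(\<Sum>j<n. \<psi> i (\<omega> j)) / real n - integral\<^sup>L M (\<psi> i)\<bar>})"
    by (simp only:) (rule emeasure_subadditive_countably, auto)
  also have "\<dots> \<le> (\<Sum>i. ennreal (256 * (real n * l\<^sup>2) / y ^ 4) * ennreal (v i))"
    by (intro suminf_le allI summableI one)
  also have "\<dots> = ennreal (256 * (real n * l\<^sup>2) / y ^ 4) * (\<Sum>i. ennreal (v i))" by simp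
  also have "\<dots> \<le> ennreal (256 * (real n * l\<^sup>2) / y ^ 4) * ennreal (B\<^sup>2)"
    by (intro mult_left_mono sumv) simp
  also have "\<dots> = ennreal (256 * (real n * l\<^sup>2 * B\<^sup>2) / y ^ 4)"
    using y by (simp add: ennreal_mult[symmetric] mult_ac)
  finally show ?thesis by (simp add: y_def)
qed

text \<open>Acceptance forces every average to be close to its expectation under \<open>p0\<close>,
  so one function that separates the two densities suffices. The sign of the separation is removed
  by passing to \<open>- F\<close>.\<close>

lemma type_II_sup:
  fixes F :: "'a \<Rightarrow> real" and n :: nat
  assumes M: "prob_space M" and F[measurable]: "F \<in> borel_measurable M" and n: "n \<ge> 1"
    and b: "\<And>x. x \<in> space M \<Longrightarrow> \<bar>F x\<bar> \<le> b" and S: "integral\<^sup>L M (\<lambda>x. (F x)\<^sup>2) \<le> S"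
    and t: "0 < t" "t * b \<le> 2 * S" and S0: "0 < S" and sep: "t + t0 \<le> \<bar>integral\<^sup>L M F - m\<bar>"
  shows "emeasure (PiM {..<n} (\<lambda>_. M)) {x \<in> space (PiM {..<n} (\<lambda>_. M)). \<bar>(\<Sum>j<n. F (x j)) / real n - m\<bar> \<le> t0}
    \<le> ennreal (exp (- real n * t\<^sup>2 / (4 * S)))"
proof -
  let ?P = "PiM {..<n} (\<lambda>_. M)"
  have main: "emeasure ?P {x \<in> space ?P. \<bar>(\<Sum>j<n. F (x j)) / real n - m\<bar> \<le> t0}
    \<le> ennreal (exp (- real n * t\<^sup>2 / (4 * S)))"
    if F[measurable]: "F \<in> borel_measurable M" and b: "\<And>x. x \<in> space M \<Longrightarrow> \<bar>F x\<bar> \<le> b"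
      and S: "integral\<^sup>L M (\<lambda>x. (F x)\<^sup>2) \<le> S" and sep: "t + t0 \<le> integral\<^sup>L M F - m"
    for F :: "'a \<Rightarrow> real" and m
  proof -
    have "emeasure ?P {x \<in> space ?P. \<bar>(\<Sum>j<n. F (x j)) / real n - m\<bar> \<le> t0} \<le>
        emeasure ?P {x \<in> space ?P. (\<Sum>i<n. F (x i)) \<le> real n * (integral\<^sup>L M F - t)}"
    proof (rule emeasure_mono)
      have "(\<Sum>i<n. F (x i)) \<le> real n * (integral\<^sup>L M F - t)" if "\<bar>(\<Sum>j<n. F (x j)) / real n - m\<bar> \<le> t0" for x
      proof -
        have "(\<Sum>j<n. F (x j)) / real n \<le> integral\<^sup>L M F - t" using that sep by linarith
        then show ?thesis using n by (simp add: field_simps)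
      qed
      then show "{x \<in> space ?P. \<bar>(\<Sum>j<n. F (x j)) / real n - m\<bar> \<le> t0} \<subseteq> {x \<in> space ?P. (\<Sum>i<n. F (x i)) \<le> real n * (integral\<^sup>L M F - t)}"
        by auto
    qed measurable
    also have "\<dots> \<le> ennreal (exp (- real n * t\<^sup>2 / (4 * S)))"
      by (rule iid_lower_tail[OF M F b S t S0])
    finally show ?thesis .
  qed
  show ?thesis
  proof (cases "m \<le> integral\<^sup>L M F")
    case True
    then show ?thesis using sep by (intro main F b S) auto
  next
    case False
    have "\<bar>(\<Sum>j<n. F (x j)) / real n - m\<bar> = \<bar>(\<Sum>j<n. - F (x j)) / real n - (- m)\<bar>" for x
      by (simp add: sum_negf abs_minus_commute)
    then show ?thesis
      using main[of "\<lambda>x. - F x" "- m"] F b S sep False by simp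
  qed
qed

subsection \<open>Admissible kernels\<close>

lemma nn_integral_restrict_le:
  fixes f :: "real \<Rightarrow> ennreal"
  assumes "T \<in> sets borel"
  shows "(\<integral>\<^sup>+x. f x \<partial>restrict_space lborel T) \<le> (\<integral>\<^sup>+x. f x \<partial>lborel)"
  using assms by (subst nn_integral_restrict_space) (auto intro!: nn_integral_mono simp: indicator_def)

lemma measurable_restrict_pair:
  fixes f :: "real \<Rightarrow> real \<Rightarrow> real"
  assumes "T \<in> sets borel" and f: "(\<lambda>(x, y). f x y) \<in> borel_measurable (borel \<Otimes>\<^sub>M borel)"
  shows "(\<lambda>(x, y). f x y) \<in> borel_measurable (restrict_space lborel T \<Otimes>\<^sub>M restrict_space lborel T)"
proof -
  have "(\<lambda>x. x) \<in> measurable (restrict_space lborel T) borel" by (rule measurable_restrict_space1) simp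
  then have "(\<lambda>z. (fst z, snd z)) \<in> measurable (restrict_space lborel T \<Otimes>\<^sub>M restrict_space lborel T) (borel \<Otimes>\<^sub>M borel)"
    by (intro measurable_Pair measurable_compose[OF measurable_fst] measurable_compose[OF measurable_snd])
  from measurable_compose[OF this f] show ?thesis by (simp add: split_beta')
qed

text \<open>Countably many functions with bounded overlap, each living at scale
  \<open>1 / R\<close>. Two instances matter: scaling functions at a given level, whose products sum
  to the projection kernel, and indicators of the cells of a grid.\<close>

locale dictionary =
  fixes \<psi> :: "nat \<Rightarrow> real \<Rightarrow> real" and b R :: real
  assumes meas[measurable]: "\<And>i. \<psi> i \<in> borel_measurable borel"
    and sum_le: "\<And>y. (\<Sum>i. ennreal \<bar>\<psi> i y\<bar>) \<le> ennreal b"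
    and int_le: "\<And>i. (\<integral>\<^sup>+y. ennreal \<bar>\<psi> i y\<bar> \<partial>lborel) \<le> ennreal (b / R)"
    and b1: "1 \<le> b" and R1: "1 \<le> R"
begin

lemma summable_abs: "summable (\<lambda>i. \<bar>\<psi> i y\<bar>)"
  using sum_le[of y] by (intro summable_suminf_not_top) (auto simp: top_unique)

lemma suminf_abs: "(\<Sum>i. \<bar>\<psi> i y\<bar>) \<le> b"
  using sum_le[of y] b1 by (subst (asm) suminf_ennreal2[OF _ summable_abs]) (auto simp: ennreal_le_iff)

lemma abs_le: "\<bar>\<psi> i y\<bar> \<le> b"
  using sum_le_suminf[OF summable_abs, of "{i}" y] suminf_abs[of y] by simp

definition ker :: "real \<Rightarrow> real \<Rightarrow> real" where "ker x y = R * (\<Sum>i. \<psi> i x * \<psi> i y)"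

lemma ker_sym: "ker x y = ker y x" by (simp add: ker_def mult.commute)

lemma ker_meas: "(\<lambda>(x, y). ker x y) \<in> borel_measurable (borel \<Otimes>\<^sub>M borel)"
  unfolding ker_def by measurable

lemma summable_prod: "summable (\<lambda>i. \<bar>\<psi> i x * \<psi> i y\<bar>)"
proof (rule summable_comparison_test'[OF summable_mult2[OF summable_abs[of x], of b]])
  show "norm \<bar>\<psi> i x * \<psi> i y\<bar> \<le> \<bar>\<psi> i x\<bar> * b" for i
    using mult_left_mono[OF abs_le[of i y] abs_ge_zero[of "\<psi> i x"]] by (simp add: abs_mult)
qed

lemma ennreal_ker_le: "ennreal \<bar>ker x y\<bar> \<le> ennreal R * (\<Sum>i. ennreal \<bar>\<psi> i x\<bar> * ennreal \<bar>\<psi> i y\<bar>)"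
proof -
  have "\<bar>ker x y\<bar> \<le> R * (\<Sum>i. \<bar>\<psi> i x * \<psi> i y\<bar>)"
    unfolding ker_def using R1 summable_rabs[OF summable_prod] by (simp add: abs_mult mult_left_mono)
  then have "ennreal \<bar>ker x y\<bar> \<le> ennreal R * ennreal (\<Sum>i. \<bar>\<psi> i x * \<psi> i y\<bar>)"
    using R1 by (simp add: ennreal_mult'[symmetric] ennreal_leI)
  also have "ennreal (\<Sum>i. \<bar>\<psi> i x * \<psi> i y\<bar>) = (\<Sum>i. ennreal \<bar>\<psi> i x\<bar> * ennreal \<bar>\<psi> i y\<bar>)"
    by (subst suminf_ennreal2[symmetric, OF _ summable_prod]) (auto simp: abs_mult ennreal_mult)
  finally show ?thesis .
qed

lemma ker_bound: "\<bar>ker x y\<bar> \<le> b\<^sup>2 * R"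
proof -
  have "ennreal \<bar>ker x y\<bar> \<le> ennreal R * (\<Sum>i. ennreal \<bar>\<psi> i x\<bar> * ennreal b)"
    by (rule order_trans[OF ennreal_ker_le]) (intro mult_left_mono suminf_le summableI allI ennreal_leI abs_le; simp)
  also have "\<dots> \<le> ennreal R * (ennreal b * ennreal b)"
    using sum_le[of x] by (simp add: mult_left_mono mult_right_mono)
  also have "\<dots> = ennreal (b\<^sup>2 * R)" using b1 R1 by (simp add: ennreal_mult[symmetric] power2_eq_square mult_ac)
  finally show ?thesis using b1 R1 by (simp add: ennreal_le_iff)
qed

lemma ker_row: "(\<integral>\<^sup>+y. ennreal \<bar>ker x y\<bar> \<partial>lborel) \<le> ennreal (b\<^sup>2)"
proof -
  have "(\<integral>\<^sup>+y. ennreal \<bar>ker x y\<bar> \<partial>lborel) \<le> (\<integral>\<^sup>+y. ennreal R * (\<Sum>i. ennreal \<bar>\<psi> i x\<bar> * ennreal \<bar>\<psi> i y\<bar>) \<partial>lborel)"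
    by (intro nn_integral_mono ennreal_ker_le)
  also have "\<dots> = ennreal R * (\<Sum>i. ennreal \<bar>\<psi> i x\<bar> * (\<integral>\<^sup>+y. ennreal \<bar>\<psi> i y\<bar> \<partial>lborel))"
    by (simp add: nn_integral_cmult nn_integral_suminf)
  also have "\<dots> \<le> ennreal R * (\<Sum>i. ennreal \<bar>\<psi> i x\<bar> * ennreal (b / R))"
    by (intro mult_left_mono suminf_le summableI allI int_le) auto
  also have "\<dots> \<le> ennreal R * (ennreal b * ennreal (b / R))"
    using sum_le[of x] by (simp add: mult_left_mono mult_right_mono)
  also have "\<dots> = ennreal (b\<^sup>2)" using b1 R1 by (simp add: ennreal_mult[symmetric] power2_eq_square)
  finally show ?thesis .
qed

lemma schur_ker:
  assumes T: "T \<in> sets borel"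
  shows "schur_kernel (restrict_space lborel T) ker (b\<^sup>2) R"
proof (intro schur_kernel.intro schur_kernel_axioms.intro sigma_finite_restrict_lborel T measurable_restrict_pair ker_meas R1 ker_bound)
  show "1 \<le> b\<^sup>2" using b1 by simp
  show r: "(\<integral>\<^sup>+y. ennreal \<bar>ker x y\<bar> \<partial>restrict_space lborel T) \<le> ennreal (b\<^sup>2)" for x
    by (rule order_trans[OF nn_integral_restrict_le[OF T] ker_row])
  show "(\<integral>\<^sup>+x. ennreal \<bar>ker x y\<bar> \<partial>restrict_space lborel T) \<le> ennreal (b\<^sup>2)" for y
    using r[of y] by (simp add: ker_sym[of _ y])
qed

text \<open>Series and integral are exchanged by domination, after which \<open>h\<close> enters
  only through its coefficients. These are at most \<open>a\<close>, and the sum of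
  \<open>\<bar>\<psi> i x\<bar>\<close> is at most \<open>b\<close>.\<close>

lemma ker_reconstruct:
  assumes T: "T \<in> sets borel" and h: "integrable (restrict_space lborel T) h"
    and a: "\<And>i. \<bar>LINT y|restrict_space lborel T. \<psi> i y * h y\<bar> \<le> a"
  shows "\<bar>LINT y|restrict_space lborel T. ker x y * h y\<bar> \<le> b * R * a"
proof -
  let ?L = "restrict_space lborel T"
  have a0: "0 \<le> a" using a[of 0] by linarith
  have \<psi>L[measurable]: "\<psi> i \<in> borel_measurable ?L" for i by (rule measurable_restrict_space1) simp
  have [measurable]: "h \<in> borel_measurable ?L" using h by simp
  have ih: "integrable ?L (\<lambda>y. \<psi> i y * h y)" for i
  proof (rule Bochner_Integration.integrable_bound[OF integrable_mult_right[OF h, of b]])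
    show "AE y in ?L. norm (\<psi> i y * h y) \<le> norm (b * h y)"
      using abs_le b1 by (auto simp: abs_mult intro!: AE_I2 mult_right_mono)
  qed measurable
  have n: "(LINT y|?L. \<bar>\<psi> i x * (\<psi> i y * h y)\<bar>) \<le> \<bar>\<psi> i x\<bar> * (b * (LINT y|?L. \<bar>h y\<bar>))" for i
  proof -
    have "(LINT y|?L. \<bar>\<psi> i x * (\<psi> i y * h y)\<bar>) \<le> (LINT y|?L. \<bar>\<psi> i x\<bar> * (b * \<bar>h y\<bar>))"
      using ih h abs_le
      by (intro integral_mono integrable_abs integrable_mult_right) (auto simp: abs_mult intro!: mult_left_mono mult_right_mono)
    then show ?thesis by simp
  qed
  have "(\<lambda>i. LINT y|?L. \<psi> i x * (\<psi> i y * h y)) sums (LINT y|?L. (\<Sum>i. \<psi> i x * (\<psi> i y * h y)))"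
  proof (rule sums_integral)
    show "AE y in ?L. summable (\<lambda>i. norm (\<psi> i x * (\<psi> i y * h y)))"
      using summable_mult2[OF summable_prod] by (intro AE_I2) (simp add: abs_mult mult.assoc)
    show "summable (\<lambda>i. LINT y|?L. norm (\<psi> i x * (\<psi> i y * h y)))"
      by (rule summable_comparison_test'[OF summable_mult2[OF summable_abs[of x], of "b * (LINT y|?L. \<bar>h y\<bar>)"]])
        (use n in auto)
  qed (use ih in auto)
  also have "(LINT y|?L. (\<Sum>i. \<psi> i x * (\<psi> i y * h y))) = (LINT y|?L. ker x y * h y) / R"
  proof -
    have "(\<Sum>i. \<psi> i x * (\<psi> i y * h y)) = ker x y * h y / R" for y
      using suminf_mult2[OF summable_rabs_cancel[OF summable_prod], of x y "h y"] R1 by (simp add: ker_def mult.assoc)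
    then show ?thesis by simp
  qed
  finally have s: "(\<lambda>i. \<psi> i x * (LINT y|?L. \<psi> i y * h y)) sums ((LINT y|?L. ker x y * h y) / R)" by simp
  have sa: "summable (\<lambda>i. \<bar>\<psi> i x\<bar> * a)" by (intro summable_mult2 summable_abs)
  have le: "\<bar>\<psi> i x * (LINT y|?L. \<psi> i y * h y)\<bar> \<le> \<bar>\<psi> i x\<bar> * a" for i
    using a by (auto simp: abs_mult intro: mult_left_mono)
  have s1: "summable (\<lambda>i. \<bar>\<psi> i x * (LINT y|?L. \<psi> i y * h y)\<bar>)"
    by (rule summable_comparison_test'[OF sa]) (use le in auto)
  have "\<bar>(LINT y|?L. ker x y * h y) / R\<bar> \<le> (\<Sum>i. \<bar>\<psi> i x * (LINT y|?L. \<psi> i y * h y)\<bar>)"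
    unfolding sums_unique[OF s] by (rule summable_rabs[OF s1])
  also have "\<dots> \<le> (\<Sum>i. \<bar>\<psi> i x\<bar> * a)" by (intro suminf_le le s1 sa)
  also have "\<dots> = (\<Sum>i. \<bar>\<psi> i x\<bar>) * a" by (rule suminf_mult2[symmetric, OF summable_abs])
  also have "\<dots> \<le> b * a" using a0 suminf_abs by (intro mult_right_mono)
  finally show ?thesis using R1 by (simp add: abs_divide field_simps)
qed

end

text \<open>The weight is submultiplicative: \<open>1 + \<bar>x\<bar>\<close> is at most
  \<open>(1 + \<bar>y\<bar>) * (1 + \<bar>u\<bar>)\<close> for \<open>u = R * (x - y)\<close>,
  because \<open>R \<ge> 1\<close>. Two moments of the profile then absorb every weight exponent up
  to \<open>2\<close>, uniformly in \<open>R\<close>.\<close>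

lemma dominated_weighted_col:
  fixes k :: "real \<Rightarrow> real \<Rightarrow> real" and \<Phi> :: "real \<Rightarrow> real"
  assumes T: "T \<in> sets borel" and \<Phi>[measurable]: "\<Phi> \<in> borel_measurable borel"
    and R: "1 \<le> R" and k: "\<And>x y. \<bar>k x y\<bar> \<le> R * \<Phi> (R * x - R * y)"
    and A: "(\<integral>\<^sup>+u. ennreal (\<Phi> u * (1 + \<bar>u\<bar>)\<^sup>2) \<partial>lborel) \<le> ennreal A" and w: "0 \<le> w" "w \<le> 2"
  shows "(\<integral>\<^sup>+x. ennreal (\<bar>k x y\<bar> * (1 + \<bar>x\<bar>) powr w) \<partial>restrict_space lborel T) \<le> ennreal A * ennreal ((1 + \<bar>y\<bar>) powr w)"
proof -
  have "(\<integral>\<^sup>+x. ennreal (\<bar>k x y\<bar> * (1 + \<bar>x\<bar>) powr w) \<partial>restrict_space lborel T) \<le>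
     (\<integral>\<^sup>+x. ennreal (\<bar>k x y\<bar> * (1 + \<bar>x\<bar>) powr w) \<partial>lborel)" by (rule nn_integral_restrict_le[OF T])
  also have "\<dots> \<le> (\<integral>\<^sup>+x. ennreal ((1 + \<bar>y\<bar>) powr w) * (ennreal R * ennreal (\<Phi> (- R * y + R * x) * (1 + \<bar>- R * y + R * x\<bar>)\<^sup>2)) \<partial>lborel)"
  proof (intro nn_integral_mono)
    fix x
    define u where "u = - R * y + R * x"
    have "\<bar>x - y\<bar> \<le> R * \<bar>x - y\<bar>" using R mult_right_mono[of 1 R "\<bar>x - y\<bar>"] by simp
    also have "\<dots> = \<bar>R * (x - y)\<bar>" using R by (simp add: abs_mult)
    also have "R * (x - y) = u" by (simp add: u_def algebra_simps)
    finally have xy: "\<bar>x - y\<bar> \<le> \<bar>u\<bar>" .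
    have "1 + \<bar>x\<bar> \<le> 1 + \<bar>y\<bar> + \<bar>u\<bar>" using xy by linarith
    also have "\<dots> \<le> (1 + \<bar>y\<bar>) * (1 + \<bar>u\<bar>)" by (simp add: algebra_simps)
    finally have "(1 + \<bar>x\<bar>) powr w \<le> ((1 + \<bar>y\<bar>) * (1 + \<bar>u\<bar>)) powr w" using w by (intro powr_mono2) auto
    also have "\<dots> = (1 + \<bar>y\<bar>) powr w * (1 + \<bar>u\<bar>) powr w" by (rule powr_mult)
    also have "(1 + \<bar>u\<bar>) powr w \<le> (1 + \<bar>u\<bar>) powr 2" using w by (intro powr_mono) auto
    also have "(1 + \<bar>u\<bar>) powr 2 = (1 + \<bar>u\<bar>)\<^sup>2" by simp
    finally have wt: "(1 + \<bar>x\<bar>) powr w \<le> (1 + \<bar>y\<bar>) powr w * (1 + \<bar>u\<bar>)\<^sup>2" by (simp add: mult_left_mono)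
    have ku: "\<bar>k x y\<bar> \<le> R * \<Phi> u" using k[of x y] by (simp add: u_def algebra_simps)
    then have R\<Phi>: "0 \<le> R * \<Phi> u" by linarith
    then have \<Phi>0: "0 \<le> \<Phi> u" using R by (simp add: zero_le_mult_iff)
    have "\<bar>k x y\<bar> * (1 + \<bar>x\<bar>) powr w \<le> (R * \<Phi> u) * ((1 + \<bar>y\<bar>) powr w * (1 + \<bar>u\<bar>)\<^sup>2)"
      using ku wt R\<Phi> by (intro mult_mono) auto
    then show "ennreal (\<bar>k x y\<bar> * (1 + \<bar>x\<bar>) powr w) \<le>
       ennreal ((1 + \<bar>y\<bar>) powr w) * (ennreal R * ennreal (\<Phi> (- R * y + R * x) * (1 + \<bar>- R * y + R * x\<bar>)\<^sup>2))"
      unfolding u_def[symmetric] using R \<Phi>0 by (simp add: ennreal_mult[symmetric] ennreal_leI mult_ac)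
  qed
  also have "\<dots> = ennreal ((1 + \<bar>y\<bar>) powr w) * (ennreal \<bar>R\<bar> * (\<integral>\<^sup>+x. ennreal (\<Phi> (- R * y + R * x) * (1 + \<bar>- R * y + R * x\<bar>)\<^sup>2) \<partial>lborel))"
    using R by (simp add: nn_integral_cmult)
  also have "ennreal \<bar>R\<bar> * (\<integral>\<^sup>+x. ennreal (\<Phi> (- R * y + R * x) * (1 + \<bar>- R * y + R * x\<bar>)\<^sup>2) \<partial>lborel) =
      (\<integral>\<^sup>+u. ennreal (\<Phi> u * (1 + \<bar>u\<bar>)\<^sup>2) \<partial>lborel)"
    using R by (intro nn_integral_real_affine[symmetric]) auto
  also have "ennreal ((1 + \<bar>y\<bar>) powr w) * \<dots> \<le> ennreal ((1 + \<bar>y\<bar>) powr w) * ennreal A"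
    by (intro mult_left_mono A) simp
  finally show ?thesis by (simp add: mult.commute)
qed

text \<open>Column integrals are the weighted estimate with \<open>w = 0\<close>; row integrals are
  the same estimate for the transposed kernel, which is dominated by the reflected profile.\<close>

lemma dominated_schur:
  fixes k :: "real \<Rightarrow> real \<Rightarrow> real" and \<Phi> :: "real \<Rightarrow> real"
  assumes T: "T \<in> sets borel" and \<Phi>[measurable]: "\<Phi> \<in> borel_measurable borel"
    and R: "1 \<le> R" and k_meas: "(\<lambda>(x, y). k x y) \<in> borel_measurable (borel \<Otimes>\<^sub>M borel)"
    and k: "\<And>x y. \<bar>k x y\<bar> \<le> R * \<Phi> (R * x - R * y)"
    and b: "\<And>u. \<Phi> u \<le> B" "1 \<le> B"
    and A: "(\<integral>\<^sup>+u. ennreal (\<Phi> u * (1 + \<bar>u\<bar>)\<^sup>2) \<partial>lborel) \<le> ennreal B"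
  shows "schur_kernel (restrict_space lborel T) k B R"
proof (intro schur_kernel.intro schur_kernel_axioms.intro sigma_finite_restrict_lborel T measurable_restrict_pair k_meas R b(2))
  have [simp]: "1 + \<bar>x\<bar> \<noteq> 0" for x :: real by linarith
  have col: "(\<integral>\<^sup>+x. ennreal \<bar>k x y\<bar> \<partial>restrict_space lborel T) \<le> ennreal B"
    if k: "\<And>x y. \<bar>k x y\<bar> \<le> R * \<Phi> (R * x - R * y)" and \<Phi>[measurable]: "\<Phi> \<in> borel_measurable borel"
      and A: "(\<integral>\<^sup>+u. ennreal (\<Phi> u * (1 + \<bar>u\<bar>)\<^sup>2) \<partial>lborel) \<le> ennreal B" for y and \<Phi> :: "real \<Rightarrow> real" and k
    using dominated_weighted_col[OF T \<Phi> R k A, of 0 y] by simp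
  show "(\<integral>\<^sup>+x. ennreal \<bar>k x y\<bar> \<partial>restrict_space lborel T) \<le> ennreal B" for y by (rule col[OF k \<Phi> A])
  have A': "(\<integral>\<^sup>+u. ennreal (\<Phi> (- u) * (1 + \<bar>u\<bar>)\<^sup>2) \<partial>lborel) \<le> ennreal B"
    using A nn_integral_real_affine[of "\<lambda>u. ennreal (\<Phi> u * (1 + \<bar>u\<bar>)\<^sup>2)" "- 1" 0] by simp
  have k': "\<bar>k y x\<bar> \<le> R * \<Phi> (- (R * x - R * y))" for x y using k[of y x] by simp
  show "(\<integral>\<^sup>+y. ennreal \<bar>k x y\<bar> \<partial>restrict_space lborel T) \<le> ennreal B" for x
    by (rule col[of "\<lambda>x y. k y x" "\<lambda>u. \<Phi> (- u)", OF k' _ A']) measurable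
  show "\<bar>k x y\<bar> \<le> B * R" for x y
  proof -
    have "\<bar>k x y\<bar> \<le> R * B" using R b(1) by (intro order_trans[OF k] mult_left_mono) auto
    then show ?thesis by (simp add: mult.commute)
  qed
qed

lemma L1_shift_sym:
  fixes k :: "real \<Rightarrow> real"
  assumes [measurable]: "k \<in> borel_measurable borel"
  shows "(\<integral>\<^sup>+u. ennreal \<bar>k (u - t) - k u\<bar> \<partial>lborel) = (\<integral>\<^sup>+u. ennreal \<bar>k (u + t) - k u\<bar> \<partial>lborel)"
  using nn_integral_real_affine[of "\<lambda>u. ennreal \<bar>k (u - t) - k u\<bar>" 1 t]
  by (simp add: abs_minus_commute add.commute)

text \<open>Continuity of translation in \<open>L^1\<close> without approximation by continuous
  functions. One-sided continuity gives pointwise convergence along shifts of one sign, Scheffe's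
  lemma upgrades it to \<open>L^1\<close>, and invariance under translation makes the sign of a
  shift irrelevant.\<close>

lemma L1_modulus:
  fixes k :: "real \<Rightarrow> real"
  assumes k: "integrable lborel k"
    and cont: "(\<forall>x. continuous (at_right x) k) \<or> (\<forall>x. continuous (at_left x) k)" and \<eta>: "0 < \<eta>"
  obtains t0 where "0 < t0" "\<And>t. \<bar>t\<bar> \<le> t0 \<Longrightarrow> (\<integral>\<^sup>+u. ennreal \<bar>k (u + t) - k u\<bar> \<partial>lborel) \<le> ennreal \<eta>"
proof -
  have [measurable]: "k \<in> borel_measurable borel" using k by simp
  have "\<exists>t0>0. \<forall>t. \<bar>t\<bar> \<le> t0 \<longrightarrow> (\<integral>\<^sup>+u. ennreal \<bar>k (u + t) - k u\<bar> \<partial>lborel) \<le> ennreal \<eta>"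
  proof (rule ccontr)
    assume "\<not> ?thesis"
    then have "\<forall>n. \<exists>t. \<bar>t\<bar> \<le> 1 / real (Suc n) \<and> ennreal \<eta> < (\<integral>\<^sup>+u. ennreal \<bar>k (u + t) - k u\<bar> \<partial>lborel)"
      by (metis divide_pos_pos not_le of_nat_0_less_iff zero_less_Suc zero_less_one)
    then obtain t where t: "\<And>n. \<bar>t n\<bar> \<le> 1 / real (Suc n)"
        "\<And>n. ennreal \<eta> < (\<integral>\<^sup>+u. ennreal \<bar>k (u + t n) - k u\<bar> \<partial>lborel)" by metis
    have big: "ennreal \<eta> < (\<integral>\<^sup>+u. ennreal \<bar>k (u + \<bar>t n\<bar>) - k u\<bar> \<partial>lborel)"
        "ennreal \<eta> < (\<integral>\<^sup>+u. ennreal \<bar>k (u + - \<bar>t n\<bar>) - k u\<bar> \<partial>lborel)" for n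
      using t(2)[of n] L1_shift_sym[of k "t n"] by (cases "0 \<le> t n"; simp)+
    \<comment> \<open>The one-sided filters omit the point itself, so vanishing shifts must be
      excluded; they would make the translation difference zero.\<close>
    have t_ne: "t n \<noteq> 0" for n
    proof
      assume "t n = 0" then show False using t(2)[of n] by simp
    qed
    have lim: "(\<lambda>n. \<bar>t n\<bar>) \<longlonglongrightarrow> 0"
      by (rule tendsto_sandwich[OF _ _ tendsto_const LIMSEQ_inverse_real_of_nat])
        (use t(1) in \<open>auto simp: inverse_eq_divide\<close>)
    have contra: False
      if s: "\<And>n. ennreal \<eta> < (\<integral>\<^sup>+u. ennreal \<bar>k (u + s n) - k u\<bar> \<partial>lborel)"
        and c: "\<And>u. (\<lambda>n. k (u + s n)) \<longlonglongrightarrow> k u" for s :: "nat \<Rightarrow> real"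
    proof -
      have "(\<lambda>n. \<integral>\<^sup>+u. norm (k (u + s n) - k u) \<partial>lborel) \<longlonglongrightarrow> 0"
      proof (rule Scheffe_lemma2)
        show "(\<integral>\<^sup>+u. norm (k (u + s n)) \<partial>lborel) \<le> (\<integral>\<^sup>+u. norm (k u) \<partial>lborel)" for n
          using nn_integral_real_affine[of "\<lambda>u. ennreal (norm (k u))" 1 "s n"] by (simp add: add.commute)
      qed (use k c in auto)
      then have "eventually (\<lambda>n. (\<integral>\<^sup>+u. norm (k (u + s n) - k u) \<partial>lborel) < ennreal \<eta>) sequentially"
        using \<eta> by (intro order_tendstoD) auto
      then obtain n where "(\<integral>\<^sup>+u. norm (k (u + s n) - k u) \<partial>lborel) < ennreal \<eta>"
        by (auto simp: eventually_sequentially)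
      then show False using s[of n] by simp
    qed
    show False
    proof (cases "\<forall>x. continuous (at_right x) k")
      case True
      show False
      proof (rule contra[of "\<lambda>n. \<bar>t n\<bar>", OF big(1)])
        fix u
        have "filterlim (\<lambda>n. u + \<bar>t n\<bar>) (at_right u) sequentially"
          using t_ne tendsto_add[OF tendsto_const lim, of u] by (auto simp: filterlim_at eventually_sequentially)
        then show "(\<lambda>n. k (u + \<bar>t n\<bar>)) \<longlonglongrightarrow> k u"
          using True by (auto simp: continuous_within intro: filterlim_compose)
      qed
    next
      case False
      with cont have c: "\<forall>x. continuous (at_left x) k" by auto
      show False
      proof (rule contra[of "\<lambda>n. - \<bar>t n\<bar>", OF big(2)])
        fix u
        have "filterlim (\<lambda>n. u + - \<bar>t n\<bar>) (at_left u) sequentially"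
          using t_ne tendsto_add[OF tendsto_const tendsto_minus[OF lim], of u] by (auto simp: filterlim_at eventually_sequentially)
        then show "(\<lambda>n. k (u + - \<bar>t n\<bar>)) \<longlonglongrightarrow> k u"
          using c by (auto simp: continuous_within intro: filterlim_compose)
      qed
    qed
  qed
  then show ?thesis using that by blast
qed

lemma nn_integral_cell:
  fixes s :: real
  assumes "0 < s"
  shows "(\<integral>\<^sup>+z. ennreal (of_bool (\<lfloor>s * z\<rfloor> = m)) \<partial>lborel) = ennreal (1 / s)"
proof -
  have "(\<integral>\<^sup>+z. ennreal (of_bool (\<lfloor>s * z\<rfloor> = m)) \<partial>lborel) = (\<integral>\<^sup>+z. indicator {real_of_int m / s..<(real_of_int m + 1) / s} z \<partial>lborel)"
  proof (intro nn_integral_cong)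
    fix z
    have "\<lfloor>s * z\<rfloor> = m \<longleftrightarrow> real_of_int m / s \<le> z \<and> z < (real_of_int m + 1) / s"
      using assms by (simp add: floor_eq_iff field_simps)
    then show "ennreal (of_bool (\<lfloor>s * z\<rfloor> = m)) = indicator {real_of_int m / s..<(real_of_int m + 1) / s} z"
      by (auto simp: indicator_def)
  qed
  also have "\<dots> = ennreal (1 / s)"
    using assms by (simp add: diff_divide_distrib[symmetric] divide_right_mono)
  finally show ?thesis .
qed

text \<open>Averaging the convolution kernel over the cells of a fixed number of refinements of the grid changes it by
  little in \<open>L\<^sup>1\<close>, hence the cell integrals of a bounded \<open>h\<close> control \<open>K\<^sub>j h\<close> up to a small multiple of \<open>\<parallel>h\<parallel>\<^sub>\<infinity>\<close>.\<close>

lemma convolution_reconstruct: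
  fixes k H :: "real \<Rightarrow> real" and q R \<Delta> a b x :: real
  assumes k: "integrable lborel k" and b: "(\<integral>\<^sup>+u. ennreal \<bar>k u\<bar> \<partial>lborel) \<le> ennreal b" "0 \<le> b"
    and q: "0 < q" and R: "1 \<le> R"
    and modulus: "\<And>t. \<bar>t\<bar> \<le> 1 / q \<Longrightarrow> (\<integral>\<^sup>+u. ennreal \<bar>k (u + t) - k u\<bar> \<partial>lborel) \<le> ennreal (1 / 8)"
    and H: "integrable lborel H" and \<Delta>: "\<And>y. \<bar>H y\<bar> \<le> \<Delta>"
    and a: "\<And>m::int. \<bar>LINT y|lborel. of_bool (\<lfloor>R * q * y\<rfloor> = m) * H y\<bar> \<le> a"
  shows "\<bar>LINT y|lborel. R * k (R * x - R * y) * H y\<bar> \<le> R * q * b * a + \<Delta> / 4"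
proof -
  have [measurable]: "k \<in> borel_measurable borel" "H \<in> borel_measurable borel" using k H by simp_all
  define s where "s = R * q"
  have s: "0 < s" using R q by (simp add: s_def)
  have \<Delta>0: "0 \<le> \<Delta>" using \<Delta>[of 0] by linarith
  have a0: "0 \<le> a" using a[of 0] by linarith
  define \<kappa> where "\<kappa> y = R * k (R * x - R * y)" for y
  have [measurable]: "\<kappa> \<in> borel_measurable borel" unfolding \<kappa>_def by measurable
  define c where "c y z = (of_bool (\<lfloor>s * y\<rfloor> = \<lfloor>s * z\<rfloor>) :: real)" for y z
  have [measurable]: "(\<lambda>(y, z). c y z) \<in> borel_measurable (borel \<Otimes>\<^sub>M borel)" unfolding c_def by measurable
  have [measurable]: "(\<lambda>z. c y z) \<in> borel_measurable borel" "(\<lambda>y. c y z) \<in> borel_measurable borel" for y z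
    unfolding c_def by measurable
  have c01: "0 \<le> c y z" "c y z \<le> 1" for y z by (auto simp: c_def)
  have c_sym: "c y z = c z y" for y z by (auto simp: c_def)
  have c_cell: "(\<integral>\<^sup>+z. ennreal (c y z) \<partial>lborel) = ennreal (1 / s)" for y
    using nn_integral_cell[OF s, of "\<lfloor>s * y\<rfloor>"] by (simp add: c_def eq_commute)
  have c_int: "integrable lborel (\<lambda>z. c y z)" "(LINT z|lborel. c y z) = 1 / s" for y
  proof -
    show "integrable lborel (\<lambda>z. c y z)"
      using c_cell[of y] c01 by (intro integrableI_nonneg) auto
    show "(LINT z|lborel. c y z) = 1 / s"
      using c_cell[of y] c01 s by (subst integral_eq_nn_integral) auto
  qed
  have scale: "(\<integral>\<^sup>+y. ennreal R * f (R * x - R * y) \<partial>lborel) = (\<integral>\<^sup>+u. f u \<partial>lborel)"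
    if [measurable]: "f \<in> borel_measurable borel" for f :: "real \<Rightarrow> ennreal"
    using nn_integral_real_affine[of f "- R" "R * x"] R by (simp add: nn_integral_cmult)
  have \<kappa>_abs: "(\<integral>\<^sup>+y. ennreal \<bar>\<kappa> y\<bar> \<partial>lborel) \<le> ennreal b"
  proof -
    have "(\<integral>\<^sup>+y. ennreal \<bar>\<kappa> y\<bar> \<partial>lborel) = (\<integral>\<^sup>+y. ennreal R * ennreal \<bar>k (R * x - R * y)\<bar> \<partial>lborel)"
      using R by (intro nn_integral_cong) (simp add: \<kappa>_def abs_mult ennreal_mult)
    also have "\<dots> = (\<integral>\<^sup>+u. ennreal \<bar>k u\<bar> \<partial>lborel)" by (rule scale) measurable
    finally show ?thesis using b by simp
  qed
  have \<kappa>_int: "integrable lborel \<kappa>"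
    using \<kappa>_abs by (intro integrableI_bounded) (auto simp: order_le_less_trans)
  have \<kappa>_shift: "(\<integral>\<^sup>+y. ennreal \<bar>\<kappa> y - \<kappa> (y + u)\<bar> \<partial>lborel) \<le> ennreal (1 / 8)" if "\<bar>u\<bar> \<le> 1 / s" for u
  proof -
    have "(\<integral>\<^sup>+y. ennreal \<bar>\<kappa> y - \<kappa> (y + u)\<bar> \<partial>lborel) =
        (\<integral>\<^sup>+y. ennreal R * ennreal \<bar>k (R * x - R * y + - (R * u)) - k (R * x - R * y)\<bar> \<partial>lborel)"
    proof (intro nn_integral_cong)
      fix y
      have "\<bar>\<kappa> y - \<kappa> (y + u)\<bar> = R * \<bar>k (R * x - R * y + - (R * u)) - k (R * x - R * y)\<bar>"
      proof -
        have e: "R * x - R * (y + u) = R * x - R * y + - (R * u)" by (simp add: algebra_simps)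
        have "\<kappa> y - \<kappa> (y + u) = R * (k (R * x - R * y) - k (R * x - R * y + - (R * u)))"
          unfolding \<kappa>_def e by (simp only: right_diff_distrib)
        then show ?thesis using R by (simp only: abs_mult abs_minus_commute)
      qed
      then show "ennreal \<bar>\<kappa> y - \<kappa> (y + u)\<bar> = ennreal R * ennreal \<bar>k (R * x - R * y + - (R * u)) - k (R * x - R * y)\<bar>"
        using R by (simp add: ennreal_mult)
    qed
    also have "\<dots> = (\<integral>\<^sup>+v. ennreal \<bar>k (v + - (R * u)) - k v\<bar> \<partial>lborel)"
      by (rule scale[of "\<lambda>v. ennreal \<bar>k (v + - (R * u)) - k v\<bar>"]) measurable
    also have "\<dots> \<le> ennreal (1 / 8)"
    proof (rule modulus)
      have "R * \<bar>u\<bar> \<le> R * (1 / s)" using that R by (intro mult_left_mono) auto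
      then show "\<bar>- (R * u)\<bar> \<le> 1 / q" using R by (simp add: s_def abs_mult)
    qed
    finally show ?thesis .
  qed
  have c\<kappa>_int: "integrable lborel (\<lambda>z. c y z * \<kappa> z)" for y
    by (rule Bochner_Integration.integrable_bound[OF \<kappa>_int])
      (use c01 in \<open>auto simp: abs_mult intro!: AE_I2 mult_left_le_one_le\<close>)
  have cH_int: "integrable lborel (\<lambda>y. c y z * H y)" for z
    by (rule Bochner_Integration.integrable_bound[OF H])
      (use c01 in \<open>auto simp: abs_mult intro!: AE_I2 mult_left_le_one_le\<close>)
  define A where "A z = (LINT y|lborel. c y z * H y)" for z
  have A_le: "\<bar>A z\<bar> \<le> a" for z
    using a[of "\<lfloor>s * z\<rfloor>"] unfolding A_def c_def s_def by simp
  have [measurable]: "A \<in> borel_measurable borel" unfolding A_def by measurable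
  \<comment> \<open>The cell relation is symmetric, so averaging \<open>H\<close> over cells and
    integrating against the kernel is the same as averaging the kernel over cells.\<close>
  have swap: "(LINT z|lborel. \<kappa> z * A z) = (LINT y|lborel. H y * (LINT z|lborel. c y z * \<kappa> z))"
  proof -
    have "integrable (lborel \<Otimes>\<^sub>M lborel) (\<lambda>(y, z). c y z * H y * \<kappa> z)"
    proof (rule integrableI_bounded)
      have "(\<integral>\<^sup>+w. ennreal (norm (case w of (y, z) \<Rightarrow> c y z * H y * \<kappa> z)) \<partial>(lborel \<Otimes>\<^sub>M lborel)) =
          (\<integral>\<^sup>+y. \<integral>\<^sup>+z. ennreal \<bar>c y z * H y * \<kappa> z\<bar> \<partial>lborel \<partial>lborel)"
        by (subst lborel.nn_integral_fst[symmetric]) (auto simp: split_beta')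
      also have "\<dots> \<le> (\<integral>\<^sup>+y. \<integral>\<^sup>+z. ennreal \<bar>H y\<bar> * ennreal \<bar>\<kappa> z\<bar> \<partial>lborel \<partial>lborel)"
      proof (intro nn_integral_mono)
        fix y z
        have "\<bar>c y z * H y * \<kappa> z\<bar> \<le> \<bar>H y\<bar> * \<bar>\<kappa> z\<bar>"
          using c01[of y z] mult_left_le_one_le[of "\<bar>H y\<bar> * \<bar>\<kappa> z\<bar>" "c y z"] by (simp add: abs_mult mult.assoc)
        then show "ennreal \<bar>c y z * H y * \<kappa> z\<bar> \<le> ennreal \<bar>H y\<bar> * ennreal \<bar>\<kappa> z\<bar>"
          by (simp add: ennreal_mult[symmetric] ennreal_leI)
      qed
      also have "\<dots> = (\<integral>\<^sup>+y. ennreal \<bar>H y\<bar> \<partial>lborel) * (\<integral>\<^sup>+z. ennreal \<bar>\<kappa> z\<bar> \<partial>lborel)"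
        by (simp add: nn_integral_cmult nn_integral_multc)
      also have "\<dots> < \<infinity>"
        using H \<kappa>_int by (auto simp: integrable_iff_bounded ennreal_mult_less_top)
      finally show "(\<integral>\<^sup>+w. ennreal (norm (case w of (y, z) \<Rightarrow> c y z * H y * \<kappa> z)) \<partial>(lborel \<Otimes>\<^sub>M lborel)) < \<infinity>" .
    qed measurable
    from lborel_pair.Fubini_integral[OF this]
    have "(LINT z|lborel. LINT y|lborel. c y z * H y * \<kappa> z) = (LINT y|lborel. LINT z|lborel. c y z * H y * \<kappa> z)" .
    moreover have "(LINT y|lborel. c y z * H y * \<kappa> z) = \<kappa> z * A z" for z by (simp add: A_def)
    moreover have "(LINT z|lborel. c y z * H y * \<kappa> z) = H y * (LINT z|lborel. c y z * \<kappa> z)" for y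
    proof -
      have "(LINT z|lborel. c y z * H y * \<kappa> z) = (LINT z|lborel. H y * (c y z * \<kappa> z))"
        by (intro Bochner_Integration.integral_cong) (auto simp: mult_ac)
      then show ?thesis by simp
    qed
    ultimately show ?thesis by (simp only:)
  qed
  \<comment> \<open>The difference between the kernel and its cell average; \<open>s\<close> is the
    reciprocal of the cell length.\<close>
  define E where "E y = s * (LINT z|lborel. c y z * (\<kappa> y - \<kappa> z))" for y
  have E_eq: "E y = \<kappa> y - s * (LINT z|lborel. c y z * \<kappa> z)" for y
  proof -
    have "(LINT z|lborel. c y z * (\<kappa> y - \<kappa> z)) = (LINT z|lborel. c y z) * \<kappa> y - (LINT z|lborel. c y z * \<kappa> z)"
      using c_int(1)[of y] c\<kappa>_int[of y] by (simp add: right_diff_distrib)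
    then show ?thesis using s by (simp add: E_def c_int right_diff_distrib)
  qed
  have [measurable]: "E \<in> borel_measurable borel" unfolding E_def by measurable
  \<comment> \<open>Points of one cell are at distance at most \<open>1 / s\<close>, so
    \<open>E\<close> is dominated by an average over shifts in a window of length
    \<open>2 / s\<close>. With modulus \<open>1 / 8\<close> this gives
    \<open>s * (1 / 8) * (2 / s) = 1 / 4\<close>, the fraction of \<open>\<Delta>\<close> that is
    tolerated.\<close>
  have E_nn: "(\<integral>\<^sup>+y. ennreal \<bar>E y\<bar> \<partial>lborel) \<le> ennreal (1 / 4)"
  proof -
    have "(\<integral>\<^sup>+y. ennreal \<bar>E y\<bar> \<partial>lborel) \<le> (\<integral>\<^sup>+y. \<integral>\<^sup>+u. ennreal s * (ennreal (of_bool (\<bar>u\<bar> \<le> 1 / s)) * ennreal \<bar>\<kappa> y - \<kappa> (y + u)\<bar>) \<partial>lborel \<partial>lborel)"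
    proof (intro nn_integral_mono)
      fix y
      have i: "integrable lborel (\<lambda>z. c y z * (\<kappa> y - \<kappa> z))"
        using c_int(1)[of y] c\<kappa>_int[of y] by (simp add: right_diff_distrib)
      have "ennreal \<bar>E y\<bar> = ennreal s * ennreal \<bar>LINT z|lborel. c y z * (\<kappa> y - \<kappa> z)\<bar>"
        using s by (simp add: E_def abs_mult ennreal_mult)
      also have "\<dots> \<le> ennreal s * (\<integral>\<^sup>+z. ennreal \<bar>c y z * (\<kappa> y - \<kappa> z)\<bar> \<partial>lborel)"
        using integral_norm_bound_ennreal[OF i] by (intro mult_left_mono) auto
      also have "\<dots> \<le> ennreal s * (\<integral>\<^sup>+z. ennreal (of_bool (\<bar>z - y\<bar> \<le> 1 / s)) * ennreal \<bar>\<kappa> y - \<kappa> z\<bar> \<partial>lborel)"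
      proof (intro mult_left_mono nn_integral_mono)
        fix z
        have "c y z \<le> of_bool (\<bar>z - y\<bar> \<le> 1 / s)"
        proof (cases "\<lfloor>s * y\<rfloor> = \<lfloor>s * z\<rfloor>")
          case True
          then have "\<bar>s * z - s * y\<bar> \<le> 1" by linarith
          then have "s * \<bar>z - y\<bar> \<le> 1" using s by (simp add: right_diff_distrib[symmetric] abs_mult)
          then have "\<bar>z - y\<bar> \<le> 1 / s" using s by (simp add: field_simps)
          then show ?thesis by (simp add: c_def)
        qed (simp add: c_def)
        then have "\<bar>c y z * (\<kappa> y - \<kappa> z)\<bar> \<le> of_bool (\<bar>z - y\<bar> \<le> 1 / s) * \<bar>\<kappa> y - \<kappa> z\<bar>"
          using c01[of y z] by (simp add: abs_mult mult_right_mono)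
        then show "ennreal \<bar>c y z * (\<kappa> y - \<kappa> z)\<bar> \<le> ennreal (of_bool (\<bar>z - y\<bar> \<le> 1 / s)) * ennreal \<bar>\<kappa> y - \<kappa> z\<bar>"
          by (subst ennreal_mult[symmetric]) (auto intro: ennreal_leI)
      qed simp
      also have "(\<integral>\<^sup>+z. ennreal (of_bool (\<bar>z - y\<bar> \<le> 1 / s)) * ennreal \<bar>\<kappa> y - \<kappa> z\<bar> \<partial>lborel) =
          (\<integral>\<^sup>+u. ennreal (of_bool (\<bar>u\<bar> \<le> 1 / s)) * ennreal \<bar>\<kappa> y - \<kappa> (y + u)\<bar> \<partial>lborel)"
        using nn_integral_real_affine[of "\<lambda>z. ennreal (of_bool (\<bar>z - y\<bar> \<le> 1 / s)) * ennreal \<bar>\<kappa> y - \<kappa> z\<bar>" 1 y] by simp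
      also have "ennreal s * \<dots> = (\<integral>\<^sup>+u. ennreal s * (ennreal (of_bool (\<bar>u\<bar> \<le> 1 / s)) * ennreal \<bar>\<kappa> y - \<kappa> (y + u)\<bar>) \<partial>lborel)"
        by (rule nn_integral_cmult[symmetric]) measurable
      finally show "ennreal \<bar>E y\<bar> \<le> (\<integral>\<^sup>+u. ennreal s * (ennreal (of_bool (\<bar>u\<bar> \<le> 1 / s)) * ennreal \<bar>\<kappa> y - \<kappa> (y + u)\<bar>) \<partial>lborel)" .
    qed
    also have "\<dots> = (\<integral>\<^sup>+u. \<integral>\<^sup>+y. ennreal s * (ennreal (of_bool (\<bar>u\<bar> \<le> 1 / s)) * ennreal \<bar>\<kappa> y - \<kappa> (y + u)\<bar>) \<partial>lborel \<partial>lborel)"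
      by (rule lborel_pair.Fubini'[symmetric]) measurable
    also have "\<dots> = (\<integral>\<^sup>+u. ennreal s * (ennreal (of_bool (\<bar>u\<bar> \<le> 1 / s)) * (\<integral>\<^sup>+y. ennreal \<bar>\<kappa> y - \<kappa> (y + u)\<bar> \<partial>lborel)) \<partial>lborel)"
      by (simp add: nn_integral_cmult)
    also have "\<dots> \<le> (\<integral>\<^sup>+u. ennreal s * (ennreal (1 / 8) * indicator {- (1 / s)..1 / s} u) \<partial>lborel)"
    proof (intro nn_integral_mono mult_left_mono)
      fix u
      show "ennreal (of_bool (\<bar>u\<bar> \<le> 1 / s)) * (\<integral>\<^sup>+y. ennreal \<bar>\<kappa> y - \<kappa> (y + u)\<bar> \<partial>lborel) \<le> ennreal (1 / 8) * indicator {- (1 / s)..1 / s} u"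
      proof (cases "\<bar>u\<bar> \<le> 1 / s")
        case True
        then show ?thesis using \<kappa>_shift[OF True] by (simp add: abs_le_iff minus_le_iff indicator_def)
      qed simp
    qed simp
    also have "\<dots> = ennreal s * (ennreal (1 / 8) * ennreal (2 / s))"
      using s by (simp add: nn_integral_cmult nn_integral_cmult_indicator field_simps)
    also have "\<dots> = ennreal (1 / 4)"
      using s by (simp add: ennreal_mult[symmetric])
    finally show ?thesis .
  qed
  have E_int: "integrable lborel E" using E_nn by (intro integrableI_bounded) (auto simp: order_le_less_trans)
  have HE: "integrable lborel (\<lambda>y. H y * E y)" "\<bar>LINT y|lborel. H y * E y\<bar> \<le> \<Delta> / 4"
  proof -
    have pt: "\<bar>H y * E y\<bar> \<le> \<Delta> * \<bar>E y\<bar>" for y using \<Delta>[of y] by (simp add: abs_mult mult_right_mono)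
    show i: "integrable lborel (\<lambda>y. H y * E y)"
      by (rule Bochner_Integration.integrable_bound[OF integrable_mult_right[OF E_int, of \<Delta>]])
        (use pt \<Delta>0 in \<open>auto simp: abs_mult\<close>)
    have "\<bar>LINT y|lborel. H y * E y\<bar> \<le> (LINT y|lborel. \<bar>H y * E y\<bar>)" by (rule integral_abs_bound)
    also have "\<dots> \<le> (LINT y|lborel. \<Delta> * \<bar>E y\<bar>)"
      using i E_int pt by (intro integral_mono integrable_abs integrable_mult_right) auto
    also have "\<dots> = \<Delta> * (LINT y|lborel. \<bar>E y\<bar>)" by simp
    also have "(LINT y|lborel. \<bar>E y\<bar>) \<le> 1 / 4"
    proof -
      have "ennreal (LINT y|lborel. \<bar>E y\<bar>) \<le> ennreal (1 / 4)"
        using E_nn E_int by (subst nn_integral_eq_integral[symmetric]) auto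
      then show ?thesis by (simp add: ennreal_le_iff del: ennreal_eq_1)
    qed
    finally show "\<bar>LINT y|lborel. H y * E y\<bar> \<le> \<Delta> / 4" using \<Delta>0 by (simp add: mult_left_mono)
  qed
  have \<kappa>A: "integrable lborel (\<lambda>z. \<kappa> z * A z)"  "\<bar>LINT z|lborel. \<kappa> z * A z\<bar> \<le> b * a"
  proof -
    have pt: "\<bar>\<kappa> z * A z\<bar> \<le> \<bar>\<kappa> z\<bar> * a" for z using A_le[of z] by (simp add: abs_mult mult_left_mono)
    show i: "integrable lborel (\<lambda>z. \<kappa> z * A z)"
      by (rule Bochner_Integration.integrable_bound[OF integrable_mult_left[OF \<kappa>_int, of a]])
        (use pt a0 in \<open>auto simp: abs_mult\<close>)
    have "\<bar>LINT z|lborel. \<kappa> z * A z\<bar> \<le> (LINT z|lborel. \<bar>\<kappa> z * A z\<bar>)" by (rule integral_abs_bound)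
    also have "\<dots> \<le> (LINT z|lborel. \<bar>\<kappa> z\<bar> * a)"
      using i \<kappa>_int pt by (intro integral_mono integrable_abs integrable_mult_left) auto
    also have "\<dots> = (LINT z|lborel. \<bar>\<kappa> z\<bar>) * a" by simp
    also have "(LINT z|lborel. \<bar>\<kappa> z\<bar>) \<le> b"
    proof -
      have "ennreal (LINT z|lborel. \<bar>\<kappa> z\<bar>) \<le> ennreal b"
        using \<kappa>_abs \<kappa>_int by (subst nn_integral_eq_integral[symmetric]) auto
      then show ?thesis using b by (simp add: ennreal_le_iff)
    qed
    finally show "\<bar>LINT z|lborel. \<kappa> z * A z\<bar> \<le> b * a" using a0 by (simp add: mult_right_mono)
  qed
  have \<kappa>H: "integrable lborel (\<lambda>y. \<kappa> y * H y)"
    by (rule Bochner_Integration.integrable_bound[OF integrable_mult_left[OF \<kappa>_int, of \<Delta>]])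
      (use \<Delta> \<Delta>0 in \<open>auto simp: abs_mult intro!: AE_I2 mult_left_mono\<close>)
  \<comment> \<open>The kernel is split into its cell average, which sees only the cell integrals of
    \<open>H\<close>, and the remainder \<open>E\<close>, which is small in \<open>L^1\<close> and
    is paired with the bounded function \<open>H\<close>.\<close>
  have "(LINT y|lborel. \<kappa> y * H y) - s * (LINT z|lborel. \<kappa> z * A z) = (LINT y|lborel. H y * E y)"
  proof -
    have eq: "s * (H y * (LINT z|lborel. c y z * \<kappa> z)) = \<kappa> y * H y - H y * E y" for y
      by (simp add: E_eq algebra_simps)
    have "s * (LINT z|lborel. \<kappa> z * A z) = (LINT y|lborel. s * (H y * (LINT z|lborel. c y z * \<kappa> z)))"
      unfolding swap by simp
    also have "\<dots> = (LINT y|lborel. \<kappa> y * H y) - (LINT y|lborel. H y * E y)"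
      unfolding eq using \<kappa>H HE by (intro Bochner_Integration.integral_diff)
    finally show ?thesis by simp
  qed
  then have "\<bar>LINT y|lborel. \<kappa> y * H y\<bar> \<le> s * \<bar>LINT z|lborel. \<kappa> z * A z\<bar> + \<bar>LINT y|lborel. H y * E y\<bar>"
    using s abs_mult[of s "LINT z|lborel. \<kappa> z * A z"] by linarith
  also have "\<dots> \<le> s * (b * a) + \<Delta> / 4" using s \<kappa>A HE by (intro add_mono mult_left_mono) auto
  finally show ?thesis by (simp add: \<kappa>_def s_def mult.assoc)
qed

lemma schur_kernel_mono:
  assumes "schur_kernel L k B R" "B \<le> B'"
  shows "schur_kernel L k B' R"
proof -
  interpret schur_kernel L k B R by fact
  have BR: "B * R \<le> B' * R" using assms(2) R1 by (intro mult_right_mono) auto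
  show ?thesis
  proof
    show "1 \<le> B'" using B1 assms(2) by simp
    show "\<bar>k x y\<bar> \<le> B' * R" if "x \<in> space L" "y \<in> space L" for x y
      by (rule order_trans[OF k_bd[OF that] BR])
    show "(\<integral>\<^sup>+y. ennreal \<bar>k x y\<bar> \<partial>L) \<le> ennreal B'" if "x \<in> space L" for x
      by (rule order_trans[OF row[OF that] ennreal_leI[OF assms(2)]])
    show "(\<integral>\<^sup>+x. ennreal \<bar>k x y\<bar> \<partial>L) \<le> ennreal B'" if "y \<in> space L" for y
      by (rule order_trans[OF col[OF that] ennreal_leI[OF assms(2)]])
  qed (rule k_meas R1)+
qed

lemma dictionary_mono:
  assumes "dictionary \<psi> b R" "b \<le> b'"
  shows "dictionary \<psi> b' R"
proof -
  interpret dictionary \<psi> b R by fact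
  have bR: "b / R \<le> b' / R" using assms(2) R1 by (intro divide_right_mono) auto
  show ?thesis
  proof
    show "1 \<le> b'" using b1 assms(2) by simp
    show "(\<Sum>i. ennreal \<bar>\<psi> i y\<bar>) \<le> ennreal b'" for y
      by (rule order_trans[OF sum_le ennreal_leI[OF assms(2)]])
    show "(\<integral>\<^sup>+y. ennreal \<bar>\<psi> i y\<bar> \<partial>lborel) \<le> ennreal (b' / R)" for i
      by (rule order_trans[OF int_le ennreal_leI[OF bR]])
  qed (rule meas R1)+
qed

text \<open>Here \<open>R\<close> is the dilation factor \<open>2 ^ j\<close>. The last condition replaces \<open>K\<^sub>j h\<close> by countably many
  functionals of \<open>h\<close> in the case \<open>r = \<infinity>\<close>; the term \<open>\<Delta> / 4\<close> is needed only for convolution kernels.\<close>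

definition good_kernel :: "real set \<Rightarrow> real \<Rightarrow> real \<Rightarrow> (real \<Rightarrow> real \<Rightarrow> real) \<Rightarrow> bool" where
  "good_kernel T B R k \<longleftrightarrow> schur_kernel (restrict_space lborel T) k B R \<and>
     (\<forall>w y. 0 \<le> w \<longrightarrow> w \<le> 2 \<longrightarrow> y \<in> T \<longrightarrow>
        (\<integral>\<^sup>+x. ennreal (\<bar>k x y\<bar> * (1 + \<bar>x\<bar>) powr w) \<partial>restrict_space lborel T)
          \<le> ennreal B * ennreal ((1 + \<bar>y\<bar>) powr w)) \<and>
     (\<exists>\<psi>. dictionary \<psi> B R \<and>
        (\<forall>h \<Delta> a x. integrable (restrict_space lborel T) h \<longrightarrow> (\<forall>y\<in>T. \<bar>h y\<bar> \<le> \<Delta>) \<longrightarrow>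
           (\<forall>i. \<bar>LINT y|restrict_space lborel T. \<psi> i y * h y\<bar> \<le> a) \<longrightarrow> x \<in> T \<longrightarrow>
           \<bar>LINT y|restrict_space lborel T. k x y * h y\<bar> \<le> B * R * a + \<Delta> / 4))"

text \<open>The requirements arise with different constants in the individual cases; this rule
  enlarges them to a common one. For the last requirement this uses that \<open>a\<close>, a bound
  for absolute values, is nonnegative.\<close>

lemma good_kernelI:
  assumes B: "schur_kernel (restrict_space lborel T) k B1 R" "B1 \<le> B"
    and W: "\<And>w y. 0 \<le> w \<Longrightarrow> w \<le> 2 \<Longrightarrow> y \<in> T \<Longrightarrow>
        (\<integral>\<^sup>+x. ennreal (\<bar>k x y\<bar> * (1 + \<bar>x\<bar>) powr w) \<partial>restrict_space lborel T)
          \<le> ennreal B2 * ennreal ((1 + \<bar>y\<bar>) powr w)" "B2 \<le> B"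
    and \<psi>: "dictionary \<psi> B3 R" "B3 \<le> B"
    and h: "\<And>h \<Delta> a x. integrable (restrict_space lborel T) h \<Longrightarrow> (\<And>y. y \<in> T \<Longrightarrow> \<bar>h y\<bar> \<le> \<Delta>) \<Longrightarrow>
           (\<And>i. \<bar>LINT y|restrict_space lborel T. \<psi> i y * h y\<bar> \<le> a) \<Longrightarrow> x \<in> T \<Longrightarrow>
           \<bar>LINT y|restrict_space lborel T. k x y * h y\<bar> \<le> B4 * R * a + \<Delta> / 4" "B4 \<le> B"
  shows "good_kernel T B R k"
  unfolding good_kernel_def
proof (intro conjI exI[of _ \<psi>] allI impI)
  show "schur_kernel (restrict_space lborel T) k B R" by (rule schur_kernel_mono[OF B])
  show "dictionary \<psi> B R" by (rule dictionary_mono[OF \<psi>])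
  show "(\<integral>\<^sup>+x. ennreal (\<bar>k x y\<bar> * (1 + \<bar>x\<bar>) powr w) \<partial>restrict_space lborel T)
          \<le> ennreal B * ennreal ((1 + \<bar>y\<bar>) powr w)" if "0 \<le> w" "w \<le> 2" "y \<in> T" for w y
    by (rule order_trans[OF W(1)[OF that]]) (intro mult_right_mono ennreal_leI W(2); simp)
  fix h :: "real \<Rightarrow> real" and \<Delta> a x
  assume *: "integrable (restrict_space lborel T) h" "\<forall>y\<in>T. \<bar>h y\<bar> \<le> \<Delta>"
    "\<forall>i. \<bar>LINT y|restrict_space lborel T. \<psi> i y * h y\<bar> \<le> a" "x \<in> T"
  have "0 \<le> a" using *(3) by (meson abs_ge_zero order_trans)
  moreover have "1 \<le> R" using B(1) by (simp add: schur_kernel_def schur_kernel_axioms_def)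
  ultimately have "B4 * R * a \<le> B * R * a" using h(2) by (intro mult_right_mono) auto
  moreover have "\<bar>LINT y|restrict_space lborel T. k x y * h y\<bar> \<le> B4 * R * a + \<Delta> / 4"
    using * by (intro h(1)) auto
  ultimately show "\<bar>LINT y|restrict_space lborel T. k x y * h y\<bar> \<le> B * R * a + \<Delta> / 4" by linarith
qed

lemma (in dictionary) good_dictionary_kernel:
  assumes T: "T \<in> sets borel" and h: "integrable (restrict_space lborel T) h"
    "\<And>y. y \<in> T \<Longrightarrow> \<bar>h y\<bar> \<le> \<Delta>" "\<And>i. \<bar>LINT y|restrict_space lborel T. \<psi> i y * h y\<bar> \<le> a" "x \<in> T"
  shows "\<bar>LINT y|restrict_space lborel T. ker x y * h y\<bar> \<le> b * R * a + \<Delta> / 4"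
proof -
  have "0 \<le> \<Delta>" using h(2)[OF h(4)] by linarith
  then show ?thesis using ker_reconstruct[OF T h(1,3), of x] by linarith
qed

lemma mu_norm_mono_weight:
  assumes "0 \<le> w" "w \<le> v"
  shows "mu_norm T w f \<le> mu_norm T v f"
  unfolding mu_norm_def using assms
  by (intro nn_integral_mono mult_right_mono ennreal_leI mult_left_mono powr_mono) auto

lemma mu_norm_square:
  fixes f :: "real \<Rightarrow> real"
  assumes "2 < v" "mu_norm UNIV v f < \<top>"
  obtains A where "0 \<le> A" "(\<integral>\<^sup>+u. ennreal (\<bar>f u\<bar> * (1 + \<bar>u\<bar>)\<^sup>2) \<partial>lborel) \<le> ennreal A"
proof -
  have "(\<integral>\<^sup>+u. ennreal (\<bar>f u\<bar> * (1 + \<bar>u\<bar>)\<^sup>2) \<partial>lborel) = mu_norm UNIV 2 f"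
    by (simp add: mu_norm_def)
  also have "\<dots> \<le> mu_norm UNIV v f" using assms by (intro mu_norm_mono_weight) auto
  finally have "(\<integral>\<^sup>+u. ennreal (\<bar>f u\<bar> * (1 + \<bar>u\<bar>)\<^sup>2) \<partial>lborel) < \<top>" using assms(2) by (rule order_le_less_trans)
  then show ?thesis
    by (cases "\<integral>\<^sup>+u. ennreal (\<bar>f u\<bar> * (1 + \<bar>u\<bar>)\<^sup>2) \<partial>lborel") (auto intro: that)
qed

section \<open>Verification of the three admissible cases, uniformly in the level\<close>

lemma good_convolution:
  assumes K: "convolution_kernel K" and T: "T \<in> sets borel"
  obtains B where "1 \<le> B" "\<And>j. good_kernel T B (2 ^ j) (dilated_kernel K j)"
proof -
  obtain k v where Kk': "\<forall>x y. K x y = k (x - y)" and k[measurable]: "k \<in> borel_measurable borel"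
    and bd: "bounded (range k)"
    and cont: "(\<forall>x. continuous (at_right x) k) \<or> (\<forall>x. continuous (at_left x) k)"
    and v: "2 < v" "mu_norm UNIV v k < \<top>"
    using K unfolding convolution_kernel_def by (elim exE conjE) (rule that; assumption)
  have Kk: "K x y = k (x - y)" for x y using Kk' by blast
  obtain A where A: "0 \<le> A" "(\<integral>\<^sup>+u. ennreal (\<bar>k u\<bar> * (1 + \<bar>u\<bar>)\<^sup>2) \<partial>lborel) \<le> ennreal A"
    using mu_norm_square[OF v] by blast
  obtain b0 where b0: "\<And>u. \<bar>k u\<bar> \<le> b0" using bd by (auto simp: bounded_iff)
  have k1: "(\<integral>\<^sup>+u. ennreal \<bar>k u\<bar> \<partial>lborel) \<le> ennreal A"
  proof (rule order_trans[OF nn_integral_mono A(2)])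
    fix u :: real
    have "1 \<le> (1 + \<bar>u\<bar>)\<^sup>2" by (intro one_le_power) simp
    then show "ennreal \<bar>k u\<bar> \<le> ennreal (\<bar>k u\<bar> * (1 + \<bar>u\<bar>)\<^sup>2)"
      using mult_left_mono[of 1 "(1 + \<bar>u\<bar>)\<^sup>2" "\<bar>k u\<bar>"] by (intro ennreal_leI) simp
  qed
  have int_k: "integrable lborel k"
    using k1 by (intro integrableI_bounded) (auto simp: order_le_less_trans)
  obtain t0 where t0: "0 < t0" "\<And>t. \<bar>t\<bar> \<le> t0 \<Longrightarrow> (\<integral>\<^sup>+u. ennreal \<bar>k (u + t) - k u\<bar> \<partial>lborel) \<le> ennreal (1 / 8)"
    using L1_modulus[OF int_k cont, of "1 / 8"] by auto
  \<comment> \<open>The number of refinements of the grid: \<open>1 / q\<close> is a shift for which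
    the modulus is at most \<open>1 / 8\<close>. Taking \<open>q \<ge> 1\<close> keeps the cells no
    longer than \<open>1 / R\<close>, as the norm bound of the dictionary demands.\<close>
  define q where "q = max 1 (1 / t0)"
  have q: "1 \<le> q" "1 / q \<le> t0"
    using t0(1) by (auto simp: q_def max_def field_simps)
  define B where "B = max (max 1 b0) (max A (q * A))"
  have "good_kernel T B (2 ^ j) (dilated_kernel K j)" for j
  proof -
    define R where "R = (2 ^ j :: real)"
    have R: "1 \<le> R" by (simp add: R_def)
    have dk: "dilated_kernel K j x y = R * k (R * x - R * y)" for x y
      by (simp add: dilated_kernel_def Kk R_def)
    have abs_dk: "\<bar>dilated_kernel K j x y\<bar> \<le> R * \<bar>k (R * x - R * y)\<bar>" for x y
      unfolding dk using R by (simp add: abs_mult)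
    \<comment> \<open>Indicators of the cells of length \<open>1 / (R * q)\<close>, enumerated by
      the natural numbers through the coding of the integers. Exactly one of them is nonzero at each
      point.\<close>
    define \<psi> where "\<psi> i y = (of_bool (\<lfloor>R * q * y\<rfloor> = int_decode i) :: real)" for i y
    have Rq: "0 < R * q" using R q by simp
    have "good_kernel T B R (dilated_kernel K j)"
    proof (rule good_kernelI)
      show "schur_kernel (restrict_space lborel T) (dilated_kernel K j) (max (max 1 b0) A) R"
      proof (rule dominated_schur[where \<Phi> = "\<lambda>u. \<bar>k u\<bar>", OF T _ R _ abs_dk])
        show "(\<lambda>(x, y). dilated_kernel K j x y) \<in> borel_measurable (borel \<Otimes>\<^sub>M borel)" unfolding dk by measurable
        show "\<bar>k u\<bar> \<le> max (max 1 b0) A" for u using b0[of u] by simp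
        show "(\<integral>\<^sup>+u. ennreal (\<bar>k u\<bar> * (1 + \<bar>u\<bar>)\<^sup>2) \<partial>lborel) \<le> ennreal (max (max 1 b0) A)"
          by (rule order_trans[OF A(2)]) (simp add: ennreal_leI)
      qed (auto simp: max_def)
      show "(\<integral>\<^sup>+x. ennreal (\<bar>dilated_kernel K j x y\<bar> * (1 + \<bar>x\<bar>) powr w) \<partial>restrict_space lborel T)
          \<le> ennreal A * ennreal ((1 + \<bar>y\<bar>) powr w)" if "0 \<le> w" "w \<le> 2" "y \<in> T" for w y
        by (rule dominated_weighted_col[where \<Phi> = "\<lambda>u. \<bar>k u\<bar>", OF T _ R abs_dk A(2) that(1,2)]) measurable
      show "dictionary \<psi> 1 R"
      proof
        show "\<psi> i \<in> borel_measurable borel" for i unfolding \<psi>_def by measurable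
        show "(\<Sum>i. ennreal \<bar>\<psi> i y\<bar>) \<le> ennreal 1" for y
        proof -
          have "(\<Sum>i. ennreal \<bar>\<psi> i y\<bar>) = (\<Sum>i\<in>{int_encode \<lfloor>R * q * y\<rfloor>}. ennreal \<bar>\<psi> i y\<bar>)"
            by (rule suminf_finite) (auto simp: \<psi>_def)
          then show ?thesis by (simp add: \<psi>_def)
        qed
        show "(\<integral>\<^sup>+y. ennreal \<bar>\<psi> i y\<bar> \<partial>lborel) \<le> ennreal (1 / R)" for i
        proof -
          have "(\<integral>\<^sup>+y. ennreal \<bar>\<psi> i y\<bar> \<partial>lborel) = ennreal (1 / (R * q))"
            using nn_integral_cell[OF Rq, of "int_decode i"] by (simp add: \<psi>_def)
          also have "\<dots> \<le> ennreal (1 / R)" using R q by (intro ennreal_leI) (simp add: frac_le)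
          finally show ?thesis .
        qed
      qed (use R in auto)
      fix h :: "real \<Rightarrow> real" and \<Delta> a x
      assume h: "integrable (restrict_space lborel T) h" and \<Delta>: "\<And>y. y \<in> T \<Longrightarrow> \<bar>h y\<bar> \<le> \<Delta>"
        and a: "\<And>i. \<bar>LINT y|restrict_space lborel T. \<psi> i y * h y\<bar> \<le> a" and x: "x \<in> T"
      \<comment> \<open>Extension by zero outside \<open>T\<close>, since translation arguments need
        functions on the whole line.\<close>
      define H where "H y = indicator T y * h y" for y
      have res: "(LINT y|restrict_space lborel T. f y * h y) = (LINT y|lborel. f y * H y)" for f :: "real \<Rightarrow> real"
        using T by (subst integral_restrict_space) (auto simp: H_def mult_ac)
      have "\<bar>LINT y|lborel. R * k (R * x - R * y) * H y\<bar> \<le> R * q * A * a + \<Delta> / 4"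
      proof (rule convolution_reconstruct[OF int_k k1 A(1) _ R])
        show "0 < q" using q by simp
        show "(\<integral>\<^sup>+u. ennreal \<bar>k (u + t) - k u\<bar> \<partial>lborel) \<le> ennreal (1 / 8)" if "\<bar>t\<bar> \<le> 1 / q" for t
          using that q by (intro t0) auto
        show "integrable lborel H"
          using h T unfolding H_def by (subst (asm) integrable_restrict_space) auto
        show "\<bar>H y\<bar> \<le> \<Delta>" for y using \<Delta>[OF x] \<Delta>[of y] by (auto simp: H_def indicator_def)
        show "\<bar>LINT y|lborel. of_bool (\<lfloor>R * q * y\<rfloor> = m) * H y\<bar> \<le> a" for m
          using a[of "int_encode m"] by (simp add: res \<psi>_def)
      qed
      then show "\<bar>LINT y|restrict_space lborel T. dilated_kernel K j x y * h y\<bar> \<le> (q * A) * R * a + \<Delta> / 4"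
        unfolding dk res[of "\<lambda>y. R * k (R * x - R * y)"] by (simp only: mult_ac)
    qed (auto simp: B_def)
    then show ?thesis by (simp add: R_def)
  qed
  moreover have "1 \<le> B" by (simp add: B_def)
  ultimately show ?thesis by (rule that[rotated])
qed

lemma infsum_int_sums:
  fixes f :: "int \<Rightarrow> real"
  assumes "f summable_on Z"
  shows "(\<lambda>i. of_bool (int_decode i \<in> Z) * f (int_decode i)) sums infsum f Z"
proof -
  have "(f has_sum infsum f Z) Z" using assms by (rule has_sum_infsum)
  then have "((\<lambda>k. of_bool (k \<in> Z) * f k) has_sum infsum f Z) UNIV"
    by (subst has_sum_cong_neutral[where S = UNIV and T = Z and g = f]) auto
  then have "((\<lambda>i. of_bool (int_decode i \<in> Z) * f (int_decode i)) has_sum infsum f Z) UNIV"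
    using has_sum_reindex_bij_betw[OF bij_int_decode, of "\<lambda>k. of_bool (k \<in> Z) * f k"] by simp
  then show ?thesis by (rule has_sum_imp_sums)
qed

lemma good_projection:
  assumes K: "projection_kernel K" and T: "T \<in> sets borel"
  obtains B where "1 \<le> B" "\<And>j. good_kernel T B (2 ^ j) (dilated_kernel K j)"
proof -
  obtain \<phi> Z \<Phi> v where \<phi>: "integrable lborel \<phi>" "bounded (range \<phi>)"
    and sum': "\<forall>x. (\<lambda>k. \<bar>\<phi> (x - of_int k)\<bar>) summable_on Z"
      "bdd_above (range (\<lambda>x. \<Sum>\<^sub>\<infinity>k\<in>Z. \<bar>\<phi> (x - of_int k)\<bar>))"
    and Keq': "\<forall>x y. K x y = (\<Sum>\<^sub>\<infinity>k\<in>Z. \<phi> (x - of_int k) * \<phi> (y - of_int k))"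
    and \<Phi>[measurable]: "\<Phi> \<in> borel_measurable borel" and v: "2 < v" "mu_norm UNIV v \<Phi> < \<top>"
    and dom': "\<forall>x y. \<bar>K x y\<bar> \<le> \<Phi> \<bar>x - y\<bar>"
    using K unfolding projection_kernel_def by (elim exE conjE) (rule that; assumption)
  have sum: "(\<lambda>k. \<bar>\<phi> (x - of_int k)\<bar>) summable_on Z"
    and Keq: "K x y = (\<Sum>\<^sub>\<infinity>k\<in>Z. \<phi> (x - of_int k) * \<phi> (y - of_int k))"
    and dom: "\<bar>K x y\<bar> \<le> \<Phi> \<bar>x - y\<bar>" for x y using sum'(1) Keq' dom' by blast+
  have [measurable]: "\<phi> \<in> borel_measurable borel" using \<phi>(1) by simp
  obtain A where A: "0 \<le> A" "(\<integral>\<^sup>+u. ennreal (\<bar>\<Phi> u\<bar> * (1 + \<bar>u\<bar>)\<^sup>2) \<partial>lborel) \<le> ennreal A"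
    using mu_norm_square[OF v] by blast
  obtain b0 where b0: "\<And>u. \<bar>\<phi> u\<bar> \<le> b0" using \<phi>(2) by (auto simp: bounded_iff)
  obtain b1 where b1: "\<And>x. (\<Sum>\<^sub>\<infinity>k\<in>Z. \<bar>\<phi> (x - of_int k)\<bar>) \<le> b1" using sum'(2) by (auto simp: bdd_above_def)
  define b2 where "b2 = (LINT x|lborel. \<bar>\<phi> x\<bar>)"
  have b2: "(\<integral>\<^sup>+x. ennreal \<bar>\<phi> x\<bar> \<partial>lborel) = ennreal b2"
    unfolding b2_def using \<phi>(1) by (intro nn_integral_eq_integral) auto
  have b2_0: "0 \<le> b2" by (simp add: b2_def)
  define b where "b = max 1 (max b1 b2)"
  \<comment> \<open>Translates with index outside \<open>Z\<close> are replaced by zero, so that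
    every subset of the integers is handled by one sequence over the natural numbers.\<close>
  define f where "f i x = of_bool (int_decode i \<in> Z) * \<phi> (x - of_int (int_decode i))" for i x
  have f_sum: "(\<Sum>i. ennreal \<bar>f i x\<bar>) \<le> ennreal b" for x
  proof -
    have s: "(\<lambda>i. \<bar>f i x\<bar>) sums (\<Sum>\<^sub>\<infinity>k\<in>Z. \<bar>\<phi> (x - of_int k)\<bar>)"
      using infsum_int_sums[OF sum[of x]] by (simp add: f_def abs_mult)
    have "(\<Sum>i. ennreal \<bar>f i x\<bar>) = ennreal (\<Sum>\<^sub>\<infinity>k\<in>Z. \<bar>\<phi> (x - of_int k)\<bar>)"
      using s by (intro suminf_ennreal_eq) auto
    then show ?thesis using b1[of x] by (simp add: b_def ennreal_leI)
  qed
  have K_sum: "K x y = (\<Sum>i. f i x * f i y)" for x y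
  proof -
    have "(\<lambda>k. \<phi> (x - of_int k) * \<phi> (y - of_int k)) summable_on Z"
    proof (rule Infinite_Sum.abs_summable_summable)
      show "(\<lambda>k. norm (\<phi> (x - of_int k) * \<phi> (y - of_int k))) summable_on Z"
      proof (rule Infinite_Sum.abs_summable_on_comparison_test)
        show "(\<lambda>k. norm (b0 * \<phi> (x - of_int k))) summable_on Z"
          using summable_on_cmult_right[OF sum[of x], of "\<bar>b0\<bar>"] by (simp add: abs_mult)
        show "norm (\<phi> (x - of_int k) * \<phi> (y - of_int k)) \<le> norm (b0 * \<phi> (x - of_int k))" for k
          using mult_left_mono[OF b0[of "y - of_int k"], of "\<bar>\<phi> (x - of_int k)\<bar>"] b0[of 0]
          by (simp add: abs_mult mult.commute)
      qed
    qed
    from sums_unique[OF infsum_int_sums[OF this]]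
    have "K x y = (\<Sum>i. of_bool (int_decode i \<in> Z) * (\<phi> (x - of_int (int_decode i)) * \<phi> (y - of_int (int_decode i))))"
      unfolding Keq .
    also have "\<dots> = (\<Sum>i. f i x * f i y)"
      by (intro suminf_cong) (auto simp: f_def)
    finally show ?thesis .
  qed
  \<comment> \<open>Folding the profile to \<open>\<Phi> \<bar>u\<bar>\<close> uses its values on
    one half line twice, hence the factor two.\<close>
  define A' where "A' = 2 * A"
  have A': "(\<integral>\<^sup>+u. ennreal (\<Phi> \<bar>u\<bar> * (1 + \<bar>u\<bar>)\<^sup>2) \<partial>lborel) \<le> ennreal A'"
  proof -
    have "(\<integral>\<^sup>+u. ennreal (\<Phi> \<bar>u\<bar> * (1 + \<bar>u\<bar>)\<^sup>2) \<partial>lborel) \<le>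
      (\<integral>\<^sup>+u. ennreal (\<bar>\<Phi> u\<bar> * (1 + \<bar>u\<bar>)\<^sup>2) + ennreal (\<bar>\<Phi> (- u)\<bar> * (1 + \<bar>u\<bar>)\<^sup>2) \<partial>lborel)"
    proof (intro nn_integral_mono)
      fix u :: real
      show "ennreal (\<Phi> \<bar>u\<bar> * (1 + \<bar>u\<bar>)\<^sup>2) \<le> ennreal (\<bar>\<Phi> u\<bar> * (1 + \<bar>u\<bar>)\<^sup>2) + ennreal (\<bar>\<Phi> (- u)\<bar> * (1 + \<bar>u\<bar>)\<^sup>2)"
      proof -
        have "\<Phi> \<bar>u\<bar> \<le> \<bar>\<Phi> u\<bar> + \<bar>\<Phi> (- u)\<bar>" by (cases "0 \<le> u") auto
        then have "\<Phi> \<bar>u\<bar> * (1 + \<bar>u\<bar>)\<^sup>2 \<le> (\<bar>\<Phi> u\<bar> + \<bar>\<Phi> (- u)\<bar>) * (1 + \<bar>u\<bar>)\<^sup>2"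
          by (rule mult_right_mono) simp
        then show ?thesis by (simp add: ennreal_plus[symmetric] distrib_right ennreal_leI del: ennreal_plus)
      qed
    qed
    also have "\<dots> = (\<integral>\<^sup>+u. ennreal (\<bar>\<Phi> u\<bar> * (1 + \<bar>u\<bar>)\<^sup>2) \<partial>lborel) + (\<integral>\<^sup>+u. ennreal (\<bar>\<Phi> (- u)\<bar> * (1 + \<bar>u\<bar>)\<^sup>2) \<partial>lborel)"
      by (rule nn_integral_add) auto
    also have "(\<integral>\<^sup>+u. ennreal (\<bar>\<Phi> (- u)\<bar> * (1 + \<bar>u\<bar>)\<^sup>2) \<partial>lborel) = (\<integral>\<^sup>+u. ennreal (\<bar>\<Phi> u\<bar> * (1 + \<bar>u\<bar>)\<^sup>2) \<partial>lborel)"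
      using nn_integral_real_affine[of "\<lambda>u. ennreal (\<bar>\<Phi> u\<bar> * (1 + \<bar>u\<bar>)\<^sup>2)" "- 1" 0] by simp
    also have "(\<integral>\<^sup>+u. ennreal (\<bar>\<Phi> u\<bar> * (1 + \<bar>u\<bar>)\<^sup>2) \<partial>lborel) + (\<integral>\<^sup>+u. ennreal (\<bar>\<Phi> u\<bar> * (1 + \<bar>u\<bar>)\<^sup>2) \<partial>lborel) \<le> ennreal A + ennreal A"
      by (intro add_mono A)
    finally show ?thesis using A(1) by (simp add: A'_def ennreal_plus[symmetric] del: ennreal_plus)
  qed
  define B where "B = max (b\<^sup>2) (max A' b)"
  have "good_kernel T B (2 ^ j) (dilated_kernel K j)" for j
  proof -
    define R where "R = (2 ^ j :: real)"
    have R: "1 \<le> R" by (simp add: R_def)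
    define \<psi> where "\<psi> i y = f i (R * y)" for i y
    interpret D: dictionary \<psi> b R
    proof
      show "\<psi> i \<in> borel_measurable borel" for i unfolding \<psi>_def f_def by measurable
      show "(\<Sum>i. ennreal \<bar>\<psi> i y\<bar>) \<le> ennreal b" for y using f_sum[of "R * y"] by (simp add: \<psi>_def)
      show "(\<integral>\<^sup>+y. ennreal \<bar>\<psi> i y\<bar> \<partial>lborel) \<le> ennreal (b / R)" for i
      proof -
        let ?m = "of_int (int_decode i) :: real"
        have "ennreal R * (\<integral>\<^sup>+y. ennreal \<bar>\<phi> (- ?m + R * y)\<bar> \<partial>lborel) = ennreal b2"
          using nn_integral_real_affine[of "\<lambda>u. ennreal \<bar>\<phi> u\<bar>" R "- ?m"] R b2 by simp
        then have "ennreal (1 / R) * (ennreal R * (\<integral>\<^sup>+y. ennreal \<bar>\<phi> (- ?m + R * y)\<bar> \<partial>lborel)) = ennreal (1 / R) * ennreal b2"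
          by simp
        then have eq: "(\<integral>\<^sup>+y. ennreal \<bar>\<phi> (- ?m + R * y)\<bar> \<partial>lborel) = ennreal (b2 / R)"
          using R b2_0 by (simp add: mult.assoc[symmetric] ennreal_mult[symmetric])
        have "(\<integral>\<^sup>+y. ennreal \<bar>\<psi> i y\<bar> \<partial>lborel) \<le> (\<integral>\<^sup>+y. ennreal \<bar>\<phi> (- ?m + R * y)\<bar> \<partial>lborel)"
          by (intro nn_integral_mono ennreal_leI) (simp add: \<psi>_def f_def abs_mult)
        also have "\<dots> \<le> ennreal (b / R)" unfolding eq using R by (intro ennreal_leI divide_right_mono) (auto simp: b_def)
        finally show ?thesis .
      qed
    qed (use R in \<open>auto simp: b_def\<close>)
    have ker: "dilated_kernel K j = D.ker"
      by (simp add: fun_eq_iff dilated_kernel_def D.ker_def K_sum \<psi>_def flip: R_def)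
    have abs_dk: "\<bar>dilated_kernel K j x y\<bar> \<le> R * \<Phi> \<bar>R * x - R * y\<bar>" for x y
      using mult_left_mono[OF dom[of "R * x" "R * y"], of R] R by (simp add: dilated_kernel_def abs_mult R_def)
    have "good_kernel T B R (dilated_kernel K j)"
    proof (rule good_kernelI)
      show "schur_kernel (restrict_space lborel T) (dilated_kernel K j) (b\<^sup>2) R" unfolding ker by (rule D.schur_ker[OF T])
      show "(\<integral>\<^sup>+x. ennreal (\<bar>dilated_kernel K j x y\<bar> * (1 + \<bar>x\<bar>) powr w) \<partial>restrict_space lborel T)
          \<le> ennreal A' * ennreal ((1 + \<bar>y\<bar>) powr w)" if "0 \<le> w" "w \<le> 2" "y \<in> T" for w y
        by (rule dominated_weighted_col[where \<Phi> = "\<lambda>u. \<Phi> \<bar>u\<bar>", OF T _ R abs_dk A' that(1,2)]) measurable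
      show "dictionary \<psi> b R" by (rule D.dictionary_axioms)
      show "\<bar>LINT y|restrict_space lborel T. dilated_kernel K j x y * h y\<bar> \<le> b * R * a + \<Delta> / 4"
        if "integrable (restrict_space lborel T) h" "\<And>y. y \<in> T \<Longrightarrow> \<bar>h y\<bar> \<le> \<Delta>"
          "\<And>i. \<bar>LINT y|restrict_space lborel T. \<psi> i y * h y\<bar> \<le> a" "x \<in> T" for h \<Delta> a x
        unfolding ker by (rule D.good_dictionary_kernel[OF T that])
    qed (auto simp: B_def)
    then show ?thesis by (simp add: R_def)
  qed
  moreover have "1 \<le> B" by (simp add: B_def b_def)
  ultimately show ?thesis by (rule that[rotated])
qed

lemma dilated_abs_integral_le:
  fixes f :: "real \<Rightarrow> real"
  assumes [measurable]: "f \<in> borel_measurable borel" and R: "0 < R" and b: "\<And>u. \<bar>f u\<bar> \<le> b"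
    and supp: "\<And>u. u \<notin> {l..l + m} \<Longrightarrow> f u = 0" and m: "0 \<le> m"
  shows "(\<integral>\<^sup>+x. ennreal \<bar>f (t + R * x)\<bar> \<partial>lborel) \<le> ennreal (b * m / R)"
proof -
  have b0: "0 \<le> b" using b[of 0] by linarith
  have "(\<integral>\<^sup>+u. ennreal \<bar>f u\<bar> \<partial>lborel) \<le> (\<integral>\<^sup>+u. ennreal b * indicator {l..l + m} u \<partial>lborel)"
    using b supp by (intro nn_integral_mono) (auto simp: indicator_def ennreal_leI)
  also have "\<dots> = ennreal (b * m)" using b0 m by (simp add: nn_integral_cmult_indicator ennreal_mult[symmetric])
  finally have *: "(\<integral>\<^sup>+u. ennreal \<bar>f u\<bar> \<partial>lborel) \<le> ennreal (b * m)" .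
  have "(\<integral>\<^sup>+x. ennreal \<bar>f (t + R * x)\<bar> \<partial>lborel) = ennreal (1 / R) * (ennreal R * (\<integral>\<^sup>+x. ennreal \<bar>f (t + R * x)\<bar> \<partial>lborel))"
    using R by (simp add: mult.assoc[symmetric] ennreal_mult[symmetric])
  also have "ennreal R * (\<integral>\<^sup>+x. ennreal \<bar>f (t + R * x)\<bar> \<partial>lborel) = (\<integral>\<^sup>+u. ennreal \<bar>f u\<bar> \<partial>lborel)"
    using nn_integral_real_affine[of "\<lambda>u. ennreal \<bar>f u\<bar>" R t] R by simp
  also have "ennreal (1 / R) * \<dots> \<le> ennreal (1 / R) * ennreal (b * m)" by (rule mult_left_mono[OF *]) simp
  also have "\<dots> = ennreal (b * m / R)" using R b0 m by (simp add: ennreal_mult[symmetric])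
  finally show ?thesis .
qed

text \<open>The overlap is bounded independently of the level: besides the \<open>2 * N\<close> edge
  functions, at most \<open>2 * N\<close> consecutive translates of the scaling function can be
  nonzero at a given point.\<close>

lemma good_cdv:
  assumes cdv: "cdv_system N \<phi> \<phi>0 \<phi>1" and J0: "2 * N \<le> 2 ^ J0"
  obtains B where "1 \<le> B" "\<And>j. J0 \<le> j \<Longrightarrow> good_kernel {0..1} B (2 ^ j) (cdv_kernel N \<phi> \<phi>0 \<phi>1 j)"
proof -
  have N: "1 \<le> N" and \<phi>[measurable]: "\<phi> \<in> borel_measurable borel" and \<phi>b: "bounded (range \<phi>)"
    and \<phi>s: "\<And>x. x \<notin> {1 - real N..real N} \<Longrightarrow> \<phi> x = 0"
    using cdv by (auto simp: cdv_system_def daubechies_scaling_def)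
  have \<phi>0: "\<phi>0 k \<in> borel_measurable borel" "bounded (range (\<phi>0 k))" "\<And>x. x \<notin> {0..2 * real N - 1} \<Longrightarrow> \<phi>0 k x = 0"
    and \<phi>1: "\<phi>1 k \<in> borel_measurable borel" "bounded (range (\<phi>1 k))" "\<And>x. x \<notin> {1 - 2 * real N..0} \<Longrightarrow> \<phi>1 k x = 0"
    if "k < N" for k
    using cdv that unfolding cdv_system_def orthonormal_edge_def by blast+
  obtain b\<phi> where b\<phi>: "\<And>x. \<bar>\<phi> x\<bar> \<le> b\<phi>" using \<phi>b by (auto simp: bounded_iff)
  have "\<forall>k. \<exists>b. k < N \<longrightarrow> (\<forall>x. \<bar>\<phi>0 k x\<bar> \<le> b \<and> \<bar>\<phi>1 k x\<bar> \<le> b)"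
  proof
    fix k
    show "\<exists>b. k < N \<longrightarrow> (\<forall>x. \<bar>\<phi>0 k x\<bar> \<le> b \<and> \<bar>\<phi>1 k x\<bar> \<le> b)"
    proof (cases "k < N")
      case True
      obtain b0 b1 where "\<And>x. \<bar>\<phi>0 k x\<bar> \<le> b0" "\<And>x. \<bar>\<phi>1 k x\<bar> \<le> b1"
        using \<phi>0(2)[OF True] \<phi>1(2)[OF True] by (auto simp: bounded_iff)
      then show ?thesis by (intro exI[of _ "max b0 b1"]) (auto simp: le_max_iff_disj)
    qed simp
  qed
  then obtain be where be: "\<And>k x. k < N \<Longrightarrow> \<bar>\<phi>0 k x\<bar> \<le> be k \<and> \<bar>\<phi>1 k x\<bar> \<le> be k" by metis
  have b\<phi>0: "0 \<le> b\<phi>" using b\<phi>[of 0] by linarith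
  have be0: "0 \<le> be k" if "k < N" for k using be[OF that, of 0] by linarith
  define bb where "bb = 1 + b\<phi> + (\<Sum>k<N. be k)"
  have bsum: "be k \<le> (\<Sum>k<N. be k)" if "k < N" for k
    using that be0 by (intro member_le_sum) auto
  have bsum0: "0 \<le> (\<Sum>k<N. be k)" using be0 by (intro sum_nonneg) auto
  have bb1: "1 \<le> bb" using b\<phi>0 bsum0 by (simp add: bb_def)
  have bb: "\<bar>\<phi> x\<bar> \<le> bb" "k < N \<Longrightarrow> \<bar>\<phi>0 k x\<bar> \<le> bb" "k < N \<Longrightarrow> \<bar>\<phi>1 k x\<bar> \<le> bb" for x k
    using b\<phi>[of x] be[of k x] bsum[of k] bsum0 b\<phi>0 by (auto simp: bb_def)
  \<comment> \<open>At most \<open>4 * N\<close> functions contribute at any point, each bounded by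
    \<open>bb\<close>. The same number also exceeds the \<open>L^1\<close> norm before scaling, as
    every support has length at most \<open>2 * N - 1\<close>.\<close>
  define b where "b = 4 * real N * bb"
  have b1: "1 \<le> b" using N bb1 mult_mono[of 1 "4 * real N" 1 bb] by (simp add: b_def)
  \<comment> \<open>The additional factor \<open>4\<close> bounds the weight
    \<open>(1 + \<bar>x\<bar>) powr w\<close> on the unit interval for
    \<open>w \<le> 2\<close>.\<close>
  define B where "B = 4 * b\<^sup>2"
  have bB: "b \<le> b\<^sup>2" using b1 mult_left_mono[of 1 b b] by (simp add: power2_eq_square)
  have T: "{0..1::real} \<in> sets borel" by simp
  have "good_kernel {0..1} B (2 ^ j) (cdv_kernel N \<phi> \<phi>0 \<phi>1 j)" if j: "J0 \<le> j" for j
  proof -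
    define R where "R = (2 ^ j :: real)"
    have R: "1 \<le> R" by (simp add: R_def)
    have "(2::nat) ^ J0 \<le> 2 ^ j" using j by (intro power_increasing) auto
    \<comment> \<open>This keeps left and right edge indices disjoint and prevents truncation in the
      natural subtraction \<open>2 ^ j - N\<close>, so the reversed index
      \<open>2 ^ j - 1 - k\<close> is below \<open>N\<close> at the right edge.\<close>
    then have Nj: "2 * N \<le> 2 ^ j" by (rule order_trans[OF J0])
    define c where "c k x = (if k < 2 ^ j then (if k < N then \<phi>0 k (R * x)
        else if k < 2 ^ j - N then \<phi> (R * x - real k) else \<phi>1 (2 ^ j - 1 - k) (R * (x - 1))) else 0)" for k x
    have cdv_c: "cdv_basis N \<phi> \<phi>0 \<phi>1 j k x = sqrt R * c k x" if "k < 2 ^ j" for k x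
      using that by (simp add: cdv_basis_def c_def R_def)
    have c_bd: "\<bar>c k x\<bar> \<le> bb" for k x
      using bb bb1 Nj by (auto simp: c_def)
    interpret D: dictionary c b R
    proof
      show "c k \<in> borel_measurable borel" for k
      proof -
        have "k < 2 ^ j \<Longrightarrow> \<not> k < 2 ^ j - N \<Longrightarrow> 2 ^ j - 1 - k < N" by auto
        then have m1: "k < 2 ^ j \<Longrightarrow> \<not> k < 2 ^ j - N \<Longrightarrow> \<phi>1 (2 ^ j - 1 - k) \<in> borel_measurable borel"
          using \<phi>1(1) by blast
        consider "\<not> k < 2 ^ j" | "k < 2 ^ j" "k < N" | "k < 2 ^ j" "\<not> k < N" "k < 2 ^ j - N"
          | "k < 2 ^ j" "\<not> k < N" "\<not> k < 2 ^ j - N" by blast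
        then show ?thesis
        proof cases
          case 1 then show ?thesis by (simp add: c_def[abs_def])
        next
          case 2
          note [measurable] = \<phi>0(1)[OF 2(2)]
          from 2 show ?thesis by (simp add: c_def[abs_def])
        next
          case 3 then show ?thesis by (simp add: c_def[abs_def])
        next
          case 4
          note [measurable] = m1[OF 4(1,3)]
          have eq: "c k = (\<lambda>x. \<phi>1 (2 ^ j - 1 - k) (R * (x - 1)))" using 4 by (simp add: c_def[abs_def])
          show ?thesis unfolding eq by measurable
        qed
      qed
      show "(\<Sum>k. ennreal \<bar>c k x\<bar>) \<le> ennreal b" for x
      proof -
        \<comment> \<open>The first translate that can reach \<open>R * x\<close>: a nonzero
          interior value requires \<open>k\<close> between \<open>R * x - N\<close> and
          \<open>R * x + N - 1\<close>. Where the lower end is negative, \<open>nat\<close> cuts it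
          off at \<open>0\<close>.\<close>
        define m where "m = nat \<lceil>R * x - real N\<rceil>"
        define A where "A = {..<N} \<union> {2 ^ j - N..<2 ^ j} \<union> {m..<m + 2 * N}"
        have cA: "c k x = 0" if "k \<notin> A" for k
        proof (cases "k < 2 ^ j")
          case True
          have k: "\<not> k < N" "k < 2 ^ j - N" "\<not> (m \<le> k \<and> k < m + 2 * N)" using that True by (auto simp: A_def)
          have "R * x - real k \<notin> {1 - real N..real N}"
          proof
            assume "R * x - real k \<in> {1 - real N..real N}"
            then have a: "1 - real N \<le> R * x - real k" "R * x - real k \<le> real N" by auto
            have "m \<le> k" using a unfolding m_def by linarith
            moreover have "k < m + 2 * N"
            proof -
              have "R * x - real N \<le> real m" unfolding m_def by linarith
              then have "real k < real m + 2 * real N" using a by linarith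
              then show ?thesis by linarith
            qed
            ultimately show False using k(3) by blast
          qed
          then show ?thesis using True k \<phi>s by (simp add: c_def)
        qed (simp add: c_def)
        have "(\<Sum>k. ennreal \<bar>c k x\<bar>) = (\<Sum>k\<in>A. ennreal \<bar>c k x\<bar>)"
          using cA by (intro suminf_finite) (auto simp: A_def)
        also have "\<dots> \<le> (\<Sum>k\<in>A. ennreal bb)" using c_bd by (intro sum_mono ennreal_leI)
        also have "\<dots> = ennreal (real (card A) * bb)" using bb1 by (simp add: ennreal_mult ennreal_of_nat_eq_real_of_nat)
        also have "\<dots> \<le> ennreal b"
        proof -
          have "card A \<le> card {..<N} + card {2 ^ j - N..<2 ^ j} + card {m..<m + 2 * N}"
            unfolding A_def by (intro order_trans[OF card_Un_le] add_right_mono card_Un_le)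
          also have "\<dots> \<le> 4 * N" by simp
          finally have "real (card A) \<le> 4 * real N" by linarith
          then show ?thesis using bb1 unfolding b_def by (intro ennreal_leI mult_right_mono) auto
        qed
        finally show ?thesis .
      qed
      show "(\<integral>\<^sup>+x. ennreal \<bar>c k x\<bar> \<partial>lborel) \<le> ennreal (b / R)" for k
      proof -
        have le: "ennreal (bb * (2 * real N - 1) / R) \<le> ennreal (b / R)"
          using R bb1 N by (intro ennreal_leI divide_right_mono) (auto simp: b_def algebra_simps intro!: add_increasing mult_nonneg_nonneg)
        consider "\<not> k < 2 ^ j" | "k < 2 ^ j" "k < N" | "k < 2 ^ j" "\<not> k < N" "k < 2 ^ j - N"
          | "k < 2 ^ j" "\<not> k < N" "\<not> k < 2 ^ j - N" by blast
        then show ?thesis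
        proof cases
          case 1 then show ?thesis by (simp add: c_def)
        next
          case 2
          have "(\<integral>\<^sup>+x. ennreal \<bar>c k x\<bar> \<partial>lborel) = (\<integral>\<^sup>+x. ennreal \<bar>\<phi>0 k (0 + R * x)\<bar> \<partial>lborel)" using 2 by (simp add: c_def)
          also have "\<dots> \<le> ennreal (bb * (2 * real N - 1) / R)"
            by (rule dilated_abs_integral_le[where l = 0]) (use 2 \<phi>0[OF 2(2)] bb R N in auto)
          finally show ?thesis using le by (rule order_trans)
        next
          case 3
          have "(\<integral>\<^sup>+x. ennreal \<bar>c k x\<bar> \<partial>lborel) = (\<integral>\<^sup>+x. ennreal \<bar>\<phi> (- real k + R * x)\<bar> \<partial>lborel)" using 3 by (simp add: c_def)
          also have "\<dots> \<le> ennreal (bb * (2 * real N - 1) / R)"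
            by (rule dilated_abs_integral_le[where l = "1 - real N"]) (use \<phi>s bb R N in auto)
          finally show ?thesis using le by (rule order_trans)
        next
          case 4
          have k': "2 ^ j - 1 - k < N" using 4 by auto
          have "(\<integral>\<^sup>+x. ennreal \<bar>c k x\<bar> \<partial>lborel) = (\<integral>\<^sup>+x. ennreal \<bar>\<phi>1 (2 ^ j - 1 - k) (- R + R * x)\<bar> \<partial>lborel)"
            using 4 by (simp add: c_def algebra_simps)
          also have "\<dots> \<le> ennreal (bb * (2 * real N - 1) / R)"
            by (rule dilated_abs_integral_le[where l = "1 - 2 * real N"]) (use \<phi>1[OF k'] bb(3)[OF k'] R N in auto)
          finally show ?thesis using le by (rule order_trans)
        qed
      qed
    qed (use b1 R in auto)
    have ker: "cdv_kernel N \<phi> \<phi>0 \<phi>1 j = D.ker"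
    proof (intro ext)
      fix x y
      have "(\<Sum>k. c k x * c k y) = (\<Sum>k<2 ^ j. c k x * c k y)" by (rule suminf_finite) (auto simp: c_def)
      moreover have "cdv_basis N \<phi> \<phi>0 \<phi>1 j k x * cdv_basis N \<phi> \<phi>0 \<phi>1 j k y = R * (c k x * c k y)" if "k < 2 ^ j" for k
        using R by (simp add: cdv_c[OF that])
      ultimately show "cdv_kernel N \<phi> \<phi>0 \<phi>1 j x y = D.ker x y"
        by (simp add: cdv_kernel_def D.ker_def sum_distrib_left)
    qed
    interpret S: schur_kernel "restrict_space lborel {0..1}" D.ker "b\<^sup>2" R by (rule D.schur_ker[OF T])
    have "good_kernel {0..1} B R D.ker"
    proof (rule good_kernelI)
      show "schur_kernel (restrict_space lborel {0..1}) D.ker (b\<^sup>2) R" by (rule D.schur_ker[OF T])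
      show "(\<integral>\<^sup>+x. ennreal (\<bar>D.ker x y\<bar> * (1 + \<bar>x\<bar>) powr w) \<partial>restrict_space lborel {0..1})
          \<le> ennreal B * ennreal ((1 + \<bar>y\<bar>) powr w)" if w: "0 \<le> w" "w \<le> 2" and y: "y \<in> {0..1}" for w y
      proof -
        have "(\<integral>\<^sup>+x. ennreal (\<bar>D.ker x y\<bar> * (1 + \<bar>x\<bar>) powr w) \<partial>restrict_space lborel {0..1})
          \<le> (\<integral>\<^sup>+x. ennreal 4 * ennreal \<bar>D.ker x y\<bar> \<partial>restrict_space lborel {0..1})"
        proof (intro nn_integral_mono)
          fix x assume "x \<in> space (restrict_space lborel {0..1::real})"
          then have x: "0 \<le> x" "x \<le> 1" by (auto simp: space_restrict_space)
          have "(1 + \<bar>x\<bar>) powr w \<le> 2 powr w" using x w by (intro powr_mono2) auto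
          also have "\<dots> \<le> 2 powr 2" using w by (intro powr_mono) auto
          finally have "(1 + \<bar>x\<bar>) powr w \<le> 4" by simp
          then have "\<bar>D.ker x y\<bar> * (1 + \<bar>x\<bar>) powr w \<le> \<bar>D.ker x y\<bar> * 4" by (rule mult_left_mono) simp
          then show "ennreal (\<bar>D.ker x y\<bar> * (1 + \<bar>x\<bar>) powr w) \<le> ennreal 4 * ennreal \<bar>D.ker x y\<bar>"
            by (subst ennreal_mult[symmetric]) (auto simp: mult.commute intro!: ennreal_leI)
        qed
        also have "\<dots> = ennreal 4 * (\<integral>\<^sup>+x. ennreal \<bar>D.ker x y\<bar> \<partial>restrict_space lborel {0..1})"
          using S.k_sec(2)[of y] y by (intro nn_integral_cmult) (auto simp: space_restrict_space)
        also have "\<dots> \<le> ennreal 4 * ennreal (b\<^sup>2)"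
          using S.col[of y] y by (intro mult_left_mono) (auto simp: space_restrict_space)
        also have "\<dots> = ennreal B * 1" by (simp add: B_def ennreal_mult)
        also have "\<dots> \<le> ennreal B * ennreal ((1 + \<bar>y\<bar>) powr w)"
          using w y by (intro mult_left_mono) (auto simp: ennreal_1[symmetric] ge_one_powr_ge_zero simp del: ennreal_1 intro!: ennreal_leI)
        finally show ?thesis .
      qed
      show "dictionary c b R" by (rule D.dictionary_axioms)
      show "\<bar>LINT y|restrict_space lborel {0..1}. D.ker x y * h y\<bar> \<le> b * R * a + \<Delta> / 4"
        if "integrable (restrict_space lborel {0..1}) h" "\<And>y. y \<in> {0..1} \<Longrightarrow> \<bar>h y\<bar> \<le> \<Delta>"
          "\<And>i. \<bar>LINT y|restrict_space lborel {0..1}. c i y * h y\<bar> \<le> a" "x \<in> {0..1}" for h \<Delta> a x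
        by (rule D.good_dictionary_kernel[OF T that])
    qed (use b1 bB in \<open>auto simp: B_def\<close>)
    then show ?thesis by (simp add: ker R_def)
  qed
  moreover have "1 \<le> B" using b1 bB by (simp add: B_def)
  ultimately show ?thesis by (rule that[rotated])
qed

lemma admissible_good:
  assumes K: "admissible_sequence T J0 Ks" and T: "T \<in> sets borel"
  obtains B where "1 \<le> B" "\<And>j. J0 \<le> j \<Longrightarrow> good_kernel T B (2 ^ j) (Ks j)"
proof -
  consider K where "convolution_kernel K" "Ks = dilated_kernel K"
    | K where "projection_kernel K" "Ks = dilated_kernel K"
    | N \<phi> \<phi>0 \<phi>1 where "T = {0..1}" "cdv_system N \<phi> \<phi>0 \<phi>1" "2 * N \<le> 2 ^ J0"
        "\<And>j. j \<ge> J0 \<Longrightarrow> Ks j = cdv_kernel N \<phi> \<phi>0 \<phi>1 j"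
    using K unfolding admissible_sequence_def by blast
  then show ?thesis
  proof cases
    case 1 then show ?thesis using good_convolution[OF 1(1) T] that by metis
  next
    case 2 then show ?thesis using good_projection[OF 2(1) T] that by metis
  next
    case 3
    obtain B where "1 \<le> B" "\<And>j. J0 \<le> j \<Longrightarrow> good_kernel {0..1} B (2 ^ j) (cdv_kernel N \<phi> \<phi>0 \<phi>1 j)"
      using good_cdv[OF 3(2,3)] by blast
    then show ?thesis using that[of B] 3(1,4) by simp
  qed
qed

subsection \<open>Construction of the tests\<close>

lemma kernel_op_restrict:
  "T \<in> sets borel \<Longrightarrow> kernel_op T K p x = (LINT y|restrict_space lborel T. K x y * p y)"
  by (subst integral_restrict_space) (auto simp: kernel_op_def set_lebesgue_integral_def)

lemma Lr_norm_le_iff: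
  assumes T: "T \<in> sets borel" and r: "1 \<le> \<rho>" and a: "0 < a"
  shows "Lr_norm T (ennreal \<rho>) f \<le> ennreal a \<longleftrightarrow>
    (\<integral>\<^sup>+x. ennreal (\<bar>f x\<bar> powr \<rho>) \<partial>restrict_space lborel T) \<le> ennreal (a powr \<rho>)"
proof -
  let ?I = "\<integral>\<^sup>+x. ennreal (\<bar>f x\<bar> powr \<rho>) \<partial>restrict_space lborel T"
  have eq: "Lr_norm T (ennreal \<rho>) f = (if ?I = \<top> then \<top> else ennreal (enn2real ?I powr (1 / \<rho>)))"
    using T r by (simp add: Lr_norm_def Let_def nn_integral_restrict_space)
  show ?thesis
  proof (cases ?I)
    case (real i)
    have "i powr (1 / \<rho>) \<le> a \<longleftrightarrow> i \<le> a powr \<rho>"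
    proof
      assume "i powr (1 / \<rho>) \<le> a"
      then have "(i powr (1 / \<rho>)) powr \<rho> \<le> a powr \<rho>" using r by (intro powr_mono2) auto
      then show "i \<le> a powr \<rho>" using r real by (simp add: powr_powr)
    next
      assume "i \<le> a powr \<rho>"
      then have "i powr (1 / \<rho>) \<le> (a powr \<rho>) powr (1 / \<rho>)" using r real by (intro powr_mono2) auto
      then show "i powr (1 / \<rho>) \<le> a" using r a by (simp add: powr_powr)
    qed
    then show ?thesis using real a by (simp add: eq ennreal_le_iff)
  next
    case top
    then show ?thesis using a by (simp add: eq top_unique)
  qed
qed

lemma Lr_norm_real:
  assumes T: "T \<in> sets borel" and r: "1 \<le> \<rho>" and fin: "Lr_norm T (ennreal \<rho>) f < \<top>"
  obtains \<Delta> where "0 \<le> \<Delta>" "Lr_norm T (ennreal \<rho>) f = ennreal \<Delta>"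
    "(\<integral>\<^sup>+x. ennreal (\<bar>f x\<bar> powr \<rho>) \<partial>restrict_space lborel T) = ennreal (\<Delta> powr \<rho>)"
proof -
  let ?I = "\<integral>\<^sup>+x. ennreal (\<bar>f x\<bar> powr \<rho>) \<partial>restrict_space lborel T"
  have eq: "Lr_norm T (ennreal \<rho>) f = (if ?I = \<top> then \<top> else ennreal (enn2real ?I powr (1 / \<rho>)))"
    using T r by (simp add: Lr_norm_def Let_def nn_integral_restrict_space)
  have I: "?I \<noteq> \<top>" using fin eq by auto
  have "enn2real ?I = (enn2real ?I powr (1 / \<rho>)) powr \<rho>" using r by (simp add: powr_powr)
  then have "?I = ennreal ((enn2real ?I powr (1 / \<rho>)) powr \<rho>)" using I by (metis ennreal_enn2real_if)
  then show ?thesis using that[of "enn2real ?I powr (1 / \<rho>)"] eq I by simp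
qed

lemma nn_integral_weight_finite:
  fixes s :: real
  assumes "1 < s"
  obtains A where "0 \<le> A" "(\<integral>\<^sup>+x. ennreal ((1 + \<bar>x\<bar>) powr (- s)) \<partial>lborel) \<le> ennreal A"
proof -
  define F where "F x = - ((1 + x) powr (1 - s) / (s - 1))" for x
  have half: "(\<integral>\<^sup>+x. ennreal ((1 + x) powr (- s)) * indicator {0..} x \<partial>lborel) = ennreal (0 - F 0)"
  proof (rule nn_integral_FTC_atLeast)
    show "DERIV F x :> (1 + x) powr (- s)" if "0 \<le> x" for x
    proof -
      have "DERIV F x :> - ((1 - s) * (1 + x) powr (1 - s - 1) / (s - 1))"
        unfolding F_def using that assms by (auto intro!: derivative_eq_intros)
      also have "- ((1 - s) * (1 + x) powr (1 - s - 1) / (s - 1)) = (1 + x) powr (- s)"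
        using assms by (simp add: field_simps)
      finally show ?thesis .
    qed
    have "((\<lambda>x. (1 + x) powr (1 - s)) \<longlongrightarrow> 0) at_top"
      using assms by (intro tendsto_neg_powr filterlim_tendsto_add_at_top[OF tendsto_const filterlim_ident]) auto
    then have "((\<lambda>x. - ((1 + x) powr (1 - s) / (s - 1))) \<longlongrightarrow> - (0 / (s - 1))) at_top"
      using assms by (intro tendsto_minus tendsto_divide tendsto_const) auto
    then show "(F \<longlongrightarrow> 0) at_top" by (simp add: F_def[abs_def])
  qed auto
  have F0: "0 - F 0 = 1 / (s - 1)" by (simp add: F_def)
  have "(\<integral>\<^sup>+x. ennreal ((1 + \<bar>x\<bar>) powr (- s)) \<partial>lborel) \<le>
    (\<integral>\<^sup>+x. ennreal ((1 + x) powr (- s)) * indicator {0..} x + ennreal ((1 + - x) powr (- s)) * indicator {0..} (- x) \<partial>lborel)"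
    by (intro nn_integral_mono) (auto simp: indicator_def)
  also have "\<dots> = (\<integral>\<^sup>+x. ennreal ((1 + x) powr (- s)) * indicator {0..} x \<partial>lborel) +
      (\<integral>\<^sup>+x. ennreal ((1 + - x) powr (- s)) * indicator {0..} (- x) \<partial>lborel)"
    by (rule nn_integral_add) auto
  also have "(\<integral>\<^sup>+x. ennreal ((1 + - x) powr (- s)) * indicator {0..} (- x) \<partial>lborel) =
      (\<integral>\<^sup>+x. ennreal ((1 + x) powr (- s)) * indicator {0..} x \<partial>lborel)"
    using nn_integral_real_affine[of "\<lambda>x. ennreal ((1 + x) powr (- s)) * indicator {0..} x" "- 1" 0] by simp
  finally have "(\<integral>\<^sup>+x. ennreal ((1 + \<bar>x\<bar>) powr (- s)) \<partial>lborel) \<le> ennreal (2 / (s - 1))"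
    unfolding half F0 using assms by (simp add: ennreal_plus[symmetric] del: ennreal_plus)
  then show ?thesis using that[of "2 / (s - 1)"] assms by simp
qed

lemma good_kernelD:
  assumes "good_kernel T B R k"
  shows "schur_kernel (restrict_space lborel T) k B R"
    "\<And>w y. 0 \<le> w \<Longrightarrow> w \<le> 2 \<Longrightarrow> y \<in> T \<Longrightarrow>
        (\<integral>\<^sup>+x. ennreal (\<bar>k x y\<bar> * (1 + \<bar>x\<bar>) powr w) \<partial>restrict_space lborel T)
          \<le> ennreal B * ennreal ((1 + \<bar>y\<bar>) powr w)"
  using assms unfolding good_kernel_def by blast+

lemma (in schur_kernel) weighted_aop:
  assumes p: "dens p" and W[measurable]: "W \<in> borel_measurable L" and W0: "\<And>x. 0 \<le> W x"
    and kW: "\<And>y. y \<in> space L \<Longrightarrow> (\<integral>\<^sup>+x. ennreal (\<bar>k x y\<bar> * W x) \<partial>L) \<le> ennreal B * ennreal (W y)"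
  shows "(\<integral>\<^sup>+x. ennreal (aop p x * W x) \<partial>L) \<le> ennreal B * (\<integral>\<^sup>+y. ennreal (p y * W y) \<partial>L)"
proof -
  note [measurable] = densD(1)[OF p]
  have "(\<integral>\<^sup>+x. ennreal (aop p x * W x) \<partial>L) = (\<integral>\<^sup>+x. \<integral>\<^sup>+y. ennreal (\<bar>k x y\<bar> * W x) * ennreal (p y) \<partial>L \<partial>L)"
  proof (intro nn_integral_cong)
    fix x assume x: "x \<in> space L"
    note [measurable] = k_sec(1)[OF x]
    have "ennreal (aop p x * W x) = ennreal (aop p x) * ennreal (W x)"
      using aop_nonneg[OF p x] W0 by (simp add: ennreal_mult)
    also have "\<dots> = (\<integral>\<^sup>+y. ennreal \<bar>k x y\<bar> * ennreal (p y) * ennreal (W x) \<partial>L)"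
      unfolding ennreal_aop[OF p x] by (rule nn_integral_multc[symmetric]) measurable
    also have "\<dots> = (\<integral>\<^sup>+y. ennreal (\<bar>k x y\<bar> * W x) * ennreal (p y) \<partial>L)"
      using W0 by (intro nn_integral_cong) (simp add: ennreal_mult mult_ac)
    finally show "ennreal (aop p x * W x) = (\<integral>\<^sup>+y. ennreal (\<bar>k x y\<bar> * W x) * ennreal (p y) \<partial>L)" .
  qed
  also have "\<dots> = (\<integral>\<^sup>+y. \<integral>\<^sup>+x. ennreal (\<bar>k x y\<bar> * W x) * ennreal (p y) \<partial>L \<partial>L)"
    by (rule Fubini_k) measurable
  also have "\<dots> \<le> (\<integral>\<^sup>+y. ennreal B * ennreal (p y * W y) \<partial>L)"
  proof (intro nn_integral_mono)
    fix y assume y: "y \<in> space L"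
    note [measurable] = k_sec(2)[OF y]
    have "(\<integral>\<^sup>+x. ennreal (\<bar>k x y\<bar> * W x) * ennreal (p y) \<partial>L) = (\<integral>\<^sup>+x. ennreal (\<bar>k x y\<bar> * W x) \<partial>L) * ennreal (p y)"
      by (rule nn_integral_multc) measurable
    also have "\<dots> \<le> (ennreal B * ennreal (W y)) * ennreal (p y)" by (intro mult_right_mono kW y) simp
    also have "\<dots> = ennreal B * ennreal (p y * W y)"
      using densD(2)[OF p y] W0[of y] by (simp add: ennreal_mult mult_ac)
    finally show "(\<integral>\<^sup>+x. ennreal (\<bar>k x y\<bar> * W x) * ennreal (p y) \<partial>L) \<le> ennreal B * ennreal (p y * W y)" .
  qed
  also have "\<dots> = ennreal B * (\<integral>\<^sup>+y. ennreal (p y * W y) \<partial>L)" by (rule nn_integral_cmult) measurable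
  finally show ?thesis .
qed

text \<open>For \<open>r > 1\<close> this is of smaller order than \<open>\<delta>\<^sub>n\<close>, whence no concentration inequality for
  the norm is needed in that case.\<close>

lemma estimator_mean_bound:
  assumes T: "T = {0..1} \<or> T = UNIV" and B: "1 \<le> B" and r: "1 \<le> \<rho>" and p0: "prob_density T p0"
    and U: "(\<integral>\<^sup>+x. ennreal (\<bar>p0 x\<bar> powr \<rho>) \<partial>restrict_space lborel T) \<le> ennreal (U powr \<rho>)" "0 < U"
    and w: "\<rho> < 2 \<Longrightarrow> (2 - \<rho>) / \<rho> < w"
    and mom: "\<rho> < 2 \<Longrightarrow> T = UNIV \<Longrightarrow> mu_norm T w p0 < \<top>"
  obtains D where "0 < D" "\<And>k R n. good_kernel T B R k \<Longrightarrow> n \<ge> 1 \<Longrightarrow> R \<le> real n \<Longrightarrow>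
    (\<integral>\<^sup>+\<omega>. \<integral>\<^sup>+x. ennreal (\<bar>schur_kernel.est k n \<omega> x - schur_kernel.op (restrict_space lborel T) k p0 x\<bar> powr \<rho>)
      \<partial>restrict_space lborel T \<partial>PiM {..<n} (\<lambda>_. law T p0)) \<le> ennreal (D * (R / real n) powr (\<rho> / 2))"
proof -
  let ?L = "restrict_space lborel T"
  have Tb: "T \<in> sets borel" using T by auto
  note p0D = prob_densityD[OF p0 Tb]
  have law: "law T p0 = density ?L (\<lambda>x. ennreal (p0 x))" by (simp add: law_def)
  show ?thesis
  proof (cases "\<rho> < 2")
    case True
    \<comment> \<open>The kernels control weights up to exponent \<open>2\<close> only. Capping is
      harmless because the threshold \<open>(2 - \<rho>) / \<rho>\<close> is at most
      \<open>1\<close>.\<close>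
    define w' where "w' = min w 2"
    have "(2 - \<rho>) / \<rho> \<le> 1" using r by (simp add: field_simps)
    then have w': "(2 - \<rho>) / \<rho> < w'" "w' \<le> 2" "w' \<le> w" using w[OF True] by (auto simp: w'_def)
    have w'0: "0 \<le> w'"
    proof -
      have "0 \<le> (2 - \<rho>) / \<rho>" using True r by simp
      then show ?thesis using w'(1) by linarith
    qed
    have w's: "1 < w' * (\<rho> / (2 - \<rho>))" using w'(1) True r by (simp add: field_simps)
    obtain A1 where A1: "0 \<le> A1" "(\<integral>\<^sup>+x. ennreal ((1 + \<bar>x\<bar>) powr (- (w' * (\<rho> / (2 - \<rho>))))) \<partial>lborel) \<le> ennreal A1"
      using nn_integral_weight_finite[OF w's] by blast
    have mu: "mu_norm T w' p0 < \<top>"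
    proof (cases "T = UNIV")
      case UNIV: True
      show ?thesis
        using mu_norm_mono_weight[OF w'0 w'(3), of T p0] mom[OF True UNIV] by (rule order_le_less_trans)
    next
      case False
      with T have T01: "T = {0..1}" by simp
      \<comment> \<open>On the unit interval the weight is at most \<open>4\<close>, so the moment
        is finite because \<open>p0\<close> integrates to one.\<close>
      have "mu_norm T w' p0 = (\<integral>\<^sup>+x. ennreal (\<bar>p0 x\<bar> * (1 + \<bar>x\<bar>) powr w') \<partial>?L)"
        using Tb by (simp add: mu_norm_def nn_integral_restrict_space)
      also have "\<dots> \<le> (\<integral>\<^sup>+x. ennreal 4 * ennreal (p0 x) \<partial>?L)"
      proof (intro nn_integral_mono)
        fix x assume "x \<in> space ?L"
        then have x: "0 \<le> x" "x \<le> 1" "0 \<le> p0 x" using p0D(2) by (auto simp: space_restrict_space T01)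
        have "(1 + \<bar>x\<bar>) powr w' \<le> 2 powr w'" using x w'0 by (intro powr_mono2) auto
        also have "\<dots> \<le> 2 powr 2" using w' by (intro powr_mono) auto
        finally have "(1 + \<bar>x\<bar>) powr w' \<le> 4" by simp
        then have "\<bar>p0 x\<bar> * (1 + \<bar>x\<bar>) powr w' \<le> 4 * p0 x" using x mult_left_mono[of "(1 + \<bar>x\<bar>) powr w'" 4 "p0 x"] by simp
        then show "ennreal (\<bar>p0 x\<bar> * (1 + \<bar>x\<bar>) powr w') \<le> ennreal 4 * ennreal (p0 x)"
          using x by (subst ennreal_mult[symmetric]) (auto intro!: ennreal_leI)
      qed
      also have "\<dots> = ennreal 4" using p0D by (simp add: nn_integral_cmult)
      finally show ?thesis by (rule order_le_less_trans) simp
    qed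
    define A2 where "A2 = B * enn2real (mu_norm T w' p0)"
    have A2: "0 \<le> A2" using B by (simp add: A2_def)
    define D where "D = B * A2 + A1 + 1"
    have D: "0 < D" using A1 A2 B by (simp add: D_def add_nonneg_pos)
    have "(\<integral>\<^sup>+\<omega>. \<integral>\<^sup>+x. ennreal (\<bar>schur_kernel.est k n \<omega> x - schur_kernel.op ?L k p0 x\<bar> powr \<rho>)
      \<partial>?L \<partial>PiM {..<n} (\<lambda>_. law T p0)) \<le> ennreal (D * (R / real n) powr (\<rho> / 2))"
      if k: "good_kernel T B R k" and n: "n \<ge> 1" for k R n
    proof -
      interpret schur_kernel ?L k B R by (rule good_kernelD(1)[OF k])
      have dens: "dens p0" using p0D by (simp add: dens_def space_restrict_space)
      have Mp: "law T p0 = Mp p0" by (simp add: law_def Mp_def)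
      have "(\<integral>\<^sup>+\<omega>. \<integral>\<^sup>+x. ennreal (\<bar>est n \<omega> x - op p0 x\<bar> powr \<rho>) \<partial>?L \<partial>PiM {..<n} (\<lambda>_. Mp p0)) \<le>
          ennreal ((B * A2 + A1) * (R / real n) powr (\<rho> / 2))"
      proof (rule type_I_weighted[where W = "\<lambda>x. (1 + \<bar>x\<bar>) powr w'", OF r True n dens])
        show "(\<lambda>x. (1 + \<bar>x\<bar>) powr w') \<in> borel_measurable ?L" by (rule measurable_restrict_space1) measurable
        show "(\<integral>\<^sup>+x. ennreal (((1 + \<bar>x\<bar>) powr w') powr - (\<rho> / (2 - \<rho>))) \<partial>?L) \<le> ennreal A1"
          using order_trans[OF nn_integral_restrict_le[OF Tb] A1(2)] by (simp add: powr_powr)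
        have "(\<integral>\<^sup>+x. ennreal (aop p0 x * (1 + \<bar>x\<bar>) powr w') \<partial>?L) \<le> ennreal B * (\<integral>\<^sup>+y. ennreal (p0 y * (1 + \<bar>y\<bar>) powr w') \<partial>?L)"
        proof (rule weighted_aop[OF dens])
          show "(\<lambda>x. (1 + \<bar>x\<bar>) powr w') \<in> borel_measurable ?L" by (rule measurable_restrict_space1) measurable
        qed (use good_kernelD(2)[OF k w'0 w'(2)] in \<open>auto simp: space_restrict_space\<close>)
        also have "(\<integral>\<^sup>+y. ennreal (p0 y * (1 + \<bar>y\<bar>) powr w') \<partial>?L) = mu_norm T w' p0"
          using Tb p0D(2) by (auto simp: mu_norm_def nn_integral_restrict_space indicator_def intro!: nn_integral_cong)
        also have "ennreal B * mu_norm T w' p0 = ennreal A2"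
          using mu B by (simp add: A2_def ennreal_mult)
        finally show "(\<integral>\<^sup>+x. ennreal (aop p0 x * (1 + \<bar>x\<bar>) powr w') \<partial>?L) \<le> ennreal A2" .
      qed (use A1 A2 in \<open>auto simp: add_pos_nonneg\<close>)
      also have "\<dots> \<le> ennreal (D * (R / real n) powr (\<rho> / 2))"
        by (intro ennreal_leI mult_right_mono) (auto simp: D_def)
      finally show ?thesis by (simp add: Mp)
    qed
    with D that show ?thesis by blast
  next
    case False
    then have r2: "2 \<le> \<rho>" by simp
    obtain C where C: "0 < C" "\<And>(M :: real measure) f b v (n :: nat). \<lbrakk>prob_space M; f \<in> borel_measurable M; 0 < b;
      \<And>x. x \<in> space M \<Longrightarrow> \<bar>f x\<bar> \<le> b; integral\<^sup>L M (\<lambda>x. (f x)\<^sup>2) \<le> v\<rbrakk> \<Longrightarrow>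
      (\<integral>\<^sup>+x. ennreal (\<bar>\<Sum>i<n. f (x i) - integral\<^sup>L M f\<bar> powr \<rho>) \<partial>PiM {..<n} (\<lambda>_. M))
      \<le> ennreal (C * (real n * v * b powr (\<rho> - 2) + (real n * v) powr (\<rho> / 2)))"
      using rosenthal_moment_bound[OF r2] by blast
    define D where "D = C * (B powr \<rho> + B powr (\<rho> / 2) * (B + (B * U) powr \<rho>))"
    have D: "0 < D" unfolding D_def using C(1) B by (intro mult_pos_pos add_pos_nonneg) auto
    have "(\<integral>\<^sup>+\<omega>. \<integral>\<^sup>+x. ennreal (\<bar>schur_kernel.est k n \<omega> x - schur_kernel.op ?L k p0 x\<bar> powr \<rho>)
      \<partial>?L \<partial>PiM {..<n} (\<lambda>_. law T p0)) \<le> ennreal (D * (R / real n) powr (\<rho> / 2))"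
      if k: "good_kernel T B R k" and n: "n \<ge> 1" "R \<le> real n" for k R n
    proof -
      interpret schur_kernel ?L k B R by (rule good_kernelD(1)[OF k])
      have dens: "dens p0" using p0D by (simp add: dens_def space_restrict_space)
      have Mp: "law T p0 = Mp p0" by (simp add: law_def Mp_def)
      show ?thesis unfolding Mp D_def by (rule type_I_ge2[OF r2 n dens U C])
    qed
    with D that show ?thesis by blast
  qed
qed

lemma emeasure_PiM_law:
  fixes n :: nat
  assumes p: "prob_density T p" and T: "T \<in> sets borel"
    and A: "A \<in> sets (PiM {..<n} (\<lambda>_. restrict_space lborel T))"
  shows "(\<integral>\<^sup>+x\<in>A. likelihood n x p \<partial>PiM {..<n} (\<lambda>_. restrict_space lborel T)) = emeasure (PiM {..<n} (\<lambda>_. law T p)) A"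
proof -
  let ?S = "PiM {..<n} (\<lambda>_. restrict_space lborel T)"
  have sets: "sets (PiM {..<n} (\<lambda>_. law T p)) = sets ?S" by (intro sets_PiM_cong) auto
  have "emeasure (PiM {..<n} (\<lambda>_. law T p)) A = (\<integral>\<^sup>+x. indicator A x \<partial>PiM {..<n} (\<lambda>_. law T p))"
    using A by (simp add: sets)
  also have "\<dots> = (\<integral>\<^sup>+x. (\<Prod>i<n. ennreal (p (x i))) * indicator A x \<partial>?S)"
    using A by (intro nn_integral_PiM_law p T) auto
  also have "\<dots> = (\<integral>\<^sup>+x\<in>A. likelihood n x p \<partial>?S)"
  proof (intro nn_integral_cong)
    fix x assume "x \<in> space ?S"
    then have "likelihood n x p = (\<Prod>i<n. ennreal (p (x i)))"
      by (intro likelihood_eq_prod[OF p]) (auto simp: space_PiM space_restrict_space)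
    then show "(\<Prod>i<n. ennreal (p (x i))) * indicator A x = likelihood n x p * indicator A x" by simp
  qed
  finally show ?thesis ..
qed

text \<open>Since \<open>\<Delta>\<^sup>2 / (U + \<Delta>)\<close> increases with
  \<open>\<Delta>\<close>, the worst case is \<open>\<Delta> = M * \<delta>\<close>, where the
  denominator is at most \<open>U + 1\<close>. There \<open>n * \<delta>\<^sup>2\<close> is at least
  \<open>N * N powr \<theta>\<close> while \<open>R powr \<theta>\<close> is at most
  \<open>max 1 c * N powr \<theta>\<close>; the powers of \<open>N\<close> cancel and the
  requirement on \<open>M\<close> remains. The monotonicity is expressed by cross multiplication in
  \<open>U\<Delta>\<close>.\<close>

lemma exponent_bound:
  fixes \<delta> M \<Delta> N n \<epsilon> \<theta> R \<kappa> U C c :: real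
  assumes \<delta>: "0 < \<delta>" "M * \<delta> \<le> 1" "M * \<delta> \<le> \<Delta>" "\<epsilon> * N powr (\<theta> / 2) \<le> \<delta>" and \<epsilon>: "0 < \<epsilon>"
    and N: "0 < N" "N = n * \<epsilon>\<^sup>2" and \<theta>: "0 \<le> \<theta>" "\<theta> \<le> 1" and R: "0 < R" "R \<le> c * N"
    and \<kappa>: "0 < \<kappa>" and U: "0 \<le> U" and M: "0 < M" and C: "0 \<le> C"
    and large: "\<kappa> * (U + 1) * max 1 c * C \<le> M\<^sup>2"
  shows "C * N \<le> n * \<Delta>\<^sup>2 / (\<kappa> * (U + \<Delta>) * R powr \<theta>)"
proof -
  have M\<delta>: "0 < M * \<delta>" using M \<delta> by simp
  have \<Delta>0: "0 < \<Delta>" using M\<delta> \<delta> by linarith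
  have n0: "0 < n" using N \<epsilon> by (simp add: zero_less_mult_iff)
  have c0: "0 < c" using R N by (metis less_le_trans zero_less_mult_pos2)
  have Rt: "R powr \<theta> \<le> max 1 c * N powr \<theta>"
  proof -
    have "R powr \<theta> \<le> (c * N) powr \<theta>" using R \<theta> by (intro powr_mono2) auto
    also have "\<dots> = c powr \<theta> * N powr \<theta>" by (rule powr_mult)
    also have "c powr \<theta> \<le> max 1 c"
    proof (cases "1 \<le> c")
      case True
      then have "c powr \<theta> \<le> c powr 1" using \<theta> by (intro powr_mono) auto
      then show ?thesis using c0 by simp
    next
      case False
      then have "c powr \<theta> \<le> 1 powr \<theta>" using c0 \<theta> by (intro powr_mono2) auto
      then show ?thesis by simp
    qed
    finally show ?thesis by (simp add: mult_right_mono)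
  qed
  have U\<Delta>: "(U + \<Delta>) * (M * \<delta>)\<^sup>2 \<le> (U + 1) * \<Delta>\<^sup>2"
  proof -
    have sq: "(M * \<delta>)\<^sup>2 \<le> \<Delta>\<^sup>2" using M\<delta> \<delta> by (intro power_mono) auto
    have "(M * \<delta>) * (M * \<delta>) \<le> \<Delta> * 1" using M\<delta> \<delta> \<Delta>0 by (intro mult_mono) auto
    then have "\<Delta> * (M * \<delta>)\<^sup>2 \<le> \<Delta> * \<Delta>" using \<Delta>0 by (intro mult_left_mono) (auto simp: power2_eq_square)
    moreover have "U * (M * \<delta>)\<^sup>2 \<le> U * \<Delta>\<^sup>2" using U sq by (intro mult_left_mono)
    ultimately show ?thesis by (simp add: distrib_right power2_eq_square)
  qed
  have n\<delta>: "N * N powr \<theta> \<le> n * \<delta>\<^sup>2"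
  proof -
    have "(N powr (\<theta> / 2))\<^sup>2 = N powr \<theta>" by (simp add: power2_eq_square powr_add[symmetric])
    then have "N * N powr \<theta> = n * (\<epsilon> * N powr (\<theta> / 2))\<^sup>2" using N(2) by (simp add: power_mult_distrib)
    also have "\<dots> \<le> n * \<delta>\<^sup>2" using \<delta> \<epsilon> n0 by (intro mult_left_mono power_mono) auto
    finally show ?thesis .
  qed
  have "C * N * (\<kappa> * (U + \<Delta>) * R powr \<theta>) * (M * \<delta>)\<^sup>2 = (C * N * \<kappa> * R powr \<theta>) * ((U + \<Delta>) * (M * \<delta>)\<^sup>2)"
    by (simp add: mult_ac)
  also have "\<dots> \<le> (C * N * \<kappa> * (max 1 c * N powr \<theta>)) * ((U + 1) * \<Delta>\<^sup>2)"
    by (rule mult_mono[OF mult_left_mono[OF Rt] U\<Delta>]) (use C N(1) \<kappa> U \<Delta>0 in auto)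
  also have "\<dots> = (\<kappa> * (U + 1) * max 1 c * C) * (\<Delta>\<^sup>2 * (N * N powr \<theta>))" by (simp only: mult_ac)
  also have "\<dots> \<le> M\<^sup>2 * (\<Delta>\<^sup>2 * (n * \<delta>\<^sup>2))"
    by (rule mult_mono[OF large mult_left_mono[OF n\<delta>]]) (use N(1) in auto)
  also have "\<dots> = n * \<Delta>\<^sup>2 * (M * \<delta>)\<^sup>2" by (simp add: power_mult_distrib mult_ac)
  finally have "C * N * (\<kappa> * (U + \<Delta>) * R powr \<theta>) \<le> n * \<Delta>\<^sup>2"
    by (rule mult_right_le_imp_le) (rule zero_less_power[OF M\<delta>])
  moreover have "0 < \<kappa> * (U + \<Delta>) * R powr \<theta>" using \<kappa> U \<Delta>0 R by simp
  ultimately show ?thesis by (simp add: pos_le_divide_eq)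
qed

text \<open>Both approximation errors are small against \<open>\<Delta>\<close>, so at least
  \<open>3 / 4 * \<Delta>\<close> of the distance survives the operator. Half of
  \<open>\<Delta>\<close> drives the exponential bound, which explains the \<open>16\<close> in the
  exponent, and the remaining quarter covers the threshold \<open>\<tau> * \<delta>\<close>.\<close>

lemma type_II_finite:
  fixes n :: nat
  assumes T: "T \<in> sets borel" and k: "good_kernel T B R k" and r: "1 \<le> \<rho>" and n: "n \<ge> 1"
    and p: "prob_density T p" and p0: "prob_density T p0"
    and U: "(\<integral>\<^sup>+x. ennreal (\<bar>p0 x\<bar> powr \<rho>) \<partial>restrict_space lborel T) \<le> ennreal (U powr \<rho>)" "0 < U"
    and A: "0 < A" "0 < \<delta>" and M: "8 * A < M" "4 * \<tau> \<le> M" "0 < \<tau>"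
    and ap: "Lr_norm T (ennreal \<rho>) (\<lambda>x. kernel_op T k p x - p x) \<le> ennreal (A * \<delta>)"
    and ap0: "Lr_norm T (ennreal \<rho>) (\<lambda>x. kernel_op T k p0 x - p0 x) \<le> ennreal (A * \<delta>)"
    and far: "ennreal (M * \<delta>) \<le> Lr_norm T (ennreal \<rho>) (\<lambda>x. p x - p0 x)"
  obtains \<Delta> where "M * \<delta> \<le> \<Delta>"
    "emeasure (PiM {..<n} (\<lambda>_. law T p)) {\<omega> \<in> space (PiM {..<n} (\<lambda>_. law T p)).
      (\<integral>\<^sup>+x. ennreal (\<bar>schur_kernel.est k n \<omega> x - schur_kernel.op (restrict_space lborel T) k p0 x\<bar> powr \<rho>)
        \<partial>restrict_space lborel T) \<le> ennreal ((\<tau> * \<delta>) powr \<rho>)}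
      \<le> ennreal (exp (- (real n * \<Delta>\<^sup>2 / (16 * B\<^sup>2 * (U + \<Delta>) * R powr (1 - 1 / \<rho>)))))"
proof -
  let ?L = "restrict_space lborel T"
  interpret schur_kernel ?L k B R by (rule good_kernelD(1)[OF k])
  note pD = prob_densityD[OF p T] and p0D = prob_densityD[OF p0 T]
  have dp: "dens p" and dp0: "dens p0" using pD p0D by (auto simp: dens_def space_restrict_space)
  have Mp: "law T q = Mp q" for q by (simp add: law_def Mp_def)
  note [measurable] = pD(1) p0D(1)
  have op: "kernel_op T k q = op q" for q by (simp add: fun_eq_iff kernel_op_restrict[OF T] op_def)
  have A\<delta>: "0 < A * \<delta>" using A by simp
  have M0: "0 < M" using A M by linarith
  have M\<delta>: "8 * (A * \<delta>) < M * \<delta>" "4 * (\<tau> * \<delta>) \<le> M * \<delta>"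
    using mult_strict_right_mono[OF M(1) A(2)] mult_right_mono[OF M(2), of \<delta>] A by (auto simp: mult_ac)
  have ap': "(\<integral>\<^sup>+x. ennreal (\<bar>op p x - p x\<bar> powr \<rho>) \<partial>?L) \<le> ennreal ((A * \<delta>) powr \<rho>)"
    and ap0': "(\<integral>\<^sup>+x. ennreal (\<bar>op p0 x - p0 x\<bar> powr \<rho>) \<partial>?L) \<le> ennreal ((A * \<delta>) powr \<rho>)"
    using ap ap0 by (simp_all add: Lr_norm_le_iff[OF T r A\<delta>] op)
  define b where "b = B * R powr (1 - 1 / \<rho>)"
  have b: "0 < b" using B1 R1 by (simp add: b_def)
  have op_b: "(\<integral>\<^sup>+x. ennreal (\<bar>op q x\<bar> powr \<rho>) \<partial>?L) \<le> ennreal (b powr \<rho>)" if "dens q" for q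
    unfolding b_def by (rule order_trans[OF op_Lr_le[OF that r] aop_Lr_finite[OF that r]])
  have neg: "(\<integral>\<^sup>+x. ennreal (\<bar>- f x\<bar> powr \<rho>) \<partial>?L) = (\<integral>\<^sup>+x. ennreal (\<bar>f x\<bar> powr \<rho>) \<partial>?L)" for f :: "real \<Rightarrow> real"
    by simp
  \<comment> \<open>Integrability of the \<open>\<rho>\<close>-th power of \<open>p\<close> is not
    assumed. It follows because the smoothed density has norm at most \<open>b\<close> and
    \<open>p\<close> differs from it by at most \<open>A * \<delta>\<close>. This crude bound only
    makes \<open>\<Delta>\<close> finite; the bound \<open>U + \<Delta>\<close> used for the
    variance comes afterwards.\<close>
  have "(\<integral>\<^sup>+x. ennreal (\<bar>op p x + - (op p x - p x)\<bar> powr \<rho>) \<partial>?L) \<le> ennreal ((b + A * \<delta>) powr \<rho>)"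
    by (rule minkowski_powr[OF r _ _ op_b[OF dp] b _ A\<delta>]) (use ap' in \<open>simp_all add: abs_minus_commute\<close>)
  then have pb: "(\<integral>\<^sup>+x. ennreal (\<bar>p x\<bar> powr \<rho>) \<partial>?L) \<le> ennreal ((b + A * \<delta>) powr \<rho>)" by simp
  have bA: "0 < b + A * \<delta>" using b A\<delta> by simp
  have "(\<integral>\<^sup>+x. ennreal (\<bar>p x + - p0 x\<bar> powr \<rho>) \<partial>?L) \<le> ennreal ((b + A * \<delta> + U) powr \<rho>)"
    by (rule minkowski_powr[OF r _ _ pb bA _ U(2)]) (use U(1) in simp_all)
  then have h_fin: "Lr_norm T (ennreal \<rho>) (\<lambda>x. p x - p0 x) \<le> ennreal (b + A * \<delta> + U)"
    using bA U by (subst Lr_norm_le_iff[OF T r]) auto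
  then have "Lr_norm T (ennreal \<rho>) (\<lambda>x. p x - p0 x) < \<top>" by (rule order_le_less_trans) simp
  then obtain \<Delta> where \<Delta>0: "0 \<le> \<Delta>" and \<Delta>n: "Lr_norm T (ennreal \<rho>) (\<lambda>x. p x - p0 x) = ennreal \<Delta>"
    and \<Delta>: "(\<integral>\<^sup>+x. ennreal (\<bar>p x - p0 x\<bar> powr \<rho>) \<partial>?L) = ennreal (\<Delta> powr \<rho>)"
    using Lr_norm_real[OF T r] by blast
  have M\<Delta>: "M * \<delta> \<le> \<Delta>" using far \<Delta>0 by (simp add: \<Delta>n ennreal_le_iff)
  have \<Delta>p: "0 < \<Delta>" using M\<Delta> M0 A mult_pos_pos[OF M0 A(2)] by linarith
  have "(\<integral>\<^sup>+x. ennreal (\<bar>p0 x + (p x - p0 x)\<bar> powr \<rho>) \<partial>?L) \<le> ennreal ((U + \<Delta>) powr \<rho>)"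
    by (rule minkowski_powr[OF r _ _ U _ \<Delta>p]) (use \<Delta> in simp_all)
  then have pU: "(\<integral>\<^sup>+x. ennreal (\<bar>p x\<bar> powr \<rho>) \<partial>?L) \<le> ennreal ((U + \<Delta>) powr \<rho>)" by simp
  have p0U: "(\<integral>\<^sup>+x. ennreal (\<bar>p0 x\<bar> powr \<rho>) \<partial>?L) \<le> ennreal ((U + \<Delta>) powr \<rho>)"
    using U r \<Delta>0 by (intro order_trans[OF U(1)] ennreal_leI powr_mono2) auto
  have "(\<integral>\<^sup>+x. ennreal (\<bar>op p x + - op p0 x\<bar> powr \<rho>) \<partial>?L) \<le> ennreal ((b + b) powr \<rho>)"
    by (rule minkowski_powr[OF r _ _ op_b[OF dp] b _ b]) (use op_b[OF dp0] in simp_all)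
  then have "Lr_norm T (ennreal \<rho>) (\<lambda>x. op p x - op p0 x) \<le> ennreal (b + b)"
    using b by (subst Lr_norm_le_iff[OF T r]) auto
  then have "Lr_norm T (ennreal \<rho>) (\<lambda>x. op p x - op p0 x) < \<top>" by (rule order_le_less_trans) simp
  then obtain G where G0: "0 \<le> G"
    and G: "(\<integral>\<^sup>+x. ennreal (\<bar>op p x - op p0 x\<bar> powr \<rho>) \<partial>?L) = ennreal (G powr \<rho>)"
    using Lr_norm_real[OF T r] by blast
  \<comment> \<open>Otherwise the triangle inequality gives
    \<open>\<Delta> \<le> 3 / 4 * \<Delta> + 2 * A * \<delta>\<close>, which is less than
    \<open>\<Delta>\<close> because
    \<open>8 * A * \<delta> < M * \<delta> \<le> \<Delta>\<close>.\<close>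
  have G_big: "3 / 4 * \<Delta> \<le> G"
  proof (rule ccontr)
    assume "\<not> ?thesis"
    then have Gs: "G \<le> 3 / 4 * \<Delta>" by simp
    have g: "(\<integral>\<^sup>+x. ennreal (\<bar>op p x - op p0 x\<bar> powr \<rho>) \<partial>?L) \<le> ennreal ((3 / 4 * \<Delta>) powr \<rho>)"
      unfolding G using Gs G0 r by (intro ennreal_leI powr_mono2) auto
    have "(\<integral>\<^sup>+x. ennreal (\<bar>- (op p x - p x) + (op p0 x - p0 x)\<bar> powr \<rho>) \<partial>?L) \<le> ennreal ((A * \<delta> + A * \<delta>) powr \<rho>)"
      by (rule minkowski_powr[OF r _ _ _ A\<delta> ap0' A\<delta>]) (use ap' in \<open>simp_all add: abs_minus_commute\<close>)
    then have "(\<integral>\<^sup>+x. ennreal (\<bar>(op p x - op p0 x) + (- (op p x - p x) + (op p0 x - p0 x))\<bar> powr \<rho>) \<partial>?L)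
        \<le> ennreal ((3 / 4 * \<Delta> + (A * \<delta> + A * \<delta>)) powr \<rho>)"
      using \<Delta>p A\<delta> by (intro minkowski_powr[OF r _ _ g]) auto
    then have "ennreal (\<Delta> powr \<rho>) \<le> ennreal ((3 / 4 * \<Delta> + (A * \<delta> + A * \<delta>)) powr \<rho>)" by (simp add: \<Delta>)
    then have "\<Delta> powr \<rho> \<le> (3 / 4 * \<Delta> + (A * \<delta> + A * \<delta>)) powr \<rho>" by (simp add: ennreal_le_iff)
    moreover have "(3 / 4 * \<Delta> + (A * \<delta> + A * \<delta>)) powr \<rho> < \<Delta> powr \<rho>"
      using r \<Delta>p A\<delta> M\<delta> M\<Delta> by (intro powr_less_mono2) auto
    ultimately show False by simp
  qed
  have \<tau>\<delta>: "0 < \<tau> * \<delta>" using M A by simp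
  have BU: "\<Delta> / 2 \<le> 2 * B * (U + \<Delta>)"
  proof -
    have "\<Delta> / 2 \<le> 2 * (U + \<Delta>)" using U(2) \<Delta>p by simp
    also have "\<dots> \<le> 2 * B * (U + \<Delta>)" using B1 U(2) \<Delta>p by (intro mult_right_mono) auto
    finally show ?thesis .
  qed
  have "emeasure (PiM {..<n} (\<lambda>_. Mp p)) {\<omega> \<in> space (PiM {..<n} (\<lambda>_. Mp p)).
      (\<integral>\<^sup>+x. ennreal (\<bar>est n \<omega> x - op p0 x\<bar> powr \<rho>) \<partial>?L) \<le> ennreal ((\<tau> * \<delta>) powr \<rho>)}
    \<le> ennreal (exp (- real n * (\<Delta> / 2)\<^sup>2 / (4 * (B\<^sup>2 * (U + \<Delta>) * R powr (1 - 1 / \<rho>)))))"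
    by (rule type_II_Lr[OF r n dp dp0 pU _ p0U G]) (use \<Delta>p U \<tau>\<delta> BU G_big M\<delta> M\<Delta> in auto)
  also have "- real n * (\<Delta> / 2)\<^sup>2 / (4 * (B\<^sup>2 * (U + \<Delta>) * R powr (1 - 1 / \<rho>))) =
      - (real n * \<Delta>\<^sup>2 / (16 * B\<^sup>2 * (U + \<Delta>) * R powr (1 - 1 / \<rho>)))"
    by (simp add: power_divide)
  finally show ?thesis using that[OF M\<Delta>] by (simp add: Mp)
qed

text \<open>One factor of the dictionary function is bounded by \<open>b\<close> and the density by
  \<open>V\<close>; the remaining factor has \<open>L^1\<close> norm at most \<open>b / R\<close>.
  The gain \<open>1 / R\<close> is what makes single coefficients at threshold
  \<open>\<delta> / R\<close> detectable.\<close>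

lemma (in dictionary) second_moment_le:
  assumes T: "T \<in> sets borel" and p: "prob_density T p" and V: "\<And>x. x \<in> T \<Longrightarrow> p x \<le> V" "0 \<le> V"
  shows "integral\<^sup>L (law T p) (\<lambda>y. (\<psi> i y)\<^sup>2) \<le> b\<^sup>2 * V / R"
proof -
  let ?L = "restrict_space lborel T"
  note pD = prob_densityD[OF p T]
  note [measurable] = pD(1)
  have spL: "space ?L = T" by (simp add: space_restrict_space)
  have [measurable]: "\<psi> i \<in> borel_measurable ?L" by (rule measurable_restrict_space1) simp
  have "(\<integral>\<^sup>+y. ennreal ((\<psi> i y)\<^sup>2 * p y) \<partial>?L) \<le> (\<integral>\<^sup>+y. ennreal (b * V) * ennreal \<bar>\<psi> i y\<bar> \<partial>?L)"
  proof (intro nn_integral_mono)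
    fix y assume "y \<in> space ?L"
    then have y: "y \<in> T" by (simp add: spL)
    have "(\<psi> i y)\<^sup>2 * p y = \<bar>\<psi> i y\<bar> * \<bar>\<psi> i y\<bar> * p y" by (simp add: power2_eq_square abs_mult[symmetric])
    also have "\<dots> \<le> b * \<bar>\<psi> i y\<bar> * V"
      using abs_le[of i y] V(1)[OF y] pD(2)[OF y] b1 by (intro mult_mono) auto
    finally show "ennreal ((\<psi> i y)\<^sup>2 * p y) \<le> ennreal (b * V) * ennreal \<bar>\<psi> i y\<bar>"
      using b1 V(2) by (simp add: ennreal_mult[symmetric] ennreal_leI mult_ac)
  qed
  also have "\<dots> = ennreal (b * V) * (\<integral>\<^sup>+y. ennreal \<bar>\<psi> i y\<bar> \<partial>?L)" by (rule nn_integral_cmult) measurable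
  also have "\<dots> \<le> ennreal (b * V) * ennreal (b / R)"
    by (intro mult_left_mono order_trans[OF nn_integral_restrict_le[OF T] int_le]) simp
  also have "\<dots> = ennreal (b\<^sup>2 * V / R)"
    using b1 R1 V(2) by (simp add: ennreal_mult[symmetric] power2_eq_square mult_ac)
  finally have *: "(\<integral>\<^sup>+y. ennreal ((\<psi> i y)\<^sup>2 * p y) \<partial>?L) \<le> ennreal (b\<^sup>2 * V / R)" .
  have "integral\<^sup>L (law T p) (\<lambda>y. (\<psi> i y)\<^sup>2) = (LINT y|?L. p y * (\<psi> i y)\<^sup>2)"
    unfolding law_def using pD(2) by (subst integral_density) (auto simp: spL)
  also have "\<dots> = (LINT y|?L. (\<psi> i y)\<^sup>2 * p y)" by (simp add: mult.commute)
  also have "\<dots> = enn2real (\<integral>\<^sup>+y. ennreal ((\<psi> i y)\<^sup>2 * p y) \<partial>?L)"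
    using pD(2) by (intro integral_eq_nn_integral) (auto simp: spL)
  also have "\<dots> \<le> b\<^sup>2 * V / R" using enn2real_mono[OF *] b1 R1 V(2) by simp
  finally show ?thesis .
qed

text \<open>If all dictionary coefficients of \<open>p - p0\<close> were small, the smoothed
  difference would be at most \<open>\<Delta> / 2\<close> everywhere, which is incompatible with a
  nearly maximal value of the difference and small approximation errors. Hence one coefficient is
  large, and a single average separates the densities.\<close>

lemma type_II_top:
  fixes n :: nat
  assumes T: "T \<in> sets borel" "T \<noteq> {}" and k: "good_kernel T B R k" and n: "n \<ge> 1"
    and \<psi>: "dictionary \<psi> B R"
    and rec: "\<And>h \<Delta> a x. integrable (restrict_space lborel T) h \<Longrightarrow> \<forall>y\<in>T. \<bar>h y\<bar> \<le> \<Delta> \<Longrightarrow>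
           \<forall>i. \<bar>LINT y|restrict_space lborel T. \<psi> i y * h y\<bar> \<le> a \<Longrightarrow> x \<in> T \<Longrightarrow>
           \<bar>LINT y|restrict_space lborel T. k x y * h y\<bar> \<le> B * R * a + \<Delta> / 4"
    and p: "prob_density T p" and p0: "prob_density T p0"
    and U: "\<And>x. x \<in> T \<Longrightarrow> p0 x \<le> U"
    and A: "0 < A" "0 < \<delta>" and M: "32 * A \<le> M" "8 * B \<le> M"
    and ap: "Lr_norm T \<top> (\<lambda>x. kernel_op T k p x - p x) \<le> ennreal (A * \<delta>)"
    and ap0: "Lr_norm T \<top> (\<lambda>x. kernel_op T k p0 x - p0 x) \<le> ennreal (A * \<delta>)"
    and far: "ennreal (M * \<delta>) \<le> Lr_norm T \<top> (\<lambda>x. p x - p0 x)"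
  obtains \<Delta> where "M * \<delta> \<le> \<Delta>"
    "emeasure (PiM {..<n} (\<lambda>_. law T p)) {\<omega> \<in> space (PiM {..<n} (\<lambda>_. law T p)).
      \<forall>i. \<bar>(\<Sum>j<n. \<psi> i (\<omega> j)) / real n - integral\<^sup>L (law T p0) (\<psi> i)\<bar> \<le> \<delta> / R}
      \<le> ennreal (exp (- (real n * \<Delta>\<^sup>2 / (256 * B ^ 4 * (U + \<Delta>) * R powr 1))))"
proof -
  let ?L = "restrict_space lborel T"
  interpret schur_kernel ?L k B R by (rule good_kernelD(1)[OF k])
  interpret D: dictionary \<psi> B R by (rule \<psi>)
  note pD = prob_densityD[OF p T(1)] and p0D = prob_densityD[OF p0 T(1)]
  have dp: "dens p" and dp0: "dens p0" using pD p0D by (auto simp: dens_def space_restrict_space)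
  have Mp: "law T q = Mp q" for q by (simp add: law_def Mp_def)
  note [measurable] = pD(1) p0D(1)
  have spL: "space ?L = T" by (simp add: space_restrict_space)
  have \<psi>L[measurable]: "\<psi> i \<in> borel_measurable ?L" for i by (rule measurable_restrict_space1) simp
  have op: "kernel_op T k q = op q" for q by (simp add: fun_eq_iff kernel_op_restrict[OF T(1)] op_def)
  have A\<delta>: "0 < A * \<delta>" using A by simp
  have M0: "0 < M" using A M(1) by linarith
  have M\<delta>: "0 < M * \<delta>" "32 * (A * \<delta>) \<le> M * \<delta>" "8 * (B * \<delta>) \<le> M * \<delta>"
    using M0 A mult_right_mono[OF M(1), of \<delta>] mult_right_mono[OF M(2), of \<delta>] by (auto simp: mult_ac)
  have sup: "\<bar>f x\<bar> \<le> a" if "Lr_norm T \<top> f \<le> ennreal a" "0 < a" "x \<in> T" for f a x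
  proof -
    have "ennreal \<bar>f x\<bar> \<le> Lr_norm T \<top> f" using that(3) by (auto simp: Lr_norm_def intro: SUP_upper)
    then have "ennreal \<bar>f x\<bar> \<le> ennreal a" using that(1) by (rule order_trans)
    then show ?thesis using that(2) by (simp add: ennreal_le_iff)
  qed
  have ap': "\<bar>op p x - p x\<bar> \<le> A * \<delta>" and ap0': "\<bar>op p0 x - p0 x\<bar> \<le> A * \<delta>" if "x \<in> T" for x
    using sup[OF ap[unfolded op] A\<delta> that] sup[OF ap0[unfolded op] A\<delta> that] by auto
  obtain x0 where x0: "x0 \<in> T" using T(2) by blast
  have U0: "0 \<le> U" using U[OF x0] p0D(2)[OF x0] by linarith
  define h where "h x = p x - p0 x" for x
  define \<Delta> where "\<Delta> = enn2real (Lr_norm T \<top> h)"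
  have fin: "Lr_norm T \<top> h \<le> ennreal (B * R + A * \<delta> + U)"
  proof -
    have "\<bar>h x\<bar> \<le> B * R + A * \<delta> + U" if x: "x \<in> T" for x
    proof -
      have "\<bar>op p x\<bar> \<le> B * R" using x by (intro order_trans[OF op_le_aop[OF dp] aop_le[OF dp]]) (auto simp: spL)
      then show ?thesis using ap'[OF x] U[OF x] p0D(2)[OF x] unfolding h_def by linarith
    qed
    then show ?thesis by (auto simp: Lr_norm_def intro!: SUP_least ennreal_leI)
  qed
  have \<Delta>n: "Lr_norm T \<top> h = ennreal \<Delta>"
    unfolding \<Delta>_def using order_le_less_trans[OF fin ennreal_less_top] by simp
  have M\<Delta>: "M * \<delta> \<le> \<Delta>"
  proof -
    have "0 \<le> \<Delta>" by (simp add: \<Delta>_def)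
    moreover have "ennreal (M * \<delta>) \<le> ennreal \<Delta>" using far unfolding \<Delta>n[symmetric] h_def .
    ultimately show ?thesis by (simp only: ennreal_le_iff)
  qed
  have \<Delta>0: "0 < \<Delta>" using M\<Delta> M\<delta>(1) by linarith
  have h\<Delta>: "\<bar>h x\<bar> \<le> \<Delta>" if "x \<in> T" for x
    using sup[OF _ \<Delta>0 that, of h] \<Delta>n by simp
  \<comment> \<open>The supremum need not be attained, so a point within a sixteenth of it is taken.
    The later comparison has room for this: the opposite bound is at most
    \<open>9 / 16 * \<Delta>\<close>.\<close>
  obtain x where x: "x \<in> T" "15 / 16 * \<Delta> < \<bar>h x\<bar>"
  proof -
    have "ennreal (15 / 16 * \<Delta>) < Lr_norm T \<top> h"
      unfolding \<Delta>n using \<Delta>0 by (intro ennreal_lessI) auto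
    then have "ennreal (15 / 16 * \<Delta>) < (SUP x\<in>T. ennreal \<bar>h x\<bar>)" by (simp add: Lr_norm_def)
    then obtain x where "x \<in> T" "ennreal (15 / 16 * \<Delta>) < ennreal \<bar>h x\<bar>" by (auto simp: less_SUP_iff)
    then show ?thesis using that \<Delta>0 by (simp add: ennreal_less_iff)
  qed
  have int_q: "integrable ?L q" if "dens q" for q
    using integrable_dens[OF that, of "\<lambda>_. 1" 1] by simp
  have int_h: "integrable ?L h" unfolding h_def using int_q[OF dp] int_q[OF dp0] by (rule Bochner_Integration.integrable_diff)
  have int_\<psi>: "integrable ?L (\<lambda>y. \<psi> i y * q y)" if "dens q" for i q
    using D.abs_le by (intro integrable_dens[OF that, of _ B]) auto
  have op_h: "op p x - op p0 x = (LINT y|?L. k x y * h y)"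
    unfolding op_def h_def right_diff_distrib using k_dens_integrable(1)[OF dp] k_dens_integrable(1)[OF dp0] x(1)
    by (subst Bochner_Integration.integral_diff) (auto simp: spL)
  \<comment> \<open>Chosen so that \<open>B * R * a = \<Delta> / 4\<close>, of the same size as the
    error allowed in the reconstruction.\<close>
  define a where "a = \<Delta> / (4 * B * R)"
  have a0: "0 < a" using \<Delta>0 B1 R1 by (simp add: a_def)
  obtain i where i: "a < \<bar>LINT y|?L. \<psi> i y * h y\<bar>"
  proof -
    have "\<exists>i. a < \<bar>LINT y|?L. \<psi> i y * h y\<bar>"
    proof (rule ccontr)
      assume "\<not> ?thesis"
      then have "\<bar>LINT y|?L. k x y * h y\<bar> \<le> B * R * a + \<Delta> / 4"
        using h\<Delta> by (intro rec int_h x(1)) (auto simp: not_less)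
      also have "B * R * a = \<Delta> / 4" using B1 R1 by (simp add: a_def)
      finally have "\<bar>op p x - op p0 x\<bar> \<le> \<Delta> / 2" by (simp add: op_h)
      then have "\<bar>h x\<bar> \<le> \<Delta> / 2 + 2 * (A * \<delta>)"
        using ap'[OF x(1)] ap0'[OF x(1)] unfolding h_def by linarith
      then show False using x(2) M\<delta>(2) M\<Delta> \<Delta>0 by linarith
    qed
    then show ?thesis using that by blast
  qed
  have diff: "integral\<^sup>L (law T p) (\<psi> i) - integral\<^sup>L (law T p0) (\<psi> i) = (LINT y|?L. \<psi> i y * h y)"
    unfolding Mp integral_Mp[OF dp \<psi>L] integral_Mp[OF dp0 \<psi>L] h_def right_diff_distrib
    using int_\<psi>[OF dp] int_\<psi>[OF dp0] by (subst Bochner_Integration.integral_diff) auto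
  \<comment> \<open>Half of the separation is used in the exponential bound; the other half exceeds
    \<open>\<delta> / R\<close> because \<open>M \<ge> 8 * B\<close>. With
    \<open>t = \<Delta> / (8 * B * R)\<close> the exponent acquires the factor
    \<open>4 * 64 = 256\<close>.\<close>
  define t where "t = a / 2"
  define S where "S = B\<^sup>2 * (U + \<Delta>) / R"
  have S0: "0 < S" using B1 R1 U0 \<Delta>0 by (simp add: S_def)
  have "\<delta> / R \<le> t"
  proof -
    have "8 * (B * \<delta>) \<le> \<Delta>" using M\<delta>(3) M\<Delta> by linarith
    then show ?thesis using B1 R1 by (simp add: t_def a_def field_simps)
  qed
  then have sep: "t + \<delta> / R \<le> \<bar>integral\<^sup>L (law T p) (\<psi> i) - integral\<^sup>L (law T p0) (\<psi> i)\<bar>"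
    unfolding diff using i t_def by linarith
  have tb: "t * B \<le> 2 * S"
  proof -
    have "t * B = \<Delta> / (8 * R)" using B1 by (simp add: t_def a_def)
    also have "\<dots> \<le> 2 * (1 * (U + \<Delta>)) / R" using R1 U0 \<Delta>0 by (simp add: field_simps)
    also have "\<dots> \<le> 2 * (B\<^sup>2 * (U + \<Delta>)) / R"
      using B1 R1 U0 \<Delta>0 one_le_power[OF B1, of 2] by (intro divide_right_mono mult_left_mono mult_right_mono) auto
    finally show ?thesis by (simp add: S_def)
  qed
  have p_le: "p y \<le> U + \<Delta>" if "y \<in> T" for y using h\<Delta>[OF that] U[OF that] unfolding h_def by linarith
  have S: "integral\<^sup>L (law T p) (\<lambda>y. (\<psi> i y)\<^sup>2) \<le> S"
    unfolding S_def using U0 \<Delta>0 by (intro D.second_moment_le[OF T(1) p p_le]) auto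
  have \<psi>law: "\<psi> i \<in> borel_measurable (law T p)" for i by (simp cong: measurable_cong_sets)
  let ?P = "PiM {..<n} (\<lambda>_. law T p)"
  have "emeasure ?P {\<omega> \<in> space ?P. \<forall>i. \<bar>(\<Sum>j<n. \<psi> i (\<omega> j)) / real n - integral\<^sup>L (law T p0) (\<psi> i)\<bar> \<le> \<delta> / R} \<le>
    emeasure ?P {\<omega> \<in> space ?P. \<bar>(\<Sum>j<n. \<psi> i (\<omega> j)) / real n - integral\<^sup>L (law T p0) (\<psi> i)\<bar> \<le> \<delta> / R}"
  proof (rule emeasure_mono)
    note \<psi>law[measurable]
    show "{\<omega> \<in> space ?P. \<bar>(\<Sum>j<n. \<psi> i (\<omega> j)) / real n - integral\<^sup>L (law T p0) (\<psi> i)\<bar> \<le> \<delta> / R} \<in> sets ?P"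
      by measurable
  qed auto
  also have "\<dots> \<le> ennreal (exp (- real n * t\<^sup>2 / (4 * S)))"
    using a0 by (intro type_II_sup[OF prob_space_law[OF p T(1)] \<psi>law n D.abs_le S _ tb S0 sep]) (simp add: t_def)
  also have "- real n * t\<^sup>2 / (4 * S) = - (real n * \<Delta>\<^sup>2 / (256 * B ^ 4 * (U + \<Delta>) * R powr 1))"
    using B1 R1 by (simp add: t_def a_def S_def power2_eq_square power4_eq_xxxx)
  finally show ?thesis using that[OF M\<Delta>] by blast
qed

text \<open>The bound is small because \<open>R\<close> is at most of order \<open>N\<close> while
  \<open>n * \<delta>\<^sup>2\<close> will be at least of order \<open>N\<^sup>2\<close>, so the
  last factor is of order \<open>1 / N\<close>.\<close>

lemma type_I_top:
  fixes n :: nat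
  assumes T: "T \<in> sets borel" and \<psi>: "dictionary \<psi> B R" and n: "n \<ge> 1" "R \<le> real n"
    and p0: "prob_density T p0" and U: "\<And>x. x \<in> T \<Longrightarrow> p0 x \<le> U" "0 \<le> U" and \<delta>: "0 < \<delta>"
  shows "emeasure (PiM {..<n} (\<lambda>_. law T p0)) {\<omega> \<in> space (PiM {..<n} (\<lambda>_. law T p0)).
      \<exists>i. \<delta> / R < \<bar>(\<Sum>j<n. \<psi> i (\<omega> j)) / real n - integral\<^sup>L (law T p0) (\<psi> i)\<bar>}
    \<le> ennreal (256 * B ^ 4 * (U + 1)\<^sup>2 * (R ^ 3 / (real n * \<delta>\<^sup>2)\<^sup>2))"
proof -
  let ?L = "restrict_space lborel T"
  interpret D: dictionary \<psi> B R by (rule \<psi>)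
  note p0D = prob_densityD[OF p0 T]
  note [measurable] = p0D(1)
  have spL: "space ?L = T" by (simp add: space_restrict_space)
  have \<psi>L[measurable]: "\<psi> i \<in> borel_measurable ?L" for i by (rule measurable_restrict_space1) simp
  have \<psi>law[measurable]: "\<psi> i \<in> borel_measurable (law T p0)" for i by (simp cong: measurable_cong_sets)
  have n0: "0 < real n" using n by simp
  have B0: "0 < B" and R0: "0 < R" using D.b1 D.R1 by auto
  \<comment> \<open>This makes \<open>l\<close> admissible twice over: \<open>l * B \<le> 1\<close>
    because \<open>R \<le> n\<close>, and \<open>n * l\<^sup>2 * V \<le> 1\<close> because the
    second moment bound \<open>V\<close> carries a factor \<open>1 / R\<close> that cancels
    \<open>R\<close>.\<close>
  define c1 where "c1 = 1 / (B * (U + 1))"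
  have c1: "0 < c1" using B0 U by (simp add: c1_def)
  define l where "l = c1 * sqrt (R / real n)"
  have l: "0 < l" using c1 R0 n0 by (simp add: l_def)
  have l2: "real n * l\<^sup>2 = c1\<^sup>2 * R" using R0 n0 by (simp add: l_def power_mult_distrib)
  have lB: "l * B \<le> 1"
  proof -
    have "sqrt (R / real n) \<le> 1" using n n0 by (simp add: divide_le_eq)
    then have "l * B \<le> c1 * 1 * B" unfolding l_def using c1 B0 by (intro mult_right_mono mult_left_mono) auto
    also have "\<dots> = 1 / (U + 1)" using B0 by (simp add: c1_def)
    also have "\<dots> \<le> 1" using U by simp
    finally show ?thesis .
  qed
  define V where "V = B\<^sup>2 * (U + 1) / R"
  have V: "integral\<^sup>L (law T p0) (\<lambda>y. (\<psi> i y)\<^sup>2) \<le> V" for i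
    unfolding V_def using U by (intro D.second_moment_le[OF T p0]) (auto intro: add_increasing2)
  have lV: "real n * l\<^sup>2 * V \<le> 1"
  proof -
    have "real n * l\<^sup>2 * V = 1 / (U + 1)"
      unfolding l2 using B0 R0 U by (simp add: V_def c1_def power2_eq_square)
    then show ?thesis using U by simp
  qed
  have "emeasure (PiM {..<n} (\<lambda>_. law T p0)) {\<omega> \<in> space (PiM {..<n} (\<lambda>_. law T p0)).
      \<exists>i. \<delta> / R < \<bar>(\<Sum>j<n. \<psi> i (\<omega> j)) / real n - integral\<^sup>L (law T p0) (\<psi> i)\<bar>}
    \<le> ennreal (256 * (real n * l\<^sup>2 * B\<^sup>2) / (l * real n * (\<delta> / R)) ^ 4)"
    using \<delta> R0 by (intro type_I_sup[OF prob_space_law[OF p0 T] \<psi>law D.sum_le B0 V l lB lV _ n(1)]) auto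
  also have "256 * (real n * l\<^sup>2 * B\<^sup>2) / (l * real n * (\<delta> / R)) ^ 4 = 256 * B ^ 4 * (U + 1)\<^sup>2 * (R ^ 3 / (real n * \<delta>\<^sup>2)\<^sup>2)"
  proof -
    have "(l * real n * (\<delta> / R))\<^sup>2 = (real n * l\<^sup>2) * real n * \<delta>\<^sup>2 / R\<^sup>2"
      by (simp add: power_mult_distrib power_divide power2_eq_square)
    also have "\<dots> = c1\<^sup>2 * (real n * \<delta>\<^sup>2) / R" unfolding l2 using R0 by (simp add: power2_eq_square)
    finally have "(l * real n * (\<delta> / R)) ^ 4 = (c1\<^sup>2 * (real n * \<delta>\<^sup>2) / R)\<^sup>2"
      by (metis (no_types) mult_2_right numeral_Bit0 power_even_eq power_mult)
    moreover have "256 * (c1\<^sup>2 * R * B\<^sup>2) / (c1\<^sup>2 * (real n * \<delta>\<^sup>2) / R)\<^sup>2 = 256 * B\<^sup>2 * (1 / c1\<^sup>2) * (R ^ 3 / (real n * \<delta>\<^sup>2)\<^sup>2)"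
      using c1 R0 by (simp add: power2_eq_square power3_eq_cube mult_ac)
    moreover have "1 / c1\<^sup>2 = B\<^sup>2 * (U + 1)\<^sup>2" by (simp add: c1_def power_mult_distrib power_one_over)
    ultimately have "256 * (real n * l\<^sup>2 * B\<^sup>2) / (l * real n * (\<delta> / R)) ^ 4 =
        256 * B\<^sup>2 * (B\<^sup>2 * (U + 1)\<^sup>2) * (R ^ 3 / (real n * \<delta>\<^sup>2)\<^sup>2)"
      unfolding l2 by (simp only:)
    moreover have "B\<^sup>2 * (B\<^sup>2 * (U + 1)\<^sup>2) = B ^ 4 * (U + 1)\<^sup>2" by (simp add: power2_eq_square power4_eq_xxxx)
    ultimately show ?thesis by (simp only: mult.assoc)
  qed
  finally show ?thesis .
qed

lemma Markov_emeasure: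
  assumes [measurable]: "f \<in> borel_measurable M" and a: "0 < a" and m: "(\<integral>\<^sup>+x. f x \<partial>M) \<le> ennreal m" "0 \<le> m"
  shows "emeasure M {x \<in> space M. \<not> f x \<le> ennreal a} \<le> ennreal (m / a)"
proof -
  have "emeasure M {x \<in> space M. \<not> f x \<le> ennreal a} \<le> emeasure M {x \<in> space M. 1 \<le> ennreal (1 / a) * f x}"
  proof (intro emeasure_mono Collect_mono conj_mono impI)
    fix x assume "\<not> f x \<le> ennreal a"
    then have "ennreal (1 / a) * ennreal a \<le> ennreal (1 / a) * f x" by (intro mult_left_mono) auto
    then show "1 \<le> ennreal (1 / a) * f x" using a by (simp add: ennreal_mult[symmetric])
  qed (auto intro!: measurable)
  also have "\<dots> \<le> ennreal (1 / a) * (\<integral>\<^sup>+x\<in>space M. f x \<partial>M)"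
    by (rule nn_integral_Markov_inequality) auto
  also have "\<dots> \<le> ennreal (1 / a) * ennreal m"
    using m by (intro mult_left_mono) (simp_all cong: nn_integral_cong_simp)
  finally show ?thesis using a m by (simp add: ennreal_mult[symmetric])
qed

text \<open>\<open>\<theta>\<close> stands for \<open>1 - 1/r\<close>, equal to \<open>1\<close> for
  \<open>r = \<infinity>\<close>, so that \<open>N powr (\<theta> / 2)\<close> is the power in the
  rate. The number \<open>C\<close> is the exponent demanded of the tests and will be instantiated
  with the prior constant increased by four.\<close>

locale rate_setting =
  fixes T :: "real set" and B c A C :: real and p0 :: "real \<Rightarrow> real" and \<epsilon> \<delta> N R :: "nat \<Rightarrow> real"
    and k :: "nat \<Rightarrow> real \<Rightarrow> real \<Rightarrow> real" and \<theta> :: real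
  assumes T: "T = {0..1} \<or> T = UNIV" and B1: "1 \<le> B" and c: "0 < c" and A: "0 < A" and C: "0 \<le> C"
    and p0: "prob_density T p0"
    and eps_pos: "\<And>n. n \<ge> 1 \<Longrightarrow> 0 < \<epsilon> n" and eps_0: "\<epsilon> \<longlonglongrightarrow> 0"
    and N_def: "\<And>n. N n = real n * (\<epsilon> n)\<^sup>2" and N_top: "filterlim N at_top sequentially"
    and good: "\<And>n. n \<ge> 1 \<Longrightarrow> good_kernel T B (R n) (k n)"
    and R_le: "\<And>n. n \<ge> 1 \<Longrightarrow> R n \<le> c * N n"
    and \<theta>: "0 \<le> \<theta>" "\<theta> \<le> 1"
    and delta_ge: "\<And>n. n \<ge> 1 \<Longrightarrow> \<epsilon> n * N n powr (\<theta> / 2) \<le> \<delta> n"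
    and delta_0: "\<delta> \<longlonglongrightarrow> 0"
begin

abbreviation "L \<equiv> restrict_space lborel T"
abbreviation "P q n \<equiv> PiM {..<n::nat} (\<lambda>_. law T q)"

text \<open>Alternatives are described by their approximation error alone. Neither prior nor sieve
  occurs, so the rejection regions are built from \<open>p0\<close> and the kernels, and a sieve
  enters later only through its approximation bound.\<close>

definition tests :: "ennreal \<Rightarrow> real \<Rightarrow> (nat \<Rightarrow> (nat \<Rightarrow> real) set) \<Rightarrow> bool" where
  "tests r M E \<longleftrightarrow> 0 < M \<and> (\<forall>n\<ge>1. E n \<in> sets (PiM {..<n} (\<lambda>_. L))) \<and>
     ((\<lambda>n. emeasure (P p0 n) (E n)) \<longlonglongrightarrow> 0) \<and>
     (\<forall>\<^sub>F n in sequentially. \<forall>p. prob_density T p \<longrightarrow>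
        Lr_norm T r (\<lambda>x. kernel_op T (k n) p x - p x) \<le> ennreal (A * \<delta> n) \<longrightarrow>
        ennreal (M * \<delta> n) \<le> Lr_norm T r (\<lambda>x. p x - p0 x) \<longrightarrow>
        emeasure (P p n) (space (P p n) - E n) \<le> ennreal (exp (- (C * N n))))"

lemma Tb: "T \<in> sets borel" and T_ne: "T \<noteq> {}" using T by auto

lemma sets_P: "sets (P q n) = sets (PiM {..<n} (\<lambda>_. L))" by (intro sets_PiM_cong) auto

lemma space_P: "space (P q n) = space (PiM {..<n} (\<lambda>_. L))" by (rule sets_eq_imp_space_eq[OF sets_P])

lemma N_pos: "n \<ge> 1 \<Longrightarrow> 0 < N n" using eps_pos[of n] by (auto simp: N_def intro!: mult_pos_pos)

lemma delta_pos: "n \<ge> 1 \<Longrightarrow> 0 < \<delta> n"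
  using delta_ge[of n] eps_pos[of n] N_pos[of n] by (auto intro: less_le_trans[rotated])

lemma R1: "n \<ge> 1 \<Longrightarrow> 1 \<le> R n"
  using good_kernelD(1)[OF good] by (simp add: schur_kernel_def schur_kernel_axioms_def)

lemma eventually_basic:
  assumes M: "0 < M"
  shows "\<forall>\<^sub>F n in sequentially. n \<ge> 1 \<and> R n \<le> real n \<and> M * \<delta> n \<le> 1"
proof -
  have "(\<lambda>n. M * \<delta> n) \<longlonglongrightarrow> M * 0" by (intro tendsto_mult tendsto_const delta_0)
  then have e1: "\<forall>\<^sub>F n in sequentially. M * \<delta> n < 1" by (rule order_tendstoD) simp
  have "(\<lambda>n. c * (\<epsilon> n)\<^sup>2) \<longlonglongrightarrow> c * 0\<^sup>2" by (intro tendsto_mult tendsto_const tendsto_power eps_0)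
  then have e2: "\<forall>\<^sub>F n in sequentially. c * (\<epsilon> n)\<^sup>2 < 1" by (rule order_tendstoD) simp
  show ?thesis using e1 e2 eventually_ge_at_top[of 1]
  proof eventually_elim
    case (elim n)
    have "R n \<le> real n * (c * (\<epsilon> n)\<^sup>2)" using R_le[OF elim(3)] by (simp add: N_def mult_ac)
    also have "\<dots> \<le> real n * 1" using elim by (intro mult_left_mono) auto
    finally show ?case using elim by simp
  qed
qed

lemma exponent:
  assumes n: "n \<ge> 1" "M * \<delta> n \<le> 1" and M: "0 < M" and \<Delta>: "M * \<delta> n \<le> \<Delta>" and \<kappa>: "0 < \<kappa>" and U: "0 \<le> U"
    and large: "sqrt (\<kappa> * (U + 1) * max 1 c * C) \<le> M"
  shows "C * N n \<le> real n * \<Delta>\<^sup>2 / (\<kappa> * (U + \<Delta>) * R n powr \<theta>)"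
proof -
  have "0 \<le> \<kappa> * (U + 1) * max 1 c * C" using \<kappa> U C by simp
  then have "\<kappa> * (U + 1) * max 1 c * C = (sqrt (\<kappa> * (U + 1) * max 1 c * C))\<^sup>2" by simp
  also have "\<dots> \<le> M\<^sup>2" using large \<kappa> U C by (intro power_mono) auto
  finally show ?thesis
    using R1[OF n(1)]
    by (intro exponent_bound[OF delta_pos[OF n(1)] n(2) \<Delta> delta_ge[OF n(1)] eps_pos[OF n(1)] N_pos[OF n(1)] N_def \<theta>
          _ R_le[OF n(1)] \<kappa> U M C]) auto
qed

lemma tendsto_inverse_N:
  assumes "0 < s"
  shows "(\<lambda>n. ennreal (D * N n powr (- s))) \<longlonglongrightarrow> 0"
proof -
  have "(\<lambda>n. N n powr (- s)) \<longlonglongrightarrow> 0" using assms by (intro tendsto_neg_powr N_top) auto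
  then have "(\<lambda>n. D * N n powr (- s)) \<longlonglongrightarrow> D * 0" by (intro tendsto_mult tendsto_const)
  then have "(\<lambda>n. ennreal (D * N n powr (- s))) \<longlonglongrightarrow> ennreal (D * 0)" by (rule tendsto_ennrealI)
  then show ?thesis by simp
qed

lemma tendsto_emeasure_bound:
  assumes "0 < s" "\<forall>\<^sub>F n in sequentially. emeasure (P p0 n) (E n) \<le> ennreal (D * N n powr (- s))"
  shows "(\<lambda>n. emeasure (P p0 n) (E n)) \<longlonglongrightarrow> 0"
  by (rule tendsto_sandwich[OF _ assms(2) tendsto_const tendsto_inverse_N[OF assms(1)]]) auto

lemma tests_top:
  assumes \<theta>1: "\<theta> = 1" and U: "Lr_norm T \<top> p0 < \<top>"
    and ap0: "\<forall>\<^sub>F n in sequentially. Lr_norm T \<top> (\<lambda>x. kernel_op T (k n) p0 x - p0 x) \<le> ennreal (A * \<delta> n)"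
  shows "\<exists>M E. tests \<top> M E"
proof -
  define u where "u = enn2real (Lr_norm T \<top> p0)"
  have u0: "0 \<le> u" by (simp add: u_def)
  have p0u: "p0 x \<le> u" if "x \<in> T" for x
  proof -
    have "ennreal \<bar>p0 x\<bar> \<le> Lr_norm T \<top> p0" using that by (auto simp: Lr_norm_def intro: SUP_upper)
    also have "\<dots> = ennreal u" using U by (simp add: u_def)
    finally show ?thesis using u0 by (simp add: ennreal_le_iff)
  qed
  define rec' where "rec' n \<psi> \<longleftrightarrow> (\<forall>h \<Delta> a x. integrable L h \<longrightarrow> (\<forall>y\<in>T. \<bar>h y\<bar> \<le> \<Delta>) \<longrightarrow>
           (\<forall>i. \<bar>LINT y|L. \<psi> i y * h y\<bar> \<le> a) \<longrightarrow> x \<in> T \<longrightarrow>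
           \<bar>LINT y|L. k n x y * h y\<bar> \<le> B * R n * a + \<Delta> / 4)" for n and \<psi> :: "nat \<Rightarrow> real \<Rightarrow> real"
  \<comment> \<open>The rejection region needs one fixed dictionary for each \<open>n\<close>,
    whereas \<open>good_kernel\<close> only asserts existence.\<close>
  define \<psi> where "\<psi> n = (SOME \<psi>. dictionary \<psi> B (R n) \<and> rec' n \<psi>)" for n
  have \<psi>': "dictionary (\<psi> n) B (R n) \<and> rec' n (\<psi> n)" if "n \<ge> 1" for n
  proof -
    have "\<exists>\<psi>. dictionary \<psi> B (R n) \<and> rec' n \<psi>"
      using good[OF that] unfolding good_kernel_def rec'_def by (elim conjE)
    then show ?thesis unfolding \<psi>_def by (rule someI_ex)
  qed
  then have \<psi>: "\<And>n. n \<ge> 1 \<Longrightarrow> dictionary (\<psi> n) B (R n)" by blast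
  have rec: "\<bar>LINT y|L. k n x y * h y\<bar> \<le> B * R n * a + \<Delta> / 4"
    if "n \<ge> 1" "integrable L h" "\<forall>y\<in>T. \<bar>h y\<bar> \<le> \<Delta>" "\<forall>i. \<bar>LINT y|L. \<psi> n i y * h y\<bar> \<le> a" "x \<in> T" for n h \<Delta> a x
    using \<psi>'[OF that(1), THEN conjunct2, unfolded rec'_def, rule_format, OF that(2) _ _ that(5)] that(3,4) by blast
  define \<kappa> where "\<kappa> = 256 * B ^ 4"
  have \<kappa>: "0 < \<kappa>" using B1 by (simp add: \<kappa>_def)
  define q where "q = sqrt (\<kappa> * (u + 1) * max 1 c * C)"
  have q: "0 \<le> q" using \<kappa> u0 C by (simp add: q_def)
  \<comment> \<open>A sum of three thresholds: approximation errors, test threshold, and size of the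
    exponent.\<close>
  define M where "M = 32 * A + 8 * B + q"
  have M: "0 < M" "32 * A \<le> M" "8 * B \<le> M" "q \<le> M" using A B1 q by (auto simp: M_def)
  define E where "E n = {\<omega> \<in> space (P p0 n).
      \<exists>i. \<delta> n / R n < \<bar>(\<Sum>j<n. \<psi> n i (\<omega> j)) / real n - integral\<^sup>L (law T p0) (\<psi> n i)\<bar>}" for n
  have E_sets: "E n \<in> sets (PiM {..<n} (\<lambda>_. L))" if n: "n \<ge> 1" for n
  proof -
    have "\<psi> n i \<in> borel_measurable L" for i
      by (rule measurable_restrict_space1) (use \<psi>[OF n] in \<open>simp add: dictionary_def\<close>)
    then have [measurable]: "\<psi> n i \<in> borel_measurable (law T p0)" for i by (simp cong: measurable_cong_sets)
    have "E n \<in> sets (P p0 n)" unfolding E_def by measurable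
    then show ?thesis by (simp only: sets_P)
  qed
  have typeI: "\<forall>\<^sub>F n in sequentially. emeasure (P p0 n) (E n) \<le> ennreal (256 * B ^ 4 * (u + 1)\<^sup>2 * c ^ 3 * N n powr (- 1))"
    using eventually_basic[OF M(1)]
  proof eventually_elim
    case (elim n)
    then have n: "n \<ge> 1" "R n \<le> real n" by auto
    note Np = N_pos[OF n(1)]
    have "emeasure (P p0 n) (E n) \<le> ennreal (256 * B ^ 4 * (u + 1)\<^sup>2 * (R n ^ 3 / (real n * (\<delta> n)\<^sup>2)\<^sup>2))"
      unfolding E_def by (rule type_I_top[OF Tb \<psi>[OF n(1)] n p0 p0u u0 delta_pos[OF n(1)]])
    also have "\<dots> \<le> ennreal (256 * B ^ 4 * (u + 1)\<^sup>2 * (c ^ 3 * N n powr (- 1)))"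
    proof (intro ennreal_leI mult_left_mono)
      \<comment> \<open>For \<open>\<theta> = 1\<close> the rate is at least
        \<open>\<epsilon>\<close> times the square root of \<open>N\<close>. Combined with
        \<open>R \<le> c * N\<close>, the quotient is at most
        \<open>c ^ 3 * N ^ 3 / N ^ 4\<close>.\<close>
      have "(N n)\<^sup>2 \<le> real n * (\<delta> n)\<^sup>2"
      proof -
        have "(N n powr (1 / 2))\<^sup>2 = N n" using Np by (simp add: powr_half_sqrt)
        then have "(N n)\<^sup>2 = real n * (\<epsilon> n * N n powr (\<theta> / 2))\<^sup>2"
          by (simp add: \<theta>1 power_mult_distrib N_def power2_eq_square)
        also have "\<dots> \<le> real n * (\<delta> n)\<^sup>2"
          using delta_ge[OF n(1)] eps_pos[OF n(1)] by (intro mult_left_mono power_mono) auto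
        finally show ?thesis .
      qed
      then have "((N n)\<^sup>2)\<^sup>2 \<le> (real n * (\<delta> n)\<^sup>2)\<^sup>2" by (intro power_mono) auto
      moreover have "R n ^ 3 \<le> (c * N n) ^ 3" using R_le[OF n(1)] R1[OF n(1)] by (intro power_mono) auto
      ultimately have "R n ^ 3 / (real n * (\<delta> n)\<^sup>2)\<^sup>2 \<le> (c * N n) ^ 3 / ((N n)\<^sup>2)\<^sup>2"
        using Np c R1[OF n(1)] by (intro frac_le) auto
      also have "\<dots> = c ^ 3 * N n powr (- 1)"
        using Np by (simp add: powr_minus power_mult_distrib power2_eq_square power3_eq_cube field_simps)
      finally show "R n ^ 3 / (real n * (\<delta> n)\<^sup>2)\<^sup>2 \<le> c ^ 3 * N n powr (- 1)" .
    qed (use u0 in simp)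
    finally show ?case by (simp add: mult.assoc)
  qed
  have typeII: "\<forall>\<^sub>F n in sequentially. \<forall>p. prob_density T p \<longrightarrow>
        Lr_norm T \<top> (\<lambda>x. kernel_op T (k n) p x - p x) \<le> ennreal (A * \<delta> n) \<longrightarrow>
        ennreal (M * \<delta> n) \<le> Lr_norm T \<top> (\<lambda>x. p x - p0 x) \<longrightarrow>
        emeasure (P p n) (space (P p n) - E n) \<le> ennreal (exp (- (C * N n)))"
    using eventually_basic[OF M(1)] ap0
  proof eventually_elim
    case (elim n)
    show ?case
    proof (intro allI impI)
      fix p assume p: "prob_density T p"
        and ap: "Lr_norm T \<top> (\<lambda>x. kernel_op T (k n) p x - p x) \<le> ennreal (A * \<delta> n)"
        and far: "ennreal (M * \<delta> n) \<le> Lr_norm T \<top> (\<lambda>x. p x - p0 x)"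
      from elim(1) have n: "n \<ge> 1" "M * \<delta> n \<le> 1" by auto
      obtain \<Delta> where \<Delta>: "M * \<delta> n \<le> \<Delta>"
        "emeasure (P p n) {\<omega> \<in> space (P p n).
          \<forall>i. \<bar>(\<Sum>j<n. \<psi> n i (\<omega> j)) / real n - integral\<^sup>L (law T p0) (\<psi> n i)\<bar> \<le> \<delta> n / R n}
          \<le> ennreal (exp (- (real n * \<Delta>\<^sup>2 / (256 * B ^ 4 * (u + \<Delta>) * R n powr 1))))"
        by (rule type_II_top[OF Tb T_ne good[OF n(1)] n(1) \<psi>[OF n(1)] rec[OF n(1)] p p0 p0u A delta_pos[OF n(1)] M(2,3) ap elim(2) far])
      have "{\<omega> \<in> space (P p n). \<forall>i. \<bar>(\<Sum>j<n. \<psi> n i (\<omega> j)) / real n - integral\<^sup>L (law T p0) (\<psi> n i)\<bar> \<le> \<delta> n / R n} =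
          space (P p n) - E n"
        by (auto simp: E_def space_P not_less) (meson not_le)
      with \<Delta>(2) have "emeasure (P p n) (space (P p n) - E n) \<le>
          ennreal (exp (- (real n * \<Delta>\<^sup>2 / (\<kappa> * (u + \<Delta>) * R n powr \<theta>))))"
        by (simp add: \<kappa>_def \<theta>1)
      also have "\<dots> \<le> ennreal (exp (- (C * N n)))"
        using exponent[OF n M(1) \<Delta>(1) \<kappa> u0 M(4)[unfolded q_def]] by (intro ennreal_leI) simp
      finally show "emeasure (P p n) (space (P p n) - E n) \<le> ennreal (exp (- (C * N n)))" .
    qed
  qed
  have "tests \<top> M E"
    unfolding tests_def using M(1) E_sets typeII tendsto_emeasure_bound[OF _ typeI] by auto
  then show ?thesis by blast
qed

lemma tests_finite:
  assumes r: "1 \<le> \<rho>" and \<theta>r: "\<theta> = 1 - 1 / \<rho>" and U: "Lr_norm T (ennreal \<rho>) p0 < \<top>"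
    and w: "\<rho> < 2 \<Longrightarrow> (2 - \<rho>) / \<rho> < w"
    and mom: "\<rho> < 2 \<Longrightarrow> T = UNIV \<Longrightarrow> mu_norm T w p0 < \<top>"
    and ap0: "\<forall>\<^sub>F n in sequentially. Lr_norm T (ennreal \<rho>) (\<lambda>x. kernel_op T (k n) p0 x - p0 x) \<le> ennreal (A * \<delta> n)"
  shows "\<exists>M E. tests (ennreal \<rho>) M E"
proof -
  obtain u' where u': "0 \<le> u'" "(\<integral>\<^sup>+x. ennreal (\<bar>p0 x\<bar> powr \<rho>) \<partial>L) = ennreal (u' powr \<rho>)"
    using Lr_norm_real[OF Tb r U] by blast
  \<comment> \<open>Raised by one because the inequalities in power form require strictly positive
    norm bounds.\<close>
  define u where "u = u' + 1"
  have u: "0 < u" using u' by (simp add: u_def)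
  have pu: "(\<integral>\<^sup>+x. ennreal (\<bar>p0 x\<bar> powr \<rho>) \<partial>L) \<le> ennreal (u powr \<rho>)"
    unfolding u'(2) using u' r by (intro ennreal_leI powr_mono2) (auto simp: u_def)
  obtain D where D: "0 < D" and mean: "\<And>k R n. good_kernel T B R k \<Longrightarrow> n \<ge> 1 \<Longrightarrow> R \<le> real n \<Longrightarrow>
    (\<integral>\<^sup>+\<omega>. \<integral>\<^sup>+x. ennreal (\<bar>schur_kernel.est k n \<omega> x - schur_kernel.op L k p0 x\<bar> powr \<rho>)
      \<partial>L \<partial>P p0 n) \<le> ennreal (D * (R / real n) powr (\<rho> / 2))"
    using estimator_mean_bound[OF T B1 r p0 pu u w mom] by blast
  \<comment> \<open>Dictated by the case \<open>\<rho> = 1\<close>: the mean error is at most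
    \<open>D * sqrt c * \<epsilon>\<close>, and the added \<open>1\<close> leaves room for a
    fluctuation of size \<open>\<epsilon>\<close>.\<close>
  define \<tau> where "\<tau> = D * sqrt c + 1"
  have \<tau>: "0 < \<tau>" "1 \<le> \<tau>" using D c by (auto simp: \<tau>_def add_nonneg_pos)
  define \<kappa> where "\<kappa> = 16 * B\<^sup>2"
  have \<kappa>: "0 < \<kappa>" using B1 by (simp add: \<kappa>_def)
  define q where "q = sqrt (\<kappa> * (u + 1) * max 1 c * C)"
  have q: "0 \<le> q" using \<kappa> u C by (simp add: q_def)
  define M where "M = 9 * A + 4 * \<tau> + q"
  have M: "0 < M" "8 * A < M" "4 * \<tau> \<le> M" "q \<le> M" using A \<tau> q by (auto simp: M_def)
  define f where "f n \<omega> = (\<integral>\<^sup>+x. ennreal (\<bar>schur_kernel.est (k n) n \<omega> x - schur_kernel.op L (k n) p0 x\<bar> powr \<rho>) \<partial>L)" for n \<omega>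
  have f_meas: "f n \<in> borel_measurable (P p0 n)" if n: "n \<ge> 1" for n
  proof -
    interpret schur_kernel L "k n" B "R n" by (rule good_kernelD(1)[OF good[OF n]])
    note [measurable] = prob_densityD(1)[OF p0 Tb]
    have Mp: "law T p0 = Mp p0" by (simp add: law_def Mp_def)
    show ?thesis unfolding f_def Mp by measurable
  qed
  define E where "E n = {\<omega> \<in> space (P p0 n). \<not> f n \<omega> \<le> ennreal ((\<tau> * \<delta> n) powr \<rho>)}" for n
  have E_sets: "E n \<in> sets (PiM {..<n} (\<lambda>_. L))" if n: "n \<ge> 1" for n
  proof -
    note [measurable] = f_meas[OF n]
    have "E n \<in> sets (P p0 n)" unfolding E_def by measurable
    then show ?thesis by (simp only: sets_P)
  qed
  have Rn: "R n / real n \<le> c * (\<epsilon> n)\<^sup>2" if "n \<ge> 1" for n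
    using R_le[OF that] that by (simp add: N_def field_simps)
  have typeI: "(\<lambda>n. emeasure (P p0 n) (E n)) \<longlonglongrightarrow> 0"
  proof (cases "\<rho> = 1")
    case True
    have "\<forall>\<^sub>F n in sequentially. emeasure (P p0 n) (E n) \<le> ennreal (4 * B\<^sup>2 * N n powr (- 1))"
      using eventually_basic[OF M(1)]
    proof eventually_elim
      case (elim n)
      then have n: "n \<ge> 1" "R n \<le> real n" by auto
      interpret schur_kernel L "k n" B "R n" by (rule good_kernelD(1)[OF good[OF n(1)]])
      have dens: "dens p0" using prob_densityD[OF p0 Tb] by (simp add: dens_def space_restrict_space)
      have Mp: "law T p0 = Mp p0" by (simp add: law_def Mp_def)
      have \<epsilon>: "0 < \<epsilon> n" by (rule eps_pos[OF n(1)])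
      have abs1: "\<bar>a\<bar> powr 1 = \<bar>a\<bar>" for a :: real by simp
      have "(R n / real n) powr (1 / 2) \<le> (c * (\<epsilon> n)\<^sup>2) powr (1 / 2)"
        using Rn[OF n(1)] R1 n by (intro powr_mono2) auto
      also have "\<dots> = sqrt c * \<epsilon> n" using c \<epsilon> by (simp add: powr_half_sqrt real_sqrt_mult)
      finally have sq: "D * (R n / real n) powr (1 / 2) \<le> D * sqrt c * \<epsilon> n" using D by (simp add: mult_left_mono mult.assoc)
      have m: "(\<integral>\<^sup>+\<omega>. \<integral>\<^sup>+x. ennreal \<bar>est n \<omega> x - op p0 x\<bar> \<partial>L \<partial>PiM {..<n} (\<lambda>_. Mp p0)) \<le> ennreal (D * sqrt c * \<epsilon> n)"
        using order_trans[OF mean[OF good[OF n(1)] n, unfolded True] ennreal_leI[OF sq]] by (simp add: Mp)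
      have "ennreal (D * sqrt c * \<epsilon> n + \<epsilon> n) < f n \<omega>" if "\<omega> \<in> E n" for \<omega>
      proof -
        \<comment> \<open>Here \<open>\<theta> = 0\<close>, so the rate may be as small as
          \<open>\<epsilon>\<close> itself, the order of the mean error. The threshold exceeds the
          mean bound by \<open>\<epsilon>\<close>, and the variance bound makes such a fluctuation
          unlikely.\<close>
        have "\<epsilon> n \<le> \<delta> n" using delta_ge[OF n(1)] N_pos[OF n(1)] by (simp add: \<theta>r True)
        then have "D * sqrt c * \<epsilon> n + \<epsilon> n \<le> \<tau> * \<delta> n" using \<tau>(1) mult_left_mono[of "\<epsilon> n" "\<delta> n" \<tau>] by (simp add: \<tau>_def algebra_simps)
        then have "ennreal (D * sqrt c * \<epsilon> n + \<epsilon> n) \<le> ennreal (\<tau> * \<delta> n)" by (rule ennreal_leI)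
        also have "\<dots> < f n \<omega>" using that \<tau>(1) delta_pos[OF n(1)] by (simp add: E_def True not_le)
        finally show ?thesis .
      qed
      then have "E n \<subseteq> {\<omega> \<in> space (PiM {..<n} (\<lambda>_. Mp p0)). ennreal (D * sqrt c * \<epsilon> n + \<epsilon> n) < (\<integral>\<^sup>+x. ennreal \<bar>est n \<omega> x - op p0 x\<bar> \<partial>L)}"
        unfolding f_def True abs1 by (auto simp: E_def Mp)
      then have "emeasure (P p0 n) (E n) \<le> emeasure (PiM {..<n} (\<lambda>_. Mp p0)) {\<omega> \<in> space (PiM {..<n} (\<lambda>_. Mp p0)). ennreal (D * sqrt c * \<epsilon> n + \<epsilon> n) < (\<integral>\<^sup>+x. ennreal \<bar>est n \<omega> x - op p0 x\<bar> \<partial>L)}"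
        unfolding Mp
      proof (rule emeasure_mono)
        note [measurable] = prob_densityD(1)[OF p0 Tb]
        show "{\<omega> \<in> space (PiM {..<n} (\<lambda>_. Mp p0)). ennreal (D * sqrt c * \<epsilon> n + \<epsilon> n) < (\<integral>\<^sup>+x. ennreal \<bar>est n \<omega> x - op p0 x\<bar> \<partial>L)} \<in> sets (PiM {..<n} (\<lambda>_. Mp p0))"
          by measurable
      qed
      also have "\<dots> \<le> ennreal (4 * B\<^sup>2 / (real n * (\<epsilon> n)\<^sup>2))"
        using D c \<epsilon> by (intro L1_concentration[OF n(1) dens \<epsilon> _ m]) auto
      also have "4 * B\<^sup>2 / (real n * (\<epsilon> n)\<^sup>2) = 4 * B\<^sup>2 * N n powr (- 1)"
        using N_pos[OF n(1)] by (simp add: N_def powr_minus divide_inverse)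
      finally show ?case .
    qed
    then show ?thesis by (rule tendsto_emeasure_bound[rotated]) simp
  next
    case False
    then have r1: "1 < \<rho>" using r by simp
    have "\<forall>\<^sub>F n in sequentially. emeasure (P p0 n) (E n) \<le> ennreal (D * c powr (\<rho> / 2) * N n powr (- ((\<rho> - 1) / 2)))"
      using eventually_basic[OF M(1)]
    proof eventually_elim
      case (elim n)
      then have n: "n \<ge> 1" "R n \<le> real n" by auto
      have \<epsilon>: "0 < \<epsilon> n" by (rule eps_pos[OF n(1)])
      have \<delta>: "0 < \<delta> n" by (rule delta_pos[OF n(1)])
      \<comment> \<open>Markov's inequality is enough: the numerator is of order
        \<open>\<epsilon> powr \<rho>\<close>, while the threshold contains the extra factor
        \<open>N powr ((\<rho> - 1) / 2)\<close>, which diverges for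
        \<open>\<rho> > 1\<close>.\<close>
      have "emeasure (P p0 n) (E n) \<le> ennreal (D * (R n / real n) powr (\<rho> / 2) / (\<tau> * \<delta> n) powr \<rho>)"
        unfolding E_def using mean[OF good[OF n(1)] n] D \<tau> \<delta>
        by (intro Markov_emeasure f_meas n(1)) (auto simp: f_def)
      also have "\<dots> \<le> ennreal (D * c powr (\<rho> / 2) * N n powr (- ((\<rho> - 1) / 2)))"
      proof (intro ennreal_leI)
        have "(R n / real n) powr (\<rho> / 2) \<le> (c * (\<epsilon> n)\<^sup>2) powr (\<rho> / 2)"
          using Rn[OF n(1)] R1[OF n(1)] r by (intro powr_mono2) auto
        also have "\<dots> = c powr (\<rho> / 2) * \<epsilon> n powr \<rho>"
          using \<epsilon> by (simp add: powr_mult powr_powr flip: powr_numeral)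
        finally have num: "D * (R n / real n) powr (\<rho> / 2) \<le> D * (c powr (\<rho> / 2) * \<epsilon> n powr \<rho>)"
          using D by (intro mult_left_mono) auto
        have "\<epsilon> n * N n powr (\<theta> / 2) \<le> \<tau> * \<delta> n"
          using delta_ge[OF n(1)] mult_right_mono[OF \<tau>(2) less_imp_le[OF \<delta>]] by simp
        then have "(\<epsilon> n * N n powr (\<theta> / 2)) powr \<rho> \<le> (\<tau> * \<delta> n) powr \<rho>"
          using \<epsilon> r by (intro powr_mono2) auto
        also have "(\<epsilon> n * N n powr (\<theta> / 2)) powr \<rho> = \<epsilon> n powr \<rho> * N n powr ((\<rho> - 1) / 2)"
        proof -
          have "\<theta> / 2 * \<rho> = (\<rho> - 1) / 2" using r by (simp add: \<theta>r field_simps)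
          then show ?thesis by (simp only: powr_mult powr_powr)
        qed
        finally have den: "\<epsilon> n powr \<rho> * N n powr ((\<rho> - 1) / 2) \<le> (\<tau> * \<delta> n) powr \<rho>" .
        have "D * (R n / real n) powr (\<rho> / 2) / (\<tau> * \<delta> n) powr \<rho> \<le>
            D * (c powr (\<rho> / 2) * \<epsilon> n powr \<rho>) / (\<epsilon> n powr \<rho> * N n powr ((\<rho> - 1) / 2))"
          using num den D \<epsilon> N_pos[OF n(1)] by (intro frac_le) auto
        also have "\<dots> = D * c powr (\<rho> / 2) * N n powr (- ((\<rho> - 1) / 2))"
        proof -
          have "D * (a * e) / (e * y) = D * a * (1 / y)" if "e \<noteq> 0" for a e y :: real using that by simp
          from this[of "\<epsilon> n powr \<rho>"] show ?thesis using \<epsilon> by (simp only: powr_minus_divide) simp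
        qed
        finally show "D * (R n / real n) powr (\<rho> / 2) / (\<tau> * \<delta> n) powr \<rho> \<le> D * c powr (\<rho> / 2) * N n powr (- ((\<rho> - 1) / 2))" .
      qed
      finally show ?case .
    qed
    then show ?thesis by (rule tendsto_emeasure_bound[rotated]) (use r1 in simp)
  qed
  have typeII: "\<forall>\<^sub>F n in sequentially. \<forall>p. prob_density T p \<longrightarrow>
        Lr_norm T (ennreal \<rho>) (\<lambda>x. kernel_op T (k n) p x - p x) \<le> ennreal (A * \<delta> n) \<longrightarrow>
        ennreal (M * \<delta> n) \<le> Lr_norm T (ennreal \<rho>) (\<lambda>x. p x - p0 x) \<longrightarrow>
        emeasure (P p n) (space (P p n) - E n) \<le> ennreal (exp (- (C * N n)))"
    using eventually_basic[OF M(1)] ap0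
  proof eventually_elim
    case (elim n)
    show ?case
    proof (intro allI impI)
      fix p assume p: "prob_density T p"
        and ap: "Lr_norm T (ennreal \<rho>) (\<lambda>x. kernel_op T (k n) p x - p x) \<le> ennreal (A * \<delta> n)"
        and far: "ennreal (M * \<delta> n) \<le> Lr_norm T (ennreal \<rho>) (\<lambda>x. p x - p0 x)"
      from elim(1) have n: "n \<ge> 1" "M * \<delta> n \<le> 1" by auto
      obtain \<Delta> where \<Delta>: "M * \<delta> n \<le> \<Delta>"
        "emeasure (P p n) {\<omega> \<in> space (P p n). f n \<omega> \<le> ennreal ((\<tau> * \<delta> n) powr \<rho>)}
          \<le> ennreal (exp (- (real n * \<Delta>\<^sup>2 / (16 * B\<^sup>2 * (u + \<Delta>) * R n powr (1 - 1 / \<rho>)))))"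
        unfolding f_def
        by (rule type_II_finite[OF Tb good[OF n(1)] r n(1) p p0 pu u A delta_pos[OF n(1)] M(2,3) \<tau>(1) ap elim(2) far])
      have "{\<omega> \<in> space (P p n). f n \<omega> \<le> ennreal ((\<tau> * \<delta> n) powr \<rho>)} = space (P p n) - E n"
        by (auto simp: E_def space_P)
      with \<Delta>(2) have "emeasure (P p n) (space (P p n) - E n) \<le>
          ennreal (exp (- (real n * \<Delta>\<^sup>2 / (\<kappa> * (u + \<Delta>) * R n powr \<theta>))))"
        by (simp add: \<kappa>_def \<theta>r)
      also have "\<dots> \<le> ennreal (exp (- (C * N n)))"
        using exponent[OF n M(1) \<Delta>(1) \<kappa> less_imp_le[OF u] M(4)[unfolded q_def]] by (intro ennreal_leI) simp
      finally show "emeasure (P p n) (space (P p n) - E n) \<le> ennreal (exp (- (C * N n)))" .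
    qed
  qed
  have "tests (ennreal \<rho>) M E"
    unfolding tests_def using M(1) E_sets typeII typeI by auto
  then show ?thesis by blast
qed

end

section \<open>Contraction of the posterior at the rate \<open>\<delta>\<close>\<close>

theorem theorem2:
  fixes T :: "real set" and \<P> :: "(real \<Rightarrow> real) set"
    and prior :: "nat \<Rightarrow> (real \<Rightarrow> real) measure"
    and r :: ennreal and \<epsilon> \<gamma> \<delta> :: "nat \<Rightarrow> real"
    and J0 :: nat and J :: "nat \<Rightarrow> nat" and Ks :: "nat \<Rightarrow> real \<Rightarrow> real \<Rightarrow> real"
    and \<P>n :: "nat \<Rightarrow> (real \<Rightarrow> real) set"
    and p0 :: "real \<Rightarrow> real" and c CK D w :: real
  assumes T: "T = {0..1} \<or> T = UNIV"
    and densities: "\<And>p. p \<in> \<P> \<Longrightarrow> prob_density T p"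
    and priors: "\<And>n. n \<ge> 1 \<Longrightarrow> is_prior T \<P> (prior n)"
    and r: "1 \<le> r"
    and eps_pos: "\<And>n. n \<ge> 1 \<Longrightarrow> \<epsilon> n > 0"
    and eps_0: "\<epsilon> \<longlonglongrightarrow> 0"
    and eps_n: "filterlim (\<lambda>n. sqrt (real n) * \<epsilon> n) at_top sequentially"
    and gamma: "\<And>n. n \<ge> 1 \<Longrightarrow> \<gamma> n \<ge> 1"
    and delta: "\<And>n. n \<ge> 1 \<Longrightarrow>
      \<delta> n = \<epsilon> n * (real n * (\<epsilon> n)\<^sup>2) powr (1 / 2 - enn2real (1 / (2 * r))) * \<gamma> n"
    and K: "admissible_sequence T J0 Ks"
    and J: "\<And>n. n \<ge> 1 \<Longrightarrow> J n \<ge> J0"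
    and c: "c > 0"
    and J_le: "\<And>n. n \<ge> 1 \<Longrightarrow> 2 ^ J n \<le> c * real n * (\<epsilon> n)\<^sup>2"
    and w: "if r < 2 then w > (2 - enn2real r) / enn2real r else w = 0"
    and Pn: "\<And>n. n \<ge> 1 \<Longrightarrow> \<P>n n \<subseteq> {p \<in> \<P>.
      Lr_norm T r (\<lambda>x. kernel_op T (Ks (J n)) p x - p x) \<le> ennreal (CK * \<delta> n) \<and>
      mu_norm T w p \<le> ennreal D}"
    and prior_mass: "\<exists>C>0. \<forall>\<^sub>F n in sequentially.
      (\<P> - \<P>n n \<in> sets (prior n) \<and>
        measure (prior n) (\<P> - \<P>n n) \<le> exp (- (C + 4) * real n * (\<epsilon> n)\<^sup>2)) \<and>
      measure (prior n) (KL_neighbourhood T \<P> p0 (\<epsilon> n)) \<ge> exp (- C * real n * (\<epsilon> n)\<^sup>2)"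
    and p0: "prob_density T p0"
    and p0_Lr: "Lr_norm T r p0 < \<top>"
    and p0_approx: "\<exists>A. \<forall>\<^sub>F n in sequentially.
      Lr_norm T r (\<lambda>x. kernel_op T (Ks (J n)) p0 x - p0 x) \<le> ennreal (A * \<delta> n)"
    and p0_moment: "T = UNIV \<Longrightarrow> r < 2 \<Longrightarrow> mu_norm T w p0 < \<top>"
    and delta_0: "\<delta> \<longlonglongrightarrow> 0"
  shows "\<exists>M :: real.
    tendsto_in_prob (\<Pi>\<^sub>M i\<in>(UNIV :: nat set). law T p0)
      (\<lambda>n \<omega>. enn2real (outer_measure_of (posterior (prior n) n \<omega>)
        {p \<in> \<P>. Lr_norm T r (\<lambda>x. p x - p0 x) \<ge> ennreal (M * \<delta> n)})) 0"
proof -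
  have Tb: "T \<in> sets borel" using T by auto
  obtain C where C: "0 < C" and mass: "\<forall>\<^sub>F n in sequentially.
      (\<P> - \<P>n n \<in> sets (prior n) \<and> measure (prior n) (\<P> - \<P>n n) \<le> exp (- (C + 4) * real n * (\<epsilon> n)\<^sup>2)) \<and>
      measure (prior n) (KL_neighbourhood T \<P> p0 (\<epsilon> n)) \<ge> exp (- C * real n * (\<epsilon> n)\<^sup>2)"
    using prior_mass by blast
  obtain A0 where A0: "\<forall>\<^sub>F n in sequentially.
      Lr_norm T r (\<lambda>x. kernel_op T (Ks (J n)) p0 x - p0 x) \<le> ennreal (A0 * \<delta> n)"
    using p0_approx by blast
  \<comment> \<open>One constant for the approximation errors of the sieve and of \<open>p0\<close>;
    the \<open>1\<close> ensures positivity.\<close>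
  define A where "A = max (max CK A0) 1"
  define N where "N n = real n * (\<epsilon> n)\<^sup>2" for n
  define R where "R n = (2 ^ J n :: real)" for n
  obtain B where B: "1 \<le> B" and good: "\<And>j. J0 \<le> j \<Longrightarrow> good_kernel T B (2 ^ j) (Ks j)"
    using admissible_good[OF K Tb] by blast
  have "filterlim (\<lambda>n. (sqrt (real n) * \<epsilon> n) * (sqrt (real n) * \<epsilon> n)) at_top sequentially"
    by (intro filterlim_at_top_mult_at_top eps_n)
  then have N_top: "filterlim N at_top sequentially"
    by (rule filterlim_cong[THEN iffD1, rotated -1]) (auto simp: N_def power2_eq_square)
  define \<theta> where "\<theta> = 1 - 2 * enn2real (1 / (2 * r))"
  have half: "\<theta> / 2 = 1 / 2 - enn2real (1 / (2 * r))" by (simp add: \<theta>_def)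
  have delta_ge: "\<epsilon> n * N n powr (\<theta> / 2) \<le> \<delta> n" if "n \<ge> 1" for n
    unfolding delta[OF that] half N_def
    using gamma[OF that] eps_pos[OF that] mult_left_mono[of 1 "\<gamma> n" "\<epsilon> n * (real n * (\<epsilon> n)\<^sup>2) powr (1 / 2 - enn2real (1 / (2 * r)))"]
    by simp
  have delta_pos: "0 \<le> \<delta> n" if "n \<ge> 1" for n
    using delta_ge[OF that] eps_pos[OF that] by (meson less_imp_le mult_nonneg_nonneg order_trans powr_ge_zero)
  have setting: "rate_setting T B c A (C + 4) p0 \<epsilon> \<delta> N R (\<lambda>n. Ks (J n)) \<theta>" if "0 \<le> \<theta>" "\<theta> \<le> 1"
  proof
    show "good_kernel T B (R n) (Ks (J n))" if "n \<ge> 1" for n unfolding R_def by (rule good[OF J[OF that]])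
    show "R n \<le> c * N n" if "n \<ge> 1" for n using J_le[OF that] by (simp add: R_def N_def mult.assoc)
  qed (use T B c C p0 eps_pos eps_0 N_top that delta_ge delta_0 in \<open>auto simp: A_def N_def\<close>)
  have ap0: "\<forall>\<^sub>F n in sequentially. Lr_norm T r (\<lambda>x. kernel_op T (Ks (J n)) p0 x - p0 x) \<le> ennreal (A * \<delta> n)"
    using A0 eventually_ge_at_top[of 1]
  proof eventually_elim
    case (elim n)
    have "A0 * \<delta> n \<le> A * \<delta> n" using delta_pos[OF elim(2)] by (intro mult_right_mono) (auto simp: A_def)
    with elim(1) show ?case by (meson ennreal_leI order_trans)
  qed
  have \<theta>01: "0 \<le> \<theta>" "\<theta> \<le> 1" and "\<exists>M E. rate_setting.tests T A (C + 4) p0 \<delta> N (\<lambda>n. Ks (J n)) r M E"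
  proof -
    have "0 \<le> \<theta> \<and> \<theta> \<le> 1 \<and> (\<exists>M E. rate_setting.tests T A (C + 4) p0 \<delta> N (\<lambda>n. Ks (J n)) r M E)"
    proof (cases r)
      case top
      \<comment> \<open>In \<open>ennreal\<close> the quotient \<open>1 / (2 * \<top>)\<close> is
        \<open>0\<close>, which agrees with the convention for
        \<open>r = \<infinity>\<close>.\<close>
      have \<theta>1: "\<theta> = 1" by (simp add: \<theta>_def top ennreal_top_mult ennreal_mult_top)
      interpret rate_setting T B c A "C + 4" p0 \<epsilon> \<delta> N R "\<lambda>n. Ks (J n)" \<theta> by (rule setting) (simp_all add: \<theta>1)
      show ?thesis using tests_top[OF \<theta>1] p0_Lr ap0 by (simp add: top \<theta>1)
    next
      case (real \<rho>)
      have \<rho>: "1 \<le> \<rho>" using r real by (simp add: ennreal_1[symmetric] ennreal_le_iff del: ennreal_1)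
      have "1 / (2 * r) = ennreal (1 / (2 * \<rho>))"
        using \<rho> by (simp add: real ennreal_mult[symmetric] divide_ennreal[symmetric] flip: ennreal_numeral ennreal_1)
      then have \<theta>\<rho>: "\<theta> = 1 - 1 / \<rho>" using \<rho> by (simp add: \<theta>_def)
      have \<theta>01: "0 \<le> \<theta>" "\<theta> \<le> 1" using \<rho> by (auto simp: \<theta>\<rho>)
      interpret rate_setting T B c A "C + 4" p0 \<epsilon> \<delta> N R "\<lambda>n. Ks (J n)" \<theta> by (rule setting) (fact \<theta>01)+
      have r2: "r < 2 \<longleftrightarrow> \<rho> < 2" using \<rho> by (simp add: real ennreal_less_iff flip: ennreal_numeral)
      have "\<exists>M E. tests (ennreal \<rho>) M E"
      proof (rule tests_finite[OF \<rho> \<theta>\<rho>])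
        show "(2 - \<rho>) / \<rho> < w" if "\<rho> < 2" using w that \<rho> r2 by (simp add: real)
        show "mu_norm T w p0 < \<top>" if "\<rho> < 2" "T = UNIV" using p0_moment that r2 by simp
      qed (use p0_Lr ap0 in \<open>simp_all add: real\<close>)
      then show ?thesis using \<theta>01 by (simp add: real)
    qed
    then show "0 \<le> \<theta>" "\<theta> \<le> 1" "\<exists>M E. rate_setting.tests T A (C + 4) p0 \<delta> N (\<lambda>n. Ks (J n)) r M E" by blast+
  qed
  then obtain M E where ME: "rate_setting.tests T A (C + 4) p0 \<delta> N (\<lambda>n. Ks (J n)) r M E" by blast
  interpret rate_setting T B c A "C + 4" p0 \<epsilon> \<delta> N R "\<lambda>n. Ks (J n)" \<theta> by (rule setting) (fact \<theta>01)+
  from ME have E: "\<And>n. n \<ge> 1 \<Longrightarrow> E n \<in> sets (PiM {..<n} (\<lambda>_. L))"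
    and E0: "(\<lambda>n. emeasure (P p0 n) (E n)) \<longlonglongrightarrow> 0"
    and sep: "\<forall>\<^sub>F n in sequentially. \<forall>p. prob_density T p \<longrightarrow>
        Lr_norm T r (\<lambda>x. kernel_op T (Ks (J n)) p x - p x) \<le> ennreal (A * \<delta> n) \<longrightarrow>
        ennreal (M * \<delta> n) \<le> Lr_norm T r (\<lambda>x. p x - p0 x) \<longrightarrow>
        emeasure (P p n) (space (P p n) - E n) \<le> ennreal (exp (- ((C + 4) * N n)))"
    unfolding tests_def by auto
  define far where "far n = {p \<in> \<P>. Lr_norm T r (\<lambda>x. p x - p0 x) \<ge> ennreal (M * \<delta> n)}" for n
  define Y where "Y n \<omega> = enn2real (outer_measure_of (posterior (prior n) n \<omega>) (far n))" for n \<omega>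
  let ?P = "\<Pi>\<^sub>M i\<in>(UNIV :: nat set). law T p0"
  have ps: "prior_setup T \<P> (prior n) p0" if "n \<ge> 1" for n
    using Tb priors[OF that] densities p0 by unfold_locales
  have "Y n \<in> borel_measurable ?P" for n
  proof (cases "n \<ge> 1")
    case True
    show ?thesis unfolding Y_def
      by (rule prior_setup.measurable_outer_posterior[OF ps[OF True]]) (auto simp: far_def)
  next
    case False
    \<comment> \<open>Nothing is assumed about the measure with index \<open>0\<close>. Without
      observations the likelihood does not depend on the sample, so \<open>Y 0\<close> is constant
      and hence measurable.\<close>
    then have "n = 0" by simp
    then have "Y n = (\<lambda>_. Y n undefined)" by (simp add: Y_def posterior_def likelihood_def fun_eq_iff)
    then show ?thesis by (metis measurable_const UNIV_I space_borel)
  qed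
  moreover have "(\<lambda>n. measure ?P {\<omega> \<in> space ?P. \<bar>Y n \<omega> - 0\<bar> > \<eta>}) \<longlonglongrightarrow> 0" if \<eta>: "\<eta> > 0" for \<eta>
  proof -
    \<comment> \<open>The term \<open>2 / N n\<close> bounds the probability of a small denominator.
      The other one arises from \<open>exp (- (C + 4) N)\<close> against
      \<open>exp ((C + 2) N)\<close>, leaving \<open>exp (- 2 N)\<close>.\<close>
    define b where "b n = 2 / N n + 4 / \<eta> * exp (- 2 * N n)" for n
    have "(\<lambda>n. 2 / N n) \<longlonglongrightarrow> 0" by (intro tendsto_divide_0[OF tendsto_const] filterlim_at_top_imp_at_infinity N_top)
    moreover have "filterlim (\<lambda>n. 2 * N n) at_top sequentially"
      by (rule filterlim_tendsto_pos_mult_at_top[OF tendsto_const _ N_top]) simp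
    then have "(\<lambda>n. exp (- (2 * N n))) \<longlonglongrightarrow> 0"
      by (intro filterlim_compose[OF exp_at_bot] filterlim_compose[OF filterlim_uminus_at_bot_at_top])
    ultimately have "b \<longlonglongrightarrow> 0 + 4 / \<eta> * 0"
      unfolding b_def by (intro tendsto_add tendsto_mult tendsto_const) auto
    then have "(\<lambda>n. ennreal (b n)) \<longlonglongrightarrow> ennreal 0" by (intro tendsto_ennrealI) simp
    then have lim: "(\<lambda>n. emeasure (P p0 n) (E n) + ennreal (b n)) \<longlonglongrightarrow> 0"
      using tendsto_add[OF E0] by fastforce
    have le: "\<forall>\<^sub>F n in sequentially. emeasure ?P {\<omega> \<in> space ?P. \<eta> < Y n \<omega>} \<le> emeasure (P p0 n) (E n) + ennreal (b n)"
      using mass sep eventually_ge_at_top[of 1]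
    proof eventually_elim
      case (elim n)
      note n = elim(3)
      \<comment> \<open>The same number bounds the prior mass outside the sieve, taken as the
        exceptional set, and the error of the second kind for far densities inside it.\<close>
      let ?\<kappa> = "exp (- (C + 4) * real n * (\<epsilon> n)\<^sup>2)"
      have "emeasure ?P {\<omega> \<in> space ?P. \<eta> < Y n \<omega>} \<le>
          emeasure (P p0 n) (E n) + ennreal (2 / (real n * (\<epsilon> n)\<^sup>2) + 4 * ?\<kappa> * exp ((C + 2) * real n * (\<epsilon> n)\<^sup>2) / \<eta>)"
        unfolding Y_def
      proof (rule prior_setup.posterior_test_bound[OF ps[OF n] _ n eps_pos[OF n] \<eta> _ E[OF n]])
        show "exp (- C * real n * (\<epsilon> n)\<^sup>2) \<le> measure (prior n) (KL_neighbourhood T \<P> p0 (\<epsilon> n))"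
          and "\<P> - \<P>n n \<in> sets (prior n)" and "measure (prior n) (\<P> - \<P>n n) \<le> ?\<kappa>"
          using elim(1) by auto
        show "far n \<subseteq> \<P>" by (auto simp: far_def)
        fix p assume "p \<in> far n - (\<P> - \<P>n n)"
        then have p: "p \<in> \<P>" "p \<in> \<P>n n" "ennreal (M * \<delta> n) \<le> Lr_norm T r (\<lambda>x. p x - p0 x)" by (auto simp: far_def)
        have pd: "prob_density T p" by (rule densities[OF p(1)])
        have "CK * \<delta> n \<le> A * \<delta> n" using delta_pos[OF n] by (intro mult_right_mono) (auto simp: A_def)
        then have ap: "Lr_norm T r (\<lambda>x. kernel_op T (Ks (J n)) p x - p x) \<le> ennreal (A * \<delta> n)"
          using Pn[OF n] p(2) by (auto intro: order_trans ennreal_leI)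
        have "(\<integral>\<^sup>+x\<in>space (PiM {..<n} (\<lambda>_. L)) - E n. likelihood n x p \<partial>PiM {..<n} (\<lambda>_. L)) =
            emeasure (P p n) (space (P p n) - E n)"
          unfolding space_P using E[OF n] by (intro emeasure_PiM_law pd Tb) auto
        also have "\<dots> \<le> ennreal (exp (- ((C + 4) * N n)))" using elim(2) pd ap p(3) by blast
        also have "- ((C + 4) * N n) = - (C + 4) * real n * (\<epsilon> n)\<^sup>2" by (simp add: N_def algebra_simps)
        finally show "(\<integral>\<^sup>+x\<in>space (PiM {..<n} (\<lambda>_. L)) - E n. likelihood n x p \<partial>PiM {..<n} (\<lambda>_. L)) \<le> ennreal ?\<kappa>" .
      qed simp
      also have "2 / (real n * (\<epsilon> n)\<^sup>2) + 4 * ?\<kappa> * exp ((C + 2) * real n * (\<epsilon> n)\<^sup>2) / \<eta> = b n"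
      proof -
        have "?\<kappa> * exp ((C + 2) * real n * (\<epsilon> n)\<^sup>2) = exp (- 2 * N n)"
          by (simp add: N_def exp_add[symmetric] algebra_simps)
        then show ?thesis by (simp add: b_def N_def mult.assoc)
      qed
      finally show ?case .
    qed
    have "(\<lambda>n. emeasure ?P {\<omega> \<in> space ?P. \<eta> < Y n \<omega>}) \<longlonglongrightarrow> 0"
      by (rule tendsto_sandwich[OF _ le tendsto_const lim]) auto
    then have "(\<lambda>n. enn2real (emeasure ?P {\<omega> \<in> space ?P. \<eta> < Y n \<omega>})) \<longlonglongrightarrow> 0"
      by (intro tendsto_enn2real) auto
    moreover have "{\<omega> \<in> space ?P. \<bar>Y n \<omega> - 0\<bar> > \<eta>} = {\<omega> \<in> space ?P. \<eta> < Y n \<omega>}" for n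
      by (auto simp: Y_def)
    ultimately show ?thesis by (simp add: measure_def)
  qed
  ultimately have "tendsto_in_prob ?P Y 0" unfolding tendsto_in_prob_def by blast
  then show ?thesis unfolding Y_def far_def by blast
qed

end
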